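(* Let $d\ge1$ and $\alpha\ge 0$. If $\delta>\max\{(\alpha-1)/4,\,0\}$, then there is a constant $C>0$ (independent of $f$) such that for all $f\in L^2(\mathbb C^d,\Psi_\alpha)$, $$\|S_*^\delta(\mathcal L)f\|_{L^2(\mathbb C^d,\Psi_\alpha)}\le C\,\|f\|_{L^2(\mathbb C^d,\Psi_\alpha)},$$ where $S_*^\delta(\mathcal L)f(z)=\sup_{t>0}|S_t^\delta(\mathcal L)f(z)|$.
   Context: Identify $\mathbb C^d\cong\mathbb R^{2d}$ via $z=x+iy$, with Lebesgue measure, and $\mathbb N_0=\{0,1,2,\dots\}$. The twisted Laplacian is $\mathcal L=-\sum_{j=1}^d\big((\partial_{x_j}-\tfrac i2 y_j)^2+(\partial_{y_j}+\tfrac i2 x_j)^2\big)$. Let $\Phi_\alpha$ ($\alpha\in\mathbb N_0^d$) be the $L^2(\mathbb R^d)$-normalized Hermite functions (products of one-dimensional ones, eigenfunctions of $-\Delta+|x|^2$). The special Hermite functions are $\Phi_{\alpha,\beta}(z)=(2\pi)^{-d/2}\int_{\mathbb R^d}e^{i\langle x,\xi\rangle}\Phi_\alpha(\xi+\tfrac12y)\Phi_\beta(\xi-\tfrac12y)\,d\xi$, $\alpha,\beta\in\mathbb N_0^d$; they form an orthonormal basis of $L^2(\mathbb C^d)$ and $\mathcal L\Phi_{\alpha,\beta}=(2|\beta|+d)\Phi_{\alpha,\beta}$. For $\mu\in 2\mathbb N_0+d=\{2k+d:k\in\mathbb N_0\}$ the spectral projection is $\mathcal P_\mu f=\sum_{\beta:2|\beta|+d=\mu}\sum_{\alpha\in\mathbb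 N_0^d}\langle f,\Phi_{\alpha,\beta}\rangle\Phi_{\alpha,\beta}$. It is the integral operator with kernel $\mathcal P_\mu(z,z')=\sum_{\beta:2|\beta|+d=\mu}\sum_{\alpha}\Phi_{\alpha,\beta}(z)\overline{\Phi_{\alpha,\beta}(z')}$, which for fixed $z$ is a Schwartz function of $z'$; $\mathcal P_\mu f$ is defined through this kernel for functions $f$ not in $L^2$. The Bochner--Riesz means are $S_t^\delta(\mathcal L)f(z)=\sum_{\mu\in2\mathbb N_0+d,\ \mu\le t^2}\big(1-\tfrac{\mu}{t^2}\big)^\delta\mathcal P_\mu f(z)$ for $t>0$, $\delta\ge0$. Weight: for $\alpha\in\mathbb R$, $\Psi_\alpha(z)=\sum_{j\ge0}2^{-\alpha j}\chi_{\mathbb A_j}(z)$, where $\mathbb A_0=\{z\in\mathbb C^d:|z|\le1\}$ and $\mathbb A_j=\{z\in\mathbb C^d:2^{j-1}<|z|\le2^j\}$ for $j\ge1$. Here $\|f\|_{L^2(\mathbb C^d,\Psi_\alpha)}^2=\int_{\mathbb C^d}|f(z)|^2\Psi_\alpha(z)\,dz$. *)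

theory Defs
  imports "HOL-Analysis.Analysis"
begin

text \<open>
  The space \<open>\<complex>\<^sup>d\<close> is \<^typ>\<open>complex ^ 'd\<close> and \<open>\<real>\<^sup>d\<close> is \<^typ>\<open>real ^ 'd\<close>, where \<open>d = CARD('d)\<close>;
  multi-indices are functions \<^typ>\<open>'d \<Rightarrow> nat\<close>.
\<close>

definition re_part :: "complex ^ 'd \<Rightarrow> real ^ 'd" where
  "re_part z = (\<chi> j. Re (z $ j))"

definition im_part :: "complex ^ 'd \<Rightarrow> real ^ 'd" where
  "im_part z = (\<chi> j. Im (z $ j))"


subsection \<open>Hermite and special Hermite functions\<close>

text \<open>Physicists' Hermite polynomials, by Rodrigues' formula.\<close>

definition hermite_poly :: "nat \<Rightarrow> real \<Rightarrow> real" where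
  "hermite_poly k x = (- 1) ^ k * exp (x\<^sup>2) * (deriv ^^ k) (\<lambda>t. exp (- t\<^sup>2)) x"

definition hermite_fun1 :: "nat \<Rightarrow> real \<Rightarrow> real" where
  "hermite_fun1 k x = hermite_poly k x * exp (- x\<^sup>2 / 2) / sqrt (2 ^ k * fact k * sqrt pi)"

definition hermite_fun :: "('d::finite \<Rightarrow> nat) \<Rightarrow> real ^ 'd \<Rightarrow> real" where
  "hermite_fun \<alpha> x = (\<Prod>j\<in>UNIV. hermite_fun1 (\<alpha> j) (x $ j))"

definition special_hermite ::
    "('d::finite \<Rightarrow> nat) \<Rightarrow> ('d \<Rightarrow> nat) \<Rightarrow> complex ^ 'd \<Rightarrow> complex" where
  "special_hermite \<alpha> \<beta> z =
     of_real ((2 * pi) powr (- real CARD('d) / 2)) *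
     (\<integral>\<xi>. exp (\<i> * of_real (re_part z \<bullet> \<xi>)) *
          of_real (hermite_fun \<alpha> (\<xi> + (1/2) *\<^sub>R im_part z) *
                   hermite_fun \<beta> (\<xi> - (1/2) *\<^sub>R im_part z)) \<partial>lborel)"


subsection \<open>Spectral projections and Bochner--Riesz means of the twisted Laplacian\<close>

text \<open>
  For every \<open>\<mu>\<close> only finitely many \<open>\<beta>\<close> occur, and for each of them the series over
  \<open>\<alpha>\<close> converges absolutely.
\<close>

definition spectral_kernel :: "nat \<Rightarrow> complex ^ 'd::finite \<Rightarrow> complex ^ 'd \<Rightarrow> complex" where
  "spectral_kernel \<mu> z z' =
     (\<Sum>\<beta> | 2 * (\<Sum>j\<in>UNIV. \<beta> j) + CARD('d) = \<mu>.
        \<Sum>\<^sub>\<infinity>\<alpha>\<in>UNIV. special_hermite \<alpha> \<beta> z * cnj (special_hermite \<alpha> \<beta> z'))"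

text \<open>
  For fixed \<open>z\<close> the kernel is a Schwartz function of \<open>z'\<close>, so the integral below converges
  absolutely for all \<open>f\<close> in the weighted spaces considered here.  For \<open>f\<close> in \<open>L\<^sup>2\<close>
  it is the continuous representative of the orthogonal expansion of \<open>f\<close> over the
  special Hermite functions with \<open>2|\<beta>| + d = \<mu>\<close>.
\<close>

definition spectral_proj ::
    "nat \<Rightarrow> (complex ^ 'd::finite \<Rightarrow> complex) \<Rightarrow> complex ^ 'd \<Rightarrow> complex" where
  "spectral_proj \<mu> f z = (\<integral>z'. spectral_kernel \<mu> z z' * f z' \<partial>lebesgue)"

text \<open>
  Since \<^term>\<open>0 powr 0 = (0::real)\<close>, the term with \<open>\<mu> = t\<^sup>2\<close> is dropped for \<open>\<delta> = 0\<close>;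
  for \<open>\<delta> > 0\<close> that term vanishes anyway.
\<close>

definition bochner_riesz ::
    "real \<Rightarrow> real \<Rightarrow> (complex ^ 'd::finite \<Rightarrow> complex) \<Rightarrow> complex ^ 'd \<Rightarrow> complex" where
  "bochner_riesz \<delta> t f z =
     (\<Sum>\<mu> | \<mu> \<in> range (\<lambda>k. 2 * k + CARD('d)) \<and> real \<mu> \<le> t\<^sup>2.
        of_real ((1 - real \<mu> / t\<^sup>2) powr \<delta>) * spectral_proj \<mu> f z)"

definition maximal_bochner_riesz ::
    "real \<Rightarrow> (complex ^ 'd::finite \<Rightarrow> complex) \<Rightarrow> complex ^ 'd \<Rightarrow> ennreal" where
  "maximal_bochner_riesz \<delta> f z = (SUP t\<in>{0<..}. ennreal (cmod (bochner_riesz \<delta> t f z)))"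


subsection \<open>Weighted \<open>L\<^sup>2\<close> spaces\<close>

definition annulus :: "nat \<Rightarrow> (complex ^ 'd::finite) set" where
  "annulus j = (if j = 0 then {z. norm z \<le> 1} else {z. 2 ^ (j - 1) < norm z \<and> norm z \<le> 2 ^ j})"

definition weight :: "real \<Rightarrow> complex ^ 'd::finite \<Rightarrow> real" where
  "weight \<alpha> z = (\<Sum>j. 2 powr (- \<alpha> * real j) * indicator (annulus j) z)"

text \<open>
  The norm is \<^typ>\<open>ennreal\<close>-valued and takes \<^typ>\<open>ennreal\<close>-valued functions, because the
  maximal function may a priori be infinite at some points.
\<close>

definition weighted_L2_norm :: "real \<Rightarrow> (complex ^ 'd::finite \<Rightarrow> ennreal) \<Rightarrow> ennreal" where
  "weighted_L2_norm \<alpha> g =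
     (let I = \<integral>\<^sup>+z. (g z)\<^sup>2 * ennreal (weight \<alpha> z) \<partial>lebesgue
      in if I = \<infinity> then \<infinity> else ennreal (sqrt (enn2real I)))"

definition weighted_L2 :: "real \<Rightarrow> (complex ^ 'd::finite \<Rightarrow> complex) set" where
  "weighted_L2 \<alpha> = {f. f \<in> borel_measurable lebesgue \<and>
                      weighted_L2_norm \<alpha> (\<lambda>z. ennreal (cmod (f z))) < \<infinity>}"

end

theory Submission
 imports Defs "HOL-Computational_Algebra.Polynomial"
begin

text \<open>
  Everything is elementary, from the ladder relations of the special Hermite functions
  \<open>\<Phi>\<^sub>\<alpha>\<^sub>\<beta>\<close>; their completeness is not needed, only orthogonality and Bessel's inequality.

  Write \<open>(1 - x)\<^sub>+\<^sup>\<delta>\<close> as a low-frequency bump plus \<open>\<Sum>\<^sub>m 2\<^sup>-\<^sup>m\<^sup>\<delta> \<eta>(2\<^sup>m(1 - x))\<close>. For each \<open>m\<close> the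
  supremum over \<open>t\<close> is dominated by a square function in \<open>dt/t\<close>, estimated in weighted \<open>L\<^sup>2\<close> with
  loss \<open>2\<^sup>\<kappa>\<^sup>m\<close>, \<open>\<kappa> > max ((\<alpha> - 1) / 2) 0\<close>. For this \<open>f\<close> is split along annuli: nearby annuli are
  controlled by orthogonality; distant annuli of large index by kernel decay, because \<open>|z - z'|\<^sup>2\<close>
  acts on a kernel \<open>\<Sum>\<^sub>k a\<^sub>k P\<^sub>k(z,z')\<close> as a second-order difference operator on \<open>a\<close>; and the remaining
  inner annuli by the trace estimate \<open>\<integral>\<^bsub>|z| \<le> r\<^esub> |P\<^sub>k f|\<^sup>2 \<le> C r k\<^sup>-\<^sup>1\<^sup>/\<^sup>2 \<parallel>P\<^sub>k f\<parallel>\<^sup>2\<close>, a virial identity.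
  The low-frequency part is dominated by a maximal function of Hardy--Littlewood type, whose
  \<open>L\<^sup>2\<close> bound comes from a \<open>T T\<^sup>*\<close> argument.
\<close>

text \<open>The weight decays, so f may grow and leave L2; projections exist only through rapidly
  decaying kernels, and every estimate must survive the passage between annuli. For the piece of
  width s = 2^(-m) at scale t the kernel lives at distances up to min(t, 1/(s t)), which is at most
  2^(m/2). Moving mass from radius R = 2^(m/2) to the centre may cost R^al in the squared weighted
  norm, while the trace estimate returns a factor 1/R. The net loss 2^((al - 1) m / 2), set against
  the squared amplitude 2^(-2 de m), is the threshold de > (al - 1)/4. The supremum over t costs
  1/s, but each eigenvalue is seen only by a set of t of dt/t-measure at most a multiple of s, so
  the two cancel. The norms of the Hermite and special Hermite functions are never evaluated:
  orthogonality with a common unknown norm is enough, and \<open>sh_norm\<close> and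
  \<open>sh_bound\<close> are carried along as constants. Infinite sums over the first index are
  reached from finite ones by Fatou, because the integrations by parts are carried out on finite
  linear combinations.\<close>

abbreviation nnL :: "('a::euclidean_space => ennreal) => ennreal" (binder "NN " 10) where "nnL f == nn_integral lborel f"
abbreviation intL :: "('a::euclidean_space => 'b::{banach,second_countable_topology}) => 'b" (binder "LI " 10) where "intL f == integral\<^sup>L lborel f"
abbreviation bm :: "('a::topological_space => 'b::topological_space) set" where "bm == borel_measurable borel"
abbreviation "nq w == ennreal ((cmod w)\<^sup>2)"
abbreviation "wt a z == ennreal (weight a z)"
abbreviation "dlog t == ennreal (1 / t) * indicator {1..} (t::real)"
abbreviation "en == ennreal"
abbreviation "dchain D f M A == D 0 = f \<and> (\<forall>i<M. \<forall>x. (D i has_real_derivative D (Suc i) x) (at x)) \<and> (\<forall>i\<le>M. \<forall>x. \<bar>D i x\<bar> <= (A::real))"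
type_synonym 'd fld = "complex ^ 'd => complex"
abbreviation "Sh == special_hermite"
abbreviation "Hf == hermite_fun"


section \<open>Integration on Euclidean space: polynomial decay, directional derivatives,
  differentiation under the integral\<close>

lemma term_le_suminf_ennreal: "g n <= (\<Sum>n. g n)" for g :: "nat => ennreal"
 using sum_le_suminf[of g "{n}"] by simp

text \<open>Points whose norm has integer part n lie in a ball of volume proportional to (n + 1)^D,
  where D is the dimension; the exponent D + 2 leaves the convergent series of 1/(n + 1)^2.\<close>

lemma integrable_poly_decay_aux:
 "integrable lborel (%x::'a::euclidean_space. 1 / (1 + norm x) ^ (DIM('a) + 2))"
proof (rule integrableI_bounded)
 let ?D = "DIM('a)"
 let ?V = "unit_ball_vol (real ?D)"
 show "(%x::'a. 1 / (1 + norm x) ^ (?D + 2)) \<in> borel_measurable lborel"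
  by measurable
 have pt: "en (norm (1 / (1 + norm x) ^ (?D + 2)))
   <= (\<Sum>n. en (1 / (1 + real n) ^ (?D + 2)) * indicator (cball 0 (real n + 1)) x)" for x :: 'a
 proof -
  define n where "n = nat \<lfloor>norm x\<rfloor>"
  have n: "real n <= norm x" "norm x <= real n + 1"
   unfolding n_def by (simp, linarith)
  have "en (norm (1 / (1 + norm x) ^ (?D + 2))) <= en (1 / (1 + real n) ^ (?D + 2))"
  proof (intro ennreal_leI)
   have "(1 + real n) ^ (?D + 2) <= (1 + norm x) ^ (?D + 2)"
    using n by (intro power_mono) auto
   moreover have "norm (1 / (1 + norm x) ^ (?D + 2)) = 1 / (1 + norm x) ^ (?D + 2)"
    by (rule real_norm_def[THEN trans], rule abs_of_nonneg) auto
   ultimately show "norm (1 / (1 + norm x) ^ (?D + 2)) <= 1 / (1 + real n) ^ (?D + 2)"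
    by (simp only:) (rule divide_left_mono, auto intro!: mult_pos_pos add_pos_nonneg zero_less_power)
  qed
  also have "... = en (1 / (1 + real n) ^ (?D + 2)) * indicator (cball 0 (real n + 1)) x"
   using n by simp
  also have "... <= (\<Sum>n. en (1 / (1 + real n) ^ (?D + 2)) * indicator (cball 0 (real n + 1)) x)"
   by (rule term_le_suminf_ennreal)
  finally show ?thesis .
 qed
 have sm: "summable (%n. ?V * inverse ((real (Suc n)) ^ 2))"
  proof (intro summable_mult)
  show "summable (%n. inverse (real (Suc n) ^ 2))"
   using inverse_power_summable[of 2, where 'a = real] by (subst summable_Suc_iff[of "%n. inverse (real n ^ 2)"]) simp
 qed
 have "(NN x. en (norm (1 / (1 + norm (x::'a)) ^ (?D + 2))))
   <= (NN x. (\<Sum>n. en (1 / (1 + real n) ^ (?D + 2)) * indicator (cball (0::'a) (real n + 1)) x))"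
  by (intro nn_integral_mono pt)
 also have "... = (\<Sum>n. (NN x. en (1 / (1 + real n) ^ (?D + 2)) * indicator (cball (0::'a) (real n + 1)) x))"
  by (intro nn_integral_suminf borel_measurable_times_ennreal borel_measurable_indicator) auto
 also have "... = (\<Sum>n. en (?V * inverse ((real (Suc n)) ^ 2)))"
 proof (intro suminf_cong)
  fix n
  have "(NN x. en (1 / (1 + real n) ^ (?D + 2)) * indicator (cball (0::'a) (real n + 1)) x)
    = en (1 / (1 + real n) ^ (?D + 2)) * en (?V * (real n + 1) ^ ?D)"
   by (simp add: nn_integral_cmult_indicator emeasure_cball)
  also have "... = en (?V * inverse ((real (Suc n)) ^ 2))"
  proof -
   have "1 / (1 + real n) ^ (?D + 2) * (?V * (real n + 1) ^ ?D) = ?V * inverse ((real (Suc n)) ^ 2)"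
    unfolding power_add by (simp add: divide_inverse add.commute[of _ 1])
   thus ?thesis by (subst ennreal_mult[symmetric]) auto
  qed
  finally show "(NN x. en (1 / (1 + real n) ^ (?D + 2)) * indicator (cball (0::'a) (real n + 1)) x)
    = en (?V * inverse ((real (Suc n)) ^ 2))" .
 qed
 also have "... = en (\<Sum>n. ?V * inverse ((real (Suc n)) ^ 2))"
  by (intro suminf_ennreal2 sm) auto
 also have "... < \<infinity>" by simp
 finally show "(NN x. en (norm (1 / (1 + norm (x::'a)) ^ (?D + 2)))) < \<infinity>" .
qed

lemma integrable_poly_decay:
 fixes f :: "'a::euclidean_space => 'b::{banach,second_countable_topology}"
 assumes "f \<in> bm" "!!x. norm (f x) <= C / (1 + norm x) ^ (DIM('a) + 2)"
 shows "integrable lborel f"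
proof (rule Bochner_Integration.integrable_bound)
 show "integrable lborel (%x::'a. C * (1 / (1 + norm x) ^ (DIM('a) + 2)))"
  by (intro integrable_mult_right integrable_poly_decay_aux)
 show "AE x in lborel. norm (f x) <= norm (C * (1 / (1 + norm x) ^ (DIM('a) + 2)))"
 proof (intro AE_I2)
  fix x show "norm (f x) <= norm (C * (1 / (1 + norm x) ^ (DIM('a) + 2)))"
   using assms(2)[of x] by (simp only: times_divide_eq_right mult_1_right real_norm_def)
 qed
qed (use assms in auto)

lemma lborel_integral_shift:
 fixes f :: "'a::euclidean_space => 'b::{banach,second_countable_topology}"
 assumes "f \<in> bm"
 shows "(LI x. f (x + c)) = (LI x. f x)"
proof -
 have "(LI x. f x) = (\<integral>x. f x \<partial>(distr lborel borel ((+) c)))"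
  by (simp add: lborel_distr_plus)
 also have "... = (LI x. f (c + x))"
  by (rule integral_distr) (use assms in auto)
 finally show ?thesis by (simp add: add.commute)
qed

lemma lborel_integrable_shift:
 fixes f :: "'a::euclidean_space => 'b::{banach,second_countable_topology}"
 assumes "integrable lborel f"
 shows "integrable lborel (%x. f (x + c))"
proof -
 have "integrable (distr lborel borel ((+) c)) f" by (simp add: lborel_distr_plus assms)
 hence "integrable lborel (%x. f (c + x))"
  by (subst (asm) integrable_distr_eq) (use assms in auto)
 thus ?thesis by (simp add: add.commute)
qed

lemma has_vector_derivative_line:
 fixes F :: "'a::real_vector => 'b::real_normed_vector"
 assumes "!!z. ((%h. F (z + h *\<^sub>R v)) has_vector_derivative G z) (at 0)"
 shows "((%h. F (z + h *\<^sub>R v)) has_vector_derivative G (z + s *\<^sub>R v)) (at s)"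
proof -
 have "((%h. F ((z + s *\<^sub>R v) + h *\<^sub>R v)) has_vector_derivative G (z + s *\<^sub>R v)) (at (s - s))"
  using assms[of "z + s *\<^sub>R v"] by simp
 moreover have "((%t. t - s) has_vector_derivative 1) (at s)"
  by (auto intro!: derivative_eq_intros)
 ultimately have "((%h. F ((z + s *\<^sub>R v) + h *\<^sub>R v)) \<circ> (%t. t - s) has_vector_derivative 1 *\<^sub>R G (z + s *\<^sub>R v)) (at s)"
  using vector_diff_chain_at by fastforce
 moreover have "(%h. F ((z + s *\<^sub>R v) + h *\<^sub>R v)) \<circ> (%t. t - s) = (%h. F (z + h *\<^sub>R v))"
  by (auto simp: algebra_simps o_def)
 ultimately show ?thesis by simp
qed

text \<open>The fundamental theorem of calculus on a unit segment, integrated over all base points: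
  after exchanging integrals one side is the integral of \<open>G\<close>, the other that of F (z +
  v) - F z, which vanishes by translation invariance. No boundary terms at infinity appear.\<close>

lemma integral_directional_derivative:
 fixes F G :: "'a::euclidean_space => complex"
 assumes der: "!!z. ((%h. F (z + h *\<^sub>R v)) has_vector_derivative G z) (at 0)"
  and cont: "continuous_on UNIV G"
  and F: "integrable lborel F" and G: "integrable lborel G"
 shows "(LI z. G z) = 0"
proof -
 have contv: "continuous_on S (%s. G (z + s *\<^sub>R v))" for S z
  by (intro continuous_on_compose2[OF cont]) (auto intro!: continuous_intros)
 have Gm[measurable]: "G \<in> bm" using G by auto
 have 1: "(LI s. indicator {0..1} s *\<^sub>R G (z + s *\<^sub>R v)) = F (z + v) - F z" for z
 proof -
  have "((LI s. indicator {0..1} s *\<^sub>R G (z + s *\<^sub>R v))) = F (z + 1 *\<^sub>R v) - F (z + 0 *\<^sub>R v)"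
   by (rule integral_FTC_atLeastAtMost)
     (auto intro: contv has_vector_derivative_at_within has_vector_derivative_line[OF der])
  thus ?thesis by simp
 qed
 have int: "integrable (lborel \<Otimes>\<^sub>M lborel) (%(s::real, z). indicator {0..1} s *\<^sub>R G (z + s *\<^sub>R v))"
 proof (rule lborel_pair.Fubini_integrable)
  show "(%(s::real, z). indicator {0..1} s *\<^sub>R G (z + s *\<^sub>R v)) \<in> borel_measurable (lborel \<Otimes>\<^sub>M lborel)"
   by measurable
  have eq: "(%s::real. (LI z. norm (case (s, z) of (s, z) => indicator {0..1} s *\<^sub>R G (z + s *\<^sub>R v))))
    = (%s. indicator {0..1} s *\<^sub>R (LI z. norm (G z)))"
   using lborel_integral_shift[of "%z. norm (G z)"] by (auto simp: fun_eq_iff indicator_def)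
  show "integrable lborel (%s::real. (LI z. norm (case (s, z) of (s, z) => indicator {0..1} s *\<^sub>R G (z + s *\<^sub>R v))))"
   unfolding eq by simp
  show "AE s::real in lborel. integrable lborel (%z. case (s, z) of (s, z) => indicator {0..1} s *\<^sub>R G (z + s *\<^sub>R v))"
   using lborel_integrable_shift[OF G] by auto
 qed
 have "(LI z. (LI s. indicator {0..1::real} s *\<^sub>R G (z + s *\<^sub>R v)))
   = (LI s. (LI z. indicator {0..1::real} s *\<^sub>R G (z + s *\<^sub>R v)))"
  by (rule lborel_pair.Fubini_integral[OF int])
 also have "... = (LI s. indicator {0..1::real} s *\<^sub>R (LI z. G z))"
  by (simp add: lborel_integral_shift[OF Gm])
 also have "... = (LI z. G z)" by simp
 finally have "(LI z. G z) = (LI z. F (z + v) - F z)" using 1 by simp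
 also have "... = 0"
  using F by (subst Bochner_Integration.integral_diff) (auto intro: lborel_integrable_shift simp: lborel_integral_shift)
 finally show ?thesis .
qed

lemma has_vector_derivative_0_iff:
 fixes f :: "real => 'b::real_normed_vector"
 shows "(f has_vector_derivative d) (at 0) \<longleftrightarrow> ((%h. (1/h) *\<^sub>R (f h - f 0)) \<longlongrightarrow> d) (at 0)"
proof -
 have "(f has_vector_derivative d) (at 0) \<longleftrightarrow> ((%h. norm (f h - f 0 - h *\<^sub>R d) / norm h) \<longlongrightarrow> 0) (at 0)"
  by (simp add: has_vector_derivative_def has_derivative_at bounded_linear_scaleR_left)
 also have "... \<longleftrightarrow> ((%h. norm ((1/h) *\<^sub>R (f h - f 0) - d)) \<longlongrightarrow> 0) (at 0)"
 proof (rule filterlim_cong[OF refl refl])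
  have "norm (f h - f 0 - h *\<^sub>R d) / norm h = norm ((1/h) *\<^sub>R (f h - f 0) - d)" if "h ~= 0" for h
  proof -
   have "(1/h) *\<^sub>R (f h - f 0) - d = (1/h) *\<^sub>R (f h - f 0 - h *\<^sub>R d)"
    using that by (simp add: scaleR_diff_right)
   thus ?thesis by (simp only: norm_scaleR) (simp add: divide_inverse abs_inverse mult.commute)
  qed
  thus "\<forall>\<^sub>F h in at 0. norm (f h - f 0 - h *\<^sub>R d) / norm h = norm ((1/h) *\<^sub>R (f h - f 0) - d)"
   by (auto simp: eventually_at_filter)
 qed
 also have "... \<longleftrightarrow> ((%h. (1/h) *\<^sub>R (f h - f 0)) \<longlongrightarrow> d) (at 0)"
  by (simp only: tendsto_norm_zero_iff LIM_zero_iff)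
 finally show ?thesis .
qed

text \<open>Dominated convergence for difference quotients; the mean value inequality on the segment
  from 0 to h turns the bound \<open>w\<close> on the derivatives into a bound on the
  quotients.\<close>

lemma has_vector_derivative_integral:
 fixes g g' :: "real => 'a => 'b::{banach,second_countable_topology}"
 assumes der: "!!h xi. \<bar>h\<bar> <= 1 ==> ((%h. g h xi) has_vector_derivative g' h xi) (at h)"
  and bd: "!!h xi. \<bar>h\<bar> <= 1 ==> norm (g' h xi) <= w xi"
  and w: "integrable M w" and g: "!!h. integrable M (g h)" and g'[measurable]: "g' 0 \<in> borel_measurable M"
 shows "((%h. \<integral>xi. g h xi \<partial>M) has_vector_derivative (\<integral>xi. g' 0 xi \<partial>M)) (at 0)"
proof -
 define F where "F h = (\<integral>xi. g h xi \<partial>M)" for h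
 have gm[measurable]: "g h \<in> borel_measurable M" for h using g by auto
 have lip: "norm ((1/h) *\<^sub>R (g h xi - g 0 xi)) <= w xi" if "\<bar>h\<bar> <= 1" "h ~= 0" for h xi
 proof -
  have seg: "\<bar>x\<bar> <= 1" if "x \<in> closed_segment 0 h" for x
   using that \<open>\<bar>h\<bar> <= 1\<close> by (auto simp: closed_segment_eq_real_ivl split: if_splits)
  have "norm (g h xi - g 0 xi) <= w xi * norm (h - 0)"
  proof (rule differentiable_bound[of "closed_segment 0 h" "%h. g h xi" "%x t. t *\<^sub>R g' x xi"])
   show "((%h. g h xi) has_derivative (%t. t *\<^sub>R g' x xi)) (at x within closed_segment 0 h)"
    if "x \<in> closed_segment 0 h" for x
    using der[OF seg[OF that]] by (simp add: has_vector_derivative_def has_derivative_at_withinI)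
   show "onorm (%t. t *\<^sub>R g' x xi) <= w xi" if "x \<in> closed_segment 0 h" for x
    using bd[OF seg[OF that]] by (intro onorm_le) (simp add: mult.commute mult_left_mono)
  qed auto
  hence "norm (g h xi - g 0 xi) / \<bar>h\<bar> <= w xi"
   using that by (simp add: divide_le_eq)
  thus ?thesis by (simp only: norm_scaleR) (simp add: divide_inverse abs_inverse mult.commute)
 qed
 have "((%h. (1/h) *\<^sub>R (F h - F 0)) \<longlongrightarrow> (\<integral>xi. g' 0 xi \<partial>M)) (at 0)"
  unfolding tendsto_at_iff_sequentially o_def
 proof (intro allI impI)
  fix X :: "nat => real" assume X: "ALL i. X i \<in> UNIV - {0}" "X \<longlonglongrightarrow> 0"
  have ev: "eventually (%n. \<bar>X n\<bar> <= 1) sequentially"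
   using X(2) by (auto simp: tendsto_iff elim!: allE[of _ 1] eventually_mono)
  \<comment> \<open>For the finitely many n with step longer than 1 the quotient is replaced by its
    limit, so that \<open>w\<close> dominates every term of the sequence.\<close>
  define q where "q n xi = (if \<bar>X n\<bar> <= 1 then (1/X n) *\<^sub>R (g (X n) xi - g 0 xi) else g' 0 xi)" for n xi
  have "(%n. \<integral>xi. q n xi \<partial>M) \<longlonglongrightarrow> (\<integral>xi. g' 0 xi \<partial>M)"
  proof (rule integral_dominated_convergence[where w=w])
   show "AE xi in M. (%n. q n xi) \<longlonglongrightarrow> g' 0 xi"
   proof (intro AE_I2)
    fix xi
    have "((%h. (1/h) *\<^sub>R (g h xi - g 0 xi)) \<longlongrightarrow> g' 0 xi) (at 0)"
     using der[of 0 xi] by (simp add: has_vector_derivative_0_iff)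
    hence "(%n. (1/X n) *\<^sub>R (g (X n) xi - g 0 xi)) \<longlonglongrightarrow> g' 0 xi"
     using X by (auto simp: tendsto_at_iff_sequentially o_def)
    thus "(%n. q n xi) \<longlonglongrightarrow> g' 0 xi"
     by (rule Lim_transform_eventually) (use ev in \<open>auto simp: q_def elim: eventually_mono\<close>)
   qed
   show "AE xi in M. norm (q n xi) <= w xi" for n
    using lip X bd[of 0] by (intro AE_I2) (auto simp: q_def)
   show "q n \<in> borel_measurable M" for n unfolding q_def by measurable
  qed (use w in auto)
  thus "(%n. (1/X n) *\<^sub>R (F (X n) - F 0)) \<longlonglongrightarrow> (\<integral>xi. g' 0 xi \<partial>M)"
  proof (rule Lim_transform_eventually)
   show "\<forall>\<^sub>F n in sequentially. (\<integral>xi. q n xi \<partial>M) = (1/X n) *\<^sub>R (F (X n) - F 0)"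
    using ev by eventually_elim (simp add: q_def F_def g Bochner_Integration.integral_diff)
  qed
 qed
 hence "(F has_vector_derivative (\<integral>xi. g' 0 xi \<partial>M)) (at 0)"
  by (simp add: has_vector_derivative_0_iff)
 thus ?thesis by (simp add: F_def[abs_def])
qed

section \<open>Square-integrable functions, orthogonal sums and Bessel's inequality\<close>

definition square_integrable :: "'a measure => ('a => complex) => bool" where
 "square_integrable M f \<longleftrightarrow> f \<in> borel_measurable M & integrable M (%x. (cmod (f x))^2)"

lemma square_integrable_mult:
 assumes "square_integrable M f" "square_integrable M g"
 shows "integrable M (%x. f x * g x)"
proof (rule Bochner_Integration.integrable_bound)
 show "integrable M (%x. (cmod (f x))^2 + (cmod (g x))^2)"
  using assms by (auto simp: square_integrable_def)
 show "AE x in M. norm (f x * g x) <= norm ((cmod (f x))^2 + (cmod (g x))^2)"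
 proof (intro AE_I2)
  fix x
  have "2 * (cmod (f x) * cmod (g x)) <= (cmod (f x))^2 + (cmod (g x))^2"
   using sum_squares_bound[of "cmod (f x)" "cmod (g x)"] by (simp add: mult.assoc)
  moreover have "0 <= cmod (f x) * cmod (g x)" by simp
  ultimately have "cmod (f x) * cmod (g x) <= (cmod (f x))^2 + (cmod (g x))^2" by linarith
  thus "norm (f x * g x) <= norm ((cmod (f x))^2 + (cmod (g x))^2)"
   by (simp add: norm_mult)
 qed
qed (use assms in \<open>auto simp: square_integrable_def\<close>)

lemma borel_measurable_cnj:
 "f \<in> borel_measurable M ==> (%x. cnj (f x)) \<in> borel_measurable M"
 by (rule measurable_compose[of f M borel]) (auto intro!: borel_measurable_continuous_onI continuous_intros)

lemma square_integrable_cnj: "square_integrable M f ==> square_integrable M (%x. cnj (f x))"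
 by (auto simp: square_integrable_def intro: borel_measurable_cnj)

lemma square_integrable_cmult: "square_integrable M f ==> square_integrable M (%x. c * f x)"
 by (auto simp: square_integrable_def norm_mult power_mult_distrib)

lemma square_integrable_add:
 assumes "square_integrable M f" "square_integrable M g"
 shows "square_integrable M (%x. f x + g x)"
 unfolding square_integrable_def
proof (intro conjI)
 show "integrable M (%x. (cmod (f x + g x))^2)"
 proof (rule Bochner_Integration.integrable_bound)
  show "integrable M (%x. 2 * (cmod (f x))^2 + 2 * (cmod (g x))^2)"
   using assms by (auto simp: square_integrable_def)
  show "AE x in M. norm ((cmod (f x + g x))^2) <= norm (2 * (cmod (f x))^2 + 2 * (cmod (g x))^2)"
  proof (intro AE_I2)
   fix x
   have "(cmod (f x + g x))^2 <= (cmod (f x) + cmod (g x))^2"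
    by (intro power_mono norm_triangle_ineq) auto
   also have "... <= 2 * (cmod (f x))^2 + 2 * (cmod (g x))^2"
    using sum_squares_bound[of "cmod (f x)" "cmod (g x)"] by (simp add: power2_sum)
   finally show "norm ((cmod (f x + g x))^2) <= norm (2 * (cmod (f x))^2 + 2 * (cmod (g x))^2)"
    by simp
  qed
 qed (use assms in \<open>auto simp: square_integrable_def\<close>)
qed (use assms in \<open>auto simp: square_integrable_def\<close>)

lemma square_integrable_sum:
 "(!!i. i \<in> G ==> square_integrable M (f i)) ==> square_integrable M (%x. \<Sum>i\<in>G. f i x)"
proof (induction G rule: infinite_finite_induct)
 case (insert x F)
 thus ?case using square_integrable_add[of M "f x" "%z. \<Sum>i\<in>F. f i z"] by auto
qed (auto simp: square_integrable_def)

lemma integral_orthogonal_sum: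
 assumes G: "finite G" and e: "!!i. i \<in> G ==> square_integrable M (e i)"
  and orth: "!!i j. i \<in> G ==> j \<in> G ==> (\<integral>x. e i x * cnj (e j x) \<partial>M) = (if i = j then of_real c0 else 0)"
 shows "(\<integral>x. (cmod (\<Sum>i\<in>G. a i * e i x))^2 \<partial>M) = c0 * (\<Sum>i\<in>G. (cmod (a i))^2)"
proof -
 have int: "integrable M (%x. a i * cnj (a j) * (e i x * cnj (e j x)))" if "i \<in> G" "j \<in> G" for i j
  by (intro integrable_mult_right square_integrable_mult square_integrable_cnj e that)
 have "complex_of_real (\<integral>x. (cmod (\<Sum>i\<in>G. a i * e i x))^2 \<partial>M)
   = (\<integral>x. (\<Sum>i\<in>G. a i * e i x) * cnj (\<Sum>i\<in>G. a i * e i x) \<partial>M)"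
  unfolding integral_complex_of_real[symmetric] complex_norm_square[symmetric] by simp
 also have "... = (\<integral>x. (\<Sum>i\<in>G. \<Sum>j\<in>G. a i * cnj (a j) * (e i x * cnj (e j x))) \<partial>M)"
  by (simp add: sum_product mult_ac)
 also have "... = (\<Sum>i\<in>G. \<Sum>j\<in>G. a i * cnj (a j) * (\<integral>x. e i x * cnj (e j x) \<partial>M))"
  using int by (simp add: Bochner_Integration.integral_sum Bochner_Integration.integrable_sum)
 also have "... = (\<Sum>i\<in>G. a i * cnj (a i) * of_real c0)"
  using G by (intro sum.cong refl) (simp add: orth if_distrib[of "%x. _ * x"] sum.delta cong: if_cong)
 also have "... = complex_of_real (c0 * (\<Sum>i\<in>G. (cmod (a i))^2))"
  by (simp add: sum_distrib_left mult_ac complex_norm_square[symmetric] flip: of_real_mult)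
    (simp add: complex_norm_square mult_ac)
 finally show ?thesis using of_real_eq_iff by blast
qed

text \<open>The system is orthogonal with a common squared norm \<open>c0\<close> instead of
  orthonormal: that norm stays an unknown constant in all applications, so the value 0 has to be
  covered as well.\<close>

lemma bessel_inequality:
 assumes G: "finite G" and e: "!!i. i \<in> G ==> square_integrable M (e i)"
  and orth: "!!i j. i \<in> G ==> j \<in> G ==> (\<integral>x. e i x * cnj (e j x) \<partial>M) = (if i = j then of_real c0 else 0)"
  and c0: "c0 >= 0" and f: "square_integrable M f"
 shows "(\<Sum>i\<in>G. (cmod (\<integral>x. f x * cnj (e i x) \<partial>M))^2) <= c0 * (\<integral>x. (cmod (f x))^2 \<partial>M)"
proof -
 define c where "c i = (\<integral>x. f x * cnj (e i x) \<partial>M)" for i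
 define S where "S x = (\<Sum>i\<in>G. c i * e i x)" for x
 define X where "X = (\<Sum>i\<in>G. (cmod (c i))^2)"
 define n where "n = (\<integral>x. (cmod (f x))^2 \<partial>M)"
 have S: "square_integrable M S"
  unfolding S_def by (intro square_integrable_sum square_integrable_cmult e)
 have SS: "(\<integral>x. (cmod (S x))^2 \<partial>M) = c0 * X"
  unfolding S_def X_def by (rule integral_orthogonal_sum[OF G e orth])
 have fS: "integrable M (%x. f x * cnj (S x))"
  by (intro square_integrable_mult square_integrable_cnj f S)
 have "(\<integral>x. f x * cnj (S x) \<partial>M) = (\<integral>x. (\<Sum>i\<in>G. cnj (c i) * (f x * cnj (e i x))) \<partial>M)"
  by (simp add: S_def sum_distrib_left mult_ac)
 also have "... = (\<Sum>i\<in>G. cnj (c i) * c i)"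
  unfolding c_def by (subst Bochner_Integration.integral_sum)
   (auto intro!: integrable_mult_right square_integrable_mult square_integrable_cnj f e)
 also have "... = of_real X"
  by (simp only: X_def of_real_sum complex_norm_square) (simp add: mult.commute)
 finally have fS': "(\<integral>x. Re (f x * cnj (S x)) \<partial>M) = X" using integral_Re[OF fS] by simp
 \<comment> \<open>The squared norm of f - l S is nonnegative for every real l; the choice l = 1 /
   c0 gives the claim.\<close>
 have q: "0 <= n - 2 * l * X + l^2 * (c0 * X)" for l :: real
 proof -
  have "(cmod (f x - of_real l * S x))^2 = (cmod (f x))^2 - 2 * l * Re (f x * cnj (S x)) + l^2 * (cmod (S x))^2" for x
   by (simp add: cmod_power2) (simp add: power2_eq_square algebra_simps)
  moreover have "0 <= (\<integral>x. (cmod (f x - of_real l * S x))^2 \<partial>M)" by simp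
  ultimately have "0 <= (\<integral>x. (cmod (f x))^2 - 2 * l * Re (f x * cnj (S x)) + l^2 * (cmod (S x))^2 \<partial>M)"
   by simp
  also have "... = n - 2 * l * X + l^2 * (c0 * X)"
  proof -
   have i1: "integrable M (%x. (cmod (f x))^2)" "integrable M (%x. l^2 * (cmod (S x))^2)"
    using f S by (auto simp: square_integrable_def)
   have i2: "integrable M (%x. 2 * l * Re (f x * cnj (S x)))"
    by (intro integrable_mult_right integrable_Re fS)
   show ?thesis
    by (simp only: Bochner_Integration.integral_add[OF Bochner_Integration.integrable_diff[OF i1(1) i2] i1(2)]
      Bochner_Integration.integral_diff[OF i1(1) i2] integral_mult_right_zero SS fS' n_def)
  qed
  finally show ?thesis .
 qed
 have "X <= c0 * n"
 proof (cases "c0 = 0")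
  case True
  have "X >= 0" unfolding X_def by (intro sum_nonneg) auto
  \<comment> \<open>For c0 = 0 the quadratic in l degenerates to a linear function, and l = (n + 1)
    / X would make it negative.\<close>
  moreover have False if "X > 0"
  proof -
   have "n >= 0" by (simp add: n_def)
   moreover have "2 * ((n + 1) / X) * X = 2 * n + 2" using that by (simp add: field_simps)
   moreover have "0 <= n - 2 * ((n + 1) / X) * X" using q[of "(n + 1) / X"] True by simp
   ultimately show False by linarith
  qed
  ultimately show ?thesis using True by force
 next
  case False
  thus ?thesis using q[of "1 / c0"] c0 by (simp add: field_simps power2_eq_square)
 qed
 thus ?thesis by (simp add: X_def c_def n_def)
qed

section \<open>Hermite functions\<close>

primrec hermite_polynomial :: "nat => real poly" where
 "hermite_polynomial 0 = 1"
| "hermite_polynomial (Suc n) = [:0, 2:] * hermite_polynomial n - pderiv (hermite_polynomial n)"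

lemma hermite_poly_eq: "hermite_poly k x = poly (hermite_polynomial k) x"
proof -
 have "(deriv ^^ k) (%t. exp (- t\<^sup>2)) = (%x::real. (-1) ^ k * poly (hermite_polynomial k) x * exp (- x\<^sup>2))"
 proof (induction k)
  case (Suc k)
  have "((%x::real. (-1) ^ k * poly (hermite_polynomial k) x * exp (- x\<^sup>2)) has_real_derivative
    (-1) ^ Suc k * poly (hermite_polynomial (Suc k)) x * exp (- x\<^sup>2)) (at x)" for x
   by (auto intro!: derivative_eq_intros poly_DERIV simp: algebra_simps)
  hence "deriv (%x::real. (-1) ^ k * poly (hermite_polynomial k) x * exp (- x\<^sup>2))
   = (%x. (-1) ^ Suc k * poly (hermite_polynomial (Suc k)) x * exp (- x\<^sup>2))"
   by (intro ext DERIV_imp_deriv)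
  thus ?case using Suc by simp
 qed simp
 thus ?thesis
  by (simp add: hermite_poly_def exp_minus field_simps flip: power_mult_distrib)
qed

lemma pderiv_hermite_polynomial:
 "pderiv (hermite_polynomial n) = smult (2 * real n) (hermite_polynomial (n - 1))"
proof (induction n)
 case (Suc n)
 have "pderiv (hermite_polynomial (Suc n)) = smult 2 (hermite_polynomial n) + [:0,2:] * pderiv (hermite_polynomial n) - pderiv (pderiv (hermite_polynomial n))"
  by (simp only: hermite_polynomial.simps pderiv_diff pderiv_mult) (simp add: pderiv_pCons)
 also have "... = smult 2 (hermite_polynomial n) + smult (2 * real n) ([:0,2:] * hermite_polynomial (n - 1) - pderiv (hermite_polynomial (n - 1)))"
  by (simp add: Suc pderiv_smult smult_diff_right)
 also have "... = smult (2 * real (Suc n)) (hermite_polynomial n)"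
  by (cases n) (simp_all add: smult_add_left[symmetric] del: mult_pCons_left)
 finally show ?case by simp
qed simp

text \<open>The three-term recurrence of the Hermite polynomials after normalisation. At n = 0 the
  truncated \<open>n - 1\<close> names a wrong neighbour, but its coefficient sqrt 0 removes it; all
  ladder relations below rely on this convention.\<close>

lemma hermite_fun1_mult:
 "x * hermite_fun1 n x = sqrt ((real n + 1) / 2) * hermite_fun1 (Suc n) x + sqrt (real n / 2) * hermite_fun1 (n - 1) x"
proof -
 define N where "N n = sqrt (2 ^ n * fact n * sqrt pi)" for n :: nat
 have Npos: "N n > 0" for n by (simp add: N_def)
 have NSuc: "N (Suc n) = sqrt (2 * (real n + 1)) * N n" for n
  by (simp add: N_def real_sqrt_mult[symmetric] algebra_simps)
 have s1: "sqrt ((real n + 1) / 2) / N (Suc n) = 1 / (2 * N n)"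
 proof -
  have "sqrt ((real n + 1) / 2) * 2 = sqrt ((real n + 1) / 2 * 4)" by (simp only: real_sqrt_mult) simp
  also have "... = sqrt (2 * (real n + 1))" by simp
  finally have "sqrt ((real n + 1) / 2) * 2 = sqrt (2 * (real n + 1))" .
  moreover have "sqrt (2 * (real n + 1)) > 0" by simp
  ultimately show ?thesis using Npos[of n] unfolding NSuc by (simp add: field_simps)
 qed
 have s2: "sqrt (real n / 2) / N (n - 1) = real n / N n"
 proof (cases n)
  case (Suc m)
  have "sqrt (real n / 2) * sqrt (2 * real n) = real n"
   by (simp add: real_sqrt_mult[symmetric])
  moreover have "sqrt (2 * real n) > 0" using Suc by simp
  ultimately show ?thesis using Npos[of m] NSuc[of m] Suc by (simp add: field_simps)
 qed simp
 have p: "2 * x * poly (hermite_polynomial n) x = poly (hermite_polynomial (Suc n)) x + 2 * real n * poly (hermite_polynomial (n - 1)) x"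
  by (simp add: pderiv_hermite_polynomial)
 have "x * hermite_fun1 n x = (2 * x * poly (hermite_polynomial n) x) * exp (- x\<^sup>2 / 2) * (1 / (2 * N n))"
  by (simp add: hermite_fun1_def hermite_poly_eq N_def)
 also have "... = poly (hermite_polynomial (Suc n)) x * exp (- x\<^sup>2 / 2) * (sqrt ((real n + 1) / 2) / N (Suc n))
   + poly (hermite_polynomial (n - 1)) x * exp (- x\<^sup>2 / 2) * (sqrt (real n / 2) / N (n - 1))"
  unfolding p s1 s2 by (simp only: distrib_right) simp
 also have "... = sqrt ((real n + 1) / 2) * hermite_fun1 (Suc n) x + sqrt (real n / 2) * hermite_fun1 (n - 1) x"
  by (simp add: hermite_fun1_def hermite_poly_eq N_def mult_ac del: hermite_polynomial.simps)
 finally show ?thesis .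
qed

lemma hermite_fun1_deriv:
 "(hermite_fun1 n has_real_derivative
   (sqrt (real n / 2) * hermite_fun1 (n - 1) x - sqrt ((real n + 1) / 2) * hermite_fun1 (Suc n) x)) (at x)"
proof -
 define N where "N n = sqrt (2 ^ n * fact n * sqrt pi)" for n :: nat
 have Npos: "N n > 0" for n by (simp add: N_def)
 have s2: "sqrt (real n / 2) / N (n - 1) = real n / N n"
 proof (cases n)
  case (Suc m)
  have NSuc: "N (Suc m) = sqrt (2 * (real m + 1)) * N m"
   by (simp add: N_def real_sqrt_mult[symmetric] algebra_simps)
  have "sqrt (real n / 2) * sqrt (2 * real n) = real n"
   by (simp add: real_sqrt_mult[symmetric])
  moreover have "sqrt (2 * real n) > 0" using Suc by simp
  ultimately show ?thesis using Npos[of m] NSuc Suc by (simp add: field_simps)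
 qed simp
 have h: "hermite_fun1 n = (%x. poly (hermite_polynomial n) x * exp (- x\<^sup>2 / 2) / N n)" for n
  by (simp add: fun_eq_iff hermite_fun1_def hermite_poly_eq N_def)
 have d: "(hermite_fun1 n has_real_derivative
   (poly (pderiv (hermite_polynomial n)) x * exp (- x\<^sup>2 / 2) / N n - x * hermite_fun1 n x)) (at x)"
  unfolding h using Npos[of n] by (auto intro!: derivative_eq_intros poly_DERIV simp: field_simps)
 have "poly (pderiv (hermite_polynomial n)) x * exp (- x\<^sup>2 / 2) / N n
   = 2 * (real n / N n) * (poly (hermite_polynomial (n - 1)) x * exp (- x\<^sup>2 / 2))"
  by (simp add: pderiv_hermite_polynomial)
 also have "... = 2 * sqrt (real n / 2) * hermite_fun1 (n - 1) x"
  unfolding s2[symmetric] h by simp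
 finally have "poly (pderiv (hermite_polynomial n)) x * exp (- x\<^sup>2 / 2) / N n - x * hermite_fun1 n x
   = sqrt (real n / 2) * hermite_fun1 (n - 1) x - sqrt ((real n + 1) / 2) * hermite_fun1 (Suc n) x"
  using hermite_fun1_mult[of x n] by linarith
 thus ?thesis using d by (simp only:)
qed

lemma hermite_fun1_bounded: "EX C. ALL x. \<bar>hermite_fun1 n x\<bar> <= C"
proof -
 have ex: "\<bar>x\<bar> ^ k * exp (- x\<^sup>2 / 2) <= fact k * exp (1/2)" for x :: real and k
 proof -
  have "\<bar>x\<bar> ^ k / fact k <= exp \<bar>x\<bar>"
  proof -
   have "\<bar>x\<bar> ^ k / fact k = (\<Sum>i\<in>{k}. \<bar>x\<bar> ^ i /\<^sub>R fact i)" by (simp add: divide_inverse)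
   also have "... <= (\<Sum>i. \<bar>x\<bar> ^ i /\<^sub>R fact i)"
    by (rule sum_le_suminf[OF summable_exp_generic]) auto
   finally show ?thesis by (simp add: exp_def)
  qed
  hence "\<bar>x\<bar> ^ k * exp (- x\<^sup>2 / 2) <= fact k * exp \<bar>x\<bar> * exp (- x\<^sup>2 / 2)"
   by (intro mult_right_mono) (auto simp: field_simps)
  also have "... = fact k * exp (\<bar>x\<bar> - x\<^sup>2 / 2)" by (simp add: mult_exp_exp)
  also have "... <= fact k * exp (1/2)"
  proof -
   have "0 <= (\<bar>x\<bar> - 1)^2" by simp
   thus ?thesis by (simp add: power2_diff)
  qed
  finally show ?thesis .
 qed
 \<comment> \<open>The additional factor x^k lets the induction over the coefficients close:
   splitting off the constant coefficient of the polynomial raises k by one.\<close>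
 have "EX C. ALL x. \<bar>x ^ k * poly p x * exp (- x\<^sup>2 / 2)\<bar> <= C" for p :: "real poly" and k
 proof (induction p arbitrary: k)
  case 0 show ?case by auto
 next
  case (pCons a p)
  obtain C where C: "!!x. \<bar>x ^ Suc k * poly p x * exp (- x\<^sup>2 / 2)\<bar> <= C" using pCons.IH by blast
  have "\<bar>x ^ k * poly (pCons a p) x * exp (- x\<^sup>2 / 2)\<bar> <= \<bar>a\<bar> * (fact k * exp (1/2)) + C" for x
  proof -
   have "\<bar>x ^ k * poly (pCons a p) x * exp (- x\<^sup>2 / 2)\<bar>
     = \<bar>a * (x ^ k * exp (- x\<^sup>2 / 2)) + x ^ Suc k * poly p x * exp (- x\<^sup>2 / 2)\<bar>"
    by (simp add: algebra_simps)
   also have "... <= \<bar>a\<bar> * (\<bar>x\<bar> ^ k * exp (- x\<^sup>2 / 2)) + \<bar>x ^ Suc k * poly p x * exp (- x\<^sup>2 / 2)\<bar>"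
    by (rule abs_triangle_ineq[THEN order_trans]) (simp add: abs_mult power_abs)
   also have "... <= \<bar>a\<bar> * (fact k * exp (1/2)) + C"
    by (intro add_mono mult_left_mono ex C) auto
   finally show ?thesis .
  qed
  thus ?case by blast
 qed
 from this[of 0 "hermite_polynomial n"] obtain C where C: "!!x. \<bar>poly (hermite_polynomial n) x * exp (- x\<^sup>2 / 2)\<bar> <= C"
  by auto
 have "\<bar>hermite_fun1 n x\<bar> <= C / sqrt (2 ^ n * fact n * sqrt pi)" for x
  using C[of x] by (simp add: hermite_fun1_def hermite_poly_eq abs_mult divide_right_mono)
 thus ?thesis by blast
qed

lemma hermite_fun_upd:
 "Hf (al(j := n)) x = hermite_fun1 n (x $ j) * (\<Prod>i\<in>UNIV - {j}. hermite_fun1 (al i) (x $ i))"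
proof -
 have "Hf (al(j := n)) x = hermite_fun1 ((al(j := n)) j) (x $ j) * (\<Prod>i\<in>UNIV - {j}. hermite_fun1 ((al(j := n)) i) (x $ i))"
  unfolding hermite_fun_def by (subst prod.remove[of UNIV j]) auto
 also have "(\<Prod>i\<in>UNIV - {j}. hermite_fun1 ((al(j := n)) i) (x $ i)) = (\<Prod>i\<in>UNIV - {j}. hermite_fun1 (al i) (x $ i))"
  by (intro prod.cong) auto
 finally show ?thesis by (simp only: fun_upd_same)
qed

lemma hermite_fun_split:
 "Hf al x = hermite_fun1 (al j) (x $ j) * (\<Prod>i\<in>UNIV - {j}. hermite_fun1 (al i) (x $ i))"
 using hermite_fun_upd[of al j "al j" x] by simp

lemma hermite_fun_mult:
 "x $ j * Hf al x = sqrt ((real (al j) + 1) / 2) * Hf (al(j := Suc (al j))) x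
   + sqrt (real (al j) / 2) * Hf (al(j := al j - 1)) x"
 unfolding hermite_fun_upd hermite_fun_split[of al x j]
 using hermite_fun1_mult[of "x $ j" "al j"] by (simp add: mult.assoc[symmetric] distrib_right[symmetric])

definition hermite_deriv :: "'d::finite => ('d => nat) => real ^ 'd => real" where
 "hermite_deriv j al x = sqrt (real (al j) / 2) * Hf (al(j := al j - 1)) x
   - sqrt ((real (al j) + 1) / 2) * Hf (al(j := Suc (al j))) x"

lemma hermite_fun_has_deriv:
 "((%h. Hf al (x + h *\<^sub>R axis j 1)) has_vector_derivative hermite_deriv j al x) (at 0)"
proof -
 define P where "P = (\<Prod>i\<in>UNIV - {j}. hermite_fun1 (al i) (x $ i))"
 have "Hf al (x + h *\<^sub>R axis j 1) = hermite_fun1 (al j) (x $ j + h) * P" for h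
 proof -
  have "(\<Prod>i\<in>UNIV - {j}. hermite_fun1 (al i) ((x + h *\<^sub>R axis j 1) $ i)) = P"
   unfolding P_def by (intro prod.cong) (auto simp: axis_def)
  thus ?thesis by (subst hermite_fun_split[of _ _ j]) (simp add: axis_def)
 qed
 moreover have "((%h. hermite_fun1 (al j) (x $ j + h) * P) has_real_derivative
   (sqrt (real (al j) / 2) * hermite_fun1 (al j - 1) (x $ j) - sqrt ((real (al j) + 1) / 2) * hermite_fun1 (Suc (al j)) (x $ j)) * P) (at 0)"
  using hermite_fun1_deriv[of "al j" "x $ j"] DERIV_shift[of "hermite_fun1 (al j)" _ 0 "x $ j"] by (intro DERIV_cmult_right) (simp add: add.commute)
 ultimately show ?thesis
  by (simp add: hermite_deriv_def hermite_fun_upd P_def algebra_simps has_real_derivative_iff_has_vector_derivative)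
qed

text \<open>Multiplication by a coordinate leads from one member of the family to two others, so a
  bound for all members gains one power of the norm per round. Neighbours have to be bounded at the
  same stage, hence the induction on \<open>M\<close> with \<open>i\<close> arbitrary.\<close>

lemma ladder_decay:
 fixes Ph :: "'i => 'a::real_normed_vector => 'b::real_normed_vector"
 assumes "finite J" and nz: "!!z. norm z <= (\<Sum>j\<in>J. norm (q j z))"
  and bd: "!!i. EX C. ALL z. norm (Ph i z) <= C"
  and lad: "!!i j. EX s t A B. 0 <= A & 0 <= B & (ALL z. norm (q j z) * norm (Ph i z) <= A * norm (Ph s z) + B * norm (Ph t z))"
 shows "\<exists>C\<ge>0. ALL z. norm (Ph i z) * (1 + norm z) ^ M <= C"
proof (induction M arbitrary: i)
 case 0
 obtain C where "ALL z. norm (Ph i z) <= C" using bd by blast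
 thus ?case by (intro exI[of _ C]) (auto intro: order_trans[OF norm_ge_zero])
next
 case (Suc M)
 have "\<exists>C\<ge>0. ALL z. norm (q j z) * (norm (Ph i z) * (1 + norm z) ^ M) <= C" for j
 proof -
  obtain s t A B where AB: "0 <= A" "0 <= B" "ALL z. norm (q j z) * norm (Ph i z) <= A * norm (Ph s z) + B * norm (Ph t z)"
   using lad by metis
  obtain C1 where C1: "C1 >= 0" "ALL z. norm (Ph s z) * (1 + norm z) ^ M <= C1" using Suc by blast
  obtain C2 where C2: "C2 >= 0" "ALL z. norm (Ph t z) * (1 + norm z) ^ M <= C2" using Suc by blast
  have "norm (q j z) * (norm (Ph i z) * (1 + norm z) ^ M) <= A * C1 + B * C2" for z
  proof -
   have "norm (q j z) * (norm (Ph i z) * (1 + norm z) ^ M) <= (A * norm (Ph s z) + B * norm (Ph t z)) * (1 + norm z) ^ M"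
    unfolding mult.assoc[symmetric] using AB by (intro mult_right_mono) auto
   also have "... = A * (norm (Ph s z) * (1 + norm z) ^ M) + B * (norm (Ph t z) * (1 + norm z) ^ M)"
    by (simp add: algebra_simps)
   also have "... <= A * C1 + B * C2" using AB C1 C2 by (intro add_mono mult_left_mono) auto
   finally show ?thesis .
  qed
  thus ?thesis using AB C1 C2 by (intro exI[of _ "A * C1 + B * C2"]) auto
 qed
 then obtain c where c: "!!j. c j >= 0" "!!j z. norm (q j z) * (norm (Ph i z) * (1 + norm z) ^ M) <= c j"
  by metis
 obtain C where C: "C >= 0" "!!z. norm (Ph i z) * (1 + norm z) ^ M <= C" using Suc by blast
 have "norm (Ph i z) * (1 + norm z) ^ Suc M <= C + (\<Sum>j\<in>J. c j)" for z
 proof -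
  have "norm (Ph i z) * (1 + norm z) ^ Suc M = norm (Ph i z) * (1 + norm z) ^ M + norm z * (norm (Ph i z) * (1 + norm z) ^ M)"
   by (simp add: algebra_simps)
  also have "... <= C + (\<Sum>j\<in>J. norm (q j z)) * (norm (Ph i z) * (1 + norm z) ^ M)"
   by (intro add_mono C mult_right_mono nz) auto
  also have "... <= C + (\<Sum>j\<in>J. c j)"
   unfolding sum_distrib_right by (intro add_mono sum_mono c) auto
  finally show ?thesis .
 qed
 thus ?case using C c by (intro exI[of _ "C + (\<Sum>j\<in>J. c j)"]) (auto intro!: add_nonneg_nonneg sum_nonneg)
qed

lemma hermite_fun_decay: "\<exists>C\<ge>0. ALL x. \<bar>Hf al x\<bar> <= C / (1 + norm x) ^ M"
proof -
 have "\<exists>C\<ge>0. ALL x. norm (Hf al x) * (1 + norm x) ^ M <= C"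
 proof (rule ladder_decay[where J = UNIV and q = "%j x. x $ j" and Ph = Hf])
  show "norm x <= (\<Sum>j\<in>UNIV. norm (x $ j))" for x :: "real ^ 'a"
   by (simp add: norm_le_l1_cart)
  show "EX C. ALL x. norm (Hf al x) <= C" for al :: "'a => nat"
  proof -
   obtain c where c: "!!n x. \<bar>hermite_fun1 n x\<bar> <= c n" using hermite_fun1_bounded by metis
   have "norm (Hf al x) <= (\<Prod>j\<in>UNIV. c (al j))" for x
    unfolding hermite_fun_def by (simp add: abs_prod prod_mono c)
   thus ?thesis by blast
  qed
  show "EX s t A B. 0 <= A & 0 <= B & (ALL x. norm (x $ j) * norm (Hf al x) <= A * norm (Hf s x) + B * norm (Hf t x))" for j :: 'a and al
  proof (intro exI conjI allI)
   fix x
   have "norm (x $ j) * norm (Hf al x) = \<bar>x $ j * Hf al x\<bar>" by (simp add: abs_mult)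
   also have "... <= \<bar>sqrt ((real (al j) + 1) / 2) * Hf (al(j := Suc (al j))) x\<bar>
     + \<bar>sqrt (real (al j) / 2) * Hf (al(j := al j - 1)) x\<bar>"
    unfolding hermite_fun_mult by (rule abs_triangle_ineq)
   finally show "norm (x $ j) * norm (Hf al x) <= sqrt ((real (al j) + 1) / 2) * norm (Hf (al(j := Suc (al j))) x)
     + sqrt (real (al j) / 2) * norm (Hf (al(j := al j - 1)) x)"
    by (simp add: abs_mult)
  qed auto
 qed simp
 then obtain C where "C >= 0" "!!x. \<bar>Hf al x\<bar> * (1 + norm x) ^ M <= C" by auto
 hence "\<bar>Hf al x\<bar> <= C / (1 + norm x) ^ M" for x
  by (simp add: pos_le_divide_eq add_pos_nonneg)
 thus ?thesis using \<open>C >= 0\<close> by blast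
qed

lemma continuous_hermite_fun1: "continuous_on S (hermite_fun1 n)"
 by (meson hermite_fun1_deriv DERIV_isCont continuous_at_imp_continuous_on)

lemma continuous_hermite_fun: "continuous_on S (Hf al)"
 unfolding hermite_fun_def by (intro continuous_intros continuous_on_compose2[OF continuous_hermite_fun1]) auto

lemma borel_measurable_hermite_fun[measurable]: "Hf al \<in> bm"
 by (intro borel_measurable_continuous_onI continuous_hermite_fun)

text \<open>The hypotheses say that raising one index is adjoint to lowering the other. Lowering
  both indices together either ends at the ground pairing or meets a vanishing coefficient on the
  way.\<close>

lemma ladder_orthogonal:
 fixes I :: "('d::finite => nat) => ('d => nat) => complex"
 assumes r1: "!!j a b. sqrt (real (a j) + 1) * I (a(j := Suc (a j))) b = sqrt (real (b j)) * I a (b(j := b j - 1))"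
  and r2: "!!j a b. sqrt (real (b j) + 1) * I a (b(j := Suc (b j))) = sqrt (real (a j)) * I (a(j := a j - 1)) b"
 shows "I a b = (if a = b then I (%_. 0) (%_. 0) else 0)"
proof (induction "\<Sum>j\<in>UNIV. a j" arbitrary: a b rule: less_induct)
 case less
 show ?case
 proof (cases "ALL j. a j = 0")
  case True
  hence a0: "a = (%_. 0)" by auto
  show ?thesis
  proof (cases "ALL j. b j = 0")
   case True hence "b = (%_. 0)" by auto
   thus ?thesis using a0 by simp
  next
   case False
   then obtain j m where j: "b j = Suc m" using not0_implies_Suc by blast
   define b' where "b' = b(j := m)"
   have b: "b = b'(j := Suc (b' j))" using j by (auto simp: b'_def)
   have "sqrt (real (b' j) + 1) * I a b = 0"
    using r2[of b' j a, folded b] a0 by simp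
   moreover have "sqrt (real (b' j) + 1) ~= 0" by (simp add: add_nonneg_eq_0_iff)
   ultimately have "I a b = 0" by simp
   thus ?thesis using False a0 by auto
  qed
 next
  case False
  then obtain j m where j: "a j = Suc m" using not0_implies_Suc by blast
  define a' where "a' = a(j := m)"
  have a: "a = a'(j := Suc (a' j))" using j by (auto simp: a'_def)
  have sm: "(\<Sum>i\<in>UNIV. a' i) < (\<Sum>i\<in>UNIV. a i)"
   by (rule sum_strict_mono_ex1) (auto simp: a'_def j)
  have r: "sqrt (real m + 1) * I a b = sqrt (real (b j)) * I a' (b(j := b j - 1))"
   using r1[of a' j b, folded a] by (simp add: a'_def)
  have nz: "complex_of_real (sqrt (real m + 1)) ~= 0" by (simp add: add_nonneg_eq_0_iff)
  show ?thesis
  proof (cases "b j")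
   case 0
   thus ?thesis using r nz j by auto
  next
   case (Suc n)
   have eq: "a = b \<longleftrightarrow> a' = b(j := b j - 1)"
   proof
    assume e: "a' = b(j := b j - 1)"
    hence "m = n" using Suc by (auto simp: a'_def fun_eq_iff split: if_splits)
    thus "a = b" using e a Suc by auto
   next
    assume "a = b" thus "a' = b(j := b j - 1)" using j by (auto simp: a'_def)
   qed
   show ?thesis
   proof (cases "a = b")
    case True
    hence "sqrt (real (b j)) = sqrt (real m + 1)" using j by (simp add: add.commute)
    hence "I a b = I a' (b(j := b j - 1))" using r nz by simp
    also have "... = I (%_. 0) (%_. 0)" using less[OF sm, of "b(j := b j - 1)"] True eq by metis
    finally show ?thesis using True by simp
   next
    case False
    hence "I a' (b(j := b j - 1)) = 0" using less[OF sm, of "b(j := b j - 1)"] eq by simp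
    thus ?thesis using r nz False by simp
   qed
  qed
 qed
qed

lemma integrable_hermite_fun_mult: "integrable lborel (%x. Hf al x * Hf be x)"
proof -
 obtain C where C: "C >= 0" "!!x. \<bar>Hf al x\<bar> <= C / (1 + norm x) ^ (DIM(real^'a) + 2)"
  using hermite_fun_decay[of al "DIM(real^'a) + 2"] by blast
 obtain B where B: "B >= 0" "!!x. \<bar>Hf be x\<bar> <= B"
  using hermite_fun_decay[of be 0] by auto
 show ?thesis
 proof (rule integrable_poly_decay[where C = "C * B"])
  fix x
  show "norm (Hf al x * Hf be x) <= C * B / (1 + norm x) ^ (DIM(real^'a) + 2)"
   using mult_mono[OF C(2)[of x] B(2)[of x]] C(1) by (simp add: abs_mult)
 qed measurable
qed

text \<open>Multiplication by a coordinate is symmetric and differentiation is antisymmetric.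
  Combining the two relations gives the adjointness of raising and lowering that
  \<open>ladder_orthogonal\<close> asks for.\<close>

lemma hermite_fun_orthogonal:
 "(LI x. Hf al x * Hf be x) =
   (if (al :: 'd::finite => nat) = be then (LI x. Hf (%_::'d. 0) x * Hf (%_. 0) x) else 0)"
proof -
 define I where "I a b = (LI x. Hf a x * Hf b x)" for a b :: "'d => nat"
 note int = integrable_hermite_fun_mult
 have sym: "I a b = I b a" for a b unfolding I_def by (simp add: mult.commute)
 have e1: "sqrt ((real (a j) + 1) / 2) * I (a(j := Suc (a j))) b + sqrt (real (a j) / 2) * I (a(j := a j - 1)) b
   = (LI x. (x $ j) * Hf a x * Hf b x)" for a b j
  by (simp add: hermite_fun_mult I_def distrib_right int mult.assoc)
 have e1': "sqrt ((real (a j) + 1) / 2) * I (a(j := Suc (a j))) b + sqrt (real (a j) / 2) * I (a(j := a j - 1)) b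
   = sqrt ((real (b j) + 1) / 2) * I a (b(j := Suc (b j))) + sqrt (real (b j) / 2) * I a (b(j := b j - 1))" for a b j
 proof -
  have "(LI x. (x $ j) * Hf a x * Hf b x) = (LI x. (x $ j) * Hf b x * Hf a x)"
   by (simp add: mult_ac)
  thus ?thesis using e1[of a j b] e1[of b j a] by (simp add: sym)
 qed
 have d: "(LI x. hermite_deriv j a x * Hf b x)
   = sqrt (real (a j) / 2) * I (a(j := a j - 1)) b - sqrt ((real (a j) + 1) / 2) * I (a(j := Suc (a j))) b" for a b j
  by (simp add: hermite_deriv_def I_def left_diff_distrib int mult.assoc)
 have di: "integrable lborel (%x. hermite_deriv j a x * Hf b x)" for j :: 'd and a b
  unfolding hermite_deriv_def by (simp add: left_diff_distrib int mult.assoc)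
 have e2: "(sqrt (real (a j) / 2) * I (a(j := a j - 1)) b - sqrt ((real (a j) + 1) / 2) * I (a(j := Suc (a j))) b)
   + (sqrt (real (b j) / 2) * I a (b(j := b j - 1)) - sqrt ((real (b j) + 1) / 2) * I a (b(j := Suc (b j)))) = 0" for a b j
 proof -
  have "(LI x. complex_of_real (hermite_deriv j a x * Hf b x + hermite_deriv j b x * Hf a x)) = 0"
  proof (rule integral_directional_derivative[where F = "%x. complex_of_real (Hf a x * Hf b x)" and v = "axis j 1"])
   show "((%h. complex_of_real (Hf a (z + h *\<^sub>R axis j 1) * Hf b (z + h *\<^sub>R axis j 1))) has_vector_derivative
     complex_of_real (hermite_deriv j a z * Hf b z + hermite_deriv j b z * Hf a z)) (at 0)" for z
    using has_vector_derivative_mult[OF hermite_fun_has_deriv[of a z j] hermite_fun_has_deriv[of b z j]]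
    by (intro has_vector_derivative_of_real) (simp add: algebra_simps has_real_derivative_iff_has_vector_derivative)
   show "continuous_on UNIV (%z. complex_of_real (hermite_deriv j a z * Hf b z + hermite_deriv j b z * Hf a z))"
    unfolding hermite_deriv_def by (intro continuous_intros continuous_hermite_fun)
   show "integrable lborel (%x. complex_of_real (Hf a x * Hf b x))"
    by (intro integrable_of_real int)
   show "integrable lborel (%z. complex_of_real (hermite_deriv j a z * Hf b z + hermite_deriv j b z * Hf a z))"
    by (intro integrable_of_real Bochner_Integration.integrable_add di)
  qed
  hence "(LI x. hermite_deriv j a x * Hf b x + hermite_deriv j b x * Hf a x) = 0"
   by (simp only: integral_complex_of_real of_real_eq_0_iff)
  thus ?thesis by (simp add: di d sym)
 qed
 have k: "sqrt ((real (a j) + 1) / 2) * I (a(j := Suc (a j))) b = sqrt (real (b j) / 2) * I a (b(j := b j - 1))" for a b j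
  using e1'[of a j b] e2[of a j b] by linarith
 have k': "sqrt (real (a j) + 1) * I (a(j := Suc (a j))) b = sqrt (real (b j)) * I a (b(j := b j - 1))" for a b j
  using k[of a j b] by (simp add: real_sqrt_divide)
 have "complex_of_real (I al be) = (if al = be then complex_of_real (I (%_. 0) (%_. 0)) else 0)"
 proof (rule ladder_orthogonal)
  show "complex_of_real (sqrt (real (a j) + 1)) * complex_of_real (I (a(j := Suc (a j))) b) =
   complex_of_real (sqrt (real (b j))) * complex_of_real (I a (b(j := b j - 1)))" for a b j
   unfolding of_real_mult[symmetric] k' ..
  show "complex_of_real (sqrt (real (b j) + 1)) * complex_of_real (I a (b(j := Suc (b j)))) =
   complex_of_real (sqrt (real (a j))) * complex_of_real (I (a(j := a j - 1)) b)" for a b j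
   unfolding of_real_mult[symmetric] using k'[of b j a] by (simp add: sym)
 qed
 thus ?thesis unfolding I_def by (auto split: if_splits)
qed

section \<open>Special Hermite functions\<close>

abbreviation up :: "('d => nat) => 'd => 'd => nat" where "up al j \<equiv> al(j := Suc (al j))"
abbreviation dn :: "('d => nat) => 'd => 'd => nat" where "dn al j \<equiv> al(j := al j - 1)"

definition sh_integrand :: "('d::finite => nat) => ('d => nat) => complex ^ 'd => real ^ 'd => complex" where
 "sh_integrand al be z xi = exp (\<i> * of_real (re_part z \<bullet> xi)) *
   of_real (Hf al (xi + (1/2) *\<^sub>R im_part z) * Hf be (xi - (1/2) *\<^sub>R im_part z))"

definition sh_const :: "'d::finite itself => complex" where
 "sh_const _ = of_real ((2 * pi) powr (- real CARD('d) / 2))"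

lemma special_hermite_eq:
 "Sh al be z = sh_const TYPE('d::finite) * (LI xi. sh_integrand (al :: 'd => nat) be z xi)"
 by (simp add: special_hermite_def sh_integrand_def sh_const_def)

lemma one_plus_norm_le: "1 + norm (x::'a::real_normed_vector) <= (1 + norm (x + y)) * (1 + norm y)"
proof -
 have "norm x <= norm (x + y) + norm y" using norm_triangle_ineq4[of "x + y" y] by simp
 moreover have "0 <= norm (x + y) * norm y" by simp
 moreover have "(1 + norm (x + y)) * (1 + norm y) = 1 + norm (x + y) + norm y + norm (x + y) * norm y"
  by (simp add: algebra_simps)
 ultimately show ?thesis by linarith
qed

text \<open>Decay in \<open>xi\<close> is paid for by growth in the shift \<open>et\<close>, through
  \<open>one_plus_norm_le\<close>. The bound is uniform for bounded \<open>et\<close> only, which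
  suffices for continuity and for differentiating under the integral; decay in z has to come from
  the ladder.\<close>

lemma hermite_pair_bound:
 "\<exists>K\<ge>0. ALL xi et. \<bar>Hf al (xi + et) * Hf be (xi - et)\<bar> <= K * (1 + norm et) ^ M / (1 + norm xi) ^ M"
proof -
 obtain C where C: "C >= 0" "!!x. \<bar>Hf al x\<bar> <= C / (1 + norm x) ^ M"
  using hermite_fun_decay[of al M] by blast
 obtain B where B: "B >= 0" "!!x. \<bar>Hf be x\<bar> <= B"
  using hermite_fun_decay[of be 0] by auto
 have "\<bar>Hf al (xi + et) * Hf be (xi - et)\<bar> <= (C * B) * (1 + norm et) ^ M / (1 + norm xi) ^ M" for xi et
 proof -
  have "(1 + norm xi) ^ M <= ((1 + norm (xi + et)) * (1 + norm et)) ^ M"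
   by (intro power_mono one_plus_norm_le) auto
  hence "(1 + norm xi) ^ M <= (1 + norm (xi + et)) ^ M * (1 + norm et) ^ M"
   by (simp add: power_mult_distrib)
  moreover have "(1 + norm xi) ^ M > 0" "(1 + norm (xi + et)) ^ M > 0" by (auto intro!: zero_less_power add_pos_nonneg)
  ultimately have "1 / (1 + norm (xi + et)) ^ M <= (1 + norm et) ^ M / (1 + norm xi) ^ M"
   by (simp add: field_simps)
  have "\<bar>Hf al (xi + et) * Hf be (xi - et)\<bar> <= C / (1 + norm (xi + et)) ^ M * B"
   unfolding abs_mult using C B by (intro mult_mono) auto
  also have "... = C * B * (1 / (1 + norm (xi + et)) ^ M)" by simp
  also have "... <= C * B * ((1 + norm et) ^ M / (1 + norm xi) ^ M)"
   using \<open>1 / _ <= _\<close> C B by (intro mult_left_mono) auto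
  finally show ?thesis by simp
 qed
 thus ?thesis using B C by (intro exI[of _ "C * B"]) auto
qed

lemma norm_sh_integrand:
 "norm (sh_integrand al be z xi) = \<bar>Hf al (xi + (1/2) *\<^sub>R im_part z) * Hf be (xi - (1/2) *\<^sub>R im_part z)\<bar>"
 by (simp add: sh_integrand_def norm_mult abs_mult)

lemma continuous_sh_integrand: "continuous_on S (sh_integrand al be z)"
 unfolding sh_integrand_def
 by (intro continuous_intros continuous_on_compose2[OF continuous_hermite_fun[of UNIV]]) auto

lemma borel_measurable_sh_integrand[measurable]: "sh_integrand al be z \<in> bm"
 by (intro borel_measurable_continuous_onI continuous_sh_integrand)

lemma sh_integrand_bound:
 "\<exists>K\<ge>0. ALL z xi. norm (sh_integrand al be z xi) <= K * (1 + norm (im_part z)) ^ M / (1 + norm xi) ^ M"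
proof -
 obtain K where K: "K >= 0" "!!xi et. \<bar>Hf al (xi + et) * Hf be (xi - et)\<bar> <= K * (1 + norm et) ^ M / (1 + norm xi) ^ M"
  using hermite_pair_bound by blast
 have "norm (sh_integrand al be z xi) <= K * (1 + norm (im_part z)) ^ M / (1 + norm xi) ^ M" for z xi
 proof -
  have "norm (sh_integrand al be z xi) <= K * (1 + norm ((1/2) *\<^sub>R im_part z)) ^ M / (1 + norm xi) ^ M"
   unfolding norm_sh_integrand by (rule K)
  also have "... <= K * (1 + norm (im_part z)) ^ M / (1 + norm xi) ^ M"
   using K by (intro divide_right_mono mult_left_mono power_mono) auto
  finally show ?thesis .
 qed
 thus ?thesis using K by blast
qed

lemma integrable_sh_integrand: "integrable lborel (sh_integrand (al :: 'd::finite => nat) be z)"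
proof -
 obtain K where "!!z xi. norm (sh_integrand al be z xi) <= K * (1 + norm (im_part z)) ^ (DIM(real^'d) + 2) / (1 + norm xi) ^ (DIM(real^'d) + 2)"
  using sh_integrand_bound by blast
 thus ?thesis by (intro integrable_poly_decay) auto
qed

lemma sh_integrand_mult_left:
 "of_real ((xi + (1/2) *\<^sub>R im_part z) $ j) * sh_integrand al be z xi =
   of_real (sqrt ((real (al j) + 1) / 2)) * sh_integrand (up al j) be z xi + of_real (sqrt (real (al j) / 2)) * sh_integrand (dn al j) be z xi"
proof -
 have "of_real ((xi + (1/2) *\<^sub>R im_part z) $ j) * sh_integrand al be z xi = exp (\<i> * of_real (re_part z \<bullet> xi)) *
   of_real ((xi + (1/2) *\<^sub>R im_part z) $ j * Hf al (xi + (1/2) *\<^sub>R im_part z) * Hf be (xi - (1/2) *\<^sub>R im_part z))"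
  unfolding sh_integrand_def by (simp only: of_real_mult mult_ac)
 also have "... = of_real (sqrt ((real (al j) + 1) / 2)) * sh_integrand (up al j) be z xi + of_real (sqrt (real (al j) / 2)) * sh_integrand (dn al j) be z xi"
  unfolding hermite_fun_mult sh_integrand_def by (simp only: of_real_mult of_real_add distrib_left distrib_right mult_ac)
 finally show ?thesis .
qed

lemma sh_integrand_mult_right:
 "of_real ((xi - (1/2) *\<^sub>R im_part z) $ j) * sh_integrand al be z xi =
   of_real (sqrt ((real (be j) + 1) / 2)) * sh_integrand al (up be j) z xi + of_real (sqrt (real (be j) / 2)) * sh_integrand al (dn be j) z xi"
proof -
 have "of_real ((xi - (1/2) *\<^sub>R im_part z) $ j) * sh_integrand al be z xi = exp (\<i> * of_real (re_part z \<bullet> xi)) *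
   of_real (Hf al (xi + (1/2) *\<^sub>R im_part z) * ((xi - (1/2) *\<^sub>R im_part z) $ j * Hf be (xi - (1/2) *\<^sub>R im_part z)))"
  unfolding sh_integrand_def by (simp only: of_real_mult mult_ac)
 also have "... = of_real (sqrt ((real (be j) + 1) / 2)) * sh_integrand al (up be j) z xi + of_real (sqrt (real (be j) / 2)) * sh_integrand al (dn be j) z xi"
  unfolding hermite_fun_mult sh_integrand_def by (simp only: of_real_mult of_real_add distrib_left distrib_right mult_ac)
 finally show ?thesis .
qed

definition shd_left :: "('d::finite => nat) => ('d => nat) => 'd => complex ^ 'd => real ^ 'd => complex" where
 "shd_left al be j z xi = of_real (sqrt (real (al j) / 2)) * sh_integrand (dn al j) be z xi - of_real (sqrt ((real (al j) + 1) / 2)) * sh_integrand (up al j) be z xi"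

definition shd_right :: "('d::finite => nat) => ('d => nat) => 'd => complex ^ 'd => real ^ 'd => complex" where
 "shd_right al be j z xi = of_real (sqrt (real (be j) / 2)) * sh_integrand al (dn be j) z xi - of_real (sqrt ((real (be j) + 1) / 2)) * sh_integrand al (up be j) z xi"

lemma shd_left_eq: "shd_left al be j z xi = exp (\<i> * of_real (re_part z \<bullet> xi)) *
   of_real (hermite_deriv j al (xi + (1/2) *\<^sub>R im_part z) * Hf be (xi - (1/2) *\<^sub>R im_part z))"
 unfolding shd_left_def sh_integrand_def hermite_deriv_def
 by (simp only: of_real_mult of_real_diff left_diff_distrib right_diff_distrib mult_ac)

lemma shd_right_eq: "shd_right al be j z xi = exp (\<i> * of_real (re_part z \<bullet> xi)) *
   of_real (Hf al (xi + (1/2) *\<^sub>R im_part z) * hermite_deriv j be (xi - (1/2) *\<^sub>R im_part z))"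
 unfolding shd_right_def sh_integrand_def hermite_deriv_def
 by (simp only: of_real_mult of_real_diff left_diff_distrib right_diff_distrib mult_ac)

lemma has_vector_derivative_direction_scaled:
 fixes F :: "'a::real_vector => 'b::real_normed_vector"
 assumes "!!x. ((%h. F (x + h *\<^sub>R v)) has_vector_derivative G x) (at 0)"
 shows "((%h. F (x + h *\<^sub>R (c *\<^sub>R v))) has_vector_derivative c *\<^sub>R G (x + s *\<^sub>R (c *\<^sub>R v))) (at s)"
proof -
 have "((%h. F (x + h *\<^sub>R v)) has_vector_derivative G (x + (c * s) *\<^sub>R v)) (at (c * s))"
  by (rule has_vector_derivative_line[OF assms])
 moreover have "((%h. c * h) has_vector_derivative c) (at s)"
  by (auto intro!: derivative_eq_intros)
 ultimately have "((%h. F (x + h *\<^sub>R v)) \<circ> (%h. c * h) has_vector_derivative c *\<^sub>R G (x + (c * s) *\<^sub>R v)) (at s)"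
  by (intro vector_diff_chain_at)
 thus ?thesis by (simp add: o_def mult.commute)
qed

lemma sh_integrand_deriv_xi:
 "((%h. sh_integrand al be z (xi + h *\<^sub>R axis j 1)) has_vector_derivative
   (\<i> * of_real (re_part z $ j) * sh_integrand al be z xi + shd_left al be j z xi + shd_right al be j z xi)) (at 0)"
proof -
 let ?e = "axis j (1::real)"
 have e: "((%h. exp (\<i> * of_real (re_part z \<bullet> (xi + h *\<^sub>R ?e)))) has_vector_derivative
   (\<i> * of_real (re_part z $ j) * exp (\<i> * of_real (re_part z \<bullet> xi)))) (at 0)"
 proof -
  have "((%h. \<i> * of_real (re_part z \<bullet> (xi + h *\<^sub>R ?e))) has_vector_derivative (\<i> * of_real (re_part z $ j))) (at 0)"
   by (auto intro!: derivative_eq_intros simp: inner_axis inner_add_right)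
  from field_vector_diff_chain_at[OF this DERIV_exp] show ?thesis
   by (simp add: o_def)
 qed
 have a: "((%h. Hf al (xi + h *\<^sub>R ?e + (1/2) *\<^sub>R im_part z)) has_vector_derivative hermite_deriv j al (xi + (1/2) *\<^sub>R im_part z)) (at 0)"
  using hermite_fun_has_deriv[of al "xi + (1/2) *\<^sub>R im_part z" j] by (simp add: algebra_simps)
 have b: "((%h. Hf be (xi + h *\<^sub>R ?e - (1/2) *\<^sub>R im_part z)) has_vector_derivative hermite_deriv j be (xi - (1/2) *\<^sub>R im_part z)) (at 0)"
  using hermite_fun_has_deriv[of be "xi - (1/2) *\<^sub>R im_part z" j] by (simp add: algebra_simps)
 show ?thesis
  unfolding shd_left_eq shd_right_eq
  using has_vector_derivative_mult[OF e has_vector_derivative_of_real[OF has_vector_derivative_mult[OF a b, folded has_real_derivative_iff_has_vector_derivative]]]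
  by (simp add: sh_integrand_def algebra_simps)
qed

lemma integrable_shd: "integrable lborel (shd_left al be j z)" "integrable lborel (shd_right al be j z)"
 unfolding shd_left_def shd_right_def
 by (intro Bochner_Integration.integrable_diff integrable_mult_right integrable_sh_integrand)+

text \<open>The imaginary part y_j is the difference of the j-th coordinates of xi + y/2 and xi -
  y/2, the arguments of the two Hermite factors, and the Hermite ladder applies to each of
  them.\<close>

lemma sh_Im_mult:
 "of_real (Im (z $ j)) * Sh al be z =
  (of_real (sqrt ((real (al j) + 1) / 2)) * Sh (up al j) be z + of_real (sqrt (real (al j) / 2)) * Sh (dn al j) be z)
 - (of_real (sqrt ((real (be j) + 1) / 2)) * Sh al (up be j) z + of_real (sqrt (real (be j) / 2)) * Sh al (dn be j) z)"
proof -
 note int = integrable_sh_integrand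
 have "of_real (Im (z $ j)) * sh_integrand al be z xi =
   (of_real (sqrt ((real (al j) + 1) / 2)) * sh_integrand (up al j) be z xi + of_real (sqrt (real (al j) / 2)) * sh_integrand (dn al j) be z xi)
  - (of_real (sqrt ((real (be j) + 1) / 2)) * sh_integrand al (up be j) z xi + of_real (sqrt (real (be j) / 2)) * sh_integrand al (dn be j) z xi)" for xi
  unfolding sh_integrand_mult_left[symmetric] sh_integrand_mult_right[symmetric]
  by (simp add: im_part_def algebra_simps)
 hence "(LI xi. of_real (Im (z $ j)) * sh_integrand al be z xi) =
   (of_real (sqrt ((real (al j) + 1) / 2)) * (LI xi. sh_integrand (up al j) be z xi) + of_real (sqrt (real (al j) / 2)) * (LI xi. sh_integrand (dn al j) be z xi))
  - (of_real (sqrt ((real (be j) + 1) / 2)) * (LI xi. sh_integrand al (up be j) z xi) + of_real (sqrt (real (be j) / 2)) * (LI xi. sh_integrand al (dn be j) z xi))"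
  by (simp add: int)
 from arg_cong[OF this, of "%x. sh_const TYPE('a) * x"] show ?thesis unfolding special_hermite_eq
  by (simp add: algebra_simps)
qed

text \<open>The real part x_j is produced by differentiating the exponential in xi_j. The full
  xi_j-derivative of the integrand has integral 0, so this factor is traded for derivatives of the
  two Hermite functions.\<close>

lemma sh_Re_mult:
 "of_real (Re (z $ j)) * Sh al be z =
  \<i> * ((of_real (sqrt (real (al j) / 2)) * Sh (dn al j) be z - of_real (sqrt ((real (al j) + 1) / 2)) * Sh (up al j) be z)
   + (of_real (sqrt (real (be j) / 2)) * Sh al (dn be j) z - of_real (sqrt ((real (be j) + 1) / 2)) * Sh al (up be j) z))"
proof -
 note int = integrable_sh_integrand
 define I where "I a b = (LI xi. sh_integrand a b z xi)" for a b
 have "(LI xi. \<i> * of_real (re_part z $ j) * sh_integrand al be z xi + shd_left al be j z xi + shd_right al be j z xi) = 0"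
 proof (rule integral_directional_derivative[OF sh_integrand_deriv_xi])
  show "continuous_on UNIV (%xi. \<i> * of_real (re_part z $ j) * sh_integrand al be z xi + shd_left al be j z xi + shd_right al be j z xi)"
   unfolding shd_left_def shd_right_def by (intro continuous_intros continuous_sh_integrand)
  show "integrable lborel (%xi. \<i> * of_real (re_part z $ j) * sh_integrand al be z xi + shd_left al be j z xi + shd_right al be j z xi)"
   by (intro Bochner_Integration.integrable_add integrable_mult_right int integrable_shd)
 qed (rule int)
 hence "\<i> * of_real (Re (z $ j)) * I al be + (of_real (sqrt (real (al j) / 2)) * I (dn al j) be - of_real (sqrt ((real (al j) + 1) / 2)) * I (up al j) be)
   + (of_real (sqrt (real (be j) / 2)) * I al (dn be j) - of_real (sqrt ((real (be j) + 1) / 2)) * I al (up be j)) = 0"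
  unfolding shd_left_def shd_right_def I_def by (simp add: int re_part_def)
 hence "\<i> * (\<i> * of_real (Re (z $ j)) * I al be + (of_real (sqrt (real (al j) / 2)) * I (dn al j) be - of_real (sqrt ((real (al j) + 1) / 2)) * I (up al j) be)
   + (of_real (sqrt (real (be j) / 2)) * I al (dn be j) - of_real (sqrt ((real (be j) + 1) / 2)) * I al (up be j))) = 0"
  by (simp only: mult_zero_right)
 hence "of_real (Re (z $ j)) * I al be = \<i> * ((of_real (sqrt (real (al j) / 2)) * I (dn al j) be - of_real (sqrt ((real (al j) + 1) / 2)) * I (up al j) be)
   + (of_real (sqrt (real (be j) / 2)) * I al (dn be j) - of_real (sqrt ((real (be j) + 1) / 2)) * I al (up be j)))"
  by (simp add: algebra_simps eq_neg_iff_add_eq_0 add_eq_0_iff)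
 thus ?thesis unfolding special_hermite_eq I_def[symmetric]
  by (simp add: mult.left_commute[of _ "sh_const _"] flip: right_diff_distrib distrib_left)
qed

lemma sqrt_half: "sqrt (x / 2) = sqrt x / sqrt 2"
 by (simp add: real_sqrt_divide)

lemma sqrt2_sq: "complex_of_real (sqrt 2) * complex_of_real (sqrt 2) = 2"
 by (simp flip: of_real_mult)

text \<open>Adding i times the y-relation to the x-relation cancels two of the four neighbours. What
  remains lowers the first index or raises the second; this separation is behind the cancellation of
  first-index shifts in \<open>shE_z\<close>.\<close>

lemma sh_z_mult:
 "z $ j * Sh al be z = \<i> * of_real (sqrt 2) *
   (of_real (sqrt (real (al j))) * Sh (dn al j) be z - of_real (sqrt (real (be j) + 1)) * Sh al (up be j) z)"
proof -
 have "z $ j * Sh al be z = of_real (Re (z $ j)) * Sh al be z + \<i> * (of_real (Im (z $ j)) * Sh al be z)"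
  by (subst (1) complex_eq[of "z $ j"]) (simp add: algebra_simps)
 also have "... = \<i> * 2 * (of_real (sqrt (real (al j) / 2)) * Sh (dn al j) be z - of_real (sqrt ((real (be j) + 1) / 2)) * Sh al (up be j) z)"
  unfolding sh_Re_mult sh_Im_mult by (simp add: algebra_simps)
 also have "... = \<i> * of_real (sqrt 2) *
   (of_real (sqrt (real (al j))) * Sh (dn al j) be z - of_real (sqrt (real (be j) + 1)) * Sh al (up be j) z)"
  unfolding sqrt_half sqrt2_sq[symmetric] by (simp add: field_simps)
 finally show ?thesis .
qed

lemma sh_cnj_mult:
 "cnj (z $ j) * Sh al be z = \<i> * of_real (sqrt 2) *
   (of_real (sqrt (real (be j))) * Sh al (dn be j) z - of_real (sqrt (real (al j) + 1)) * Sh (up al j) be z)"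
proof -
 have "cnj (z $ j) = of_real (Re (z $ j)) - \<i> * of_real (Im (z $ j))"
  by (simp add: complex_eq_iff)
 hence "cnj (z $ j) * Sh al be z = of_real (Re (z $ j)) * Sh al be z - \<i> * (of_real (Im (z $ j)) * Sh al be z)"
  by (simp only: left_diff_distrib mult.assoc)
 also have "... = \<i> * 2 * (of_real (sqrt (real (be j) / 2)) * Sh al (dn be j) z - of_real (sqrt ((real (al j) + 1) / 2)) * Sh (up al j) be z)"
  unfolding sh_Re_mult sh_Im_mult by (simp add: algebra_simps)
 also have "... = \<i> * of_real (sqrt 2) *
   (of_real (sqrt (real (be j))) * Sh al (dn be j) z - of_real (sqrt (real (al j) + 1)) * Sh (up al j) be z)"
  unfolding sqrt_half sqrt2_sq[symmetric] by (simp add: field_simps)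
 finally show ?thesis .
qed

lemma norm_le_sum_cmod: "norm (z :: complex ^ 'd::finite) <= (\<Sum>j\<in>UNIV. cmod (z $ j))"
 unfolding norm_vec_def by (rule L2_set_le_sum) auto

text \<open>One Hermite factor is bounded by a constant, and a translation by y/2 in the integral of
  the other removes z completely. This uniform bound is the starting point for
  \<open>ladder_decay\<close>.\<close>

lemma special_hermite_bounded: "EX C. ALL z. cmod (Sh (al :: 'd::finite => nat) be z) <= C"
proof -
 let ?M = "DIM(real^'d) + 2"
 obtain A where A: "A >= 0" "!!x. \<bar>Hf al x\<bar> <= A / (1 + norm x) ^ ?M"
  using hermite_fun_decay by blast
 obtain B where B: "B >= 0" "!!x. \<bar>Hf be x\<bar> <= B"
  using hermite_fun_decay[of be 0] by auto
 have ia: "integrable lborel (%x. \<bar>Hf al x\<bar>)"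
  using A by (intro integrable_poly_decay) auto
 have "cmod (Sh al be z) <= cmod (sh_const TYPE('d)) * (LI x. \<bar>Hf al x\<bar> * B)" for z
 proof -
  have "cmod (LI xi. sh_integrand al be z xi) <= (LI xi. cmod (sh_integrand al be z xi))"
   by (rule integral_norm_bound)
  also have "... <= (LI xi. \<bar>Hf al (xi + (1/2) *\<^sub>R im_part z)\<bar> * B)"
  proof (intro integral_mono)
   show "integrable lborel (%xi. cmod (sh_integrand al be z xi))"
    by (intro integrable_norm integrable_sh_integrand)
   show "integrable lborel (%xi. \<bar>Hf al (xi + (1/2) *\<^sub>R im_part z)\<bar> * B)"
    using lborel_integrable_shift[OF ia] by simp
  qed (auto simp: norm_sh_integrand abs_mult intro!: mult_left_mono B)
  also have "... = (LI x. \<bar>Hf al x\<bar> * B)"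
   by (rule lborel_integral_shift) measurable
  finally show ?thesis unfolding special_hermite_eq norm_mult by (intro mult_left_mono) auto
 qed
 thus ?thesis by blast
qed

lemma special_hermite_decay: "\<exists>C\<ge>0. ALL z. cmod (Sh al be z) <= C / (1 + norm z) ^ M"
proof -
 define Ph where "Ph p = Sh (fst p) (snd p)" for p :: "('a => nat) \<times> ('a => nat)"
 have "\<exists>C\<ge>0. ALL z. norm (Ph (al, be) z) * (1 + norm z) ^ M <= C"
 proof (rule ladder_decay[where J = UNIV and q = "%j x. x $ j" and Ph = Ph])
  show "norm z <= (\<Sum>j\<in>UNIV. norm (z $ j))" for z :: "complex ^ 'a" by (rule norm_le_sum_cmod)
  show "EX C. ALL z. norm (Ph p z) <= C" for p unfolding Ph_def by (rule special_hermite_bounded)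
  show "EX s t A B. 0 <= A & 0 <= B & (ALL z. norm (z $ j) * norm (Ph p z) <= A * norm (Ph s z) + B * norm (Ph t z))" for j :: 'a and p
  proof -
   obtain a b where p: "p = (a, b)" by fastforce
   have "norm (z $ j) * norm (Ph p z) <= (sqrt 2 * sqrt (real (a j))) * norm (Ph (dn a j, b) z)
     + (sqrt 2 * sqrt (real (b j) + 1)) * norm (Ph (a, up b j) z)" for z
   proof -
    have "norm (z $ j) * norm (Ph p z) = norm (z $ j * Sh a b z)" by (simp add: Ph_def p norm_mult)
    also have "... = sqrt 2 * norm (of_real (sqrt (real (a j))) * Sh (dn a j) b z - of_real (sqrt (real (b j) + 1)) * Sh a (up b j) z)"
     unfolding sh_z_mult by (simp add: norm_mult)
    also have "... <= sqrt 2 * (norm (of_real (sqrt (real (a j))) * Sh (dn a j) b z) + norm (of_real (sqrt (real (b j) + 1)) * Sh a (up b j) z))"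
     by (intro mult_left_mono norm_triangle_ineq4) auto
    finally show ?thesis by (simp add: Ph_def norm_mult algebra_simps)
   qed
   thus ?thesis by (intro exI[of _ "(dn a j, b)"] exI[of _ "(a, up b j)"] exI[of _ "sqrt 2 * sqrt (real (a j))"] exI[of _ "sqrt 2 * sqrt (real (b j) + 1)"]) auto
  qed
 qed simp
 then obtain C where "C >= 0" "!!z. cmod (Sh al be z) * (1 + norm z) ^ M <= C" by (auto simp: Ph_def)
 hence "cmod (Sh al be z) <= C / (1 + norm z) ^ M" for z
  by (simp add: pos_le_divide_eq add_pos_nonneg)
 thus ?thesis using \<open>C >= 0\<close> by blast
qed

lemma continuous_re_im_part: "continuous_on S re_part" "continuous_on S im_part"
 unfolding re_part_def[abs_def] im_part_def[abs_def] by (auto intro!: continuous_intros)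

lemma continuous_special_hermite: "continuous_on S (Sh (al :: 'd::finite => nat) be)"
proof -
 let ?M = "DIM(real^'d) + 2"
 obtain K where K: "K >= 0" "!!z xi. norm (sh_integrand al be z xi) <= K * (1 + norm (im_part z)) ^ ?M / (1 + norm xi) ^ ?M"
  using sh_integrand_bound by blast
 have "isCont (Sh al be) z" for z
  unfolding continuous_at_sequentially
 proof (intro allI impI)
  fix X assume X: "X \<longlonglongrightarrow> z"
  have tr: "(%n. re_part (X n)) \<longlonglongrightarrow> re_part z" "(%n. im_part (X n)) \<longlonglongrightarrow> im_part z"
   using continuous_on_tendsto_compose[OF continuous_re_im_part(1)[of UNIV] X]
    continuous_on_tendsto_compose[OF continuous_re_im_part(2)[of UNIV] X] by auto
  obtain b where b: "!!n. norm (im_part (X n)) <= b"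
   using convergent_imp_Bseq[OF convergentI[OF tr(2)]] by (auto simp: Bseq_def)
  have lim: "(%n. sh_integrand al be (X n) xi) \<longlonglongrightarrow> sh_integrand al be z xi" for xi
  proof -
   have h: "(%n. Hf a (f n)) \<longlonglongrightarrow> Hf a l" if "f \<longlonglongrightarrow> l" for a :: "'d => nat" and f l
    using continuous_on_tendsto_compose[OF continuous_hermite_fun[of UNIV] that] by auto
   show ?thesis unfolding sh_integrand_def
    by (intro tendsto_intros h tr)
  qed
  have "(%n. (LI xi. sh_integrand al be (X n) xi)) \<longlonglongrightarrow> (LI xi. sh_integrand al be z xi)"
  proof (rule integral_dominated_convergence[where w = "%xi. (K * (1 + b) ^ ?M) * (1 / (1 + norm xi) ^ ?M)"])
   show "integrable lborel (%xi::real^'d. (K * (1 + b) ^ ?M) * (1 / (1 + norm xi) ^ ?M))"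
    by (intro integrable_mult_right integrable_poly_decay_aux)
   show "AE xi in lborel. norm (sh_integrand al be (X n) xi) <= (K * (1 + b) ^ ?M) * (1 / (1 + norm xi) ^ ?M)" for n
   proof (intro AE_I2)
    fix xi :: "real ^ 'd"
    have "norm (sh_integrand al be (X n) xi) <= K * (1 + norm (im_part (X n))) ^ ?M / (1 + norm xi) ^ ?M" by (rule K)
    also have "... <= K * (1 + b) ^ ?M / (1 + norm xi) ^ ?M"
     using K(1) b[of n] by (intro divide_right_mono mult_left_mono power_mono) auto
    finally show "norm (sh_integrand al be (X n) xi) <= (K * (1 + b) ^ ?M) * (1 / (1 + norm xi) ^ ?M)" by simp
   qed
  qed (use lim in auto)
  thus "(Sh al be \<circ> X) \<longlonglongrightarrow> Sh al be z"
   unfolding special_hermite_eq o_def by (intro tendsto_intros)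
 qed
 thus ?thesis by (simp add: continuous_at_imp_continuous_on)
qed

lemma borel_measurable_special_hermite[measurable]: "Sh al be \<in> bm"
 by (intro borel_measurable_continuous_onI continuous_special_hermite)

section \<open>Derivatives of special Hermite functions and the magnetic connection\<close>

definition dirv :: "bool => 'd::finite => complex ^ 'd" where
 "dirv b j = axis j (if b then 1 else \<i>)"

text \<open>Vector potential of the constant magnetic field: the first-order operators d_x - i y/2
  and d_y + i x/2 of the twisted Laplacian are the plain derivative minus i times
  \<open>conn\<close>. The value \<open>True\<close> stands for an x-direction, \<open>False\<close>
  for a y-direction.\<close>

definition conn :: "bool => 'd::finite => complex ^ 'd => real" where
 "conn b j z = (if b then Im (z $ j) / 2 else - Re (z $ j) / 2)"

lemma re_im_part_dirv:
 "re_part (z + h *\<^sub>R dirv True j) = re_part z + h *\<^sub>R axis j 1"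
 "im_part (z + h *\<^sub>R dirv True j) = im_part z"
 "re_part (z + h *\<^sub>R dirv False j) = re_part z"
 "im_part (z + h *\<^sub>R dirv False j) = im_part z + h *\<^sub>R axis j 1"
 by (auto simp: re_part_def im_part_def dirv_def axis_def vec_eq_iff)

text \<open>Differentiation brings down i xi_j, written as i (xi - y/2)_j + i y_j / 2. The first
  summand moves the second index by the Hermite ladder, the second one is the connection
  term.\<close>

lemma special_hermite_deriv_x:
 "((%h. Sh (al :: 'd::finite => nat) be (z + h *\<^sub>R dirv True j)) has_vector_derivative
  (\<i> * (of_real (sqrt ((real (be j) + 1) / 2)) * Sh al (up be j) z + of_real (sqrt (real (be j) / 2)) * Sh al (dn be j) z)
   + \<i> * of_real (conn True j z) * Sh al be z)) (at 0)"
proof -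
 let ?M = "DIM(real^'d) + 2"
 let ?g = "%h xi. sh_integrand al be (z + h *\<^sub>R dirv True j) xi"
 let ?g' = "%h xi. \<i> * of_real (xi $ j) * sh_integrand al be (z + h *\<^sub>R dirv True j) xi"
 obtain K where K: "K >= 0" "!!z xi. norm (sh_integrand al be z xi) <= K * (1 + norm (im_part z)) ^ (Suc ?M) / (1 + norm xi) ^ (Suc ?M)"
  using sh_integrand_bound by blast
 define K' where "K' = K * (1 + norm (im_part z)) ^ (Suc ?M)"
 have "((%h. (LI xi. ?g h xi)) has_vector_derivative (LI xi. ?g' 0 xi)) (at 0)"
 proof (rule has_vector_derivative_integral[where w = "%xi. K' * (1 / (1 + norm xi) ^ ?M)"])
  show "((%h. ?g h xi) has_vector_derivative ?g' h xi) (at h)" for h xi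
  proof -
   have "((%h. exp (\<i> * of_real (re_part (z + h *\<^sub>R dirv True j) \<bullet> xi))) has_vector_derivative
    (\<i> * of_real (xi $ j) * exp (\<i> * of_real (re_part (z + h *\<^sub>R dirv True j) \<bullet> xi)))) (at h)"
   proof -
    have "((%h. \<i> * of_real ((re_part z + h *\<^sub>R axis j 1) \<bullet> xi)) has_vector_derivative (\<i> * of_real (xi $ j))) (at h)"
     by (auto intro!: derivative_eq_intros simp: inner_axis' inner_add_left)
    from field_vector_diff_chain_at[OF this DERIV_exp] show ?thesis
     by (simp add: o_def re_im_part_dirv)
   qed
   from has_vector_derivative_mult_left[OF this] show ?thesis
    unfolding sh_integrand_def by (simp add: re_im_part_dirv mult.assoc)
  qed
  show "norm (?g' h xi) <= K' * (1 / (1 + norm xi) ^ ?M)" for h xi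
  proof -
   have p: "1 + norm xi > 0" by (simp add: add_pos_nonneg)
   have "norm (?g' h xi) = \<bar>xi $ j\<bar> * norm (?g h xi)" by (simp add: norm_mult)
   also have "... <= (1 + norm xi) * (K' / (1 + norm xi) ^ (Suc ?M))"
    using component_le_norm_cart[of xi j] K(2)[of "z + h *\<^sub>R dirv True j" xi] unfolding K'_def re_im_part_dirv
    by (intro mult_mono) auto
   also have "... = K' * (1 / (1 + norm xi) ^ ?M)" using p by simp
   finally show ?thesis .
  qed
  show "integrable lborel (%xi::real^'d. K' * (1 / (1 + norm xi) ^ ?M))"
   by (intro integrable_mult_right integrable_poly_decay_aux)
  show "integrable lborel (?g h)" for h by (rule integrable_sh_integrand)
  show "?g' 0 \<in> borel_measurable lborel" by measurable
 qed
 moreover have "(LI xi. ?g' 0 xi) = \<i> * (of_real (sqrt ((real (be j) + 1) / 2)) * (LI xi. sh_integrand al (up be j) z xi)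
   + of_real (sqrt (real (be j) / 2)) * (LI xi. sh_integrand al (dn be j) z xi)) + \<i> * of_real (conn True j z) * (LI xi. sh_integrand al be z xi)"
 proof -
  have "?g' 0 xi = \<i> * (of_real (sqrt ((real (be j) + 1) / 2)) * sh_integrand al (up be j) z xi
    + of_real (sqrt (real (be j) / 2)) * sh_integrand al (dn be j) z xi) + \<i> * of_real (conn True j z) * sh_integrand al be z xi" for xi
   unfolding sh_integrand_mult_right[symmetric] by (simp add: conn_def im_part_def algebra_simps)
  thus ?thesis by (simp add: integrable_sh_integrand)
 qed
 ultimately have "((%h. (LI xi. ?g h xi)) has_vector_derivative (\<i> * (of_real (sqrt ((real (be j) + 1) / 2)) * (LI xi. sh_integrand al (up be j) z xi)
   + of_real (sqrt (real (be j) / 2)) * (LI xi. sh_integrand al (dn be j) z xi)) + \<i> * of_real (conn True j z) * (LI xi. sh_integrand al be z xi))) (at 0)"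
  by simp
 from has_vector_derivative_mult_right[OF this, of "sh_const TYPE('d)"] show ?thesis
  unfolding special_hermite_eq by (simp add: algebra_simps)
qed

text \<open>The shifts by y/2 differentiate the two Hermite factors with opposite signs. By
  \<open>sh_Re_mult\<close> the part moving the first index equals a part moving the second one plus
  a multiple of x_j, and the latter is exactly the connection term.\<close>

lemma special_hermite_deriv_y:
 "((%h. Sh (al :: 'd::finite => nat) be (z + h *\<^sub>R dirv False j)) has_vector_derivative
  (of_real (sqrt ((real (be j) + 1) / 2)) * Sh al (up be j) z - of_real (sqrt (real (be j) / 2)) * Sh al (dn be j) z
   + \<i> * of_real (conn False j z) * Sh al be z)) (at 0)"
proof -
 let ?M = "DIM(real^'d) + 2"
 let ?z = "%h. z + h *\<^sub>R dirv False j"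
 let ?g = "%h xi. sh_integrand al be (?z h) xi"
 let ?g' = "%h xi. (1/2) * (shd_left al be j (?z h) xi - shd_right al be j (?z h) xi)"
 have nim: "norm (im_part (?z h)) <= norm (im_part z) + 1" if "\<bar>h\<bar> <= 1" for h
 proof -
  have "norm (im_part (?z h)) <= norm (im_part z) + norm (h *\<^sub>R axis j (1::real))"
   unfolding re_im_part_dirv by (rule norm_triangle_ineq)
  thus ?thesis using that by simp
 qed
 have ex: "EX K. ALL h xi. \<bar>h\<bar> <= 1 --> norm (sh_integrand a b (?z h) xi) <= K * (1 / (1 + norm xi) ^ ?M)" for a b
 proof -
  obtain K where K: "K >= 0" "!!z xi. norm (sh_integrand a b z xi) <= K * (1 + norm (im_part z)) ^ ?M / (1 + norm xi) ^ ?M"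
   using sh_integrand_bound by blast
  have "norm (sh_integrand a b (?z h) xi) <= (K * (1 + (norm (im_part z) + 1)) ^ ?M) * (1 / (1 + norm xi) ^ ?M)" if "\<bar>h\<bar> <= 1" for h xi
  proof -
   have "norm (sh_integrand a b (?z h) xi) <= K * (1 + norm (im_part (?z h))) ^ ?M / (1 + norm xi) ^ ?M" by (rule K)
   also have "... <= K * (1 + (norm (im_part z) + 1)) ^ ?M / (1 + norm xi) ^ ?M"
    using K(1) nim[OF that] by (intro divide_right_mono mult_left_mono power_mono) auto
   finally show ?thesis by simp
  qed
  thus ?thesis by blast
 qed
 then obtain k where k: "!!a b h xi. \<bar>h\<bar> <= 1 ==> norm (sh_integrand a b (?z h) xi) <= k a b * (1 / (1 + norm xi) ^ ?M)"
  by metis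
 define s where "s n = sqrt (real n / 2)" for n
 define t where "t n = sqrt ((real n + 1) / 2)" for n
 have st: "s n >= 0" "t n >= 0" for n by (auto simp: s_def t_def)
 define K where "K = (s (al j) * k (dn al j) be + t (al j) * k (up al j) be) + (s (be j) * k al (dn be j) + t (be j) * k al (up be j))"
 have "((%h. (LI xi. ?g h xi)) has_vector_derivative (LI xi. ?g' 0 xi)) (at 0)"
 proof (rule has_vector_derivative_integral[where w = "%xi. K * (1 / (1 + norm xi) ^ ?M)"])
  show "((%h. ?g h xi) has_vector_derivative ?g' h xi) (at h)" for h xi
  proof -
   have a: "((%h. Hf al (xi + (1/2) *\<^sub>R im_part (?z h))) has_vector_derivative (1/2) *\<^sub>R hermite_deriv j al (xi + (1/2) *\<^sub>R im_part (?z h))) (at h)"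
    using has_vector_derivative_direction_scaled[OF hermite_fun_has_deriv, of al "xi + (1/2) *\<^sub>R im_part z" "1/2" j h]
    by (simp add: re_im_part_dirv scaleR_add_right add.assoc)
   have b: "((%h. Hf be (xi - (1/2) *\<^sub>R im_part (?z h))) has_vector_derivative (-1/2) *\<^sub>R hermite_deriv j be (xi - (1/2) *\<^sub>R im_part (?z h))) (at h)"
    using has_vector_derivative_direction_scaled[OF hermite_fun_has_deriv, of be "xi - (1/2) *\<^sub>R im_part z" "-1/2" j h]
    by (simp add: re_im_part_dirv scaleR_add_right algebra_simps)
   from has_vector_derivative_mult_right[OF has_vector_derivative_of_real[OF has_vector_derivative_mult[OF a b, folded has_real_derivative_iff_has_vector_derivative]], of "exp (\<i> * of_real (re_part z \<bullet> xi))"]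
   show ?thesis unfolding shd_left_eq shd_right_eq
    by (simp add: sh_integrand_def re_im_part_dirv algebra_simps)
  qed
  show "norm (?g' h xi) <= K * (1 / (1 + norm xi) ^ ?M)" if h: "\<bar>h\<bar> <= 1" for h xi
  proof -
   let ?w = "1 / (1 + norm xi) ^ ?M"
   have l: "norm (shd_left al be j (?z h) xi) <= s (al j) * (k (dn al j) be * ?w) + t (al j) * (k (up al j) be * ?w)"
    unfolding shd_left_def s_def[symmetric] t_def[symmetric]
    by (rule norm_triangle_ineq4[THEN order_trans])
     (simp only: norm_mult norm_of_real abs_of_nonneg[OF st(1)] abs_of_nonneg[OF st(2)], intro add_mono mult_left_mono st k h)
   have r: "norm (shd_right al be j (?z h) xi) <= s (be j) * (k al (dn be j) * ?w) + t (be j) * (k al (up be j) * ?w)"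
    unfolding shd_right_def s_def[symmetric] t_def[symmetric]
    by (rule norm_triangle_ineq4[THEN order_trans])
     (simp only: norm_mult norm_of_real abs_of_nonneg[OF st(1)] abs_of_nonneg[OF st(2)], intro add_mono mult_left_mono st k h)
   have "norm (?g' h xi) <= norm (shd_left al be j (?z h) xi) + norm (shd_right al be j (?z h) xi)"
    using norm_triangle_ineq4[of "shd_left al be j (?z h) xi" "shd_right al be j (?z h) xi"]
     norm_ge_zero[of "shd_left al be j (?z h) xi - shd_right al be j (?z h) xi"]
    unfolding norm_mult by (simp del: norm_ge_zero)
   also have "... <= (s (al j) * (k (dn al j) be * ?w) + t (al j) * (k (up al j) be * ?w)) + (s (be j) * (k al (dn be j) * ?w) + t (be j) * (k al (up be j) * ?w))"
    by (rule add_mono[OF l r])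
   also have "... = K * ?w" unfolding K_def by (simp only: distrib_right mult.assoc)
   finally show ?thesis .
  qed
  show "integrable lborel (%xi::real^'d. K * (1 / (1 + norm xi) ^ ?M))"
   by (intro integrable_mult_right integrable_poly_decay_aux)
  show "integrable lborel (?g h)" for h by (rule integrable_sh_integrand)
  show "?g' 0 \<in> borel_measurable lborel" unfolding shd_left_def shd_right_def by measurable
 qed
 moreover have "(LI xi. ?g' 0 xi) = (1/2) * ((LI xi. shd_left al be j z xi) - (LI xi. shd_right al be j z xi))"
  by (simp add: integrable_shd)
 ultimately have 1: "((%h. Sh al be (?z h)) has_vector_derivative
   sh_const TYPE('d) * ((1/2) * ((LI xi. shd_left al be j z xi) - (LI xi. shd_right al be j z xi)))) (at 0)"
  unfolding special_hermite_eq by (intro has_vector_derivative_mult_right) simp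
 define SL where "SL = of_real (sqrt (real (al j) / 2)) * Sh (dn al j) be z - of_real (sqrt ((real (al j) + 1) / 2)) * Sh (up al j) be z"
 define SR where "SR = of_real (sqrt (real (be j) / 2)) * Sh al (dn be j) z - of_real (sqrt ((real (be j) + 1) / 2)) * Sh al (up be j) z"
 have L: "sh_const TYPE('d) * (LI xi. shd_left al be j z xi) = SL"
  unfolding shd_left_def SL_def special_hermite_eq by (simp add: integrable_sh_integrand algebra_simps)
 have R: "sh_const TYPE('d) * (LI xi. shd_right al be j z xi) = SR"
  unfolding shd_right_def SR_def special_hermite_eq by (simp add: integrable_sh_integrand algebra_simps)
 have "sh_const TYPE('d) * ((1/2) * ((LI xi. shd_left al be j z xi) - (LI xi. shd_right al be j z xi))) = (1/2) * (SL - SR)"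
  unfolding L[symmetric] R[symmetric] by (simp add: algebra_simps)
 also have "... = - SR + \<i> * of_real (conn False j z) * Sh al be z"
 proof -
  have "of_real (Re (z $ j)) * Sh al be z = \<i> * (SL + SR)"
   unfolding SL_def SR_def by (rule sh_Re_mult)
  hence "\<i> * (of_real (Re (z $ j)) * Sh al be z) = - (SL + SR)"
   by (simp flip: mult.assoc)
  moreover have "\<i> * of_real (conn False j z) * Sh al be z = - (\<i> * (of_real (Re (z $ j)) * Sh al be z)) / 2"
   by (simp add: conn_def)
  ultimately have e: "\<i> * of_real (conn False j z) * Sh al be z = (SL + SR) / 2" by (simp only: minus_minus)
  show ?thesis unfolding e by (simp add: field_simps)
 qed
 finally show ?thesis using 1 unfolding SR_def by (simp only: minus_diff_eq)
qed

section \<open>Covariant derivatives and the trace estimate\<close>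

definition rapid :: "('a::euclidean_space => complex) => bool" where
 "rapid F \<longleftrightarrow> continuous_on UNIV F & (ALL M. \<exists>C\<ge>0. ALL z. cmod (F z) <= C / (1 + norm z) ^ M)"

lemma rapid_special_hermite: "rapid (Sh al be)"
 unfolding rapid_def using continuous_special_hermite special_hermite_decay by blast

lemma rapid_add: assumes "rapid F" "rapid G" shows "rapid (%z. F z + G z)"
 unfolding rapid_def
proof (intro conjI allI)
 fix M
 obtain C where C: "C >= 0" "!!z. cmod (F z) <= C / (1 + norm z) ^ M" using assms(1) unfolding rapid_def by blast
 obtain D where D: "D >= 0" "!!z. cmod (G z) <= D / (1 + norm z) ^ M" using assms(2) unfolding rapid_def by blast
 have "cmod (F z + G z) <= (C + D) / (1 + norm z) ^ M" for z
  using norm_triangle_ineq[of "F z" "G z"] C(2)[of z] D(2)[of z] by (simp add: add_divide_distrib)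
 thus "\<exists>C\<ge>0. ALL z. cmod (F z + G z) <= C / (1 + norm z) ^ M"
  using C(1) D(1) by (intro exI[of _ "C + D"]) auto
qed (use assms in \<open>auto simp: rapid_def intro!: continuous_intros\<close>)

lemma rapid_mult_bounded:
 assumes F: "rapid F" and G: "continuous_on UNIV G" "!!z. cmod (G z) <= B"
 shows "rapid (%z. G z * F z)"
 unfolding rapid_def
proof (intro conjI allI)
 fix M
 obtain C where C: "C >= 0" "!!z. cmod (F z) <= C / (1 + norm z) ^ M" using F unfolding rapid_def by blast
 have B: "B >= 0" using order_trans[OF norm_ge_zero G(2)] .
 have "cmod (G z * F z) <= (B * C) / (1 + norm z) ^ M" for z
  using mult_mono[OF G(2)[of z] C(2)[of z] B norm_ge_zero] by (simp add: norm_mult)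
 thus "\<exists>C\<ge>0. ALL z. cmod (G z * F z) <= C / (1 + norm z) ^ M"
  using C(1) B by (intro exI[of _ "B * C"]) auto
qed (use F G in \<open>auto simp: rapid_def intro!: continuous_intros\<close>)

lemma rapid_cmult: "rapid F ==> rapid (%z. c * F z)"
 using rapid_mult_bounded[of F "%_. c" "cmod c"] by simp

lemma rapid_bounded: assumes "rapid F" shows "EX B. ALL z. cmod (F z) <= B"
proof -
 obtain C where "ALL z. cmod (F z) <= C / (1 + norm z) ^ 0" using assms unfolding rapid_def by blast
 thus ?thesis by auto
qed

lemma rapid_cnj: "rapid F ==> rapid (%z. cnj (F z))"
 by (auto simp: rapid_def intro!: continuous_intros)

lemma rapid_mult: assumes "rapid F" "rapid G" shows "rapid (%z. F z * G z)"
proof -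
 obtain B where "!!z. cmod (F z) <= B" using rapid_bounded[OF assms(1)] by blast
 thus ?thesis using rapid_mult_bounded[OF assms(2), of F B] assms(1) by (auto simp: rapid_def)
qed

lemma rapid_integrable:
 fixes F :: "'a::euclidean_space => complex"
 assumes "rapid F" shows "integrable lborel F"
proof -
 obtain C where "!!z. cmod (F z) <= C / (1 + norm z) ^ (DIM('a) + 2)" using assms unfolding rapid_def by blast
 moreover have "F \<in> bm" using assms by (auto simp: rapid_def intro: borel_measurable_continuous_onI)
 ultimately show ?thesis by (rule integrable_poly_decay[rotated])
qed

lemma rapid_square_integrable: assumes "rapid F" shows "square_integrable lborel F"
proof -
 have "integrable lborel (%z. cmod (F z * F z))"
  by (intro integrable_norm rapid_integrable rapid_mult assms)
 moreover have "F \<in> bm" using assms by (auto simp: rapid_def intro: borel_measurable_continuous_onI)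
 ultimately show ?thesis by (simp add: square_integrable_def norm_mult power2_eq_square)
qed

text \<open>The class of test functions for integration by parts: its members decay rapidly and
  covariant derivatives keep them inside. It contains finite combinations only; series are reached
  by limits later.\<close>

inductive_set sh_span :: "('d::finite fld) set" where
 zero: "(%z. 0) \<in> sh_span"
| base: "Sh al be \<in> sh_span"
| add: "F \<in> sh_span ==> G \<in> sh_span ==> (%z. F z + G z) \<in> sh_span"
| cmult: "F \<in> sh_span ==> (%z. c * F z) \<in> sh_span"

lemma sh_span_rapid: "F \<in> sh_span ==> rapid F"
proof (induction rule: sh_span.induct)
 case zero
 thus ?case by (auto simp: rapid_def)
qed (auto intro: rapid_add rapid_cmult rapid_special_hermite)

lemma sh_span_sum: "(!!i. i \<in> A ==> F i \<in> sh_span) ==> (%z. \<Sum>i\<in>A. F i z) \<in> sh_span"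
proof (induction A rule: infinite_finite_induct)
 case (insert x A)
 thus ?case using sh_span.add[of "F x" "%z. \<Sum>i\<in>A. F i z"] by auto
qed (auto intro: sh_span.zero)

definition nabla :: "bool \<times> 'd::finite => ('d fld) => 'd fld" where
 "nabla p F z = vector_derivative (%h. F (z + h *\<^sub>R dirv (fst p) (snd p))) (at 0) - \<i> * of_real (conn (fst p) (snd p) z) * F z"

text \<open>In contrast to the total function \<open>nabla\<close>, the relation asserts that the
  directional derivative exists.\<close>

definition has_nabla :: "bool \<times> 'd::finite => ('d fld) => ('d fld) => bool" where
 "has_nabla p F G \<longleftrightarrow> (ALL z. ((%h. F (z + h *\<^sub>R dirv (fst p) (snd p))) has_vector_derivative
   (G z + \<i> * of_real (conn (fst p) (snd p) z) * F z)) (at 0))"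

lemma has_nabla_unique: "has_nabla p F G ==> nabla p F = G"
proof
 fix z assume "has_nabla p F G"
 from vector_derivative_at[OF this[unfolded has_nabla_def, rule_format, of z]]
 show "nabla p F z = G z" by (simp add: nabla_def)
qed

definition nfac :: "bool => complex" where "nfac b = (if b then \<i> else 1) / of_real (sqrt 2)"
definition nsgn :: "bool => complex" where "nsgn b = (if b then 1 else -1)"

lemma has_nabla_special_hermite:
 "has_nabla (b, j) (Sh al be)
   (%z. nfac b * (of_real (sqrt (real (be j) + 1)) * Sh al (up be j) z + nsgn b * (of_real (sqrt (real (be j))) * Sh al (dn be j) z)))"
proof (cases b)
 case True
 thus ?thesis
  unfolding has_nabla_def
  using special_hermite_deriv_x[of al be _ j] by (simp add: nfac_def nsgn_def sqrt_half add_divide_distrib[symmetric])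
next
 case False
 thus ?thesis
  unfolding has_nabla_def
  using special_hermite_deriv_y[of al be _ j] by (simp add: nfac_def nsgn_def sqrt_half diff_divide_distrib[symmetric])
qed

lemma has_nabla_add: "has_nabla p F F' ==> has_nabla p G G' ==> has_nabla p (%z. F z + G z) (%z. F' z + G' z)"
 unfolding has_nabla_def
proof
 fix z
 assume "ALL z. ((%h. F (z + h *\<^sub>R dirv (fst p) (snd p))) has_vector_derivative (F' z + \<i> * of_real (conn (fst p) (snd p) z) * F z)) (at 0)"
  and "ALL z. ((%h. G (z + h *\<^sub>R dirv (fst p) (snd p))) has_vector_derivative (G' z + \<i> * of_real (conn (fst p) (snd p) z) * G z)) (at 0)"
 from has_vector_derivative_add[OF this(1)[rule_format, of z] this(2)[rule_format, of z]]
 show "((%h. F (z + h *\<^sub>R dirv (fst p) (snd p)) + G (z + h *\<^sub>R dirv (fst p) (snd p))) has_vector_derivative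
   (F' z + G' z + \<i> * of_real (conn (fst p) (snd p) z) * (F z + G z))) (at 0)"
  by (simp add: algebra_simps)
qed

lemma has_nabla_cmult: "has_nabla p F F' ==> has_nabla p (%z. c * F z) (%z. c * F' z)"
 unfolding has_nabla_def
proof
 fix z
 assume "ALL z. ((%h. F (z + h *\<^sub>R dirv (fst p) (snd p))) has_vector_derivative (F' z + \<i> * of_real (conn (fst p) (snd p) z) * F z)) (at 0)"
 from has_vector_derivative_mult_right[OF this[rule_format, of z], of c]
 show "((%h. c * F (z + h *\<^sub>R dirv (fst p) (snd p))) has_vector_derivative
   (c * F' z + \<i> * of_real (conn (fst p) (snd p) z) * (c * F z))) (at 0)"
  by (simp add: algebra_simps)
qed

lemma sh_span_has_nabla: "F \<in> sh_span ==> \<exists>G\<in>sh_span. has_nabla p F G"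
proof (induction rule: sh_span.induct)
 case zero
 thus ?case by (intro bexI[of _ "%z. 0"]) (auto simp: has_nabla_def intro: sh_span.zero)
next
 case (base al be)
 obtain b j where p: "p = (b, j)" by fastforce
 show ?case unfolding p
  by (rule bexI, rule has_nabla_special_hermite) (intro sh_span.cmult sh_span.add sh_span.base)
next
 case (add F G)
 thus ?case using has_nabla_add sh_span.add by blast
next
 case (cmult F c)
 thus ?case using has_nabla_cmult sh_span.cmult by blast
qed

lemma has_nabla_nabla: "F \<in> sh_span ==> has_nabla p F (nabla p F)"
 and nabla_sh_span: "F \<in> sh_span ==> nabla p F \<in> sh_span"
 using sh_span_has_nabla[of F p] has_nabla_unique[of p F] by auto

lemma nabla_add: "F \<in> sh_span ==> G \<in> sh_span ==> nabla p (%z. F z + G z) = (%z. nabla p F z + nabla p G z)"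
 by (intro has_nabla_unique has_nabla_add has_nabla_nabla)

lemma nabla_cmult: "F \<in> sh_span ==> nabla p (%z. c * F z) = (%z. c * nabla p F z)"
 by (intro has_nabla_unique has_nabla_cmult has_nabla_nabla)

lemma nabla_zero: "nabla p (%z. 0) = (%z. 0)"
 by (intro has_nabla_unique) (simp add: has_nabla_def)

lemma nabla_sum: "(!!i. i \<in> A ==> F i \<in> sh_span) ==> nabla p (%z. \<Sum>i\<in>A. F i z) = (%z. \<Sum>i\<in>A. nabla p (F i) z)"
proof (induction A rule: infinite_finite_induct)
 case (insert x A)
 thus ?case using nabla_add[of "F x" "%z. \<Sum>i\<in>A. F i z" p] sh_span_sum[of A F] by (auto simp: fun_eq_iff)
qed (auto simp: nabla_zero)

lemma nabla_special_hermite: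
 "nabla (b, j) (Sh al be) =
   (%z. nfac b * (of_real (sqrt (real (be j) + 1)) * Sh al (up be j) z + nsgn b * (of_real (sqrt (real (be j))) * Sh al (dn be j) z)))"
 by (rule has_nabla_unique[OF has_nabla_special_hermite])

lemma nabla_comb: "nabla p (%z. a * (b * Sh al be z + c * (e * Sh ga de z))) =
  (%z. a * (b * nabla p (Sh al be) z + c * (e * nabla p (Sh ga de) z)))"
 by (simp add: nabla_cmult nabla_add sh_span.base sh_span.add sh_span.cmult)

lemma nabla_nabla_same:
 "nabla (b', j) (nabla (b, j) (Sh al be)) z = nfac b * nfac b' *
   (of_real (sqrt (real (be j) + 1)) * of_real (sqrt (real (be j) + 2)) * Sh al (be(j := be j + 2)) z
   + nsgn b' * of_real (real (be j) + 1) * Sh al be z + nsgn b * of_nat (be j) * Sh al be z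
   + nsgn b * nsgn b' * (of_real (sqrt (real (be j))) * of_real (sqrt (real (be j - 1)))) * Sh al (be(j := be j - 2)) z)"
proof -
 define A where "A = complex_of_real (sqrt (real (be j) + 1))"
 define B where "B = complex_of_real (sqrt (real (be j) + 2))"
 define C where "C = complex_of_real (sqrt (real (be j)))"
 define C' where "C' = complex_of_real (sqrt (real (be j - 1) + 1))"
 define D where "D = complex_of_real (sqrt (real (be j - 1)))"
 define P where "P = Sh al (be(j := be j + 2)) z"
 define Q where "Q = Sh al be z"
 define Q' where "Q' = Sh al (be(j := Suc (be j - 1))) z"
 define R where "R = Sh al (be(j := be j - 2)) z"
 have A: "A * A = of_real (real (be j) + 1)" unfolding A_def by (simp flip: of_real_mult)
 \<comment> \<open>Lowering and then raising returns to \<open>be\<close> only when be j > 0. For be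
   j = 0 the truncated index is a different one, but then the coefficient \<open>C\<close> is
   0.\<close>
 have C: "C * C' * Q' = of_nat (be j) * Q"
 proof (cases "be j")
  case 0
  thus ?thesis by (simp add: C_def)
 next
  case (Suc n)
  have "be(j := Suc n) = be" using Suc by auto
  hence "Q' = Q" using Suc by (simp add: Q'_def Q_def)
  moreover have "C * C' = of_nat (be j)"
   using Suc by (simp add: C_def C'_def add.commute flip: of_real_mult)
  ultimately show ?thesis by simp
 qed
 have "be(j := be j) = be" by auto
 hence "nabla (b', j) (nabla (b, j) (Sh al be)) z
   = nfac b * (A * (nfac b' * (B * P + nsgn b' * (A * Q))) + nsgn b * (C * (nfac b' * (C' * Q' + nsgn b' * (D * R)))))"
  unfolding nabla_special_hermite nabla_comb A_def B_def C_def C'_def D_def P_def Q_def Q'_def R_def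
  by (simp add: add.commute numeral_2_eq_2)
 also have "... = nfac b * nfac b' * (A * B * P + nsgn b' * of_real (real (be j) + 1) * Q + nsgn b * of_nat (be j) * Q
   + nsgn b * nsgn b' * (C * D) * R)"
 proof -
  have "nfac b * (A * (nfac b' * (B * P + nsgn b' * (A * Q))) + nsgn b * (C * (nfac b' * (C' * Q' + nsgn b' * (D * R)))))
   = nfac b * nfac b' * (A * B * P + nsgn b' * (A * A) * Q + nsgn b * (C * C' * Q') + nsgn b * nsgn b' * (C * D) * R)"
   by (simp add: algebra_simps)
  thus ?thesis unfolding A C by (simp add: mult.assoc)
 qed
 finally show ?thesis unfolding A_def B_def C_def D_def P_def Q_def R_def .
qed

lemma nabla_commute_base:
 "nabla (b, j) (nabla (b', j') (Sh al be)) z =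
  nabla (b', j') (nabla (b, j) (Sh al be)) z + (if j = j' then nfac b * nfac b' * (nsgn b - nsgn b') else 0) * Sh al be z"
proof (cases "j = j'")
 case True
 thus ?thesis unfolding True nabla_nabla_same by (simp add: algebra_simps)
next
 case False
 thus ?thesis unfolding nabla_special_hermite nabla_comb
  by (simp add: fun_upd_twist[OF False] algebra_simps)
qed

text \<open>Curvature of the connection: a constant of modulus 1 between the x- and the y-direction
  of the same coordinate, and 0 for all other pairs.\<close>

definition ncomm :: "bool \<times> 'd => bool \<times> 'd => complex" where
 "ncomm p q = (if snd p = snd q then nfac (fst p) * nfac (fst q) * (nsgn (fst p) - nsgn (fst q)) else 0)"

lemma ncomm_eq_0: "p ~= (\<not> fst q, snd q) ==> ncomm p q = 0"
 by (cases p; cases q) (auto simp: ncomm_def)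

lemma cmod_ncomm: "cmod (ncomm p q) <= 1"
proof -
 have n: "cmod (nfac b) = 1 / sqrt 2" for b by (simp add: nfac_def norm_divide)
 have s: "cmod (nsgn b - nsgn b') <= 2" for b b' by (simp add: nsgn_def)
 have "cmod (nfac b * nfac b' * (nsgn b - nsgn b')) <= 1" for b b'
  using s[of b b'] unfolding norm_mult n by simp
 thus ?thesis by (simp add: ncomm_def)
qed

lemma nabla_commute: "F \<in> sh_span ==> nabla p (nabla q F) z = nabla q (nabla p F) z + ncomm p q * F z"
proof (induction arbitrary: z rule: sh_span.induct)
 case (base al be)
 obtain b j b' j' where "p = (b, j)" "q = (b', j')" by fastforce
 thus ?case using nabla_commute_base[of b j b' j'] by (simp add: ncomm_def)
qed (auto simp: nabla_zero nabla_add nabla_cmult nabla_sh_span algebra_simps)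

lemma UNIV_bool_prod: "(\<Sum>p\<in>(UNIV :: (bool \<times> 'd::finite) set). f p) = (\<Sum>j\<in>UNIV. f (True, j) + f (False, j))"
proof -
 have "(\<Sum>p\<in>(UNIV :: (bool \<times> 'd) set). f p) = (\<Sum>b\<in>UNIV. \<Sum>j\<in>UNIV. f (b, j))"
  by (simp add: sum.cartesian_product flip: UNIV_Times_UNIV)
 thus ?thesis by (simp add: UNIV_bool sum.distrib add.commute)
qed

lemma nabla_laplacian_base:
 "(\<Sum>p\<in>UNIV. nabla p (nabla p (Sh al (be :: 'd::finite => nat))) z) = - of_nat (2 * (\<Sum>j\<in>UNIV. be j) + CARD('d)) * Sh al be z"
proof -
 have "nabla (True, j) (nabla (True, j) (Sh al be)) z + nabla (False, j) (nabla (False, j) (Sh al be)) z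
   = - of_nat (2 * be j + 1) * Sh al be z" for j
  unfolding nabla_nabla_same by (simp add: nfac_def nsgn_def algebra_simps sqrt2_sq)
 hence "(\<Sum>p\<in>UNIV. nabla p (nabla p (Sh al be)) z) = (\<Sum>j\<in>UNIV. - of_nat (2 * be j + 1) * Sh al be z)"
  by (simp only: UNIV_bool_prod)
 also have "... = (\<Sum>j\<in>UNIV. - of_nat (2 * be j + 1)) * Sh al be z"
  by (simp only: sum_distrib_right)
 also have "(\<Sum>j\<in>UNIV. - of_nat (2 * be j + 1)) = (- of_nat (2 * (\<Sum>j\<in>UNIV. be j) + CARD('d)) :: complex)"
  unfolding sum_negf of_nat_sum[symmetric] by (simp only: sum.distrib sum_distrib_left[symmetric]) simp
 finally show ?thesis .
qed

lemma nabla_laplacian: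
 fixes c :: "_ => complex"
 assumes "!!al be. (al, be) \<in> A ==> (\<Sum>j\<in>UNIV. be j) = k"
 defines "u \<equiv> %z. \<Sum>(al, be :: 'd::finite => nat)\<in>A. c (al, be) * Sh al be z"
 shows "u \<in> sh_span" "(\<Sum>p\<in>UNIV. nabla p (nabla p u) z) = - of_nat (2 * k + CARD('d)) * u z"
proof -
 have u: "u = (%z. \<Sum>x\<in>A. (%z. c x * Sh (fst x) (snd x) z) z)"
  by (simp add: u_def split_beta)
 have S: "(%z. c x * Sh (fst x) (snd x) z) \<in> sh_span" for x
  by (intro sh_span.cmult sh_span.base)
 show "u \<in> sh_span" unfolding u by (intro sh_span_sum S)
 have "nabla p (nabla p u) = (%z. \<Sum>x\<in>A. c x * nabla p (nabla p (Sh (fst x) (snd x))) z)" for p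
  unfolding u
  by (simp only: nabla_sum[OF S] nabla_cmult[OF sh_span.base])
   (simp only: nabla_sum[OF sh_span.cmult[OF nabla_sh_span[OF sh_span.base]]] nabla_cmult[OF nabla_sh_span[OF sh_span.base]])
 hence "(\<Sum>p\<in>UNIV. nabla p (nabla p u) z) = (\<Sum>x\<in>A. c x * (\<Sum>p\<in>UNIV. nabla p (nabla p (Sh (fst x) (snd x))) z))"
  by (simp only: sum_distrib_left) (rule sum.swap)
 also have "... = (\<Sum>x\<in>A. c x * (- of_nat (2 * k + CARD('d)) * Sh (fst x) (snd x) z))"
 proof (intro sum.cong refl)
  fix x assume "x \<in> A"
  hence k: "(\<Sum>j\<in>UNIV. snd x j) = k" using assms(1)[of "fst x" "snd x"] by simp
  show "c x * (\<Sum>p\<in>UNIV. nabla p (nabla p (Sh (fst x) (snd x))) z) = c x * (- of_nat (2 * k + CARD('d)) * Sh (fst x) (snd x) z)"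
   unfolding nabla_laplacian_base k ..
 qed
 also have "... = - of_nat (2 * k + CARD('d)) * u z"
  unfolding u sum_distrib_left by (intro sum.cong) (auto simp: algebra_simps)
 finally show "(\<Sum>p\<in>UNIV. nabla p (nabla p u) z) = - of_nat (2 * k + CARD('d)) * u z" .
qed

section \<open>Weighted pairings and integration by parts for covariant derivatives\<close>

definition wip :: "(complex ^ 'd::finite => real) => ('d fld) => ('d fld) => complex" where
 "wip g F G = (LI z. of_real (g z) * (F z * cnj (G z)))"

definition cbounded :: "('a::topological_space => real) => real => bool" where
 "cbounded g B \<longleftrightarrow> continuous_on UNIV g & (ALL z. \<bar>g z\<bar> <= B)"

lemma wip_integrable:
 assumes "cbounded g B" "rapid F" "rapid G"
 shows "integrable lborel (%z. of_real (g z) * (F z * cnj (G z)))"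
 by (intro rapid_integrable rapid_mult_bounded[where B = B] rapid_mult rapid_cnj assms)
   (use assms(1) in \<open>auto simp: cbounded_def intro!: continuous_intros\<close>)

lemma wip_parts:
 assumes F: "F \<in> sh_span" and G: "G \<in> sh_span"
  and g: "cbounded g B" and g': "cbounded g' B'"
  and d: "!!z. ((%h. g (z + h *\<^sub>R dirv (fst p) (snd p))) has_vector_derivative g' z) (at 0)"
 shows "wip g (nabla p F) G + wip g F (nabla p G) = - wip g' F G"
proof -
 let ?v = "dirv (fst p) (snd p)"
 note rF = sh_span_rapid[OF F] and rG = sh_span_rapid[OF G]
  and rF' = sh_span_rapid[OF nabla_sh_span[OF F, of p]] and rG' = sh_span_rapid[OF nabla_sh_span[OF G, of p]]
 note ints = wip_integrable[OF g rF' rG] wip_integrable[OF g rF rG'] wip_integrable[OF g' rF rG]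
 let ?D = "%z. of_real (g' z) * (F z * cnj (G z)) + (of_real (g z) * (nabla p F z * cnj (G z)) + of_real (g z) * (F z * cnj (nabla p G z)))"
 have "(LI z. ?D z) = 0"
 proof (rule integral_directional_derivative[where F = "%z. of_real (g z) * (F z * cnj (G z))" and v = ?v])
  fix z
  let ?c = "\<i> * of_real (conn (fst p) (snd p) z)"
  have dF: "((%h. F (z + h *\<^sub>R ?v)) has_vector_derivative (nabla p F z + ?c * F z)) (at 0)"
   using has_nabla_nabla[OF F, of p] by (simp add: has_nabla_def)
  have dG: "((%h. cnj (G (z + h *\<^sub>R ?v))) has_vector_derivative cnj (nabla p G z + ?c * G z)) (at 0)"
   using has_nabla_nabla[OF G, of p] by (intro has_vector_derivative_cnj) (simp add: has_nabla_def)
  have dg: "((%h. complex_of_real (g (z + h *\<^sub>R ?v))) has_vector_derivative of_real (g' z)) (at 0)"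
   using d[of z] by (intro has_vector_derivative_of_real) (simp add: has_real_derivative_iff_has_vector_derivative)
  show "((%h. of_real (g (z + h *\<^sub>R ?v)) * (F (z + h *\<^sub>R ?v) * cnj (G (z + h *\<^sub>R ?v)))) has_vector_derivative ?D z) (at 0)"
   using has_vector_derivative_mult[OF dg has_vector_derivative_mult[OF dF dG]] by (simp add: algebra_simps)
 next
  show "continuous_on UNIV ?D"
   using g g' rF rG rF' rG' unfolding cbounded_def rapid_def by (intro continuous_intros) auto
  show "integrable lborel ?D" by (intro Bochner_Integration.integrable_add ints)
  show "integrable lborel (%z. of_real (g z) * (F z * cnj (G z)))" by (rule wip_integrable[OF g rF rG])
 qed
 hence "wip g' F G + (wip g (nabla p F) G + wip g F (nabla p G)) = 0"
  unfolding wip_def by (simp add: ints)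
 thus ?thesis by (simp add: eq_neg_iff_add_eq_0 add.commute)
qed

lemma wip_cnj: "cnj (wip g F G) = wip g G F"
proof -
 have "cnj (wip g F G) = (LI z. cnj (of_real (g z) * (F z * cnj (G z))))"
  unfolding wip_def by (rule Bochner_Integration.integral_cnj[symmetric])
 thus ?thesis by (simp add: wip_def mult.commute)
qed

lemma wip_self: "wip g F F = of_real (LI z. g z * (cmod (F z))^2)"
proof -
 have "of_real (g z) * (F z * cnj (F z)) = of_real (g z * (cmod (F z))^2)" for z
  by (simp only: of_real_mult complex_norm_square)
 thus ?thesis unfolding wip_def by (simp only: integral_complex_of_real)
qed

definition nsq :: "('d::finite fld) => real" where
 "nsq F = (LI z. (cmod (F z))^2)"

lemma wip_1_self: "wip (%_. 1) F F = of_real (nsq F)"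
 by (simp add: wip_self nsq_def)

lemma nsq_nonneg: "nsq F >= 0" by (simp add: nsq_def)

text \<open>The free parameter \<open>l\<close> will be 1 / sqrt mu: it balances a gradient, of
  squared norm up to mu times that of u, against u itself, so one derivative costs sqrt mu.\<close>

lemma wip_bound:
 assumes g: "cbounded g B" and F: "rapid F" and G: "rapid G" and l: "l > 0"
 shows "2 * cmod (wip g F G) <= B * (l * nsq F + nsq G / l)"
proof -
 have B: "B >= 0" using g unfolding cbounded_def by (meson abs_ge_zero order_trans)
 have iF: "integrable lborel (%z. (cmod (F z))^2)" "integrable lborel (%z. (cmod (G z))^2)"
  using rapid_square_integrable[OF F] rapid_square_integrable[OF G] by (auto simp: square_integrable_def)
 have "2 * cmod (wip g F G) <= 2 * (LI z. cmod (of_real (g z) * (F z * cnj (G z))))"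
  unfolding wip_def by (intro mult_left_mono integral_norm_bound) auto
 also have "... = (LI z. 2 * cmod (of_real (g z) * (F z * cnj (G z))))" by simp
 also have "... <= (LI z. B * (l * (cmod (F z))^2 + (cmod (G z))^2 / l))"
 proof (rule integral_mono)
  show "integrable lborel (%z. 2 * cmod (of_real (g z) * (F z * cnj (G z))))"
   by (intro integrable_mult_right integrable_norm wip_integrable[OF g F G])
  show "integrable lborel (%z. B * (l * (cmod (F z))^2 + (cmod (G z))^2 / l))"
   using iF by simp
  fix z
  have "0 <= (l * cmod (F z) - cmod (G z))^2 / l" using l by simp
  also have "... = l * (cmod (F z))^2 + (cmod (G z))^2 / l - 2 * (cmod (F z) * cmod (G z))"
   using l by (simp add: power2_eq_square field_simps)
  finally have 1: "2 * (cmod (F z) * cmod (G z)) <= l * (cmod (F z))^2 + (cmod (G z))^2 / l" by simp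
  have "\<bar>g z\<bar> * (2 * (cmod (F z) * cmod (G z))) <= B * (l * (cmod (F z))^2 + (cmod (G z))^2 / l)"
   using g B by (intro mult_mono 1) (auto simp: cbounded_def)
  thus "2 * cmod (of_real (g z) * (F z * cnj (G z))) <= B * (l * (cmod (F z))^2 + (cmod (G z))^2 / l)"
   by (simp add: norm_mult mult_ac)
 qed
 also have "... = B * (l * nsq F + nsq G / l)" unfolding nsq_def using iF by simp
 finally show ?thesis .
qed

definition coord :: "bool \<times> 'd::finite => complex ^ 'd => real" where
 "coord p z = (if fst p then Re (z $ snd p) else Im (z $ snd p))"

lemma coord_line: "coord p (z + h *\<^sub>R dirv (fst q) (snd q)) = coord p z + (if p = q then h else 0)"
 by (cases p; cases q) (auto simp: coord_def dirv_def axis_def)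

lemma coord_le_norm: "\<bar>coord p z\<bar> <= norm z"
 using Finite_Cartesian_Product.norm_nth_le[of z "snd p"] abs_Re_le_cmod[of "z $ snd p"] abs_Im_le_cmod[of "z $ snd p"]
 by (auto simp: coord_def)

lemma continuous_coord: "continuous_on S (coord p)"
 unfolding coord_def by (cases "fst p") (auto intro!: continuous_intros)

lemma norm_sq_coord: "(norm z)^2 = (\<Sum>p\<in>UNIV. (coord p z)^2)"
proof -
 have "(norm z)^2 = (\<Sum>j\<in>UNIV. (norm (z $ j))^2)"
  unfolding norm_vec_def L2_set_def by (simp add: sum_nonneg)
 thus ?thesis by (simp add: UNIV_bool_prod coord_def cmod_power2)
qed

lemma two_abs_le: "2 * \<bar>t\<bar> <= 1 + t^2" for t :: real
 using sum_squares_bound[of "\<bar>t\<bar>" 1] by simp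

lemma one_plus_sq_le: "1 + t^2 <= (1 + t^2)^2" for t :: real
 using power_increasing[of 1 2 "1 + t^2"] by simp

section \<open>Virial identity and trace estimate for a single eigenvalue\<close>

context
 fixes u :: "'d::finite fld" and mu :: real
 assumes u: "u \<in> sh_span" and mu: "mu >= 1"
  and eig: "!!z. (\<Sum>p\<in>UNIV. nabla p (nabla p u) z) = - of_real mu * u z"
begin

lemma wip_eigen:
 assumes g: "cbounded g B" and G: "rapid G"
 shows "(\<Sum>p\<in>UNIV. wip g (nabla p (nabla p u)) G) = - of_real mu * wip g u G"
proof -
 have r: "rapid (nabla p (nabla p u))" for p by (intro sh_span_rapid nabla_sh_span u)
 have "(\<Sum>p\<in>UNIV. wip g (nabla p (nabla p u)) G) = (LI z. (\<Sum>p\<in>UNIV. of_real (g z) * (nabla p (nabla p u) z * cnj (G z))))"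
  unfolding wip_def by (rule Bochner_Integration.integral_sum[symmetric]) (intro wip_integrable[OF g r G])
 also have "... = (LI z. (- of_real mu) * (of_real (g z) * (u z * cnj (G z))))"
 proof (intro Bochner_Integration.integral_cong refl)
  fix z
  have "(\<Sum>p\<in>UNIV. of_real (g z) * (nabla p (nabla p u) z * cnj (G z))) = of_real (g z) * ((\<Sum>p\<in>UNIV. nabla p (nabla p u) z) * cnj (G z))"
   by (simp add: sum_distrib_left sum_distrib_right)
  thus "(\<Sum>p\<in>UNIV. of_real (g z) * (nabla p (nabla p u) z * cnj (G z))) = (- of_real mu) * (of_real (g z) * (u z * cnj (G z)))"
   unfolding eig by simp
 qed
 finally show ?thesis unfolding wip_def by simp
qed

lemma nsq_nabla_le: "nsq (nabla p u) <= mu * nsq u"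
proof -
 have c1: "cbounded (%_. 1) 1" and c0: "cbounded (%_. 0) 0" by (auto simp: cbounded_def)
 have "wip (%_. 1) (nabla q (nabla q u)) u = - of_real (nsq (nabla q u))" for q
  using wip_parts[OF nabla_sh_span[OF u] u c1 c0, of q q]
  by (simp add: wip_1_self wip_def[of "%_. 0"] eq_neg_iff_add_eq_0)
 hence "(\<Sum>q\<in>UNIV. of_real (nsq (nabla q u))) = complex_of_real (mu * nsq u)"
  using wip_eigen[OF c1 sh_span_rapid[OF u]] by (simp add: wip_1_self sum_negf)
 hence "(\<Sum>q\<in>UNIV. nsq (nabla q u)) = mu * nsq u"
  unfolding of_real_sum[symmetric] of_real_eq_iff .
 moreover have "nsq (nabla p u) <= (\<Sum>q\<in>UNIV. nsq (nabla q u))"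
  by (rule member_le_sum) (auto simp: nsq_nonneg)
 ultimately show ?thesis by simp
qed

lemma wip_nabla_bound:
 assumes "cbounded g B"
 shows "cmod (wip g (nabla p u) u) <= B * (sqrt mu * nsq u)"
proof -
 have B: "B >= 0" using assms unfolding cbounded_def by (meson abs_ge_zero order_trans)
 have s: "sqrt mu > 0" using mu by simp
 have "2 * cmod (wip g (nabla p u) u) <= B * ((1 / sqrt mu) * nsq (nabla p u) + nsq u / (1 / sqrt mu))"
  using s by (intro wip_bound assms sh_span_rapid nabla_sh_span u) auto
 also have "... <= B * ((1 / sqrt mu) * (mu * nsq u) + nsq u / (1 / sqrt mu))"
  using s B nsq_nabla_le by (intro mult_left_mono add_right_mono) auto
 also have "(1 / sqrt mu) * (mu * nsq u) = sqrt mu * nsq u"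
 proof -
  have "mu / sqrt mu = sqrt mu" using mu by (simp add: real_div_sqrt)
  thus ?thesis by (metis (no_types, opaque_lifting) mult.left_commute mult_1 times_divide_eq_left times_divide_eq_right mult.commute)
 qed
 finally show ?thesis by (simp add: mult.commute algebra_simps)
qed

text \<open>Integration by parts against \<open>g = r arctan(x / r)\<close>, whose derivative is a bump of width \<open>r\<close>.\<close>
lemma virial:
 assumes r: "r >= 1"
 shows "(LI z. 1 / (1 + (coord e z / r)^2) * (cmod (nabla e u z))^2) <= 3 * r * sqrt mu * nsq u"
proof -
 define g where "g z = r * arctan (coord e z / r)" for z :: "complex ^ 'd"
 define g' where "g' z = 1 / (1 + (coord e z / r)^2)" for z :: "complex ^ 'd"
 define g'' where "g'' z = - (2 * coord e z / r^2) / (1 + (coord e z / r)^2)^2" for z :: "complex ^ 'd"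
 have nz: "1 + (x / r)^2 > 0" for x :: real by (simp add: add_pos_nonneg)
 have g: "cbounded g (2 * r)"
  unfolding cbounded_def g_def
 proof (intro conjI allI)
  show "continuous_on UNIV (%z. r * arctan (coord e z / r))"
   using r by (intro continuous_intros continuous_coord) auto
  fix z
  have "\<bar>arctan (coord e z / r)\<bar> <= 2"
   using arctan_bounded[of "coord e z / r"] pi_half_less_two by (auto simp: abs_le_iff)
  thus "\<bar>r * arctan (coord e z / r)\<bar> <= 2 * r" using r by (simp add: abs_mult)
 qed
 have g': "cbounded g' 1"
  unfolding cbounded_def g'_def using r nz
  by (auto intro!: continuous_intros continuous_coord simp: abs_of_pos less_imp_neq[OF nz, symmetric])
 have g'': "cbounded g'' 1"
  unfolding cbounded_def g''_def
 proof (intro conjI allI)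
  show "continuous_on UNIV (%z. - (2 * coord e z / r^2) / (1 + (coord e z / r)^2)^2)"
   using r less_imp_neq[OF nz, symmetric] by (intro continuous_intros continuous_coord) auto
  fix z
  let ?t = "coord e z / r"
  have "2 * \<bar>?t\<bar> <= 1 + ?t\<^sup>2" by (rule two_abs_le)
  moreover have "1 + ?t\<^sup>2 <= (1 + ?t\<^sup>2)^2" by (rule one_plus_sq_le)
  moreover have "(1 + ?t\<^sup>2)^2 > 0" using nz[of "coord e z"] by simp
  ultimately have "2 * \<bar>?t\<bar> / (1 + ?t\<^sup>2)^2 <= 1" by (simp only: pos_divide_le_eq)
  hence "(2 * \<bar>?t\<bar> / (1 + ?t\<^sup>2)^2) / r <= 1 / 1" using r by (intro frac_le) auto
  moreover have "\<bar>- (2 * coord e z / r^2) / (1 + ?t\<^sup>2)^2\<bar> = (2 * \<bar>?t\<bar> / (1 + ?t\<^sup>2)^2) / r"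
   using r by (simp add: abs_mult abs_divide power2_eq_square)
  ultimately show "\<bar>- (2 * coord e z / r^2) / (1 + ?t\<^sup>2)^2\<bar> <= 1" by simp
 qed
 have c0: "cbounded (%_. 0) 0" by (auto simp: cbounded_def)
 have dg: "((%h. g (z + h *\<^sub>R dirv (fst e) (snd e))) has_vector_derivative g' z) (at 0)" for z
 proof -
  have "((%h. (coord e z + h) / r) has_real_derivative 1 / r) (at 0)"
   using r by (auto intro!: derivative_eq_intros)
  from DERIV_cmult[OF DERIV_chain2[OF DERIV_arctan this], of r]
  have "((%h. r * arctan ((coord e z + h) / r)) has_real_derivative r * (inverse (1 + ((coord e z + 0) / r)^2) * (1 / r))) (at 0)" .
  moreover have "r * (inverse (1 + ((coord e z + 0) / r)^2) * (1 / r)) = g' z"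
   using r by (simp add: g'_def inverse_eq_divide)
  ultimately have "((%h. r * arctan ((coord e z + h) / r)) has_real_derivative g' z) (at 0)" by (simp only:)
  thus ?thesis unfolding g_def coord_line by (simp add: has_real_derivative_iff_has_vector_derivative)
 qed
 have dg0: "((%h. g (z + h *\<^sub>R dirv (fst q) (snd q))) has_vector_derivative 0) (at 0)" if "q ~= e" for z q
  unfolding g_def coord_line using that by simp
 have dg': "((%h. g' (z + h *\<^sub>R dirv (fst e) (snd e))) has_vector_derivative g'' z) (at 0)" for z
  unfolding g'_def g''_def coord_line using r nz[of "coord e z"]
  by (auto intro!: derivative_eq_intros simp: has_real_derivative_iff_has_vector_derivative[symmetric] power2_eq_square)
 have dg'0: "((%h. g' (z + h *\<^sub>R dirv (fst q) (snd q))) has_vector_derivative 0) (at 0)" if "q ~= e" for z q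
  unfolding g'_def coord_line using that by simp
 have S: "nabla p u \<in> sh_span" "nabla p (nabla q u) \<in> sh_span" for p q by (intro nabla_sh_span u)+
 note R = sh_span_rapid[OF u] sh_span_rapid[OF S(1)] sh_span_rapid[OF S(2)]
 define Q where "Q p = (LI z. g' z * (cmod (nabla p u z))^2)" for p
 define q where "q = (LI z. g' z * (cmod (u z))^2)"
 have Q: "wip g' (nabla p u) (nabla p u) = of_real (Q p)" for p unfolding Q_def by (rule wip_self)
 have q: "wip g' u u = of_real q" unfolding q_def by (rule wip_self)
 have w0: "wip (%_. 0) F G = 0" for F G :: "'d fld" by (simp add: wip_def)
 \<comment> \<open>The real part of g F against its own derivative is half a total derivative, so
   only the derivative of g survives.\<close>
 have re2: "2 * Re (wip g F (nabla e F)) = - Re (wip g' F F)" if "F \<in> sh_span" for F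
 proof -
  have "wip g (nabla e F) F + wip g F (nabla e F) = - wip g' F F"
   by (rule wip_parts[OF that that g g' dg])
  from arg_cong[OF this, of Re] show ?thesis
   using arg_cong[OF wip_cnj[of g F "nabla e F"], of Re] by simp
 qed
 define m where "m p = Re (cnj (ncomm p e) * wip g (nabla p u) u)" for p
 \<comment> \<open>The weight g depends on the coordinate e only, so nabla p moves across without
   error when p differs from e. Exchanging it with nabla e costs the curvature term
   \<open>m p\<close>, which contains a single derivative.\<close>
 have s1: "2 * Re (wip g (nabla p (nabla p u)) (nabla e u)) = Q p - 2 * m p" if "p ~= e" for p
 proof -
  have "wip g (nabla p (nabla p u)) (nabla e u) = - wip g (nabla p u) (nabla p (nabla e u))"
   using wip_parts[OF S(1) S(1) g c0 dg0[OF that], of p e] by (simp add: w0 eq_neg_iff_add_eq_0)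
  also have "wip g (nabla p u) (nabla p (nabla e u)) = wip g (nabla p u) (nabla e (nabla p u)) + cnj (ncomm p e) * wip g (nabla p u) u"
  proof -
   have "wip g (nabla p u) (nabla p (nabla e u)) = (LI z. of_real (g z) * (nabla p u z * cnj (nabla e (nabla p u) z))
      + cnj (ncomm p e) * (of_real (g z) * (nabla p u z * cnj (u z))))"
    unfolding wip_def nabla_commute[OF u, of p e] by (simp add: algebra_simps)
   also have "... = wip g (nabla p u) (nabla e (nabla p u)) + cnj (ncomm p e) * wip g (nabla p u) u"
    unfolding wip_def
    by (subst Bochner_Integration.integral_add) (simp_all add: wip_integrable[OF g] R)
   finally show ?thesis .
  qed
  finally have "2 * Re (wip g (nabla p (nabla p u)) (nabla e u)) = - (2 * Re (wip g (nabla p u) (nabla e (nabla p u)))) - 2 * m p"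
   by (simp add: m_def)
  thus ?thesis unfolding re2[OF S(1)] Q by simp
 qed
 have s2: "2 * Re (wip g (nabla e (nabla e u)) (nabla e u)) = - Q e"
  using re2[OF S(1), of e] arg_cong[OF wip_cnj[of g "nabla e u" "nabla e (nabla e u)"], of Re] by (simp add: Q)
 have s3: "(\<Sum>p\<in>UNIV. 2 * Re (wip g (nabla p (nabla p u)) (nabla e u))) = mu * q"
 proof -
  have "(\<Sum>p\<in>UNIV. 2 * Re (wip g (nabla p (nabla p u)) (nabla e u))) = 2 * Re (\<Sum>p\<in>UNIV. wip g (nabla p (nabla p u)) (nabla e u))"
   by (simp add: sum_distrib_left)
  also have "... = - mu * (2 * Re (wip g u (nabla e u)))"
   unfolding wip_eigen[OF g R(2)] by simp
  finally show ?thesis unfolding re2[OF u] q by simp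
 qed
 have m0: "m p = 0" if "p ~= (\<not> fst e, snd e)" for p
  unfolding m_def using ncomm_eq_0[OF that] by simp
 define e' where "e' = (\<not> fst e, snd e)"
 have e': "e' ~= e" by (cases e) (auto simp: e'_def)
 have split: "(\<Sum>p\<in>UNIV. f p) = f e + (\<Sum>p\<in>UNIV - {e}. f p)" for f :: "bool \<times> 'd => real"
  by (rule sum.remove) auto
 have "(\<Sum>p\<in>UNIV - {e}. m p) = m e'"
  using e' m0 by (subst sum.remove[of _ e']) (auto simp: e'_def intro!: sum.neutral)
 \<comment> \<open>Pairing the eigenvalue equation with g nabla e u yields this formula for mu q;
   pairing it with g' u yields the formula \<open>B\<close>. Subtracting them cancels all
   contributions of size mu except 2 \<open>Q e\<close>, which is thereby expressed by terms with
   one derivative, of size sqrt mu.\<close>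
 hence A: "mu * q = - Q e + (\<Sum>p\<in>UNIV - {e}. Q p) - 2 * m e'"
  unfolding s3[symmetric] split[of "%p. 2 * Re (wip g (nabla p (nabla p u)) (nabla e u))"] s2
  using s1 by (simp add: sum_subtractf sum_distrib_left[symmetric])
 have B: "mu * q = (\<Sum>p\<in>UNIV. Q p) + Re (wip g'' (nabla e u) u)"
 proof -
  have t: "Re (wip g' (nabla p (nabla p u)) u) = - Q p - (if p = e then Re (wip g'' (nabla e u) u) else 0)" for p
  proof (cases "p = e")
   case True
   show ?thesis using arg_cong[OF wip_parts[OF S(1) u g' g'' dg', of e], of Re] True by (simp add: Q)
  next
   case False
   show ?thesis using arg_cong[OF wip_parts[OF S(1) u g' c0 dg'0[OF False], of p], of Re] False by (simp add: Q w0)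
  qed
  have "- mu * q = Re (\<Sum>p\<in>UNIV. wip g' (nabla p (nabla p u)) u)"
   unfolding wip_eigen[OF g' R(1)] q by simp
  also have "... = - (\<Sum>p\<in>UNIV. Q p) - Re (wip g'' (nabla e u) u)"
   by (simp add: t sum_subtractf sum_negf)
  finally show ?thesis by simp
 qed
 have "2 * Q e = - Re (wip g'' (nabla e u) u) - 2 * m e'"
  using A B split[of Q] by linarith
 also have "... <= cmod (wip g'' (nabla e u) u) + 2 * cmod (wip g (nabla e' u) u)"
 proof -
  have "\<bar>m e'\<bar> <= cmod (cnj (ncomm e' e) * wip g (nabla e' u) u)" unfolding m_def by (rule abs_Re_le_cmod)
  also have "... <= 1 * cmod (wip g (nabla e' u) u)"
   unfolding norm_mult using cmod_ncomm[of e' e] by (intro mult_right_mono) auto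
  finally show ?thesis using abs_Re_le_cmod[of "wip g'' (nabla e u) u"] by (simp add: abs_le_iff)
 qed
 also have "... <= 1 * (sqrt mu * nsq u) + 2 * (2 * r * (sqrt mu * nsq u))"
  by (intro add_mono mult_left_mono wip_nabla_bound g g'') auto
 also have "... <= 6 * r * (sqrt mu * nsq u)"
 proof -
  have p: "0 <= sqrt mu * nsq u" using mu nsq_nonneg[of u] by (intro mult_nonneg_nonneg) auto
  have "1 * (sqrt mu * nsq u) <= r * (sqrt mu * nsq u)"
   using r p by (intro mult_right_mono) auto
  moreover have "0 <= r * (sqrt mu * nsq u)" using r p by simp
  ultimately show ?thesis by simp
 qed
 finally show ?thesis unfolding Q_def g'_def by simp
qed

text \<open>Pairing the eigenvalue equation with w u expresses mu times the local mass by local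
  gradient energies and lower-order terms. The bump w is below each one-dimensional bump of
  \<open>virial\<close>, so each of the 2 d directions contributes at most 4 r sqrt mu; dividing by
  mu and using that the indicator is at most 2 w gives the constant 16 d.\<close>

lemma trace_bound:
 fixes r :: real
 assumes r: "r >= 1"
 shows "(LI z. indicator (cball 0 r) z * (cmod (u z))^2) <= 16 * real CARD('d) * r / sqrt mu * nsq u"
proof -
 define w where "w z = 1 / (1 + (norm z / r)^2)" for z :: "complex ^ 'd"
 define w' where "w' p z = - (2 * coord p z / r^2) / (1 + (norm z / r)^2)^2" for p :: "bool \<times> 'd" and z
 have nz: "1 + (x / r)^2 > 0" for x :: real by (simp add: add_pos_nonneg)
 have w: "cbounded w 1"
  unfolding cbounded_def w_def using r nz
  by (auto intro!: continuous_intros simp: abs_of_pos less_imp_neq[OF nz, symmetric])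
 have w': "cbounded (w' p) 1" for p
  unfolding cbounded_def w'_def
 proof (intro conjI allI)
  show "continuous_on UNIV (%z. - (2 * coord p z / r^2) / (1 + (norm z / r)^2)^2)"
   using r less_imp_neq[OF nz, symmetric] by (intro continuous_intros continuous_coord) auto
  fix z :: "complex ^ 'd"
  let ?t = "norm z / r"
  have "2 * \<bar>?t\<bar> <= 1 + ?t\<^sup>2" by (rule two_abs_le)
  moreover have "1 + ?t\<^sup>2 <= (1 + ?t\<^sup>2)^2" by (rule one_plus_sq_le)
  moreover have "\<bar>coord p z / r\<bar> <= ?t" using coord_le_norm[of p z] r by (simp add: divide_right_mono)
  moreover have "(1 + ?t\<^sup>2)^2 > 0" using nz[of "norm z"] by simp
  ultimately have "2 * \<bar>coord p z / r\<bar> / (1 + ?t\<^sup>2)^2 <= 1" by (simp only: pos_divide_le_eq)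
  hence "(2 * \<bar>coord p z / r\<bar> / (1 + ?t\<^sup>2)^2) / r <= 1 / 1" using r by (intro frac_le) auto
  moreover have "\<bar>- (2 * coord p z / r^2) / (1 + ?t\<^sup>2)^2\<bar> = (2 * \<bar>coord p z / r\<bar> / (1 + ?t\<^sup>2)^2) / r"
   using r by (simp add: abs_mult abs_divide power2_eq_square)
  ultimately show "\<bar>- (2 * coord p z / r^2) / (1 + ?t\<^sup>2)^2\<bar> <= 1" by simp
 qed
 have dw: "((%h. w (z + h *\<^sub>R dirv (fst p) (snd p))) has_vector_derivative w' p z) (at 0)" for p z
 proof -
  let ?s = "\<Sum>q\<in>UNIV - {p}. (coord q z)^2"
  have n: "(norm (z + h *\<^sub>R dirv (fst p) (snd p)))^2 = (coord p z + h)^2 + ?s" for h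
   unfolding norm_sq_coord coord_line by (subst sum.remove[of _ p]) auto
  have n0: "(norm z)^2 = (coord p z)^2 + ?s" using n[of 0] by simp
  have "((%h. 1 / (1 + ((coord p z + h)^2 + ?s) / r^2)) has_real_derivative w' p z) (at 0)"
  proof -
   have nn: "1 + ((coord p z)^2 + ?s) / r^2 ~= 0" using nz[of "norm z"] unfolding power_divide n0 by linarith
   have "((%h. 1 + ((coord p z + h)^2 + ?s) / r^2) has_real_derivative 2 * coord p z / r^2) (at 0)"
    using r by (auto intro!: derivative_eq_intros simp: power2_eq_square power4_eq_xxxx)
   from DERIV_inverse'[OF this] nn show ?thesis
    unfolding w'_def power_divide n0 by (simp add: inverse_eq_divide power2_eq_square mult_ac)
  qed
  thus ?thesis unfolding w_def power_divide n by (simp add: has_real_derivative_iff_has_vector_derivative)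
 qed
 have S: "nabla p u \<in> sh_span" for p by (intro nabla_sh_span u)
 note R = sh_span_rapid[OF u] sh_span_rapid[OF S]
 define W where "W p = (LI z. w z * (cmod (nabla p u z))^2)" for p
 define a where "a = (LI z. w z * (cmod (u z))^2)"
 have isq: "integrable lborel (%z. g z * (cmod (F z))^2)" if "cbounded g B" "rapid F" for g B and F :: "'d fld"
 proof -
  have eq: "(%z. g z * (cmod (F z))^2) = (%z. Re (of_real (g z) * (F z * cnj (F z))))"
   by (auto simp: fun_eq_iff complex_norm_square[symmetric] simp flip: of_real_power)
  show ?thesis unfolding eq by (intro integrable_Re wip_integrable[OF that(1,2,2)])
 qed
 have "mu * a = (\<Sum>p\<in>UNIV. W p + Re (wip (w' p) (nabla p u) u))"
 proof -
  have t: "Re (wip w (nabla p (nabla p u)) u) = - (W p + Re (wip (w' p) (nabla p u) u))" for p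
   using arg_cong[OF wip_parts[OF S u w w' dw, of p p], of Re] by (simp add: wip_self W_def)
  have "- mu * a = Re (\<Sum>p\<in>UNIV. wip w (nabla p (nabla p u)) u)"
   unfolding wip_eigen[OF w R(1)] by (simp add: wip_self a_def)
  also have "... = - (\<Sum>p\<in>UNIV. W p + Re (wip (w' p) (nabla p u) u))"
   unfolding Re_sum t by (rule sum_negf)
  finally show ?thesis by simp
 qed
 also have "... <= (\<Sum>p\<in>(UNIV :: (bool \<times> 'd) set). 3 * r * sqrt mu * nsq u + 1 * (sqrt mu * nsq u))"
 proof (intro sum_mono add_mono)
  fix p :: "bool \<times> 'd"
  show "W p <= 3 * r * sqrt mu * nsq u"
  proof -
   have c: "cbounded (%z. 1 / (1 + (coord p z / r)^2)) 1"
    unfolding cbounded_def using r nz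
    by (auto intro!: continuous_intros continuous_coord simp: abs_of_pos less_imp_neq[OF nz, symmetric])
   have "W p <= (LI z. 1 / (1 + (coord p z / r)^2) * (cmod (nabla p u z))^2)"
    unfolding W_def
   proof (intro integral_mono isq[OF w R(2)] isq[OF c R(2)] mult_right_mono)
    fix z
    have "(coord p z / r)^2 <= (norm z / r)^2"
     using coord_le_norm[of p z] r by (intro power2_le_iff_abs_le[THEN iffD2]) (auto simp: divide_right_mono)
    thus "w z <= 1 / (1 + (coord p z / r)^2)"
     unfolding w_def using nz by (intro divide_left_mono) (auto intro: mult_pos_pos)
   qed auto
   also have "... <= 3 * r * sqrt mu * nsq u" by (rule virial[OF r])
   finally show ?thesis .
  qed
  show "Re (wip (w' p) (nabla p u) u) <= 1 * (sqrt mu * nsq u)"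
   using wip_nabla_bound[OF w', of p p] complex_Re_le_cmod order_trans by blast
 qed
 also have "... <= 8 * real CARD('d) * r * (sqrt mu * nsq u)"
 proof -
  have "sqrt mu * nsq u <= r * (sqrt mu * nsq u)"
   using r mu nsq_nonneg[of u] mult_right_mono[of 1 r "sqrt mu * nsq u"] by simp
  hence "3 * r * sqrt mu * nsq u + 1 * (sqrt mu * nsq u) <= 4 * (r * (sqrt mu * nsq u))" by simp
  hence "2 * real CARD('d) * (3 * r * sqrt mu * nsq u + 1 * (sqrt mu * nsq u)) <= 2 * real CARD('d) * (4 * (r * (sqrt mu * nsq u)))"
   by (intro mult_left_mono) auto
  thus ?thesis by (simp add: card_cartesian_product[of UNIV UNIV, simplified UNIV_Times_UNIV] card_prod mult_ac)
 qed
 finally have A: "mu * a <= 8 * real CARD('d) * r * (sqrt mu * nsq u)" .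
 have sq: "mu = sqrt mu * sqrt mu" "sqrt mu > 0" using mu by auto
 have "sqrt mu * (sqrt mu * a) <= sqrt mu * (8 * real CARD('d) * r * nsq u)"
  using A by (subst (asm) (1) sq(1)) (simp add: mult_ac)
 hence "sqrt mu * a <= 8 * real CARD('d) * r * nsq u" using sq(2) by simp
 hence a: "a <= 8 * real CARD('d) * r * nsq u / sqrt mu" using sq(2) by (simp add: pos_le_divide_eq mult.commute)
 have "(LI z. indicator (cball 0 r) z * (cmod (u z))^2) <= (LI z. 2 * (w z * (cmod (u z))^2))"
 proof (rule integral_mono)
  show "integrable lborel (%z. 2 * (w z * (cmod (u z))^2))" by (intro integrable_mult_right isq[OF w R(1)])
  have "integrable lborel (%z. indicator (cball 0 r) z *\<^sub>R (cmod (u z))\<^sup>2)"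
   using rapid_square_integrable[OF R(1)] by (intro integrable_mult_indicator) (auto simp: square_integrable_def)
  thus "integrable lborel (%z. indicator (cball 0 r) z * (cmod (u z))^2)" by simp
  fix z
  have "indicator (cball 0 r) z <= 2 * w z"
  proof (cases "z \<in> cball 0 r")
   case True
   hence "(norm z / r)^2 <= 1" using r by (simp add: power_le_one)
   thus ?thesis using True nz[of "norm z"] by (simp add: w_def pos_le_divide_eq)
  next
   case False
   thus ?thesis using nz[of "norm z"] by (simp add: w_def)
  qed
  hence "indicator (cball 0 r) z * (cmod (u z))^2 <= (2 * w z) * (cmod (u z))^2"
   by (intro mult_right_mono) auto
  thus "indicator (cball 0 r) z * (cmod (u z))^2 <= 2 * (w z * (cmod (u z))^2)" by simp
 qed
 also have "... = 2 * a" by (simp add: a_def)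
 finally show ?thesis using a by simp
qed

end

section \<open>Kernels of spectral multipliers\<close>

definition sh_norm :: "'d::finite itself => real" where
 "sh_norm _ = nsq (Sh (%_::'d. 0) (%_. 0))"

lemma sh_norm_nonneg: "sh_norm T >= 0" by (simp add: sh_norm_def nsq_nonneg)

lemma wip_add_left:
 assumes "cbounded g B" "rapid F" "rapid F'" "rapid G"
 shows "wip g (%z. a * F z + b * F' z) G = a * wip g F G + b * wip g F' G"
proof -
 have "wip g (%z. a * F z + b * F' z) G = (LI z. a * (of_real (g z) * (F z * cnj (G z))) + b * (of_real (g z) * (F' z * cnj (G z))))"
  unfolding wip_def by (simp add: algebra_simps)
 also have "... = a * wip g F G + b * wip g F' G"
  unfolding wip_def by (subst Bochner_Integration.integral_add) (simp_all add: wip_integrable[OF assms(1)] assms)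
 finally show ?thesis .
qed

lemma wip_add_right:
 assumes "cbounded g B" "rapid F" "rapid F'" "rapid G"
 shows "wip g G (%z. a * F z + b * F' z) = cnj a * wip g G F + cnj b * wip g G F'"
 using arg_cong[OF wip_add_left[OF assms, of a b], of cnj] by (simp add: wip_cnj)

text \<open>Antisymmetry of the covariant derivatives gives adjointness of raising and lowering in
  the second index. For the first index, multiplication by z_j is adjoint to multiplication by its
  conjugate; the second-index terms in that identity cancel by what has just been found.\<close>

lemma sh_orthogonal_aux:
 fixes a a' b b' :: "'d::finite => nat"
 shows "wip (%_. 1) (Sh a b) (Sh a' b') = (if a = a' & b = b' then of_real (sh_norm TYPE('d)) else 0)"
proof -
 define I where "I a b a' b' = wip (%_. 1) (Sh a b) (Sh a' b')" for a b a' b' :: "'d => nat"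
 have c1: "cbounded (%_. 1) 1" and c0: "cbounded (%_. 0) 0" by (auto simp: cbounded_def)
 note r = rapid_special_hermite
 have Icnj: "cnj (I a b a' b') = I a' b' a b" for a b a' b' unfolding I_def by (rule wip_cnj)
 have par: "wip (%_. 1) (nabla p (Sh a b)) (Sh a' b') = - wip (%_. 1) (Sh a b) (nabla p (Sh a' b'))" for p :: "bool \<times> 'd" and a b a' b'
  using wip_parts[OF sh_span.base sh_span.base c1 c0, of p a b a' b'] by (simp add: wip_def[of "%_. 0"] eq_neg_iff_add_eq_0)
 have nab: "nabla (h, j) (Sh a b) = (%z. (nfac h * of_real (sqrt (real (b j) + 1))) * Sh a (up b j) z + (nfac h * nsgn h * of_real (sqrt (real (b j)))) * Sh a (dn b j) z)" for h and j :: 'd and a b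
  unfolding nabla_special_hermite by (simp add: algebra_simps)
 define U where "U a b a' b' j = of_real (sqrt (real (b j) + 1)) * I a (up b j) a' b'" for a b a' b' and j :: 'd
 define D where "D a b a' b' j = of_real (sqrt (real (b j))) * I a (dn b j) a' b'" for a b a' b' and j :: 'd
 define U' where "U' a b a' b' j = of_real (sqrt (real (b' j) + 1)) * I a b a' (up b' j)" for a b a' b' and j :: 'd
 define D' where "D' a b a' b' j = of_real (sqrt (real (b' j))) * I a b a' (dn b' j)" for a b a' b' and j :: 'd
 have eq: "nfac h * (U a b a' b' j + nsgn h * D a b a' b' j) = - cnj (nfac h) * (U' a b a' b' j + nsgn h * D' a b a' b' j)" for h a b a' b' j
 proof -
  have "cnj (nsgn h) = nsgn h" by (simp add: nsgn_def)
  thus ?thesis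
  using par[of "(h, j)" a b a' b'] unfolding nab wip_add_left[OF c1 r r r] wip_add_right[OF c1 r r r] I_def[symmetric]
  by (simp add: U_def D_def U'_def D'_def algebra_simps)
 qed
 have bU: "U a b a' b' j = D' a b a' b' j" and bD: "U' a b a' b' j = D a b a' b' j" for a b a' b' j
 proof -
  have nz: "nfac h ~= 0" for h by (simp add: nfac_def)
  have "nfac True * (U a b a' b' j + D a b a' b' j) = nfac True * (U' a b a' b' j + D' a b a' b' j)"
   using eq[of True a b a' b' j] by (simp add: nfac_def nsgn_def)
  hence "U a b a' b' j + D a b a' b' j = U' a b a' b' j + D' a b a' b' j" using nz by simp
  moreover have "nfac False * (U a b a' b' j - D a b a' b' j) = nfac False * (- (U' a b a' b' j - D' a b a' b' j))"
   using eq[of False a b a' b' j] unfolding nfac_def nsgn_def by (simp add: diff_divide_distrib)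
  hence "U a b a' b' j - D a b a' b' j = - (U' a b a' b' j - D' a b a' b' j)" using nz by simp
  ultimately show "U a b a' b' j = D' a b a' b' j" "U' a b a' b' j = D a b a' b' j"
   by (simp_all add: complex_eq_iff)
 qed
 have zr: "of_real (sqrt (real (a j))) * I (dn a j) b a' b' = of_real (sqrt (real (a' j) + 1)) * I a b (up a' j) b'" for a b a' b' j
 proof -
  have w1: "wip (%_. 1) (%z. z $ j * Sh a b z) (Sh a' b') = wip (%_. 1) (Sh a b) (%z. cnj (z $ j) * Sh a' b' z)"
   unfolding wip_def by (simp add: mult_ac)
  have e1: "(%z. z $ j * Sh a b z) = (%z. (\<i> * of_real (sqrt 2) * of_real (sqrt (real (a j)))) * Sh (dn a j) b z + (- \<i> * of_real (sqrt 2) * of_real (sqrt (real (b j) + 1))) * Sh a (up b j) z)"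
   unfolding sh_z_mult by (simp add: algebra_simps)
  have e2: "(%z. cnj (z $ j) * Sh a' b' z) = (%z. (\<i> * of_real (sqrt 2) * of_real (sqrt (real (b' j)))) * Sh a' (dn b' j) z + (- \<i> * of_real (sqrt 2) * of_real (sqrt (real (a' j) + 1))) * Sh (up a' j) b' z)"
   unfolding sh_cnj_mult by (simp add: algebra_simps)
  from w1 have "\<i> * of_real (sqrt 2) * (of_real (sqrt (real (a j))) * I (dn a j) b a' b' - U a b a' b' j)
    = \<i> * of_real (sqrt 2) * (of_real (sqrt (real (a' j) + 1)) * I a b (up a' j) b' - D' a b a' b' j)"
   unfolding e1 e2 wip_add_left[OF c1 r r r] wip_add_right[OF c1 r r r] I_def[symmetric]
   by (simp add: U_def D'_def algebra_simps)
  thus ?thesis by (simp add: bU)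
 qed
 have "I a b a' b' = (if b = b' then I a (%_. 0) a' (%_. 0) else 0)"
 proof (rule ladder_orthogonal[where I = "%b b'. I a b a' b'"])
  show "complex_of_real (sqrt (real (b j) + 1)) * I a (b(j := Suc (b j))) a' b' = complex_of_real (sqrt (real (b' j))) * I a b a' (b'(j := b' j - 1))" for j b b'
   using bU[of a b a' b' j] by (simp add: U_def D'_def)
  show "complex_of_real (sqrt (real (b' j) + 1)) * I a b a' (b'(j := Suc (b' j))) = complex_of_real (sqrt (real (b j))) * I a (b(j := b j - 1)) a' b'" for j b b'
   using bD[of a b a' b' j] by (simp add: U'_def D_def)
 qed
 moreover have "I a (%_. 0) a' (%_. 0) = (if a = a' then I (%_. 0) (%_. 0) (%_. 0) (%_. 0) else 0)"
 proof (rule ladder_orthogonal[where I = "%a a'. I a (%_. 0) a' (%_. 0)"])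
  fix j a a'
  show "complex_of_real (sqrt (real (a' j) + 1)) * I a (%_. 0) (a'(j := Suc (a' j))) (%_. 0) = complex_of_real (sqrt (real (a j))) * I (a(j := a j - 1)) (%_. 0) a' (%_. 0)"
   using zr[of a j "%_. 0" a' "%_. 0"] by simp
  show "complex_of_real (sqrt (real (a j) + 1)) * I (a(j := Suc (a j))) (%_. 0) a' (%_. 0) = complex_of_real (sqrt (real (a' j))) * I a (%_. 0) (a'(j := a' j - 1)) (%_. 0)"
   using arg_cong[OF zr[of a' j "%_. 0" a "%_. 0"], of cnj] by (simp add: Icnj)
 qed
 moreover have "I (%_. 0) (%_. 0) (%_. 0) (%_. 0) = of_real (sh_norm TYPE('d))"
  unfolding I_def sh_norm_def by (rule wip_1_self)
 ultimately show ?thesis unfolding I_def by auto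
qed

lemma sh_orthogonal:
 fixes a a' b b' :: "'d::finite => nat"
 shows "(LI z. Sh a b z * cnj (Sh a' b' z)) = (if a = a' & b = b' then of_real (sh_norm TYPE('d)) else 0)"
 using sh_orthogonal_aux[of a b a' b'] by (simp add: wip_def)

definition sh_bound :: "'d::finite itself => real" where
 "sh_bound _ = (cmod (sh_const TYPE('d)) * (LI x. (Hf (%_::'d. 0) x)^2))^2"

text \<open>For fixed z the values \<open>Sh al be z\<close> are, up to a constant, the coefficients
  of one function, a modulated translate of the Hermite function with index \<open>be\<close>,
  against the translated Hermite functions. Bessel's inequality is therefore uniform in z and in
  \<open>be\<close>.\<close>

lemma sh_bessel:
 fixes be :: "'d::finite => nat"
 assumes A: "finite A"
 shows "(\<Sum>al\<in>A. (cmod (Sh al be z))^2) <= sh_bound TYPE('d)"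
proof -
 define h0 where "h0 = (LI x. (Hf (%_::'d. 0) x)^2)"
 define et where "et = (1/2) *\<^sub>R im_part z"
 define e where "e al xi = complex_of_real (Hf al (xi + et))" for al :: "'d => nat" and xi
 define f where "f xi = exp (\<i> * of_real (re_part z \<bullet> xi)) * of_real (Hf be (xi + (- et)))" for xi
 have sq: "integrable lborel (%x. (Hf al (x + y))^2)" for al :: "'d => nat" and y
  using lborel_integrable_shift[OF integrable_hermite_fun_mult[of al al], of y] by (simp add: power2_eq_square)
 have cn: "(cmod (e al xi))^2 = (Hf al (xi + et))^2" "(cmod (f xi))^2 = (Hf be (xi + (- et)))^2" for al xi
  by (simp_all add: e_def f_def norm_mult)
 have se: "square_integrable lborel (e al)" for al
  unfolding square_integrable_def cn
 proof
  show "e al \<in> borel_measurable lborel" unfolding e_def by measurable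
 qed (rule sq)
 have sf: "square_integrable lborel f"
  unfolding square_integrable_def cn
 proof
  have "continuous_on UNIV f" unfolding f_def
   by (intro continuous_intros continuous_on_compose2[OF continuous_hermite_fun[of UNIV]]) auto
  thus "f \<in> borel_measurable lborel" by (simp add: borel_measurable_continuous_onI)
 qed (rule sq)
 have orth: "(LI x. e al x * cnj (e al' x)) = (if al = al' then of_real h0 else 0)" for al al'
 proof -
  have "(LI x. e al x * cnj (e al' x)) = of_real (LI x. Hf al (x + et) * Hf al' (x + et))"
   unfolding e_def complex_cnj_complex_of_real of_real_mult[symmetric] integral_complex_of_real ..
  also have "(LI x. Hf al (x + et) * Hf al' (x + et)) = (LI x. Hf al x * Hf al' x)"
   by (rule lborel_integral_shift) measurable
  also have "... = (if al = al' then h0 else 0)"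
   unfolding hermite_fun_orthogonal[of al al'] h0_def by (simp add: power2_eq_square)
  finally show ?thesis by simp
 qed
 have nf: "(LI x. (cmod (f x))^2) = h0"
 proof -
  have "(LI x. (cmod (f x))^2) = (LI x. (Hf be x)^2)"
   unfolding cn by (rule lborel_integral_shift) measurable
  also have "... = h0"
   unfolding h0_def power2_eq_square using hermite_fun_orthogonal[of be be] by simp
  finally show ?thesis .
 qed
 have "h0 >= 0" by (simp add: h0_def)
 from bessel_inequality[OF A se orth this sf]
 have b: "(\<Sum>al\<in>A. (cmod (LI x. f x * cnj (e al x)))^2) <= h0 * h0" unfolding nf .
 have "Sh al be z = sh_const TYPE('d) * (LI x. f x * cnj (e al x))" for al
  unfolding special_hermite_eq sh_integrand_def f_def e_def et_def by (simp add: mult_ac)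
 hence "(\<Sum>al\<in>A. (cmod (Sh al be z))^2) = (cmod (sh_const TYPE('d)))^2 * (\<Sum>al\<in>A. (cmod (LI x. f x * cnj (e al x)))^2)"
  by (simp add: norm_mult power_mult_distrib sum_distrib_left)
 also have "... <= (cmod (sh_const TYPE('d)))^2 * (h0 * h0)" by (intro mult_left_mono b) auto
 finally show ?thesis by (simp add: sh_bound_def h0_def power2_eq_square mult_ac)
qed

section \<open>Kernels obtained by summing over the first index\<close>

lemma sh_sq_summable: "(%al. (cmod (Sh al be z))^2) summable_on UNIV"
 using sh_bessel by (intro nonneg_bdd_above_summable_on) (auto simp: bdd_above_def)

lemma sh_sq_infsum_le:
 fixes be :: "'d::finite => nat"
 shows "(\<Sum>\<^sub>\<infinity>al. (cmod (Sh al be z))^2) <= sh_bound TYPE('d)"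
 by (rule infsum_le_finite_sums[OF sh_sq_summable sh_bessel])

lemma sh_bound_nonneg: "sh_bound T >= 0" by (simp add: sh_bound_def)

lemma square_summable_mult:
 fixes f g :: "'i => complex"
 assumes "(%i. (cmod (f i))^2) summable_on A" "(%i. (cmod (g i))^2) summable_on A"
 shows "(%i. cmod (f i * g i)) summable_on A"
proof (rule summable_on_comparison_test)
 show "(%i. (cmod (f i))^2 + (cmod (g i))^2) summable_on A" by (intro summable_on_add assms)
 show "cmod (f i * g i) <= (cmod (f i))^2 + (cmod (g i))^2" for i
 proof -
  have "2 * (cmod (f i) * cmod (g i)) <= (cmod (f i))^2 + (cmod (g i))^2"
   using sum_squares_bound[of "cmod (f i)" "cmod (g i)"] by (simp add: mult.assoc)
  moreover have "0 <= cmod (f i) * cmod (g i)" by simp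
  ultimately show ?thesis unfolding norm_mult by linarith
 qed
qed auto

text \<open>The projection kernels have equal second indices; unequal ones arise as intermediate
  states after multiplying by z_j - z'_j once.\<close>

definition shE :: "('d::finite => nat) => ('d => nat) => complex ^ 'd => 'd fld" where
 "shE be ga z z' = (\<Sum>\<^sub>\<infinity>al. Sh al be z * cnj (Sh al ga z'))"

lemma shE_summable: "(%al. Sh al be z * cnj (Sh al ga z')) summable_on UNIV"
 by (rule abs_summable_summable, rule square_summable_mult) (auto intro: sh_sq_summable)

lemma shE_cnj: "shE be ga z z' = cnj (shE ga be z' z)"
 unfolding shE_def infsum_cnj[symmetric] by (simp add: mult.commute)

lemma cmod_shE_le:
 fixes be :: "'d::finite => nat"
 shows "cmod (shE be be z z') <= sh_bound TYPE('d)"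
proof -
 have abs: "(%al. cmod (Sh al be z * cnj (Sh al be z'))) summable_on UNIV"
  by (rule square_summable_mult) (auto intro: sh_sq_summable)
 have "cmod (shE be be z z') <= (\<Sum>\<^sub>\<infinity>al. cmod (Sh al be z * cnj (Sh al be z')))"
  unfolding shE_def by (rule norm_infsum_bound[OF abs])
 also have "... <= (\<Sum>\<^sub>\<infinity>al. (1/2) * (cmod (Sh al be z))^2 + (1/2) * (cmod (Sh al be z'))^2)"
 proof (rule infsum_mono[OF abs])
  show "(%al. (1/2) * (cmod (Sh al be z))^2 + (1/2) * (cmod (Sh al be z'))^2) summable_on UNIV"
   by (intro summable_on_add summable_on_cmult_right sh_sq_summable)
  show "cmod (Sh al be z * cnj (Sh al be z')) <= (1/2) * (cmod (Sh al be z))^2 + (1/2) * (cmod (Sh al be z'))^2" for al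
   using sum_squares_bound[of "cmod (Sh al be z)" "cmod (Sh al be z')"]
   by (simp add: norm_mult)
 qed
 also have "... = (1/2) * (\<Sum>\<^sub>\<infinity>al. (cmod (Sh al be z))^2) + (1/2) * (\<Sum>\<^sub>\<infinity>al. (cmod (Sh al be z'))^2)"
  by (simp only: infsum_add[OF summable_on_cmult_right[OF sh_sq_summable] summable_on_cmult_right[OF sh_sq_summable]] infsum_cmult_right')
 also have "... <= (1/2) * sh_bound TYPE('d) + (1/2) * sh_bound TYPE('d)"
  by (intro add_mono mult_left_mono sh_sq_infsum_le) auto
 finally show ?thesis by simp
qed

lemma inj_up: "inj (%al. up al j)"
 by (auto simp: inj_on_def fun_eq_iff split: if_splits)

lemma sum_sq_le: "(x + y)^2 <= 2 * x^2 + 2 * y^2" for x y :: real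
 using sum_squares_bound[of x y] by (simp add: power2_sum)

text \<open>Reading \<open>sh_z_mult\<close> at \<open>up al j\<close> and solving for the weighted
  term exhibits it as a combination of two square-summable families. It makes the two shifted sums
  in \<open>shE_z\<close> converge separately before they are cancelled.\<close>

lemma sh_sq_summable_weighted:
 "(%al. (cmod (of_real (sqrt (real (al j) + 1)) * Sh al be z))^2) summable_on UNIV"
proof (rule summable_on_comparison_test)
 let ?f = "%al. (cmod (z $ j))^2 * (cmod (Sh (up al j) be z))^2 + (2 * (real (be j) + 1)) * (cmod (Sh (up al j) (up be j) z))^2"
 have re: "(%al. (cmod (Sh (up al j) ga z))^2) summable_on UNIV" for ga
 proof -
  have "(%al. (cmod (Sh al ga z))^2) summable_on (range (%al. up al j))"
   by (rule summable_on_subset_banach[OF sh_sq_summable]) auto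
  thus ?thesis by (subst (asm) summable_on_reindex[OF inj_up]) (simp add: o_def)
 qed
 show "?f summable_on UNIV" by (intro summable_on_add summable_on_cmult_right re)
 fix al
 have "of_real (sqrt (real (al j) + 1)) * Sh al be z = z $ j * Sh (up al j) be z / (\<i> * of_real (sqrt 2)) + of_real (sqrt (real (be j) + 1)) * Sh (up al j) (up be j) z"
  unfolding sh_z_mult by (simp add: field_simps)
 hence "cmod (of_real (sqrt (real (al j) + 1)) * Sh al be z) <= cmod (z $ j * Sh (up al j) be z / (\<i> * of_real (sqrt 2))) + cmod (of_real (sqrt (real (be j) + 1)) * Sh (up al j) (up be j) z)"
  by (simp only: norm_triangle_ineq)
 hence "(cmod (of_real (sqrt (real (al j) + 1)) * Sh al be z))^2 <= (cmod (z $ j * Sh (up al j) be z / (\<i> * of_real (sqrt 2))) + cmod (of_real (sqrt (real (be j) + 1)) * Sh (up al j) (up be j) z))^2"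
  by (intro power_mono) auto
 also have "... <= 2 * (cmod (z $ j * Sh (up al j) be z / (\<i> * of_real (sqrt 2))))^2 + 2 * (cmod (of_real (sqrt (real (be j) + 1)) * Sh (up al j) (up be j) z))^2"
  by (rule sum_sq_le)
 also have "... = ?f al" by (simp add: norm_mult norm_divide power_mult_distrib power_divide)
 finally show "(cmod (of_real (sqrt (real (al j) + 1)) * Sh al be z))^2 <= ?f al" .
qed auto

text \<open>Applying z_j to the left factor and z'_j to the right one produces, besides shifts of
  the second indices, two sums over the first index that are reindexings of each other along
  \<open>up\<close>. They cancel, so the first index stays out of the result.\<close>

lemma shE_z:
 "(z $ j - z' $ j) * shE be ga z z' = \<i> * of_real (sqrt 2) *
   (of_real (sqrt (real (ga j))) * shE be (dn ga j) z z' - of_real (sqrt (real (be j) + 1)) * shE (up be j) ga z z')"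
proof -
 define T where "T al = of_real (sqrt (real (al j) + 1)) * Sh al be z * cnj (Sh (up al j) ga z')" for al
 define T' where "T' al = of_real (sqrt (real (al j))) * Sh (dn al j) be z * cnj (Sh al ga z')" for al
 have re: "(%al. (cmod (cnj (Sh (up al j) ga z')))^2) summable_on UNIV"
 proof -
  have "(%al. (cmod (Sh al ga z'))^2) summable_on (range (%al. up al j))"
   by (rule summable_on_subset_banach[OF sh_sq_summable]) auto
  thus ?thesis by (subst (asm) summable_on_reindex[OF inj_up]) (simp add: o_def)
 qed
 have T: "T summable_on UNIV"
  unfolding T_def by (rule abs_summable_summable, rule square_summable_mult[OF sh_sq_summable_weighted re])
 have TT: "T' \<circ> (%al. up al j) = T" by (auto simp: T_def T'_def fun_eq_iff add.commute)
 have T'0: "T' al = 0" if "al \<notin> range (%al. up al j)" for al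
 proof -
  have "al j = 0"
  proof (rule ccontr)
   assume "al j ~= 0"
   hence "al = up (dn al j) j" by (auto simp: fun_eq_iff)
   thus False using that by blast
  qed
  thus ?thesis by (simp add: T'_def)
 qed
 have T'r: "T' summable_on (range (%al. up al j))" unfolding summable_on_reindex[OF inj_up] TT by (rule T)
 have T': "T' summable_on UNIV"
  using T'r by (rule summable_on_cong_neutral[THEN iffD1, rotated -1]) (auto simp: T'0)
 have sT: "infsum T' UNIV = infsum T UNIV"
 proof -
  have "infsum T' UNIV = infsum T' (range (%al. up al j))"
   by (rule infsum_cong_neutral) (auto simp: T'0)
  thus ?thesis by (simp only: infsum_reindex[OF inj_up] TT)
 qed
 define A where "A al = Sh al be z * cnj (Sh al (dn ga j) z')" for al
 define B where "B al = Sh al (up be j) z * cnj (Sh al ga z')" for al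
 have AB: "A summable_on UNIV" "B summable_on UNIV" unfolding A_def B_def by (rule shE_summable)+
 have pt: "(z $ j - z' $ j) * (Sh al be z * cnj (Sh al ga z')) =
   \<i> * of_real (sqrt 2) * ((T' al - T al) + (of_real (sqrt (real (ga j))) * A al - of_real (sqrt (real (be j) + 1)) * B al))" for al
 proof -
  have "(z $ j - z' $ j) * (Sh al be z * cnj (Sh al ga z'))
    = (z $ j * Sh al be z) * cnj (Sh al ga z') - Sh al be z * cnj (cnj (z' $ j) * Sh al ga z')"
   by (simp add: algebra_simps)
  thus ?thesis unfolding sh_z_mult sh_cnj_mult T_def T'_def A_def B_def by (simp add: algebra_simps)
 qed
 have "(z $ j - z' $ j) * shE be ga z z' = (\<Sum>\<^sub>\<infinity>al. (z $ j - z' $ j) * (Sh al be z * cnj (Sh al ga z')))"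
  unfolding shE_def by (rule infsum_cmult_right'[symmetric])
 also have "... = \<i> * of_real (sqrt 2) * (\<Sum>\<^sub>\<infinity>al. (T' al - T al) + (of_real (sqrt (real (ga j))) * A al - of_real (sqrt (real (be j) + 1)) * B al))"
  unfolding pt by (rule infsum_cmult_right')
 also have "(\<Sum>\<^sub>\<infinity>al. (T' al - T al) + (of_real (sqrt (real (ga j))) * A al - of_real (sqrt (real (be j) + 1)) * B al))
   = (infsum T' UNIV - infsum T UNIV) + (of_real (sqrt (real (ga j))) * infsum A UNIV - of_real (sqrt (real (be j) + 1)) * infsum B UNIV)"
 proof (rule infsumI)
  have "((%al. (T' al + (- 1) * T al) + (of_real (sqrt (real (ga j))) * A al + (- of_real (sqrt (real (be j) + 1))) * B al)) has_sum
    ((infsum T' UNIV + (- 1) * infsum T UNIV) + (of_real (sqrt (real (ga j))) * infsum A UNIV + (- of_real (sqrt (real (be j) + 1))) * infsum B UNIV))) UNIV"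
   by (intro has_sum_add has_sum_cmult_right has_sum_infsum T T' AB)
  thus "((%al. (T' al - T al) + (of_real (sqrt (real (ga j))) * A al - of_real (sqrt (real (be j) + 1)) * B al)) has_sum
    ((infsum T' UNIV - infsum T UNIV) + (of_real (sqrt (real (ga j))) * infsum A UNIV - of_real (sqrt (real (be j) + 1)) * infsum B UNIV))) UNIV"
   by simp
 qed
 finally show ?thesis unfolding sT A_def B_def shE_def by simp
qed

lemma shE_cnj_z:
 "(cnj (z $ j) - cnj (z' $ j)) * shE be ga z z' = \<i> * of_real (sqrt 2) *
   (of_real (sqrt (real (be j))) * shE (dn be j) ga z z' - of_real (sqrt (real (ga j) + 1)) * shE be (up ga j) z z')"
proof -
 have "(z' $ j - z $ j) * shE ga be z' z = \<i> * of_real (sqrt 2) *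
   (of_real (sqrt (real (be j))) * shE ga (dn be j) z' z - of_real (sqrt (real (ga j) + 1)) * shE (up ga j) be z' z)"
  by (rule shE_z)
 from arg_cong[OF this, of "%x. - cnj x"] show ?thesis
  by (simp add: shE_cnj[symmetric] algebra_simps)
qed

text \<open>The conjugate difference moves one second index and the difference moves the other, so
  the product leads back to diagonal kernels. What appears is a second-order difference in the j-th
  component of \<open>be\<close>.\<close>

lemma shE_norm_sq_component:
 fixes z z' :: "complex ^ 'd::finite"
 shows "of_real ((cmod (z $ j - z' $ j))^2) * shE be be z z' =
  - 2 * (of_nat (be j) * (shE (dn be j) (dn be j) z z' - shE be be z z') + (of_nat (be j) + 1) * (shE (up be j) (up be j) z z' - shE be be z z'))"
proof -
 define s where "s = \<i> * complex_of_real (sqrt 2)"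
 have ss: "s * s = -2" unfolding s_def using sqrt2_sq by (simp add: algebra_simps)
 define p where "p = complex_of_real (sqrt (real (be j)))"
 define q where "q = complex_of_real (sqrt (real (be j) + 1))"
 have pp: "p * p = of_nat (be j)" and qq: "q * q = of_nat (be j) + 1"
  unfolding p_def q_def by (simp_all flip: of_real_mult)
 have x1: "(z $ j - z' $ j) * (p * shE (dn be j) be z z') = s * (of_nat (be j) * (shE (dn be j) (dn be j) z z' - shE be be z z'))"
 proof (cases "be j = 0")
  case True thus ?thesis by (simp add: p_def)
 next
  case False
  hence u: "up (dn be j) j = be" and r: "real ((dn be j) j) + 1 = real (be j)" by auto
  have "(z $ j - z' $ j) * shE (dn be j) be z z' = s * (p * shE (dn be j) (dn be j) z z' - p * shE be be z z')"
   unfolding shE_z[of z j z' "dn be j" be] u r s_def p_def ..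
  hence "p * ((z $ j - z' $ j) * shE (dn be j) be z z') = p * (s * (p * shE (dn be j) (dn be j) z z' - p * shE be be z z'))"
   by simp
  also have "... = s * (p * p * (shE (dn be j) (dn be j) z z' - shE be be z z'))" by (simp add: algebra_simps)
  finally show ?thesis unfolding pp by (simp add: algebra_simps)
 qed
 have x2: "(z $ j - z' $ j) * (q * shE be (up be j) z z') = - s * ((of_nat (be j) + 1) * (shE (up be j) (up be j) z z' - shE be be z z'))"
 proof -
  have d: "dn (up be j) j = be" and r: "real ((up be j) j) = real (be j) + 1" by auto
  have "(z $ j - z' $ j) * shE be (up be j) z z' = s * (q * shE be be z z' - q * shE (up be j) (up be j) z z')"
   unfolding shE_z[of z j z' be "up be j"] d r s_def q_def ..
  hence "q * ((z $ j - z' $ j) * shE be (up be j) z z') = q * (s * (q * shE be be z z' - q * shE (up be j) (up be j) z z'))"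
   by simp
  also have "... = - s * (q * q * (shE (up be j) (up be j) z z' - shE be be z z'))" by (simp add: algebra_simps)
  finally show ?thesis unfolding qq by (simp add: algebra_simps)
 qed
 have "of_real ((cmod (z $ j - z' $ j))^2) * shE be be z z' = (z $ j - z' $ j) * ((cnj (z $ j) - cnj (z' $ j)) * shE be be z z')"
  unfolding complex_norm_square by (simp add: algebra_simps)
 also have "... = (z $ j - z' $ j) * (s * (p * shE (dn be j) be z z' - q * shE be (up be j) z z'))"
  unfolding shE_cnj_z s_def p_def q_def ..
 also have "... = s * ((z $ j - z' $ j) * (p * shE (dn be j) be z z') - (z $ j - z' $ j) * (q * shE be (up be j) z z'))"
  by (simp add: algebra_simps)
 also have "... = (s * s) * (of_nat (be j) * (shE (dn be j) (dn be j) z z' - shE be be z z') + (of_nat (be j) + 1) * (shE (up be j) (up be j) z z' - shE be be z z'))"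
  unfolding x1 x2 by (simp add: algebra_simps)
 finally show ?thesis unfolding ss .
qed

section \<open>Multiplier kernels and multiplication by the squared distance\<close>

definition lvl :: "nat => ('d::finite => nat) set" where "lvl K = {be. (\<Sum>j\<in>UNIV. be j) <= K}"

lemma lvl_subset: "lvl K \<subseteq> {be :: 'd::finite => nat. ALL j. be j <= K}"
proof
 fix be :: "'d => nat" assume "be \<in> lvl K"
 moreover have "be j <= (\<Sum>j\<in>UNIV. be j)" for j by (rule member_le_sum) auto
 ultimately show "be \<in> {be. ALL j. be j <= K}" by (auto simp: lvl_def intro: order_trans)
qed

definition box_nat :: "nat => ('d::finite => nat) set" where "box_nat K = {be. ALL j. be j <= K}"

lemma box_nat_eq: "box_nat K = PiE (UNIV :: 'd::finite set) (%_. {..K})"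
 by (auto simp: box_nat_def PiE_def extensional_def)

lemma finite_box_nat: "finite (box_nat K)" and card_box_nat: "card (box_nat K :: ('d::finite => nat) set) = (K + 1) ^ CARD('d)"
 unfolding box_nat_eq by (auto intro: finite_PiE simp: card_PiE)

lemma finite_lvl: "finite (lvl K)" and card_lvl: "card (lvl K :: ('d::finite => nat) set) <= (K + 1) ^ CARD('d)"
 using lvl_subset[of K, where 'd = 'd] card_mono[OF finite_box_nat lvl_subset[folded box_nat_def]] finite_subset[OF lvl_subset[folded box_nat_def] finite_box_nat]
 by (auto simp: card_box_nat)

definition mlen :: "('d::finite => nat) => nat" where "mlen be = (\<Sum>j\<in>UNIV. be j)"

lemma mlen_up: "mlen (up be j) = Suc (mlen be)"
 unfolding mlen_def by (subst (1 2) sum.remove[of UNIV j]) auto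

lemma mlen_dn: "be j > 0 ==> Suc (mlen (dn be j)) = mlen be"
 unfolding mlen_def by (subst (1 2) sum.remove[of UNIV j]) auto

lemma lvl_mlen: "lvl K = {be. mlen be <= K}" by (simp add: lvl_def mlen_def)

definition kerA :: "nat => (nat => real) => complex ^ 'd::finite => 'd fld" where
 "kerA K a z z' = (\<Sum>be\<in>lvl K. of_real (a (mlen be)) * shE be be z z')"

text \<open>A difference operator of Laguerre type: the component identities are summed over j,
  where the be_j add up to k and the be_j + 1 to k + d. At k = 0 the truncated predecessor is
  multiplied by 0.\<close>

definition dlap :: "nat => (nat => real) => nat => real" where
 "dlap d a k = - 2 * ((real k + real d) * (a (Suc k) - a k) + real k * (a (k - 1) - a k))"

text \<open>Summation by parts: the shifted kernels are reindexed so that the differences fall on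
  the coefficients instead. The support of the coefficients grows by one level in the
  process.\<close>

lemma kerA_norm_sq:
 fixes z z' :: "complex ^ 'd::finite"
 assumes a: "!!k. k > K ==> a k = 0"
 shows "of_real ((norm (z - z'))^2) * kerA K a z z' = kerA (Suc K) (dlap CARD('d) a) z z'"
proof -
 define e where "e be = shE be be z z'" for be
 define w where "w be = complex_of_real (a (mlen be))" for be :: "'d => nat"
 have up: "(\<Sum>be\<in>lvl K. w be * (of_nat (be j) + 1) * e (up be j)) = (\<Sum>be\<in>lvl (Suc K). of_real (a (mlen be - 1)) * of_nat (be j) * e be)" for j
 proof -
  have "(\<Sum>be\<in>lvl (Suc K). of_real (a (mlen be - 1)) * of_nat (be j) * e be) = (\<Sum>be\<in>(%be. up be j) ` lvl K. of_real (a (mlen be - 1)) * of_nat (be j) * e be)"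
  proof (rule sum.mono_neutral_right[OF finite_lvl])
   show "(%be. up be j) ` lvl K \<subseteq> lvl (Suc K)" by (auto simp: lvl_mlen mlen_up)
   show "\<forall>be\<in>lvl (Suc K) - (%be. up be j) ` lvl K. of_real (a (mlen be - 1)) * of_nat (be j) * e be = 0"
   proof
    fix be assume b: "be \<in> lvl (Suc K) - (%be. up be j) ` lvl K"
    have "be j = 0"
    proof (rule ccontr)
     assume n: "be j ~= 0"
     hence "be = up (dn be j) j" by (auto simp: fun_eq_iff)
     moreover have "dn be j \<in> lvl K" using b mlen_dn[of be j] n by (auto simp: lvl_mlen)
     ultimately show False using b by blast
    qed
    thus "of_real (a (mlen be - 1)) * of_nat (be j) * e be = 0" by simp
   qed
  qed
  also have "... = (\<Sum>be\<in>lvl K. w be * (of_nat (be j) + 1) * e (up be j))"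
   by (subst sum.reindex) (auto simp: mlen_up w_def add.commute intro: inj_on_subset[OF inj_up])
  finally show ?thesis by simp
 qed
 have dn: "(\<Sum>be\<in>lvl K. w be * of_nat (be j) * e (dn be j)) = (\<Sum>be\<in>lvl (Suc K). of_real (a (Suc (mlen be))) * (of_nat (be j) + 1) * e be)" for j
 proof -
  have "(\<Sum>be\<in>lvl (Suc K). of_real (a (Suc (mlen be))) * (of_nat (be j) + 1) * e be) = (\<Sum>be\<in>lvl K \<inter> {be. Suc (mlen be) <= K}. of_real (a (Suc (mlen be))) * (of_nat (be j) + 1) * e be)"
  proof (rule sum.mono_neutral_right[OF finite_lvl])
   have "a (Suc (mlen be)) = 0" if "\<not> (mlen be <= K & Suc (mlen be) <= K)" for be :: "'d => nat"
    using that by (intro a) linarith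
   thus "\<forall>be\<in>lvl (Suc K) - lvl K \<inter> {be. Suc (mlen be) <= K}. of_real (a (Suc (mlen be))) * (of_nat (be j) + 1) * e be = 0"
    by (auto simp: lvl_mlen)
  qed (auto simp: lvl_mlen)
  also have "... = (\<Sum>be\<in>(%be. up be j) ` (lvl K \<inter> {be. Suc (mlen be) <= K}). w be * of_nat (be j) * e (dn be j))"
   by (subst sum.reindex) (auto simp: mlen_up w_def add.commute intro: inj_on_subset[OF inj_up])
  also have "... = (\<Sum>be\<in>lvl K. w be * of_nat (be j) * e (dn be j))"
  proof (rule sum.mono_neutral_left[OF finite_lvl])
   show "(%be. up be j) ` (lvl K \<inter> {be. Suc (mlen be) <= K}) \<subseteq> lvl K" by (auto simp: lvl_mlen mlen_up)
   show "\<forall>be\<in>lvl K - (%be. up be j) ` (lvl K \<inter> {be. Suc (mlen be) <= K}). w be * of_nat (be j) * e (dn be j) = 0"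
   proof
    fix be assume b: "be \<in> lvl K - (%be. up be j) ` (lvl K \<inter> {be. Suc (mlen be) <= K})"
    have "be j = 0"
    proof (rule ccontr)
     assume n: "be j ~= 0"
     hence "be = up (dn be j) j" by (auto simp: fun_eq_iff)
     moreover have "dn be j \<in> lvl K \<inter> {be. Suc (mlen be) <= K}" using b mlen_dn[of be j] n by (auto simp: lvl_mlen)
     ultimately show False using b by blast
    qed
    thus "w be * of_nat (be j) * e (dn be j) = 0" by simp
   qed
  qed
  finally show ?thesis by simp
 qed
 have mid: "(\<Sum>be\<in>lvl K. w be * (2 * of_nat (be j) + 1) * e be) = (\<Sum>be\<in>lvl (Suc K). w be * (2 * of_nat (be j) + 1) * e be)" for j
  by (rule sum.mono_neutral_left[OF finite_lvl]) (auto simp: lvl_mlen w_def a)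
 have comp: "of_real ((cmod (z $ j - z' $ j))^2) * kerA K a z z' = (\<Sum>be\<in>lvl (Suc K).
   (- 2 * (of_real (a (Suc (mlen be))) * (of_nat (be j) + 1) + of_real (a (mlen be - 1)) * of_nat (be j) - w be * (2 * of_nat (be j) + 1))) * e be)" for j
 proof -
  have "of_real ((cmod (z $ j - z' $ j))^2) * kerA K a z z' = (\<Sum>be\<in>lvl K. w be * (of_real ((cmod (z $ j - z' $ j))^2) * e be))"
   unfolding kerA_def w_def e_def sum_distrib_left by (simp add: mult_ac)
  also have "... = (\<Sum>be\<in>lvl K. - 2 * (w be * of_nat (be j) * e (dn be j) + w be * (of_nat (be j) + 1) * e (up be j) - w be * (2 * of_nat (be j) + 1) * e be))"
   unfolding e_def shE_norm_sq_component by (intro sum.cong refl) (simp add: algebra_simps)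
  also have "... = - 2 * ((\<Sum>be\<in>lvl K. w be * of_nat (be j) * e (dn be j)) + (\<Sum>be\<in>lvl K. w be * (of_nat (be j) + 1) * e (up be j)) - (\<Sum>be\<in>lvl K. w be * (2 * of_nat (be j) + 1) * e be))"
   by (simp only: sum_distrib_left[symmetric] sum.distrib[symmetric] sum_subtractf[symmetric])
  also have "... = (\<Sum>be\<in>lvl (Suc K). - 2 * (of_real (a (Suc (mlen be))) * (of_nat (be j) + 1) * e be + of_real (a (mlen be - 1)) * of_nat (be j) * e be - w be * (2 * of_nat (be j) + 1) * e be))"
   unfolding up dn mid by (simp only: sum_distrib_left[symmetric] sum.distrib[symmetric] sum_subtractf[symmetric])
  also have "... = (\<Sum>be\<in>lvl (Suc K).
   (- 2 * (of_real (a (Suc (mlen be))) * (of_nat (be j) + 1) + of_real (a (mlen be - 1)) * of_nat (be j) - w be * (2 * of_nat (be j) + 1))) * e be)"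
   by (intro sum.cong refl) (simp add: algebra_simps)
  finally show ?thesis .
 qed
 have nz: "(norm (z - z'))^2 = (\<Sum>j\<in>UNIV. (cmod (z $ j - z' $ j))^2)"
  unfolding norm_vec_def L2_set_def by (simp add: sum_nonneg)
 have "of_real ((norm (z - z'))^2) * kerA K a z z' = (\<Sum>j\<in>UNIV. of_real ((cmod (z $ j - z' $ j))^2) * kerA K a z z')"
  unfolding nz of_real_sum by (rule sum_distrib_right)
 also have "... = (\<Sum>be\<in>lvl (Suc K). \<Sum>j\<in>UNIV.
   (- 2 * (of_real (a (Suc (mlen be))) * (of_nat (be j) + 1) + of_real (a (mlen be - 1)) * of_nat (be j) - w be * (2 * of_nat (be j) + 1))) * e be)"
  unfolding comp by (rule sum.swap)
 also have "... = (\<Sum>be\<in>lvl (Suc K). of_real (dlap CARD('d) a (mlen be)) * e be)"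
 proof (intro sum.cong refl)
  fix be :: "'d => nat"
  have ml: "(\<Sum>j\<in>UNIV. of_nat (be j)) = (of_nat (mlen be) :: complex)" by (simp add: mlen_def)
  have "(\<Sum>j\<in>UNIV. (- 2 * (of_real (a (Suc (mlen be))) * (of_nat (be j) + 1) + of_real (a (mlen be - 1)) * of_nat (be j) - w be * (2 * of_nat (be j) + 1))) * e be)
   = (- 2 * (of_real (a (Suc (mlen be))) * (of_nat (mlen be) + of_nat CARD('d)) + of_real (a (mlen be - 1)) * of_nat (mlen be) - w be * (2 * of_nat (mlen be) + of_nat CARD('d)))) * e be"
   by (simp only: sum_distrib_right[symmetric] sum_distrib_left[symmetric] sum.distrib sum_subtractf ml sum_constant) simp
  also have "... = of_real (dlap CARD('d) a (mlen be)) * e be"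
   unfolding dlap_def w_def by (simp add: algebra_simps)
  finally show "(\<Sum>j\<in>UNIV. (- 2 * (of_real (a (Suc (mlen be))) * (of_nat (be j) + 1) + of_real (a (mlen be - 1)) * of_nat (be j) - w be * (2 * of_nat (be j) + 1))) * e be)
   = of_real (dlap CARD('d) a (mlen be)) * e be" .
 qed
 finally show ?thesis unfolding kerA_def e_def .
qed

lemma kerA_norm_pow:
 fixes z z' :: "complex ^ 'd::finite"
 assumes a: "!!k. k > K ==> a k = 0"
 shows "of_real ((norm (z - z')) ^ (2 * N)) * kerA K a z z' = kerA (K + N) ((dlap CARD('d) ^^ N) a) z z'"
  and "!!k. k > K + N ==> (dlap CARD('d) ^^ N) a k = 0"
proof (induction N)
 case 0
 { case 1 show ?case by simp }
 { case 2 thus ?case using a by simp }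
next
 case (Suc N)
 { case 1
  have "of_real ((norm (z - z')) ^ (2 * Suc N)) * kerA K a z z' = of_real ((norm (z - z'))^2) * (of_real ((norm (z - z')) ^ (2 * N)) * kerA K a z z')"
   by (simp add: power_add power2_eq_square)
  also have "... = kerA (Suc (K + N)) (dlap CARD('d) ((dlap CARD('d) ^^ N) a)) z z'"
   unfolding Suc(1) by (rule kerA_norm_sq) (rule Suc(2))
  finally show ?case by simp }
 { case 2 thus ?case using Suc(2) by (auto simp: dlap_def) }
qed

section \<open>Spectral projections\<close>

text \<open>Squares of partial sums of complex series are not monotone, so Fatou carries the bounds
  from finite sums over the first index to the full series. Finiteness of \<open>w\<close> makes
  multiplication by it continuous.\<close>

lemma fatou_bound:
 fixes u :: "nat => 'a => real" and B :: ennreal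
 assumes m: "!!n. u n \<in> borel_measurable M" and lim: "!!x. (%n. u n x) \<longlonglongrightarrow> v x"
  and b: "!!n. n >= N ==> (\<integral>\<^sup>+x. en (u n x) * w x \<partial>M) <= B" and w: "w \<in> borel_measurable M" "!!x. w x < \<infinity>"
 shows "(\<integral>\<^sup>+x. en (v x) * w x \<partial>M) <= B"
proof -
 have "(\<integral>\<^sup>+x. en (v x) * w x \<partial>M) = (\<integral>\<^sup>+x. liminf (%n. en (u n x) * w x) \<partial>M)"
 proof (intro nn_integral_cong)
  fix x
  have "(%n. en (u n x) * w x) \<longlonglongrightarrow> en (v x) * w x"
   using w(2)[of x] by (intro ennreal_tendsto_cmult[THEN tendsto_cong_limit] tendsto_mult_ennreal tendsto_ennrealI lim tendsto_const) auto
  thus "en (v x) * w x = liminf (%n. en (u n x) * w x)"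
   by (intro lim_imp_Liminf[symmetric]) auto
 qed
 also have "... <= liminf (%n. \<integral>\<^sup>+x. en (u n x) * w x \<partial>M)"
  using m w by (intro nn_integral_liminf) auto
 also have "... <= B"
 proof -
  have "liminf (%n. \<integral>\<^sup>+x. en (u n x) * w x \<partial>M) <= limsup (%n. \<integral>\<^sup>+x. en (u n x) * w x \<partial>M)"
   by (rule Liminf_le_Limsup) simp
  also have "... <= B" by (rule Limsup_bounded) (use b in \<open>auto simp: eventually_sequentially\<close>)
  finally show ?thesis .
 qed
 finally show ?thesis .
qed

text \<open>The boxes are a sequence cofinal among the finite sets of multi-indices. They turn
  unordered sums into limits of sequences, the form in which Fatou and measurability of limits
  apply.\<close>

lemma filterlim_box_nat: "filterlim (box_nat :: nat => ('d::finite => nat) set) (finite_subsets_at_top UNIV) sequentially"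
 unfolding filterlim_finite_subsets_at_top
proof (intro allI impI)
 fix X :: "('d => nat) set" assume X: "finite X & X \<subseteq> UNIV"
 have "X \<subseteq> box_nat n" if "n >= (\<Sum>x\<in>X. mlen x)" for n
 proof
  fix x assume x: "x \<in> X"
  have "x j <= n" for j
  proof -
   have "x j <= mlen x" unfolding mlen_def by (rule member_le_sum) auto
   also have "mlen x <= (\<Sum>x\<in>X. mlen x)" by (rule member_le_sum) (use X x in auto)
   finally show ?thesis using that by simp
  qed
  thus "x \<in> box_nat n" by (simp add: box_nat_def)
 qed
 thus "\<forall>\<^sub>F y in sequentially. finite (box_nat y) & X \<subseteq> box_nat y & box_nat y \<subseteq> (UNIV :: ('d => nat) set)"
  by (auto simp: eventually_sequentially finite_box_nat)
qed

lemma box_nat_sum_tendsto: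
 fixes g :: "('d::finite => nat) => 'b::{real_normed_vector}"
 assumes "g summable_on UNIV"
 shows "(%n. \<Sum>al\<in>box_nat n. g al) \<longlonglongrightarrow> (\<Sum>\<^sub>\<infinity>al. g al)"
proof -
 have "(g has_sum (\<Sum>\<^sub>\<infinity>al. g al)) UNIV" using assms by (rule has_sum_infsum)
 hence "(sum g \<longlongrightarrow> (\<Sum>\<^sub>\<infinity>al. g al)) (finite_subsets_at_top UNIV)" by (simp add: has_sum_def)
 from filterlim_compose[OF this filterlim_box_nat] show ?thesis by simp
qed

lemma cauchy_schwarz_square_integrable:
 assumes f: "square_integrable M f" and h: "square_integrable M h"
 shows "(cmod (\<integral>x. f x * cnj (h x) \<partial>M))^2 <= (\<integral>x. (cmod (h x))^2 \<partial>M) * (\<integral>x. (cmod (f x))^2 \<partial>M)"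
proof -
 have "(\<integral>x. h x * cnj (h x) \<partial>M) = of_real (\<integral>x. (cmod (h x))^2 \<partial>M)"
  unfolding complex_norm_square[symmetric] by (rule integral_complex_of_real)
 thus ?thesis using bessel_inequality[of "{()}" M "%_. h" "\<integral>x. (cmod (h x))^2 \<partial>M" f] f h by auto
qed

lemma square_integrable_iff:
 "square_integrable M f \<longleftrightarrow> f \<in> borel_measurable M & (\<integral>\<^sup>+x. nq (f x) \<partial>M) < \<infinity>"
 unfolding square_integrable_def by (auto simp: integrable_iff_bounded)

lemma square_integrable_nn: "square_integrable M f ==> (\<integral>\<^sup>+x. nq (f x) \<partial>M) = en (\<integral>x. (cmod (f x))^2 \<partial>M)"
 by (rule nn_integral_eq_integral) (auto simp: square_integrable_def)

lemma square_integrable_sh: "square_integrable lborel (Sh al be)"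
 by (rule rapid_square_integrable[OF rapid_special_hermite])

lemma sh_pair_orthogonal:
 "(LI z. Sh (fst i) (snd i) z * cnj (Sh (fst j) (snd j) z)) = (if i = (j :: ('d::finite => nat) \<times> ('d => nat)) then of_real (sh_norm TYPE('d)) else 0)"
 by (simp add: sh_orthogonal prod_eq_iff)

lemma sh_sum_norm:
 fixes c :: "('d::finite => nat) \<times> ('d => nat) => complex"
 assumes "finite G"
 shows "(NN z. nq (\<Sum>i\<in>G. c i * Sh (fst i) (snd i) z)) = en (sh_norm TYPE('d) * (\<Sum>i\<in>G. (cmod (c i))^2))"
proof -
 have "square_integrable lborel (%z. \<Sum>i\<in>G. c i * Sh (fst i) (snd i) z)"
  by (intro square_integrable_sum square_integrable_cmult square_integrable_sh)
 from square_integrable_nn[OF this] show ?thesis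
  using integral_orthogonal_sum[OF assms square_integrable_sh sh_pair_orthogonal, of c] by simp
qed

lemma sh_sum_norm_cnj:
 fixes c :: "('d::finite => nat) \<times> ('d => nat) => complex"
 assumes "finite G"
 shows "(NN z. nq (\<Sum>i\<in>G. c i * cnj (Sh (fst i) (snd i) z))) = en (sh_norm TYPE('d) * (\<Sum>i\<in>G. (cmod (c i))^2))"
proof -
 have "cmod (\<Sum>i\<in>G. c i * cnj (Sh (fst i) (snd i) z)) = cmod (\<Sum>i\<in>G. cnj (c i) * Sh (fst i) (snd i) z)" for z
  by (subst complex_mod_cnj[symmetric]) (simp only: cnj_sum complex_cnj_mult complex_cnj_cnj)
 thus ?thesis using sh_sum_norm[OF assms, of "%i. cnj (c i)"] by simp
qed

lemma shE_tendsto: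
 "(%n. \<Sum>al\<in>box_nat n. Sh al be z * cnj (Sh al ga z')) \<longlonglongrightarrow> shE be ga z z'"
 unfolding shE_def by (rule box_nat_sum_tendsto[OF shE_summable])

lemma borel_measurable_cnj_sh[measurable]: "(%z. cnj (Sh al be z)) \<in> bm"
 by (rule borel_measurable_cnj) measurable

lemma borel_measurable_shE[measurable]: "(%z'. shE be ga z z') \<in> bm"
 by (rule borel_measurable_LIMSEQ_metric[OF _ shE_tendsto]) measurable

lemma sum_snd_const: "(\<Sum>i\<in>A \<times> {be}. f i) = (\<Sum>al\<in>A. f (al, be))"
 using sum.cartesian_product[of "%a b. f (a, b)" "{be}" A] by simp

text \<open>By orthogonality in z' a finite block of the tail has squared norm equal to
  \<open>sh_norm\<close> times the same block of the convergent sum of squares at z; Fatou passes to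
  the whole tail.\<close>

lemma shE_tail:
 fixes be :: "'d::finite => nat"
 defines "S \<equiv> %z. \<Sum>\<^sub>\<infinity>al. (cmod (Sh al be z))^2"
 shows "(NN z'. nq (shE be be z z' - (\<Sum>al\<in>box_nat n. Sh al be z * cnj (Sh al be z'))))
   <= en (sh_norm TYPE('d) * (S z - (\<Sum>al\<in>box_nat n. (cmod (Sh al be z))^2)))"
proof -
 let ?K = "%m z'. \<Sum>al\<in>box_nat m. Sh al be z * cnj (Sh al be z')"
 have "(NN z'. nq (shE be be z z' - ?K n z') * 1)
   <= en (sh_norm TYPE('d) * (S z - (\<Sum>al\<in>box_nat n. (cmod (Sh al be z))^2)))"
 proof (rule fatou_bound[where u = "%m z'. (cmod (?K m z' - ?K n z'))^2" and N = n])
  show "(%z'. (cmod (?K m z' - ?K n z'))^2) \<in> borel_measurable lborel" for m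
   by measurable
  show "(%m. (cmod (?K m z' - ?K n z'))^2) \<longlonglongrightarrow> (cmod (shE be be z z' - ?K n z'))\<^sup>2" for z'
   by (intro tendsto_intros shE_tendsto)
  fix m assume m: "m >= n"
  have sub: "box_nat n \<subseteq> (box_nat m :: ('d => nat) set)" using m by (auto simp: box_nat_def intro: order_trans)
  let ?D = "box_nat m - box_nat n :: ('d => nat) set"
  have "?K m z' - ?K n z' = (\<Sum>i\<in>?D \<times> {be}. Sh (fst i) be z * cnj (Sh (fst i) (snd i) z'))" for z'
   unfolding sum_snd_const using sum_diff[OF finite_box_nat sub, of "%al. Sh al be z * cnj (Sh al be z')"] by simp
  hence "(NN z'. nq (?K m z' - ?K n z') * 1) = en (sh_norm TYPE('d) * (\<Sum>al\<in>?D. (cmod (Sh al be z))^2))"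
   using sh_sum_norm_cnj[of "?D \<times> {be}" "%i. Sh (fst i) be z"]
   by (simp add: sum_snd_const finite_box_nat)
  also have "... <= en (sh_norm TYPE('d) * (S z - (\<Sum>al\<in>box_nat n. (cmod (Sh al be z))^2)))"
  proof (intro ennreal_leI mult_left_mono sh_norm_nonneg)
   have "(\<Sum>al\<in>box_nat m. (cmod (Sh al be z))^2) <= S z"
    unfolding S_def by (rule finite_sum_le_infsum[OF sh_sq_summable finite_box_nat]) auto
   thus "(\<Sum>al\<in>?D. (cmod (Sh al be z))^2) <= S z - (\<Sum>al\<in>box_nat n. (cmod (Sh al be z))^2)"
    unfolding sum_diff[OF finite_box_nat sub] by simp
  qed
  finally show "(NN z'. nq (?K m z' - ?K n z') * 1) <= ..." .
 qed auto
 thus ?thesis by simp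
qed

lemma borel_shE_partial: "(%z'. \<Sum>al\<in>A. Sh al be z * cnj (Sh al be z')) \<in> bm"
 by measurable

lemma square_integrable_shE_diff:
 "square_integrable lborel (%z'. shE be be z z' - (\<Sum>al\<in>box_nat n. Sh al be z * cnj (Sh al be z')))"
 unfolding square_integrable_iff
proof
 show "(%z'. shE be be z z' - (\<Sum>al\<in>box_nat n. Sh al be z * cnj (Sh al be z'))) \<in> borel_measurable lborel"
  using borel_shE_partial[of be z "box_nat n"] by (intro borel_measurable_diff) auto
qed (rule le_less_trans[OF shE_tail], simp)

lemma square_integrable_shE: "square_integrable lborel (%z'. shE be be z z')"
proof -
 have "square_integrable lborel (%z'. \<Sum>al\<in>box_nat 0. Sh al be z * cnj (Sh al be z'))"
  by (intro square_integrable_sum square_integrable_cmult square_integrable_cnj square_integrable_sh)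
 from square_integrable_add[OF square_integrable_shE_diff[of be z 0] this] show ?thesis by simp
qed

section \<open>Coefficients, projections and spectral energy\<close>

definition coef :: "('d::finite fld) => ('d => nat) => ('d => nat) => complex" where
 "coef f al be = (LI z. f z * cnj (Sh al be z))"

lemma coef_bessel:
 fixes f :: "'d::finite fld"
 assumes "finite G" "square_integrable lborel f"
 shows "(\<Sum>i\<in>G. (cmod (coef f (fst i) (snd i)))^2) <= sh_norm TYPE('d) * (LI z. (cmod (f z))^2)"
 unfolding coef_def
 by (rule bessel_inequality[OF assms(1) square_integrable_sh sh_pair_orthogonal sh_norm_nonneg assms(2)])

lemma coef_summable:
 assumes "square_integrable lborel f"
 shows "(%al. (cmod (coef f al be))^2) summable_on UNIV"
proof (rule nonneg_bdd_above_summable_on)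
 show "bdd_above (sum (%al. (cmod (coef f al be))^2) ` {F. F \<subseteq> UNIV & finite F})"
  unfolding bdd_above_def
 proof (intro exI ballI, elim imageE CollectE conjE)
  fix x F assume F: "x = (\<Sum>al\<in>F. (cmod (coef f al be))^2)" "finite F"
  show "x <= sh_norm TYPE('a) * (LI z. (cmod (f z))^2)"
   using coef_bessel[of "F \<times> {be}" f] F assms by (simp add: sum_snd_const)
 qed
qed auto

definition projb :: "('d::finite => nat) => ('d fld) => 'd fld" where
 "projb be f z = (LI z'. shE be be z z' * f z')"

text \<open>The convergence is at every point: the error is f integrated against the tail of the
  kernel at z, and by Cauchy-Schwarz and \<open>shE_tail\<close> it tends to 0.\<close>

lemma projb_tendsto:
 fixes f :: "'d::finite fld"
 assumes f: "square_integrable lborel f"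
 shows "(%n. \<Sum>al\<in>box_nat n. coef f al be * Sh al be z) \<longlonglongrightarrow> projb be f z"
proof -
 let ?K = "%n z'. \<Sum>al\<in>box_nat n. Sh al be z * cnj (Sh al be z')"
 define S where "S = (\<Sum>\<^sub>\<infinity>al. (cmod (Sh al be z))^2)"
 define F where "F = (LI z. (cmod (f z))^2)"
 have sK: "square_integrable lborel (?K n)" for n
  by (intro square_integrable_sum square_integrable_cmult square_integrable_cnj square_integrable_sh)
 have eq: "projb be f z - (\<Sum>al\<in>box_nat n. coef f al be * Sh al be z) = (LI z'. f z' * cnj (cnj (shE be be z z' - ?K n z')))" for n
 proof -
  have i1: "integrable lborel (%z'. shE be be z z' * f z')" by (rule square_integrable_mult[OF square_integrable_shE f])
  have i2: "integrable lborel (%z'. ?K n z' * f z')" by (rule square_integrable_mult[OF sK f])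
  have "(LI z'. ?K n z' * f z') = (LI z'. (\<Sum>al\<in>box_nat n. Sh al be z * (f z' * cnj (Sh al be z'))))"
   by (simp add: sum_distrib_left sum_distrib_right mult_ac)
  also have "... = (\<Sum>al\<in>box_nat n. coef f al be * Sh al be z)"
   unfolding coef_def
   by (subst Bochner_Integration.integral_sum)
     (auto intro!: integrable_mult_right square_integrable_mult f square_integrable_cnj square_integrable_sh simp: mult.commute)
  finally have k: "(\<Sum>al\<in>box_nat n. coef f al be * Sh al be z) = (LI z'. ?K n z' * f z')" by simp
  show ?thesis unfolding k projb_def complex_cnj_cnj
   by (subst Bochner_Integration.integral_diff[OF i1 i2, symmetric]) (simp add: algebra_simps)
 qed
 have b: "(cmod (projb be f z - (\<Sum>al\<in>box_nat n. coef f al be * Sh al be z)))^2 <= sh_norm TYPE('d) * (S - (\<Sum>al\<in>box_nat n. (cmod (Sh al be z))^2)) * F" for n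
 proof -
  have nn: "0 <= S - (\<Sum>al\<in>box_nat n. (cmod (Sh al be z))^2)"
   unfolding S_def using finite_sum_le_infsum[OF sh_sq_summable[of be z] finite_box_nat[of n]] by simp
  have "(cmod (projb be f z - (\<Sum>al\<in>box_nat n. coef f al be * Sh al be z)))^2 <= (LI z'. (cmod (cnj (shE be be z z' - ?K n z')))^2) * F"
   unfolding eq F_def by (rule cauchy_schwarz_square_integrable[OF f square_integrable_cnj[OF square_integrable_shE_diff]])
  also have "(LI z'. (cmod (cnj (shE be be z z' - ?K n z')))^2) <= sh_norm TYPE('d) * (S - (\<Sum>al\<in>box_nat n. (cmod (Sh al be z))^2))"
   using shE_tail[of be z n] nn sh_norm_nonneg[of "TYPE('d)"] unfolding complex_mod_cnj square_integrable_nn[OF square_integrable_shE_diff] S_def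
   by (subst (asm) ennreal_le_iff) auto
  finally show ?thesis by (simp add: F_def mult_right_mono)
 qed
 have "(%n. sh_norm TYPE('d) * (S - (\<Sum>al\<in>box_nat n. (cmod (Sh al be z))^2)) * F) \<longlonglongrightarrow> sh_norm TYPE('d) * (S - S) * F"
  unfolding S_def by (intro tendsto_intros box_nat_sum_tendsto sh_sq_summable)
 hence t: "(%n. sh_norm TYPE('d) * (S - (\<Sum>al\<in>box_nat n. (cmod (Sh al be z))^2)) * F) \<longlonglongrightarrow> 0" by simp
 have "(%n. (cmod (projb be f z - (\<Sum>al\<in>box_nat n. coef f al be * Sh al be z)))^2) \<longlonglongrightarrow> 0"
  by (rule tendsto_sandwich[OF _ _ tendsto_const t]) (use b in auto)
 from tendsto_real_sqrt[OF this]
 have "(%n. projb be f z - (\<Sum>al\<in>box_nat n. coef f al be * Sh al be z)) \<longlonglongrightarrow> 0"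
  by (simp add: tendsto_norm_zero_iff)
 from tendsto_diff[OF tendsto_const[of "projb be f z"] this] show ?thesis by simp
qed

definition levk :: "nat => ('d::finite => nat) set" where "levk k = {be. mlen be = k}"

lemma finite_levk: "finite (levk k)"
 by (rule finite_subset[OF _ finite_lvl[of k]]) (auto simp: levk_def lvl_mlen)

definition kk :: "nat => complex ^ 'd::finite => 'd fld" where
 "kk k z z' = (\<Sum>be\<in>levk k. shE be be z z')"

lemma spectral_kernel_kk: "spectral_kernel (2 * k + CARD('d)) z z' = kk k z (z' :: complex ^ 'd::finite)"
 unfolding spectral_kernel_def kk_def shE_def levk_def mlen_def by (intro sum.cong) auto

lemma lvl_decomp: "(\<Sum>be\<in>lvl K. g be) = (\<Sum>k\<le>K. \<Sum>be\<in>levk k. g be)"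
proof -
 have e: "lvl K = (\<Union>k\<in>{..K}. levk k)" by (auto simp: lvl_mlen levk_def)
 show ?thesis unfolding e by (rule sum.UNION_disjoint) (auto simp: finite_levk, auto simp: levk_def)
qed

lemma kerA_kk: "kerA K a z z' = (\<Sum>k\<le>K. of_real (a k) * kk k z z')"
 unfolding kerA_def lvl_decomp kk_def sum_distrib_left by (intro sum.cong refl) (auto simp: levk_def)

lemma kk_kerA: "kk k z z' = kerA k (%i. if i = k then 1 else 0) z z'"
proof -
 have "kerA k (%i. if i = k then 1 else 0) z z' = (\<Sum>i\<le>k. if i = k then kk k z z' else 0)"
  unfolding kerA_kk by (intro sum.cong) auto
 thus ?thesis by simp
qed

definition spj :: "nat => ('d::finite fld) => 'd fld" where
 "spj k f z = (LI z'. kk k z z' * f z')"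

lemma borel_measurable_kk[measurable]: "(%z'. kk k z z') \<in> bm"
 unfolding kk_def by measurable

lemma spectral_proj_spj:
 fixes f :: "'d::finite fld"
 assumes "f \<in> bm"
 shows "spectral_proj (2 * k + CARD('d)) f z = spj k f z"
 unfolding spectral_proj_def spj_def spectral_kernel_kk
 by (rule integral_completion) (use assms in measurable)

lemma square_integrable_kk: "square_integrable lborel (%z'. kk k z z')"
 unfolding kk_def by (intro square_integrable_sum square_integrable_shE)

lemma spj_projb: "square_integrable lborel f ==> spj k f z = (\<Sum>be\<in>levk k. projb be f z)"
 unfolding spj_def projb_def kk_def sum_distrib_right
 by (rule Bochner_Integration.integral_sum) (rule square_integrable_mult[OF square_integrable_shE])

text \<open>Energy of the coefficients at level k. Norms of projections are compared with it from
  above, and its sum with the norm of f from above, so Bessel's inequality is all that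
  enters.\<close>

definition pen :: "nat => ('d::finite fld) => real" where
 "pen k f = (\<Sum>be\<in>levk k. \<Sum>\<^sub>\<infinity>al. (cmod (coef f al be))^2)"

lemma pen_nonneg: "pen k f >= 0"
 unfolding pen_def by (intro sum_nonneg infsum_nonneg) auto

lemma pen_sum_le:
 fixes f :: "'d::finite fld"
 assumes f: "square_integrable lborel f" and A: "finite A"
 shows "(\<Sum>k\<in>A. pen k f) <= sh_norm TYPE('d) * (LI z. (cmod (f z))^2)"
proof -
 have "(%n. \<Sum>k\<in>A. \<Sum>be\<in>levk k. \<Sum>al\<in>box_nat n. (cmod (coef f al be))^2) \<longlonglongrightarrow> (\<Sum>k\<in>A. pen k f)"
  unfolding pen_def by (intro tendsto_sum box_nat_sum_tendsto coef_summable f)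
 thus ?thesis
 proof (rule LIMSEQ_le_const2, intro exI allI impI)
  fix n
  let ?B = "\<Union>k\<in>A. levk k :: ('d => nat) set"
  have fB: "finite ?B" using A finite_levk by auto
  have "(\<Sum>k\<in>A. \<Sum>be\<in>levk k. \<Sum>al\<in>box_nat n. (cmod (coef f al be))^2) = (\<Sum>be\<in>?B. \<Sum>al\<in>box_nat n. (cmod (coef f al be))^2)"
   by (rule sum.UNION_disjoint[symmetric]) (use A finite_levk in \<open>auto simp: levk_def\<close>)
  also have "... = (\<Sum>i\<in>box_nat n \<times> ?B. (cmod (coef f (fst i) (snd i)))^2)"
   by (subst sum.swap) (simp add: sum.cartesian_product split_beta)
  also have "... <= sh_norm TYPE('d) * (LI z. (cmod (f z))^2)"
   by (rule coef_bessel) (use fB finite_box_nat f in auto)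
  finally show "(\<Sum>k\<in>A. \<Sum>be\<in>levk k. \<Sum>al\<in>box_nat n. (cmod (coef f al be))^2) <= sh_norm TYPE('d) * (LI z. (cmod (f z))^2)" .
 qed
qed

definition spart :: "(nat => real) => nat => nat => ('d::finite fld) => 'd fld" where
 "spart a K n f z = (\<Sum>k\<le>K. \<Sum>be\<in>levk k. \<Sum>al\<in>box_nat n. of_real (a k) * coef f al be * Sh al be z)"

lemma spart_tendsto:
 assumes f: "square_integrable lborel f"
 shows "(%n. spart a K n f z) \<longlonglongrightarrow> (\<Sum>k\<le>K. of_real (a k) * spj k f z)"
proof -
 have "(%n. \<Sum>k\<le>K. of_real (a k) * (\<Sum>be\<in>levk k. \<Sum>al\<in>box_nat n. coef f al be * Sh al be z)) \<longlonglongrightarrow> (\<Sum>k\<le>K. of_real (a k) * spj k f z)"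
  unfolding spj_projb[OF f] by (intro tendsto_sum tendsto_mult_left projb_tendsto f)
 thus ?thesis unfolding spart_def sum_distrib_left by (simp add: mult.assoc)
qed

lemma spart_alt:
 "spart a K n f z = (\<Sum>i\<in>box_nat n \<times> lvl K. (of_real (a (mlen (snd i))) * coef f (fst i) (snd i)) * Sh (fst i) (snd i) z)"
proof -
 have "(\<Sum>i\<in>box_nat n \<times> lvl K. (of_real (a (mlen (snd i))) * coef f (fst i) (snd i)) * Sh (fst i) (snd i) z)
  = (\<Sum>be\<in>lvl K. \<Sum>al\<in>box_nat n. of_real (a (mlen be)) * coef f al be * Sh al be z)"
  by (subst sum.swap) (simp add: sum.cartesian_product split_beta)
 moreover have "spart a K n f z = (\<Sum>k\<le>K. \<Sum>be\<in>levk k. \<Sum>al\<in>box_nat n. of_real (a (mlen be)) * coef f al be * Sh al be z)"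
  unfolding spart_def by (intro sum.cong refl) (simp add: levk_def)
 ultimately show ?thesis unfolding lvl_decomp by simp
qed

lemma borel_measurable_spart[measurable]: "spart a K n f \<in> bm"
 unfolding spart_def[abs_def] by measurable

lemma borel_measurable_spj[measurable (raw)]:
 assumes "square_integrable lborel f"
 shows "(%z. spj k f z) \<in> bm"
proof -
 have "(%n. spart (%i. if i = k then 1 else 0) k n f z) \<longlonglongrightarrow> spj k f z" for z
 proof -
  have "(\<Sum>i\<le>k. of_real (if i = k then 1 else 0) * spj i f z) = (\<Sum>i\<le>k. if i = k then spj k f z else 0)"
   by (intro sum.cong) auto
  thus ?thesis using spart_tendsto[OF assms, of "%i. if i = k then 1 else 0" k z] by simp
 qed
 thus ?thesis by (rule borel_measurable_LIMSEQ_metric[OF borel_measurable_spart])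
qed

lemma pen_partial_le:
 assumes "square_integrable lborel f"
 shows "(\<Sum>be\<in>levk k. \<Sum>al\<in>box_nat n. (cmod (coef f al be))^2) <= pen k f"
 unfolding pen_def by (intro sum_mono finite_sum_le_infsum[OF coef_summable[OF assms] finite_box_nat]) auto

lemma spectral_L2:
 fixes f :: "'d::finite fld"
 assumes f: "square_integrable lborel f"
 shows "(NN z. nq (\<Sum>k\<le>K. of_real (a k) * spj k f z)) <= en (sh_norm TYPE('d) * (\<Sum>k\<le>K. (a k)^2 * pen k f))"
proof -
 have "(NN z. nq (\<Sum>k\<le>K. of_real (a k) * spj k f z) * 1) <= en (sh_norm TYPE('d) * (\<Sum>k\<le>K. (a k)^2 * pen k f))"
 proof (rule fatou_bound[where u = "%n z. (cmod (spart a K n f z))^2" and N = 0])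
  show "(%n. (cmod (spart a K n f z))^2) \<longlonglongrightarrow> (cmod (\<Sum>k\<le>K. of_real (a k) * spj k f z))\<^sup>2" for z
   by (intro tendsto_intros spart_tendsto f)
  fix n
  have "(\<Sum>i\<in>box_nat n \<times> lvl K. (cmod (of_real (a (mlen (snd i))) * coef f (fst i) (snd i)))^2)
    = (\<Sum>be\<in>lvl K. \<Sum>al\<in>box_nat n. (a (mlen be))^2 * (cmod (coef f al be))^2)"
   by (subst sum.swap) (simp add: sum.cartesian_product split_beta norm_mult power_mult_distrib)
  also have "... = (\<Sum>k\<le>K. (a k)^2 * (\<Sum>be\<in>levk k. \<Sum>al\<in>box_nat n. (cmod (coef f al be))^2))"
   unfolding lvl_decomp sum_distrib_left by (intro sum.cong refl) (auto simp: levk_def)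
  also have "... <= (\<Sum>k\<le>K. (a k)^2 * pen k f)"
   by (intro sum_mono mult_left_mono pen_partial_le f) auto
  finally show "(NN z. nq (spart a K n f z) * 1) <= en (sh_norm TYPE('d) * (\<Sum>k\<le>K. (a k)^2 * pen k f))"
   unfolding spart_alt
   by (simp add: sh_sum_norm finite_box_nat finite_lvl) (intro ennreal_leI mult_left_mono sh_norm_nonneg)
 qed auto
 thus ?thesis by simp
qed

text \<open>All functions of one level share an eigenvalue, so \<open>trace_bound\<close> treats a
  finite combination of them as one eigenfunction and the multiplicity costs nothing. Fatou then
  removes the truncation in the first index.\<close>

lemma spectral_trace:
 fixes f :: "'d::finite fld" and r :: real
 assumes f: "square_integrable lborel f" and r: "r >= 1"
 shows "(NN z. nq (spj k f z) * indicator (cball 0 r) z)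
   <= en (16 * real CARD('d) * r / sqrt (2 * real k + real CARD('d)) * (sh_norm TYPE('d) * pen k f))"
proof -
 let ?u = "%n z. \<Sum>(al, be)\<in>box_nat n \<times> levk k. (%i. coef f (fst i) (snd i)) (al, be) * Sh al be z"
 let ?mu = "2 * real k + real CARD('d)"
 have ulim: "(%n. ?u n z) \<longlonglongrightarrow> spj k f z" for z
 proof -
  have "(%n. \<Sum>be\<in>levk k. \<Sum>al\<in>box_nat n. coef f al be * Sh al be z) \<longlonglongrightarrow> spj k f z"
   unfolding spj_projb[OF f] by (intro tendsto_sum projb_tendsto f)
  thus ?thesis by (subst (asm) sum.swap) (simp add: sum.cartesian_product split_beta)
 qed
 have mu: "?mu >= 1"
 proof -
  have "real CARD('d) >= 1" by (simp add: Suc_leI)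
  thus ?thesis by linarith
 qed
 show ?thesis
 proof (rule fatou_bound[where u = "%n z. (cmod (?u n z))^2" and N = 0])
  show "(%z. (cmod (?u n z))^2) \<in> borel_measurable lborel" for n by measurable
  show "(%n. (cmod (?u n z))^2) \<longlonglongrightarrow> (cmod (spj k f z))\<^sup>2" for z by (intro tendsto_intros ulim)
  show "(indicator (cball 0 r) :: complex ^ 'd => ennreal) \<in> borel_measurable lborel"
   by (intro borel_measurable_indicator) auto
  show "indicator (cball 0 r) x < (\<infinity> :: ennreal)" for x :: "complex ^ 'd" by (simp add: indicator_def)
  fix n
  have A: "(\<Sum>j\<in>UNIV. be j) = k" if "(al, be) \<in> box_nat n \<times> levk k" for al be :: "'d => nat"
   using that by (auto simp: levk_def mlen_def)
  have eig: "(\<Sum>p\<in>UNIV. nabla p (nabla p (?u n)) z) = - of_real ?mu * ?u n z" for z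
  proof -
   have "(\<Sum>p\<in>UNIV. nabla p (nabla p (?u n)) z) = - of_nat (2 * k + CARD('d)) * ?u n z"
    by (rule nabla_laplacian(2)) (erule A)
   thus ?thesis by simp
  qed
  have sp: "?u n \<in> sh_span" by (rule nabla_laplacian(1)) (erule A)
  have tb: "(LI z. indicator (cball 0 r) z * (cmod (?u n z))^2) <= 16 * real CARD('d) * r / sqrt ?mu * nsq (?u n)"
   by (rule trace_bound[OF sp mu eig r])
  have si: "square_integrable lborel (?u n)" by (rule rapid_square_integrable[OF sh_span_rapid[OF sp]])
  have ii: "integrable lborel (%z. indicator (cball 0 r) z * (cmod (?u n z))^2)"
  proof -
   have "integrable lborel (%z. indicator (cball 0 r) z *\<^sub>R (cmod (?u n z))\<^sup>2)"
    using si by (intro integrable_mult_indicator) (auto simp: square_integrable_def)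
   thus ?thesis by simp
  qed
  have "(NN z. nq (?u n z) * indicator (cball 0 r) z) = (NN z. en (indicator (cball 0 r) z * (cmod (?u n z))^2))"
   by (intro nn_integral_cong) (simp add: indicator_def)
  also have "... = en (LI z. indicator (cball 0 r) z * (cmod (?u n z))^2)"
   by (rule nn_integral_eq_integral[OF ii]) auto
  also have "... <= en (16 * real CARD('d) * r / sqrt ?mu * (sh_norm TYPE('d) * pen k f))"
  proof (rule ennreal_leI, rule order_trans[OF tb], rule mult_left_mono)
   have "nsq (?u n) = sh_norm TYPE('d) * (\<Sum>i\<in>box_nat n \<times> levk k. (cmod (coef f (fst i) (snd i)))^2)"
    unfolding nsq_def split_beta
    using integral_orthogonal_sum[OF _ square_integrable_sh sh_pair_orthogonal, of "box_nat n \<times> levk k" "%i. coef f (fst i) (snd i)"]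
    by (simp add: finite_box_nat finite_levk)
   also have "(\<Sum>i\<in>box_nat n \<times> levk k. (cmod (coef f (fst i) (snd i)))^2) = (\<Sum>be\<in>levk k. \<Sum>al\<in>box_nat n. (cmod (coef f al be))^2)"
    by (subst sum.swap) (simp add: sum.cartesian_product split_beta)
   finally show "nsq (?u n) <= sh_norm TYPE('d) * pen k f"
    using pen_partial_le[OF f, of n k] by (simp add: mult_left_mono sh_norm_nonneg)
  qed (use r mu in auto)
  finally show "(NN z. nq (?u n z) * indicator (cball 0 r) z) <= ..." .
 qed
qed

section \<open>Size and decay of multiplier kernels\<close>

lemma borel_measurable_kerA[measurable]: "(%z'. kerA K a z z') \<in> bm"
 unfolding kerA_def by measurable

text \<open>At most (K + 1)^d second indices occur, each contributing at most
  \<open>sh_bound\<close> by \<open>sh_bessel\<close>; orthogonality in z' makes the contributions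
  add up.\<close>

lemma kerA_L2:
 fixes z :: "complex ^ 'd::finite"
 assumes a: "!!k. \<bar>a k\<bar> <= A"
 shows "(NN z'. nq (kerA K a z z')) <= en (sh_norm TYPE('d) * sh_bound TYPE('d) * A^2 * (real K + 1) ^ CARD('d))"
proof -
 let ?u = "%n z'. \<Sum>be\<in>lvl K. of_real (a (mlen be)) * (\<Sum>al\<in>box_nat n. Sh al be z * cnj (Sh al be z'))"
 have "(NN z'. nq (kerA K a z z') * 1) <= en (sh_norm TYPE('d) * sh_bound TYPE('d) * A^2 * (real K + 1) ^ CARD('d))"
 proof (rule fatou_bound[where u = "%n z'. (cmod (?u n z'))^2" and N = 0])
  show "(%z'. (cmod (?u n z'))^2) \<in> borel_measurable lborel" for n
   using borel_shE_partial[of _ z "box_nat n"] by measurable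
  show "(%n. (cmod (?u n z'))^2) \<longlonglongrightarrow> (cmod (kerA K a z z'))\<^sup>2" for z'
   unfolding kerA_def by (intro tendsto_intros shE_tendsto)
  fix n
  have u: "?u n z' = (\<Sum>i\<in>box_nat n \<times> lvl K. (of_real (a (mlen (snd i))) * Sh (fst i) (snd i) z) * cnj (Sh (fst i) (snd i) z'))" for z'
  proof -
   have "?u n z' = (\<Sum>be\<in>lvl K. \<Sum>al\<in>box_nat n. of_real (a (mlen be)) * Sh al be z * cnj (Sh al be z'))"
    by (simp add: sum_distrib_left mult.assoc)
   thus ?thesis by (subst (asm) sum.swap) (simp add: sum.cartesian_product split_beta)
  qed
  have A0: "A >= 0" using a[of 0] by linarith
  have "(\<Sum>i\<in>box_nat n \<times> lvl K. (cmod (of_real (a (mlen (snd i))) * Sh (fst i) (snd i) z))^2)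
    = (\<Sum>be\<in>lvl K. (a (mlen be))^2 * (\<Sum>al\<in>box_nat n. (cmod (Sh al be z))^2))"
   unfolding sum_distrib_left by (subst sum.swap) (simp add: sum.cartesian_product split_beta norm_mult power_mult_distrib)
  also have "... <= (\<Sum>be\<in>(lvl K :: ('d => nat) set). A^2 * sh_bound TYPE('d))"
   using a A0 by (intro sum_mono mult_mono sh_bessel finite_box_nat) (auto simp: abs_le_square_iff[symmetric] intro!: sum_nonneg)
  also have "... <= (real K + 1) ^ CARD('d) * (A^2 * sh_bound TYPE('d))"
  proof -
   have "real (card (lvl K :: ('d => nat) set)) <= real ((K + 1) ^ CARD('d))" using card_lvl[of K, where 'd = 'd] by (rule of_nat_mono)
   hence "real (card (lvl K :: ('d => nat) set)) <= (real K + 1) ^ CARD('d)" by (simp add: add.commute)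
   thus ?thesis by (simp add: mult_right_mono sh_bound_nonneg)
  qed
  finally have s: "(\<Sum>i\<in>box_nat n \<times> lvl K. (cmod (of_real (a (mlen (snd i))) * Sh (fst i) (snd i) z))^2) <= (real K + 1) ^ CARD('d) * (A^2 * sh_bound TYPE('d))" .
  have "(NN z'. nq (?u n z') * 1) = en (sh_norm TYPE('d) * (\<Sum>i\<in>box_nat n \<times> lvl K. (cmod (of_real (a (mlen (snd i))) * Sh (fst i) (snd i) z))^2))"
   unfolding u by (simp add: sh_sum_norm_cnj finite_box_nat finite_lvl)
  also have "... <= en (sh_norm TYPE('d) * ((real K + 1) ^ CARD('d) * (A^2 * sh_bound TYPE('d))))"
   by (intro ennreal_leI mult_left_mono sh_norm_nonneg s)
  finally show "(NN z'. nq (?u n z') * 1) <= en (sh_norm TYPE('d) * sh_bound TYPE('d) * A^2 * (real K + 1) ^ CARD('d))"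
   by (simp add: mult_ac)
 qed auto
 thus ?thesis by simp
qed

lemma kerA_pointwise:
 fixes z :: "complex ^ 'd::finite"
 assumes a: "!!k. \<bar>a k\<bar> <= A"
 shows "cmod (kerA K a z z') <= sh_bound TYPE('d) * A * (real K + 1) ^ CARD('d)"
proof -
 have A0: "A >= 0" using a[of 0] by linarith
 have "cmod (kerA K a z z') <= (\<Sum>be\<in>lvl K. cmod (of_real (a (mlen be)) * shE be be z z'))"
  unfolding kerA_def by (rule norm_sum)
 also have "... <= (\<Sum>be\<in>(lvl K :: ('d => nat) set). A * sh_bound TYPE('d))"
  unfolding norm_mult using a A0 by (intro sum_mono mult_mono cmod_shE_le) auto
 also have "... <= (real K + 1) ^ CARD('d) * (A * sh_bound TYPE('d))"
 proof -
  have "real (card (lvl K :: ('d => nat) set)) <= real ((K + 1) ^ CARD('d))" using card_lvl[of K, where 'd = 'd] by (rule of_nat_mono)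
  hence "real (card (lvl K :: ('d => nat) set)) <= (real K + 1) ^ CARD('d)" by (simp add: add.commute)
  thus ?thesis by (simp add: mult_right_mono sh_bound_nonneg A0)
 qed
 finally show ?thesis by (simp add: mult_ac)
qed

lemma kerA_weighted_L2:
 fixes z :: "complex ^ 'd::finite"
 assumes a: "!!k. k > K ==> a k = 0" and A: "!!k. \<bar>(dlap CARD('d) ^^ N) a k\<bar> <= A"
 shows "(NN z'. en (((norm (z - z')) ^ (2 * N) * cmod (kerA K a z z'))^2)) <= en (sh_norm TYPE('d) * sh_bound TYPE('d) * A^2 * (real (K + N) + 1) ^ CARD('d))"
proof -
 have "(norm (z - z')) ^ (2 * N) * cmod (kerA K a z z') = cmod (kerA (K + N) ((dlap CARD('d) ^^ N) a) z z')" for z'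
 proof -
  have "of_real ((norm (z - z')) ^ (2 * N)) * kerA K a z z' = kerA (K + N) ((dlap CARD('d) ^^ N) a) z z'"
   by (rule kerA_norm_pow(1)) (rule a)
  from arg_cong[OF this, of cmod] show ?thesis by (simp add: norm_mult norm_power)
 qed
 thus ?thesis using kerA_L2[OF A, where K = "K + N" and z = z] by simp
qed

lemma kerA_weighted_pointwise:
 fixes z :: "complex ^ 'd::finite"
 assumes a: "!!k. k > K ==> a k = 0" and A: "!!k. \<bar>(dlap CARD('d) ^^ N) a k\<bar> <= A"
 shows "(norm (z - z')) ^ (2 * N) * cmod (kerA K a z z') <= sh_bound TYPE('d) * A * (real (K + N) + 1) ^ CARD('d)"
proof -
 have "(norm (z - z')) ^ (2 * N) * cmod (kerA K a z z') = cmod (kerA (K + N) ((dlap CARD('d) ^^ N) a) z z')"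
 proof -
  have "of_real ((norm (z - z')) ^ (2 * N)) * kerA K a z z' = kerA (K + N) ((dlap CARD('d) ^^ N) a) z z'"
   by (rule kerA_norm_pow(1)) (rule a)
  from arg_cong[OF this, of cmod] show ?thesis by (simp add: norm_mult norm_power)
 qed
 thus ?thesis using kerA_pointwise[OF A, where K = "K + N" and z = z and z' = z'] by simp
qed

section \<open>Differences of multipliers\<close>

text \<open>Working on all integers avoids a boundary at 0 and provides shifts in both directions,
  so that differences commute with translation exactly.\<close>

definition fd :: "(int => real) => int => real" where "fd F x = F (x + 1) - F x"

lemma fd_apply: "fd F x = F (x + 1) - F x"
 by (simp add: fd_def)

lemma fd_pow_Suc: "(fd ^^ Suc i) F x = (fd ^^ i) F (x + 1) - (fd ^^ i) F x"
 by (simp add: fd_apply)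

lemma fd_pow_add: "(fd ^^ i) (%x. F x + G x) x = (fd ^^ i) F x + (fd ^^ i) G x"
proof (induction i arbitrary: x)
 case (Suc i) thus ?case unfolding fd_pow_Suc by simp
qed simp

lemma fd_pow_cmult: "(fd ^^ i) (%x. c * F x) x = c * (fd ^^ i) F x"
proof (induction i arbitrary: x)
 case (Suc i) thus ?case unfolding fd_pow_Suc by (simp add: right_diff_distrib)
qed simp

lemma fd_pow_shift: "(fd ^^ i) (%x. F (x + c)) x = (fd ^^ i) F (x + c)"
proof (induction i arbitrary: x)
 case (Suc i) thus ?case unfolding fd_pow_Suc by (simp add: add.assoc add.commute[of 1 c])
qed simp

lemma fd_pow_mult: "(fd ^^ i) (%x. of_int x * G x) x = of_int x * (fd ^^ i) G x + real i * (fd ^^ (i - 1)) G (x + 1)"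
proof (induction i arbitrary: x)
 case (Suc i)
 show ?case
 proof (cases i)
  case 0 thus ?thesis by (simp add: fd_apply algebra_simps)
 next
  case (Suc j)
  have P: "(fd ^^ i) G y = (fd ^^ j) G (y + 1) - (fd ^^ j) G y" for y
   unfolding Suc by (rule fd_pow_Suc)
  have "(fd ^^ Suc i) (%x. of_int x * G x) x = (of_int (x + 1) * (fd ^^ i) G (x + 1) + real i * (fd ^^ j) G (x + 2)) - (of_int x * (fd ^^ i) G x + real i * (fd ^^ j) G (x + 1))"
   unfolding fd_pow_Suc Suc.IH using Suc by (simp add: add.assoc)
  also have "... = of_int x * ((fd ^^ i) G (x + 1) - (fd ^^ i) G x) + ((fd ^^ i) G (x + 1) + real i * ((fd ^^ j) G (x + 1 + 1) - (fd ^^ j) G (x + 1)))"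
   by (simp add: algebra_simps)
  also have "... = of_int x * (fd ^^ Suc i) G x + real (Suc i) * (fd ^^ i) G (x + 1)"
   unfolding P[of "x + 1", symmetric] fd_pow_Suc[of i G x] by (simp add: algebra_simps)
  finally show ?thesis by simp
 qed
qed simp

definition dlapZ :: "nat => (int => real) => int => real" where
 "dlapZ d F x = - 2 * ((of_int x + real d) * (F (x + 1) - F x) + of_int x * (F (x - 1) - F x))"

lemma dlapZ_fd: "dlapZ d F = (%x. (- 2 * real d) * fd F x + (- 2) * (of_int x * (fd ^^ 2) F (x + (- 1))))"
 by (simp add: fun_eq_iff dlapZ_def fd_apply numeral_2_eq_2 algebra_simps)

text \<open>The two operators could differ only at k = 0, where the predecessors are 0 and -1; there
  both are multiplied by 0.\<close>

lemma dlap_dlapZ: "(!!k. a k = F (int k)) ==> dlap d a k = dlapZ d F (int k)"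
 by (cases k) (auto simp: dlap_def dlapZ_def algebra_simps)

lemma dlap_dlapZ_pow: "(dlap d ^^ N) (%k. F (int k)) k = (dlapZ d ^^ N) F (int k)"
proof (induction N arbitrary: k)
 case (Suc N)
 thus ?case using dlap_dlapZ[of "(dlap d ^^ N) (%k. F (int k))" "(dlapZ d ^^ N) F" d k] by simp
qed simp

text \<open>A discrete symbol class: every difference gains a factor h, as for a function varying on
  the scale 1 / h.\<close>

definition fdb :: "real => real => nat => real => (int => real) => bool" where
 "fdb A h n K F \<longleftrightarrow> (\<forall>i\<le>n. ALL x. \<bar>(fd ^^ i) F x\<bar> <= A * h ^ i) & (ALL x. \<bar>of_int x\<bar> > K --> F x = 0)"

lemma fd_pow_support:
 assumes "!!x. \<bar>of_int x\<bar> > K ==> F x = 0"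
 shows "\<bar>of_int x\<bar> > K + real i ==> (fd ^^ i) F x = 0"
proof (induction i arbitrary: x)
 case (Suc i)
 have "\<bar>real_of_int x\<bar> > K + real i" using Suc.prems by simp
 moreover have "\<bar>real_of_int (x + 1)\<bar> > K + real i" using Suc.prems by simp
 ultimately show ?case using Suc.IH unfolding fd_pow_Suc by simp
qed (use assms in simp)

text \<open>On the support, of size L, the term x times a second difference costs L h^2. The
  first-order terms cost only h, which 1 <= L h absorbs.\<close>

lemma fdb_dlapZ:
 assumes F: "fdb A h (n + 2) K F" and L: "K + real n + 3 <= L" and h: "h > 0" "1 <= L * h" and A: "A >= 0" and L0: "L >= 0"
 shows "fdb (2 * (real d + real n + 1) * L * h^2 * A) h n (K + 1) (dlapZ d F)"
 unfolding fdb_def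
proof (intro conjI allI impI)
 have b: "\<bar>(fd ^^ i) F x\<bar> <= A * h ^ i" if "i <= n + 2" for i x using F that by (auto simp: fdb_def)
 have sup: "F x = 0" if "\<bar>of_int x\<bar> > K" for x using F that by (auto simp: fdb_def)
 fix i x assume i: "i <= n"
 have e: "(fd ^^ i) (dlapZ d F) x = (- 2 * real d) * (fd ^^ (i + 1)) F x + (- 2) * (of_int x * (fd ^^ (i + 2)) F (x + (- 1)) + real i * (fd ^^ (i - 1 + 2)) F (x + 1 + (- 1)))"
 proof -
  have e1: "(fd ^^ (i + 1)) F = (fd ^^ i) (fd F)" by (simp add: funpow_swap1)
  have e2: "(fd ^^ (j + 2)) F = (fd ^^ j) ((fd ^^ 2) F)" for j by (simp only: funpow_add o_apply)
  show ?thesis unfolding dlapZ_fd fd_pow_add fd_pow_cmult fd_pow_mult fd_pow_shift e1 e2 ..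
 qed
 have t1: "\<bar>(fd ^^ (i + 1)) F x\<bar> <= L * h * (A * h ^ (i + 1))"
 proof -
  have "\<bar>(fd ^^ (i + 1)) F x\<bar> <= A * h ^ (i + 1)" using i by (intro b) auto
  also have "... <= L * h * (A * h ^ (i + 1))" using h A mult_right_mono[of 1 "L * h" "A * h ^ (i + 1)"] by simp
  finally show ?thesis .
 qed
 have t2: "\<bar>of_int x * (fd ^^ (i + 2)) F (x + (- 1))\<bar> <= L * (A * h ^ (i + 2))"
 proof (cases "\<bar>real_of_int x\<bar> <= L")
  case True
  thus ?thesis unfolding abs_mult using b[of "i + 2" "x + (- 1)"] i L0 by (intro mult_mono) auto
 next
  case False
  \<comment> \<open>The margin n + 3 in the hypothesis on L consists of the n + 2 steps by which the
    differences enlarge the support and of the shift by one.\<close>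
  have "\<bar>real_of_int (x + (- 1))\<bar> > K + real (i + 2)" using False L i by simp
  from fd_pow_support[of K F, OF sup this] show ?thesis using L0 A h by simp
 qed
 have t3: "\<bar>real i * (fd ^^ (i - 1 + 2)) F (x + 1 + (- 1))\<bar> <= real n * (L * h * (A * h ^ (i + 1)))"
 proof (cases "i = 0")
  case True thus ?thesis using L0 A h by simp
 next
  case False
  hence ii: "i - 1 + 2 = i + 1" by simp
  have "\<bar>real i * (fd ^^ (i + 1)) F x\<bar> <= real n * (L * h * (A * h ^ (i + 1)))"
   unfolding abs_mult using t1 i by (intro mult_mono) auto
  thus ?thesis unfolding ii by simp
 qed
 have "\<bar>(fd ^^ i) (dlapZ d F) x\<bar> <= 2 * real d * \<bar>(fd ^^ (i + 1)) F x\<bar> + 2 * (\<bar>of_int x * (fd ^^ (i + 2)) F (x + (- 1))\<bar> + \<bar>real i * (fd ^^ (i - 1 + 2)) F (x + 1 + (- 1))\<bar>)"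
 proof -
  have tri: "\<bar>(- 2 * real d) * p + (- 2) * (q + r)\<bar> <= 2 * real d * \<bar>p\<bar> + 2 * (\<bar>q\<bar> + \<bar>r\<bar>)" for p q r :: real
  proof -
   have "\<bar>(- 2 * real d) * p + (- 2) * (q + r)\<bar> <= \<bar>(- 2 * real d) * p\<bar> + \<bar>(- 2) * (q + r)\<bar>" by (rule abs_triangle_ineq)
   also have "... <= 2 * real d * \<bar>p\<bar> + 2 * (\<bar>q\<bar> + \<bar>r\<bar>)"
    unfolding abs_mult using abs_triangle_ineq[of q r] by simp
   finally show ?thesis .
  qed
  show ?thesis unfolding e by (rule tri)
 qed
 also have "... <= 2 * real d * (L * h * (A * h ^ (i + 1))) + 2 * (L * (A * h ^ (i + 2)) + real n * (L * h * (A * h ^ (i + 1))))"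
  by (intro add_mono mult_left_mono t1 t2 t3) auto
 also have "... = 2 * (real d + real n + 1) * L * h^2 * A * h ^ i"
  by (simp add: power2_eq_square algebra_simps)
 finally show "\<bar>(fd ^^ i) (dlapZ d F) x\<bar> <= 2 * (real d + real n + 1) * L * h^2 * A * h ^ i" .
next
 fix x assume x: "\<bar>real_of_int x\<bar> > K + 1"
 have sup: "F x = 0" if "\<bar>of_int x\<bar> > K" for x using F that by (auto simp: fdb_def)
 have "F x = 0" "F (x + 1) = 0" "F (x - 1) = 0" using x by (auto intro!: sup)
 thus "dlapZ d F x = 0" by (simp add: dlapZ_def)
qed

text \<open>Each application consumes two orders of differences and enlarges the support by one, so
  2 N orders are needed at the start and L must leave room for all N steps.\<close>

lemma fdb_dlapZ_pow:
 assumes F: "fdb A h (2 * N) K F" and L: "K + 2 * real N + 3 <= L" and h: "h > 0" "1 <= L * h" and A: "A >= 0" and L0: "L >= 0"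
 shows "\<bar>(dlapZ d ^^ N) F x\<bar> <= (2 * (real d + 2 * real N + 1) * L * h^2) ^ N * A"
proof -
 let ?c = "2 * (real d + 2 * real N + 1) * L * h^2"
 have c: "?c >= 0" using L0 by simp
 have mono: "fdb A' h n K' G ==> A' <= A'' ==> fdb A'' h n K' G" for A' A'' n K' G
  unfolding fdb_def using h by (meson mult_right_mono order_trans zero_le_power less_imp_le)
 have "j <= N ==> fdb (?c ^ j * A) h (2 * (N - j)) (K + real j) ((dlapZ d ^^ j) F)" for j
 proof (induction j)
  case 0 thus ?case using F by simp
 next
  case (Suc j)
  have e: "2 * (N - j) = 2 * (N - Suc j) + 2" using Suc.prems by simp
  have "fdb (?c ^ j * A) h (2 * (N - Suc j) + 2) (K + real j) ((dlapZ d ^^ j) F)" using Suc unfolding e by simp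
  hence "fdb (2 * (real d + real (2 * (N - Suc j)) + 1) * L * h^2 * (?c ^ j * A)) h (2 * (N - Suc j)) (K + real j + 1) (dlapZ d ((dlapZ d ^^ j) F))"
  proof (rule fdb_dlapZ)
   have "j + 2 * (N - Suc j) <= 2 * N" using Suc.prems by simp
   hence "real j + real (2 * (N - Suc j)) <= 2 * real N" by linarith
   thus "K + real j + real (2 * (N - Suc j)) + 3 <= L" using L by linarith
  qed (use h A L0 c in auto)
  moreover have "2 * (real d + real (2 * (N - Suc j)) + 1) * L * h^2 * (?c ^ j * A) <= ?c ^ Suc j * A"
  proof -
   have "2 * (real d + real (2 * (N - Suc j)) + 1) * L * h^2 <= ?c"
    using L0 by (intro mult_right_mono mult_left_mono add_mono) auto
   hence "2 * (real d + real (2 * (N - Suc j)) + 1) * L * h^2 * (?c ^ j * A) <= ?c * (?c ^ j * A)"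
    by (rule mult_right_mono) (use c A in auto)
   thus ?thesis by (simp add: mult.assoc)
  qed
  ultimately have "fdb (?c ^ Suc j * A) h (2 * (N - Suc j)) (K + real j + 1) (dlapZ d ((dlapZ d ^^ j) F))"
   by (rule mono)
  moreover have "K + real j + 1 = K + real (Suc j)" by simp
  ultimately show ?case by (simp only: funpow.simps o_apply)
 qed
 from this[of N] show ?thesis by (auto simp: fdb_def)
qed

text \<open>A first difference of a chain of derivatives is a chain that is one shorter; by the mean
  value inequality its last member is bounded by the step length times \<open>A\<close>.\<close>

lemma fd_pow_derivative:
 fixes D :: "nat => real => real"
 assumes "!!i x. i < n ==> (D i has_real_derivative D (Suc i) x) (at x)" and "!!x. \<bar>D n x\<bar> <= A"
 shows "\<bar>(fd ^^ n) (%x. D 0 (c + e * of_int x)) x\<bar> <= \<bar>e\<bar> ^ n * A"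
 using assms
proof (induction n arbitrary: D A)
 case (Suc n)
 define E where "E i y = D i (y + e) - D i y" for i y
 have "\<bar>(fd ^^ n) (%x. E 0 (c + e * of_int x)) x\<bar> <= \<bar>e\<bar> ^ n * (\<bar>e\<bar> * A)"
 proof (rule Suc.IH)
  fix i y assume "i < n"
  hence d: "(D i has_real_derivative D (Suc i) x) (at x)" for x using Suc.prems(1) by simp
  have "((%y. D i (y + e)) has_real_derivative D (Suc i) (y + e)) (at y)"
   using d[of "y + e"] by (simp add: DERIV_shift)
  from DERIV_diff[OF this d[of y]] show "(E i has_real_derivative E (Suc i) y) (at y)"
   unfolding E_def[abs_def] by simp
 next
  fix y
  have d: "(D n has_real_derivative D (Suc n) x) (at x)" for x using Suc.prems(1) by simp
  have "norm (D n (y + e) - D n y) <= A * norm ((y + e) - y)"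
  proof (rule field_differentiable_bound[of UNIV])
   show "(D n has_field_derivative D (Suc n) z) (at z within UNIV)" for z using d by simp
  qed (use Suc.prems(2) in auto)
  thus "\<bar>E n y\<bar> <= \<bar>e\<bar> * A" by (simp add: E_def mult.commute)
 qed
 moreover have "fd (%x. D 0 (c + e * of_int x)) = (%x. E 0 (c + e * of_int x))"
  by (simp add: fd_apply E_def fun_eq_iff algebra_simps)
 ultimately show ?case by (simp add: funpow_swap1 mult_ac)
qed simp

lemma fd_pow_trivial: "(!!x. \<bar>F x\<bar> <= A) ==> \<bar>(fd ^^ n) F x\<bar> <= 2 ^ n * A"
proof (induction n arbitrary: x)
 case (Suc n)
 have "\<bar>(fd ^^ Suc n) F x\<bar> <= \<bar>(fd ^^ n) F (x + 1)\<bar> + \<bar>(fd ^^ n) F x\<bar>" unfolding fd_pow_Suc by (rule abs_triangle_ineq4)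
 also have "... <= 2 ^ n * A + 2 ^ n * A" using Suc by (intro add_mono) auto
 also have "... = 2 ^ Suc n * A" by simp
 finally show ?case .
qed simp

section \<open>Bump functions and the multipliers they generate\<close>

definition bump :: "nat => real => (real => real) => bool" where
 "bump M A ze \<longleftrightarrow> (EX D. dchain D ze M A)
   & (ALL u. u \<notin> {1/8..2} --> ze u = 0)"

lemma bumpD: assumes "bump M A ze" shows "\<bar>ze u\<bar> <= A" "ze u ~= 0 ==> 1/8 <= u & u <= 2" "A >= 0"
proof -
 obtain D where D: "D 0 = ze" "!!i x. i <= M ==> \<bar>D i x\<bar> <= A" using assms by (auto simp: bump_def)
 show 1: "\<bar>ze u\<bar> <= A" for u using D(2)[of 0 u] D(1) by simp
 show "A >= 0" using 1[of 0] by linarith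
 show "ze u ~= 0 ==> 1/8 <= u & u <= 2" using assms by (auto simp: bump_def)
qed

text \<open>The bump is evaluated at the distance of the eigenvalue 2 k + d below t^2, measured in
  units of s t^2; thus s is the relative width of the spectral window.\<close>

definition am :: "nat => (real => real) => real => real => nat => real" where
 "am d ze s t k = ze ((1 - (2 * real k + real d) / t^2) / s)"

text \<open>In k the multiplier varies on the scale s t^2 and lives on k of size at most about t^2,
  so one application of \<open>dlap\<close> costs about t^2 / (s t^2)^2 = 1 / (s t)^2. When s t^2 <
  1 the window is finer than the integers and trivial differences cost t^2 instead. The kernel thus
  has width min(t, 1 / (s t)).\<close>

lemma am_dlap_bound:
 fixes d N :: nat and A :: real
 assumes "A >= 0"
 shows "\<exists>C\<ge>0. ALL ze s t k. bump (2 * N) A ze --> 0 < s --> s <= 1 --> 1 <= t -->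
  \<bar>(dlap d ^^ N) (am d ze s t) k\<bar> <= C * (min t (1 / (s * t))) ^ (2 * N)"
proof -
 define c1 where "c1 = 2 + real d + 2 * real N + 3"
 define C where "C = (2 * (real d + 2 * real N + 1) * (4 * c1)) ^ N * A"
 have C: "C >= 0" unfolding C_def c1_def using assms by (intro mult_nonneg_nonneg zero_le_power) auto
 have "\<bar>(dlap d ^^ N) (am d ze s t) k\<bar> <= C * (min t (1 / (s * t))) ^ (2 * N)"
  if b: "bump (2 * N) A ze" and s: "0 < s" "s <= 1" and t: "1 <= t" for ze s t k
 proof -
  obtain D where D: "D 0 = ze" "!!i x. i < 2 * N ==> (D i has_real_derivative D (Suc i) x) (at x)" "!!i x. i <= 2 * N ==> \<bar>D i x\<bar> <= A"
   using b by (auto simp: bump_def)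
  define F where "F x = ze ((1 - (2 * of_int x + real d) / t^2) / s)" for x :: int
  define e where "e = - 2 / (s * t^2)"
  have t2: "t^2 >= 1" using t by simp
  have Fe: "F = (%x. D 0 ((1 - real d / t^2) / s + e * of_int x))"
   unfolding F_def e_def D(1) using s t by (auto simp: fun_eq_iff field_simps intro!: arg_cong[of _ _ ze])
  \<comment> \<open>The 2 serves both regimes: 2 / (s t^2) is the slope of the argument of the bump
    in x, and 2 is the price of a trivial difference.\<close>
  define h where "h = 2 * min 1 (1 / (s * t^2))"
  have h: "h > 0" unfolding h_def using s t by simp
  define K where "K = t^2 + real d"
  define L where "L = c1 * t^2"
  have fdb: "fdb A h (2 * N) K F"
   unfolding fdb_def
  proof (intro conjI allI impI)
   fix i x assume i: "i <= 2 * N"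
   have 1: "\<bar>(fd ^^ i) F x\<bar> <= \<bar>e\<bar> ^ i * A"
    unfolding Fe by (rule fd_pow_derivative) (use D i in auto)
   have 2: "\<bar>(fd ^^ i) F x\<bar> <= 2 ^ i * A"
    by (rule fd_pow_trivial) (use bumpD(1)[OF b] in \<open>simp add: F_def\<close>)
   show "\<bar>(fd ^^ i) F x\<bar> <= A * h ^ i"
   proof (cases "1 <= 1 / (s * t^2)")
    case True
    hence "h = 2" by (simp add: h_def)
    thus ?thesis using 2 by (simp add: mult.commute)
   next
    case False
    hence "h = \<bar>e\<bar>" using s t by (simp add: h_def e_def abs_mult)
    thus ?thesis using 1 by (simp add: mult.commute)
   qed
  next
   fix x assume x: "\<bar>real_of_int x\<bar> > K"
   show "F x = 0"
   proof (rule ccontr)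
    assume "F x ~= 0"
    hence u: "1/8 <= (1 - (2 * of_int x + real d) / t^2) / s & (1 - (2 * of_int x + real d) / t^2) / s <= 2"
     unfolding F_def by (rule bumpD(2)[OF b])
    have "1 - (2 * of_int x + real d) / t^2 <= 2 * s" using u s by (simp add: pos_divide_le_eq)
    hence l: "- 1 <= (2 * of_int x + real d) / t^2" using s by linarith
    have "0 <= 1 - (2 * of_int x + real d) / t^2" using u s
     by (meson divide_nonneg_nonneg order_trans zero_le_divide_1_iff zero_le_divide_iff zero_le_numeral divide_less_0_iff not_le less_le_trans le_less_trans less_imp_le)
    hence r: "(2 * of_int x + real d) / t^2 <= 1" by linarith
    have tp: "t^2 > 0" using t2 by linarith
    have "- t\<^sup>2 <= 2 * of_int x + real d" using l tp by (simp add: pos_le_divide_eq)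
    moreover have "2 * of_int x + real d <= t^2" using r tp by (simp add: pos_divide_le_eq)
    ultimately have "\<bar>real_of_int x\<bar> <= K" using t2 unfolding K_def by (simp add: abs_le_iff)
    thus False using x by linarith
   qed
  qed
  have KL: "K + 2 * real N + 3 <= L"
  proof -
   have "real d + 2 * real N + 3 <= (real d + 2 * real N + 3) * t^2"
    using mult_left_mono[OF t2, of "real d + 2 * real N + 3"] by simp
   thus ?thesis using t2 unfolding K_def L_def c1_def by (simp add: algebra_simps)
  qed
  have L0: "L >= 0" unfolding L_def c1_def by simp
  have Lt: "t^2 <= L" unfolding L_def c1_def using t2 by (simp add: algebra_simps)
  have Lh: "1 <= L * h"
  proof (cases "1 <= 1 / (s * t^2)")
   case True
   thus ?thesis using Lt t2 by (simp add: h_def)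
  next
   case False
   hence "t^2 * h = 2 / s" using s t by (simp add: h_def)
   moreover have "1 <= 2 / s" using s by simp
   moreover have "t^2 * h <= L * h" using Lt h by (intro mult_right_mono) auto
   ultimately show ?thesis by linarith
  qed
  have "\<bar>(dlap d ^^ N) (am d ze s t) k\<bar> = \<bar>(dlapZ d ^^ N) F (int k)\<bar>"
   using dlap_dlapZ_pow[of N d F k] by (simp add: am_def[abs_def] F_def)
  also have "... <= (2 * (real d + 2 * real N + 1) * L * h^2) ^ N * A"
   by (rule fdb_dlapZ_pow[OF fdb KL h Lh assms L0])
  also have "2 * (real d + 2 * real N + 1) * L * h^2 = (2 * (real d + 2 * real N + 1) * (4 * c1)) * (min t (1 / (s * t)))^2"
  proof -
   have "min t (1 / (s * t)) = t * min 1 (1 / (s * t^2))"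
   proof (cases "1 <= 1 / (s * t^2)")
    case True
    hence "s * t^2 <= 1" using s t by (simp add: field_simps)
    hence "t <= 1 / (s * t)" using s t by (simp add: field_simps power2_eq_square)
    thus ?thesis using True by simp
   next
    case False
    hence "s * t^2 >= 1" using s t by (simp add: field_simps)
    hence "t >= 1 / (s * t)" using s t by (simp add: field_simps power2_eq_square)
    thus ?thesis using False s t by (simp add: power2_eq_square)
   qed
   thus ?thesis unfolding L_def h_def by (simp add: power_mult_distrib)
  qed
  also have "(2 * (real d + 2 * real N + 1) * (4 * c1) * (min t (1 / (s * t)))^2) ^ N * A = C * (min t (1 / (s * t))) ^ (2 * N)"
   unfolding C_def by (simp add: power_mult_distrib power_mult[symmetric] mult_ac)
  finally show ?thesis .
 qed
 thus ?thesis using C by blast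
qed

lemma am_zero: assumes "bump M A ze" "s > 0" "t >= 1" "k > nat \<lfloor>t\<^sup>2\<rfloor>" shows "am d ze s t k = 0"
proof (rule ccontr)
 assume "am d ze s t k ~= 0"
 hence "1/8 <= (1 - (2 * real k + real d) / t^2) / s" unfolding am_def using bumpD(2)[OF assms(1)] by blast
 hence "(1 - (2 * real k + real d) / t^2) / s > 0" by linarith
 hence "1 - (2 * real k + real d) / t^2 > 0" using assms(2) by (simp add: zero_less_divide_iff)
 hence "2 * real k + real d < t\<^sup>2" using assms(3) by (simp add: pos_divide_less_eq)
 hence "real k <= t^2" by linarith
 hence "int k <= \<lfloor>t\<^sup>2\<rfloor>" by (simp add: le_floor_iff)
 thus False using assms(4) by linarith
qed

lemma am_window: assumes "bump M A ze" "0 < s" "s <= 1/4" "t >= 1" "am d ze s t k ~= 0"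
 shows "t^2 / 2 <= 2 * real k + real d" "2 * real k + real d <= t^2" "t^2 * (1 - 2 * s) <= 2 * real k + real d"
proof -
 have u: "1/8 <= (1 - (2 * real k + real d) / t^2) / s" "(1 - (2 * real k + real d) / t^2) / s <= 2"
  using assms(5) bumpD(2)[OF assms(1)] unfolding am_def by blast+
 have "1 - (2 * real k + real d) / t^2 <= 2 * s" using u assms by (simp add: pos_divide_le_eq)
 hence l: "1 - 2 * s <= (2 * real k + real d) / t^2" by linarith
 have t2: "t^2 > 0" using assms by simp
 thus "t^2 * (1 - 2 * s) <= 2 * real k + real d" using l by (simp add: pos_le_divide_eq mult.commute)
 moreover have "t^2 * (1/2) <= t^2 * (1 - 2 * s)" using assms by (intro mult_left_mono) auto
 ultimately show "t^2 / 2 <= 2 * real k + real d" by simp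
 have "(1 - (2 * real k + real d) / t^2) / s > 0" using u by linarith
 hence "1 - (2 * real k + real d) / t^2 > 0" using assms(2) by (simp add: zero_less_divide_iff)
 thus "2 * real k + real d <= t^2" using t2 by (simp add: pos_divide_less_eq)
qed

lemma card_nat_interval:
 fixes S :: "nat set"
 assumes "!!x. x \<in> S ==> a <= real x & real x <= a + c" "c >= 0"
 shows "finite S" "real (card S) <= c + 1"
proof -
 have "S \<subseteq> {..nat \<lfloor>a + c\<rfloor>}"
 proof
  fix x assume "x \<in> S"
  hence "real x <= a + c" using assms by blast
  hence "int x <= \<lfloor>a + c\<rfloor>" by (simp add: le_floor_iff)
  thus "x \<in> {..nat \<lfloor>a + c\<rfloor>}" by simp
 qed
 thus fin: "finite S" by (rule finite_subset) simp
 show "real (card S) <= c + 1"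
 proof (cases "S = {}")
  case True thus ?thesis using assms by simp
 next
  case False
  have "S \<subseteq> {Min S..Max S}" using fin by auto
  hence "card S <= Suc (Max S) - Min S" using card_mono[of "{Min S..Max S}" S] by simp
  moreover have "Min S <= Max S" using fin False by simp
  ultimately have "real (card S) <= real (Max S) - real (Min S) + 1" by linarith
  moreover have "real (Max S) <= a + c" "a <= real (Min S)" using assms(1) fin False by auto
  ultimately show ?thesis by linarith
 qed
qed

text \<open>The window has length 2 s t^2 in the eigenvalue, and consecutive eigenvalues differ by
  2.\<close>

lemma am_count: assumes "bump M A ze" "0 < s" "s <= 1/4" "t >= 1"
 shows "finite {k. am d ze s t k ~= 0}" "real (card {k. am d ze s t k ~= 0}) <= s * t^2 + 1"
proof -
 have "(t^2 * (1 - 2 * s) - real d) / 2 <= real k & real k <= (t^2 * (1 - 2 * s) - real d) / 2 + s * t^2"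
  if "k \<in> {k. am d ze s t k ~= 0}" for k
  using am_window[OF assms, of d k] that by (simp add: field_simps)
 note w = this
 show "finite {k. am d ze s t k ~= 0}"
  by (rule card_nat_interval(1)[OF w]) (use assms in auto)
 show "real (card {k. am d ze s t k ~= 0}) <= s * t^2 + 1"
  by (rule card_nat_interval(2)[OF w]) (use assms in auto)
qed

lemma bump_continuous: "bump (Suc M) A ze ==> continuous_on S ze"
 unfolding bump_def by (metis DERIV_isCont continuous_at_imp_continuous_on zero_less_Suc)

text \<open>A level with eigenvalue q^2 is seen only for t in [q, q (1 + 4 s)], because (1 + 4 s)(1
  - 2 s) >= 1 for s <= 1/4. The dt/t-measure of this interval is at most 4 s, and this s later pays
  for the 1 / s in \<open>Tm_sup_bound\<close>.\<close>

lemma am_window_integral: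
 assumes "bump M A ze" "0 < s" "s <= 1/4" "d >= 1"
 shows "(NN t. en ((am d ze s t k)^2 / t) * indicator {1..} t) <= en (4 * A^2 * s)"
proof -
 define mu where "mu = 2 * real k + real d"
 have mu: "mu >= 1" using assms by (simp add: mu_def)
 define q where "q = sqrt mu"
 have q: "q >= 1" "q^2 = mu" using mu by (auto simp: q_def)
 have pt: "en ((am d ze s t k)^2 / t) * indicator {1..} t <= en (A^2 / q) * indicator {q..q * (1 + 4 * s)} t" for t
 proof (cases "t >= 1 & am d ze s t k ~= 0")
  case True
  hence t: "t >= 1" by simp
  have w: "mu <= t^2" "t^2 * (1 - 2 * s) <= mu" using am_window[OF assms(1-3) t] True by (auto simp: mu_def)
  have qt: "q <= t" using w(1) q t by (intro power2_le_imp_le[of q t]) auto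
  have "(1 + 4 * s) * (1 - 2 * s) >= 1"
  proof -
   have "s * s <= s * (1/4)" using assms by (intro mult_left_mono) auto
   thus ?thesis by (simp add: algebra_simps)
  qed
  hence "t^2 <= t^2 * ((1 + 4 * s) * (1 - 2 * s))" using t mult_left_mono[of 1 "(1 + 4 * s) * (1 - 2 * s)" "t^2"] by simp
  also have "... = (1 + 4 * s) * (t^2 * (1 - 2 * s))" by simp
  also have "... <= (1 + 4 * s) * mu" using w assms by (intro mult_left_mono) auto
  also have "... <= (1 + 4 * s)^2 * mu" using assms mu by (intro mult_right_mono) (auto simp: power2_eq_square)
  also have "... = (q * (1 + 4 * s))^2" using q by (simp add: power_mult_distrib)
  finally have tq: "t <= q * (1 + 4 * s)" using q assms by (intro power2_le_imp_le[of t "q * (1 + 4 * s)"]) auto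
  have "(am d ze s t k)^2 <= A^2"
   using bumpD(1)[OF assms(1)] bumpD(3)[OF assms(1)] unfolding am_def by (simp add: power2_le_iff_abs_le)
  hence "(am d ze s t k)^2 / t <= A^2 / q" using qt q by (intro frac_le) auto
  thus ?thesis using qt tq t by (simp add: ennreal_leI)
 next
  case False
  thus ?thesis by (auto simp: indicator_def)
 qed
 have "(NN t. en ((am d ze s t k)^2 / t) * indicator {1..} t) <= (NN t. en (A^2 / q) * indicator {q..q * (1 + 4 * s)} t)"
  by (intro nn_integral_mono pt)
 also have "... = en (A^2 / q) * en (q * (1 + 4 * s) - q)"
  using q assms by (subst nn_integral_cmult_indicator) (auto simp: algebra_simps)
 also have "... = en (4 * A^2 * s)"
  using q assms by (subst ennreal_mult[symmetric]) (auto simp: field_simps)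
 finally show ?thesis .
qed

section \<open>Annuli\<close>

definition idx :: "complex ^ 'd::finite => nat" where
 "idx z = (LEAST j. norm z <= 2 ^ j)"

lemma idx_le: "norm z <= 2 ^ idx z"
 unfolding idx_def
proof (rule LeastI_ex)
 obtain n where "norm z < 2 ^ n" using real_arch_pow[of 2 "norm z"] by auto
 thus "EX j. norm z <= 2 ^ j" by (meson less_imp_le)
qed

lemma idx_less: "j < idx z ==> 2 ^ j < norm z"
 unfolding idx_def using not_less_Least by (metis not_le)

lemma annulus_idx: "z \<in> annulus j \<longleftrightarrow> idx z = j"
proof
 assume z: "z \<in> annulus j"
 show "idx z = j"
 proof (rule antisym)
  have "norm z <= 2 ^ j" using z by (auto simp: annulus_def split: if_splits)
  thus "idx z <= j" unfolding idx_def by (rule Least_le)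
  show "j <= idx z"
  proof (rule ccontr)
   assume "\<not> j <= idx z"
   hence l: "idx z <= j - 1" "j ~= 0" by auto
   hence "norm z <= 2 ^ (j - 1)" using idx_le[of z] power_increasing[OF l(1), of "2::real"] by linarith
   moreover have "2 ^ (j - 1) < norm z" using z l(2) by (auto simp: annulus_def)
   ultimately show False by simp
  qed
 qed
next
 assume "idx z = j"
 thus "z \<in> annulus j" using idx_le[of z] idx_less[of "j - 1" z] by (auto simp: annulus_def)
qed

lemma annulus_borel: "(annulus j :: (complex ^ 'd::finite) set) \<in> sets borel"
 unfolding annulus_def by (auto simp: Collect_conj_eq intro!: sets.Int)

lemma measurable_idx[measurable]: "(idx :: complex ^ 'd::finite => nat) \<in> measurable borel (count_space UNIV)"
proof (subst measurable_count_space_eq2_countable)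
 have v: "idx -` {j} = (annulus j :: (complex ^ 'd) set)" for j :: nat using annulus_idx by blast
 thus "(idx :: complex ^ 'd => nat) \<in> space borel \<rightarrow> UNIV & (\<forall>a\<in>UNIV. (idx :: complex ^ 'd => nat) -` {a} \<inter> space borel \<in> sets borel)"
  unfolding v using annulus_borel[where 'd = 'd] by simp
qed

lemma weight_idx: "weight al z = 2 powr (- al * real (idx z))"
proof -
 have "weight al z = (\<Sum>j. if j = idx z then 2 powr (- al * real j) else 0)"
  unfolding weight_def by (intro suminf_cong) (auto simp: indicator_def annulus_idx)
 also have "... = 2 powr (- al * real (idx z))"
  using suminf_finite[of "{idx z}" "%j. if j = idx z then 2 powr (- al * real j) else 0"] by simp
 finally show ?thesis .
qed

lemma measurable_weight[measurable]: "weight al \<in> bm"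
 unfolding weight_idx[abs_def] by measurable

lemma weight_pos: "weight al z > 0" by (simp add: weight_idx)

lemma weight_le_1: "al >= 0 ==> weight al z <= 1"
 using powr_mono[of "- al * real (idx z)" 0 2] by (simp add: weight_idx)

section \<open>The weighted integral, cutting along annuli, and integrability against the
  kernels\<close>

definition wn :: "real => ('d::finite fld) => ennreal" where
 "wn al f = (NN z. nq (f z) * wt al z)"

definition cut :: "(complex ^ 'd::finite => bool) => ('d fld) => 'd fld" where
 "cut P f z = (if P z then f z else 0)"

lemma measurable_cut[measurable]:
 assumes [measurable]: "f \<in> bm" "Measurable.pred borel P"
 shows "cut P f \<in> bm"
 unfolding cut_def[abs_def] by measurable

lemma wn_cut_le: "wn al (cut P f) <= wn al f"
 unfolding wn_def by (intro nn_integral_mono mult_right_mono) (auto simp: cut_def)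

lemma norm_le_two_idx: "1 + norm z <= 2 * 2 ^ idx z"
 using idx_le[of z] one_le_power[of "2::real" "idx z"] by linarith

lemma two_idx_le: "2 ^ idx z <= 2 * (1 + norm z)"
proof (cases "idx z")
 case 0 thus ?thesis using norm_ge_zero[of z] by (simp add: add_increasing2)
next
 case (Suc j)
 hence "2 ^ j < norm z" by (intro idx_less) simp
 thus ?thesis using Suc by simp
qed

lemma one_plus_pow_le: "x >= 0 ==> (1 + x) ^ n <= 2 ^ n * (1 + x ^ n)" for x :: real
proof -
 assume x: "x >= 0"
 have "(1 + x) ^ n <= (2 * max 1 x) ^ n" using x by (intro power_mono) auto
 also have "... = 2 ^ n * (max 1 x) ^ n" by (simp add: power_mult_distrib)
 also have "(max 1 x) ^ n <= 1 + x ^ n" using x by (cases "x <= 1") (auto simp: max_def)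
 finally show ?thesis by simp
qed

text \<open>The weight permits f to grow. The kernel stays square integrable after multiplication by
  1 + |z - z'|^(2N), and f becomes square integrable after division by it, since its permitted
  growth is of order at most N >= al.\<close>

lemma kk_integrable:
 fixes f :: "'d::finite fld"
 assumes [measurable]: "f \<in> bm" and f: "wn al f < \<infinity>" and al: "al >= 0"
 shows "integrable lborel (%z'. kk k z z' * f z')"
proof -
 define N where "N = nat \<lceil>al\<rceil> + 1"
 have N: "al <= real N" unfolding N_def by linarith
 define g where "g z' = kk k z z' * (1 + of_real (norm (z - z') ^ (2 * N)))" for z'
 define h where "h z' = f z' / (1 + of_real (norm (z - z') ^ (2 * N)))" for z'
 let ?a = "%i. if i = k then 1 else (0::real)"
 have sg: "square_integrable lborel g"
 proof -
  have "square_integrable lborel (%z'. kk k z z' * of_real (norm (z - z') ^ (2 * N)))"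
   unfolding square_integrable_iff
  proof
   show "(%z'. kk k z z' * of_real (norm (z - z') ^ (2 * N))) \<in> borel_measurable lborel" by measurable
   have a0: "?a i = 0" if "i > k" for i using that by simp
   have z0: "(dlap CARD('d) ^^ N) ?a i = 0" if "i > k + N" for i
    by (rule kerA_norm_pow(2)[OF a0 that])
   \<comment> \<open>The image under the difference operator vanishes beyond k + N, so a maximum
     over finitely many values bounds it everywhere.\<close>
   define B where "B = Max ((%i. \<bar>(dlap CARD('d) ^^ N) ?a i\<bar>) ` {..k + N})"
   have B: "\<bar>(dlap CARD('d) ^^ N) ?a i\<bar> <= B" for i
   proof (cases "i <= k + N")
    case True thus ?thesis unfolding B_def by (intro Max_ge) auto
   next
    case False
    have "0 <= \<bar>(dlap CARD('d) ^^ N) ?a 0\<bar>" by simp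
    also have "... <= B" unfolding B_def by (intro Max_ge) auto
    finally show ?thesis using z0[of i] False by simp
   qed
   have "(NN z'. nq (kk k z z' * of_real (norm (z - z') ^ (2 * N)))) = (NN z'. en (((norm (z - z')) ^ (2 * N) * cmod (kerA k ?a z z'))^2))"
    by (intro nn_integral_cong) (simp add: kk_kerA norm_mult norm_power mult.commute)
   also have "... < \<infinity>" by (rule le_less_trans[OF kerA_weighted_L2[OF a0 B]]) auto
   finally show "(NN z'. nq (kk k z z' * of_real (norm (z - z') ^ (2 * N)))) < \<infinity>" .
  qed
  from square_integrable_add[OF square_integrable_kk this] show ?thesis
   unfolding g_def by (simp add: distrib_left)
 qed
 have sh: "square_integrable lborel h"
  unfolding square_integrable_iff
 proof
  show "h \<in> borel_measurable lborel" unfolding h_def by measurable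
  define c where "c = (2 * (1 + norm z)) powr al * 2 ^ (2 * N)"
  have pt: "(cmod (h z'))^2 <= c * ((cmod (f z'))^2 * weight al z')" for z'
  proof -
   let ?q = "norm (z - z')"
   define D where "D = 1 + ?q ^ (2 * N)"
   have D: "D >= 1" by (simp add: D_def)
   have "1 / weight al z' = (2 ^ idx z') powr al"
   proof -
    have "(2 ^ idx z') powr al = 2 powr (real (idx z') * al)"
     by (subst powr_realpow[symmetric]) (auto simp: powr_powr)
    thus ?thesis by (simp add: weight_idx powr_minus_divide mult.commute)
   qed
   also have "... <= (2 * (1 + norm z')) powr al" by (intro powr_mono2 two_idx_le al) auto
   also have "... <= (2 * ((1 + norm z) * (1 + ?q))) powr al"
   proof -
    have "1 + norm z' <= (1 + norm (z' + (z - z'))) * (1 + ?q)" by (rule one_plus_norm_le)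
    thus ?thesis using al by (intro powr_mono2) auto
   qed
   also have "... = (2 * (1 + norm z)) powr al * (1 + ?q) powr al" by (simp add: powr_mult mult.assoc[symmetric])
   also have "(1 + ?q) powr al <= (1 + ?q) powr (real N)" using N by (intro powr_mono) auto
   also have "(1 + ?q) powr (real N) = (1 + ?q) ^ N" by (simp add: powr_realpow add_pos_nonneg)
   also have "... <= (1 + ?q) ^ (2 * N)" by (intro power_increasing) auto
   also have "... <= 2 ^ (2 * N) * D" unfolding D_def by (rule one_plus_pow_le) simp
   also have "... <= 2 ^ (2 * N) * D^2" using D by (simp add: power2_eq_square)
   finally have "1 / weight al z' <= (2 * (1 + norm z)) powr al * (2 ^ (2 * N) * D^2)" by (simp add: mult_left_mono)
   also have "... = c * D^2" unfolding c_def by (simp only: mult.assoc)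
   finally have "1 / D^2 <= c * weight al z'" using weight_pos[of al z'] D by (simp add: field_simps)
   hence "(cmod (f z'))^2 * (1 / D^2) <= (cmod (f z'))^2 * (c * weight al z')" by (intro mult_left_mono) auto
   moreover have "cmod (h z') = cmod (f z') / D"
   proof -
    have "1 + of_real (?q ^ (2 * N)) = complex_of_real D" unfolding D_def by simp
    hence "cmod (1 + of_real (?q ^ (2 * N))) = D" using D by (simp only: norm_of_real)
    thus ?thesis by (simp add: h_def norm_divide)
   qed
   ultimately show ?thesis by (simp add: power_divide mult_ac)
  qed
  have c: "c >= 0" by (simp add: c_def)
  have "(NN z'. nq (h z')) <= (NN z'. en c * (nq (f z') * en (weight al z')))"
  proof (intro nn_integral_mono)
   fix z'
   have "nq (h z') <= en (c * ((cmod (f z'))^2 * weight al z'))" by (intro ennreal_leI pt)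
   thus "nq (h z') <= en c * (nq (f z') * en (weight al z'))"
    using c weight_pos[of al z'] by (simp add: ennreal_mult less_imp_le)
  qed
  also have "... = en c * wn al f" unfolding wn_def by (rule nn_integral_cmult) measurable
  also have "... < \<infinity>" using f by (simp add: ennreal_mult_less_top)
  finally show "(NN z'. nq (h z')) < \<infinity>" .
 qed
 have "g z' * h z' = kk k z z' * f z'" for z'
 proof -
  have "1 + complex_of_real (norm (z - z') ^ (2 * N)) ~= 0"
  proof -
   have "1 + norm (z - z') ^ (2 * N) > 0" by (simp add: add_pos_nonneg)
   hence "complex_of_real (1 + norm (z - z') ^ (2 * N)) ~= 0" by (metis less_irrefl of_real_eq_0_iff)
   thus ?thesis by simp
  qed
  thus ?thesis by (simp add: g_def h_def)
 qed
 thus ?thesis using square_integrable_mult[OF sg sh] by simp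
qed

section \<open>Multiplier operators and their near, low and far parts\<close>

definition Tm :: "(real => real) => real => real => ('d::finite fld) => 'd fld" where
 "Tm ze s t f z = (\<Sum>k\<le>nat \<lfloor>t\<^sup>2\<rfloor>. of_real (am CARD('d) ze s t k) * spj k f z)"

definition wadm :: "real => ('d::finite fld) => bool" where
 "wadm al f \<longleftrightarrow> al >= 0 & f \<in> bm & wn al f < \<infinity>"

lemma wadm_cut:
 assumes "wadm al f" "Measurable.pred borel P" shows "wadm al (cut P f)"
 using assms wn_cut_le[of al P f] unfolding wadm_def by (auto intro: le_less_trans)

lemma kk_integrable': "wadm al f ==> integrable lborel (%z'. kk k z z' * f z')"
 unfolding wadm_def by (auto intro: kk_integrable)

lemma spj_add:
 assumes "wadm al f" "wadm al g"
 shows "spj k (%z. f z + g z) z = spj k f z + spj k g z"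
 unfolding spj_def distrib_left by (rule Bochner_Integration.integral_add) (use assms kk_integrable' in auto)

lemma Tm_add:
 assumes "wadm al f" "wadm al g"
 shows "Tm ze s t (%z. f z + g z) z = Tm ze s t f z + Tm ze s t g z"
 unfolding Tm_def spj_add[OF assms] by (simp add: distrib_left sum.distrib)

lemma Tm_split:
 assumes f: "wadm al f" and P: "Measurable.pred borel P"
 shows "Tm ze s t f z = Tm ze s t (cut P f) z + Tm ze s t (cut (%z. \<not> P z) f) z"
proof -
 have "f = (%z. cut P f z + cut (%z. \<not> P z) f z)" by (auto simp: cut_def fun_eq_iff)
 moreover have "Tm ze s t (%z. cut P f z + cut (%z. \<not> P z) f z) z = Tm ze s t (cut P f) z + Tm ze s t (cut (%z. \<not> P z) f) z"
  by (rule Tm_add) (use f P in \<open>auto intro: wadm_cut\<close>)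
 ultimately show ?thesis by simp
qed

lemma Tm_kernel:
 fixes f :: "'d::finite fld"
 assumes "wadm al f"
 shows "integrable lborel (%z'. kerA (nat \<lfloor>t\<^sup>2\<rfloor>) (am CARD('d) ze s t) z z' * f z')"
  "Tm ze s t f z = (LI z'. kerA (nat \<lfloor>t\<^sup>2\<rfloor>) (am CARD('d) ze s t) z z' * f z')"
proof -
 have e: "kerA (nat \<lfloor>t\<^sup>2\<rfloor>) (am CARD('d) ze s t) z z' * f z' = (\<Sum>k\<le>nat \<lfloor>t\<^sup>2\<rfloor>. of_real (am CARD('d) ze s t k) * (kk k z z' * f z'))" for z'
  unfolding kerA_kk sum_distrib_right by (simp add: mult.assoc)
 show "integrable lborel (%z'. kerA (nat \<lfloor>t\<^sup>2\<rfloor>) (am CARD('d) ze s t) z z' * f z')"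
  unfolding e by (intro Bochner_Integration.integrable_sum integrable_mult_right kk_integrable'[OF assms])
 show "Tm ze s t f z = (LI z'. kerA (nat \<lfloor>t\<^sup>2\<rfloor>) (am CARD('d) ze s t) z z' * f z')"
  unfolding e Tm_def spj_def
  by (subst Bochner_Integration.integral_sum) (auto intro: kk_integrable'[OF assms])
qed

text \<open>A gap of two indices separates the annuli by a distance comparable to the larger radius;
  neighbouring annuli touch.\<close>

definition apart :: "nat => nat => bool" where "apart i j \<longleftrightarrow> i + 2 <= j \<or> j + 2 <= i"

lemma apart_dist:
 fixes z z' :: "complex ^ 'd::finite"
 assumes "apart (idx z) (idx z')"
 shows "2 ^ (max (idx z) (idx z')) <= 4 * norm (z - z')"
proof -
 have gen: "2 ^ j <= 4 * norm (x - y)" if x: "idx x = i" and y: "idx y = j" and ij: "i + 2 <= j" for x y :: "complex ^ 'd" and i j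
 proof -
  obtain n where n: "j = n + 2" using ij by (metis add.commute le_Suc_ex le_add2 order_trans)
  have "2 ^ (n + 1) < norm y" using idx_less[of "n + 1" y] y n by simp
  moreover have "norm x <= 2 ^ n" 
  proof -
   have "(2::real) ^ i <= 2 ^ n" using ij n by (intro power_increasing) auto
   thus ?thesis using idx_le[of x] unfolding x by (rule order_trans[rotated])
  qed
  moreover have "norm y <= norm x + norm (x - y)" using norm_triangle_ineq4[of x "x - y"] by simp
  ultimately show ?thesis using n by simp
 qed
 show ?thesis
 proof (cases "idx z + 2 <= idx z'")
  case True
  thus ?thesis using gen[OF refl refl True] by (simp add: max_def)
 next
  case False
  hence l: "idx z' + 2 <= idx z" using assms by (auto simp: apart_def)
  thus ?thesis using gen[OF refl refl l] by (simp add: max_def norm_minus_commute)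
 qed
qed

text \<open>For given i and J, far, low and near partition the space. J marks the dyadic radius
  beyond which the decay of the kernel is exploited.\<close>

definition farP :: "nat => nat => complex ^ 'd::finite => bool" where
 "farP i J z' \<longleftrightarrow> apart i (idx z') & J < max i (idx z')"
definition lowP :: "nat => nat => complex ^ 'd::finite => bool" where
 "lowP i J z' \<longleftrightarrow> apart i (idx z') & max i (idx z') <= J"
definition nearP :: "nat => complex ^ 'd::finite => bool" where
 "nearP i z' \<longleftrightarrow> \<not> apart i (idx z')"

lemma measurable_preds[measurable]:
 "Measurable.pred borel (farP i J)" "Measurable.pred borel (lowP i J)" "Measurable.pred borel (nearP i)"
 unfolding farP_def[abs_def] lowP_def[abs_def] nearP_def[abs_def] apart_def[abs_def] by measurable

lemma half_pow_le_weight: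
 assumes "al <= real P" shows "(1/2) ^ (j * P) <= 2 powr (- al * real j)"
proof -
 have "(1/2::real) ^ (j * P) = 2 powr (- (real P) * real j)"
  by (simp add: powr_minus_divide powr_realpow[symmetric] power_one_over mult.commute)
 also have "... <= 2 powr (- al * real j)" using assms by (intro powr_mono mult_right_mono) auto
 finally show ?thesis .
qed

text \<open>Cauchy-Schwarz with the factor |z - z'|^(2N) put on the kernel and its inverse on f.
  Squared, the latter provides 4 N powers of 2^(-max) of the two indices: Q of them are spent on J,
  P on integrability in z, and P on the growth of f that the weight permits.\<close>

lemma far_pointwise:
 fixes f :: "'d::finite fld"
 assumes f: "wadm al f" and b: "bump M A ze" and s: "0 < s" and t: "1 <= t"
  and B: "!!k. \<bar>(dlap CARD('d) ^^ N) (am CARD('d) ze s t) k\<bar> <= B"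
  and P: "al <= real P" and Q: "4 * N = 2 * P + Q"
 shows "nq (Tm ze s t (cut (farP (idx z) J) f) z)
  <= en (sh_norm TYPE('d) * sh_bound TYPE('d) * B^2 * (t^2 + real N + 1) ^ CARD('d) * (2 ^ (8 * N) * (1/2) ^ (J * Q)) * (1/2) ^ (idx z * P)) * wn al f"
proof -
 let ?K = "nat \<lfloor>t\<^sup>2\<rfloor>"
 let ?k = "%z'. kerA ?K (am CARD('d) ze s t) z z'"
 let ?g = "cut (farP (idx z) J) f"
 let ?q = "%z'. norm (z - z')"
 have [measurable]: "f \<in> bm" using f by (simp add: wadm_def)
 have wg: "wadm al ?g" by (rule wadm_cut[OF f]) measurable
 define u where "u z' = en (?q z' ^ (2 * N) * cmod (?k z'))" for z'
 define v where "v z' = en (cmod (?g z') / ?q z' ^ (2 * N))" for z'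
 have [measurable]: "u \<in> borel_measurable lborel" "v \<in> borel_measurable lborel" unfolding u_def v_def by measurable
 have am0: "am CARD('d) ze s t k = 0" if "k > ?K" for k by (rule am_zero[OF b s t that])
 define C where "C = sh_norm TYPE('d) * sh_bound TYPE('d) * B^2 * (t^2 + real N + 1) ^ CARD('d)"
 have C: "C >= 0" unfolding C_def by (intro mult_nonneg_nonneg sh_norm_nonneg sh_bound_nonneg) auto
 have "en (cmod (Tm ze s t ?g z)) <= (NN z'. en (norm (?k z' * ?g z')))"
  unfolding Tm_kernel(2)[OF wg] by (rule integral_norm_bound_ennreal[OF Tm_kernel(1)[OF wg]])
 also have "... <= (NN z'. u z' * v z')"
 proof (intro nn_integral_mono)
  fix z' :: "complex ^ 'd"
  show "en (norm (?k z' * ?g z')) <= u z' * v z'"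
  proof (cases "farP (idx z) J z'")
   case True
   hence "2 ^ (max (idx z) (idx z')) <= 4 * ?q z'" by (intro apart_dist) (simp add: farP_def)
   hence "?q z' > 0" by (smt (verit) zero_less_power)
   hence "norm (?k z' * ?g z') = (?q z' ^ (2 * N) * cmod (?k z')) * (cmod (?g z') / ?q z' ^ (2 * N))"
    by (simp add: norm_mult)
   thus ?thesis unfolding u_def v_def by (simp add: ennreal_mult[symmetric])
  qed (simp add: cut_def)
 qed
 finally have 1: "en (cmod (Tm ze s t ?g z)) <= (NN z'. u z' * v z')" .
 have "nq (Tm ze s t ?g z) = (en (cmod (Tm ze s t ?g z)))^2" by (simp add: ennreal_power)
 also have "... <= (NN z'. u z' * v z')^2" using 1 by (rule power_mono) simp
 also have "... <= (NN z'. (u z')^2) * (NN z'. (v z')^2)"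
  by (rule Cauchy_Schwarz_nn_integral) measurable
 also have "... <= en C * (en ((2 ^ (8 * N) * (1/2) ^ (J * Q)) * (1/2) ^ (idx z * P)) * wn al f)"
 proof (intro mult_mono)
  have "(NN z'. (u z')^2) = (NN z'. en ((?q z' ^ (2 * N) * cmod (?k z'))^2))"
   unfolding u_def by (intro nn_integral_cong) (simp add: ennreal_power)
  also have "... <= en (sh_norm TYPE('d) * sh_bound TYPE('d) * B^2 * (real (?K + N) + 1) ^ CARD('d))"
   by (rule kerA_weighted_L2[OF am0 B])
  also have "... <= en C"
   unfolding C_def using t
   by (intro ennreal_leI mult_left_mono power_mono mult_nonneg_nonneg sh_norm_nonneg sh_bound_nonneg) auto
  finally show "(NN z'. (u z')^2) <= en C" .
  define c where "c = (2 ^ (8 * N) * (1/2) ^ (J * Q)) * (1/2::real) ^ (idx z * P)"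
  have c: "c >= 0" by (simp add: c_def)
  have pt: "(v z')^2 <= en c * (nq (f z') * en (weight al z'))" for z'
  proof (cases "farP (idx z) J z'")
   case True
   let ?x = "max (idx z) (idx z')"
   have qx: "2 ^ ?x <= 4 * ?q z'" using True by (intro apart_dist) (simp add: farP_def)
   hence q0: "?q z' > 0" by (smt (verit) zero_less_power)
   have "1 / ?q z' <= 4 * (1/2) ^ ?x" using qx q0 by (simp add: field_simps)
   hence "(1 / ?q z') ^ (4 * N) <= (4 * (1/2) ^ ?x) ^ (4 * N)" using q0 by (intro power_mono) auto
   also have "... = 2 ^ (8 * N) * (1/2) ^ (?x * (4 * N))"
   proof -
    have "(4::real) ^ (4 * N) = (2 ^ 2) ^ (4 * N)" by simp
    also have "... = 2 ^ (8 * N)" by (simp only: power_mult[symmetric]) simp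
    finally show ?thesis by (simp only: power_mult_distrib power_mult[symmetric])
   qed
   also have "(1/2::real) ^ (?x * (4 * N)) <= (1/2) ^ (J * Q + idx z * P + idx z' * P)"
   proof (intro power_decreasing)
    have "J * Q <= ?x * Q" using True by (intro mult_le_mono) (auto simp: farP_def)
    moreover have "idx z * P <= ?x * P" "idx z' * P <= ?x * P" by (auto intro: mult_le_mono)
    moreover have "?x * (4 * N) = ?x * Q + ?x * P + ?x * P" unfolding Q by (simp add: algebra_simps)
    ultimately show "J * Q + idx z * P + idx z' * P <= ?x * (4 * N)" by linarith
   qed auto
   also have "2 ^ (8 * N) * (1/2::real) ^ (J * Q + idx z * P + idx z' * P) = c * (1/2) ^ (idx z' * P)"
    by (simp add: c_def power_add)
   also have "... <= c * weight al z'" unfolding weight_idx by (intro mult_left_mono half_pow_le_weight P c)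
   finally have "(1 / ?q z') ^ (4 * N) <= c * weight al z'" by simp
   hence "(cmod (f z'))^2 * (1 / ?q z') ^ (4 * N) <= (cmod (f z'))^2 * (c * weight al z')"
    by (intro mult_left_mono) auto
   moreover have "(cmod (?g z') / ?q z' ^ (2 * N))^2 = (cmod (f z'))^2 * (1 / ?q z') ^ (4 * N)"
    using True by (simp add: cut_def power_divide power_mult[symmetric] power_one_over mult.commute)
   ultimately have "(cmod (?g z') / ?q z' ^ (2 * N))^2 <= c * ((cmod (f z'))^2 * weight al z')" by (simp add: mult_ac)
   thus ?thesis unfolding v_def using c weight_pos[of al z']
    by (simp add: ennreal_power ennreal_mult[symmetric] less_imp_le ennreal_leI)
  qed (simp add: v_def cut_def)
  have "(NN z'. (v z')^2) <= (NN z'. en c * (nq (f z') * en (weight al z')))"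
   by (intro nn_integral_mono pt)
  also have "... = en c * wn al f" unfolding wn_def by (rule nn_integral_cmult) measurable
  finally show "(NN z'. (v z')^2) <= en c * wn al f" .
 qed auto
 also have "... = en (C * (2 ^ (8 * N) * (1/2) ^ (J * Q)) * (1/2) ^ (idx z * P)) * wn al f"
  using C by (simp add: mult.assoc[symmetric] ennreal_mult[symmetric])
 finally show ?thesis unfolding C_def .
qed

lemma idx_decay_integral:
 assumes P: "DIM(complex ^ 'd::finite) + 2 <= P"
 shows "(NN z. en ((1/2) ^ (idx (z :: complex ^ 'd) * P))) < \<infinity>"
proof -
 let ?D = "DIM(complex ^ 'd) + 2"
 have "(NN z. en ((1/2) ^ (idx (z :: complex ^ 'd) * P))) <= (NN z. en (2 ^ ?D * (1 / (1 + norm (z :: complex ^ 'd)) ^ ?D)))"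
 proof (intro nn_integral_mono ennreal_leI)
  fix z :: "complex ^ 'd"
  have p: "1 + norm z > 0" by (simp add: add_pos_nonneg)
  have "(1/2::real) ^ (idx z * P) <= (1/2) ^ (idx z * ?D)" using P by (intro power_decreasing mult_le_mono) auto
  also have "... = ((1/2) ^ idx z) ^ ?D" by (simp only: power_mult)
  also have "... <= (2 / (1 + norm z)) ^ ?D"
  proof (intro power_mono)
   show "(1/2) ^ idx z <= 2 / (1 + norm z)" using norm_le_two_idx[of z] p by (simp add: field_simps)
  qed simp
  also have "... = 2 ^ ?D * (1 / (1 + norm z) ^ ?D)" by (simp only: power_divide) simp
  finally show "(1/2) ^ (idx z * P) <= 2 ^ ?D * (1 / (1 + norm z) ^ ?D)" .
 qed
 also have "... < \<infinity>"
 proof -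
  have "integrable lborel (%z::complex ^ 'd. 2 ^ ?D * (1 / (1 + norm z) ^ ?D))"
   by (intro integrable_mult_right integrable_poly_decay_aux)
  hence "(NN z. en (norm (2 ^ ?D * (1 / (1 + norm (z :: complex ^ 'd)) ^ ?D)))) < \<infinity>"
   unfolding integrable_iff_bounded by blast
  moreover have "norm (2 ^ ?D * (1 / (1 + norm z) ^ ?D)) = 2 ^ ?D * (1 / (1 + norm z) ^ ?D)" for z :: "complex ^ 'd"
   unfolding real_norm_def by (rule abs_of_nonneg) auto
  ultimately show ?thesis by (simp only:)
 qed
 finally show ?thesis .
qed

lemma nn_integral_idx:
 fixes g :: "complex ^ 'd::finite => ennreal"
 assumes [measurable]: "g \<in> bm"
 shows "(NN z. g z) = (\<Sum>i. (NN z. g z * indicator (annulus i) z))"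
proof -
 have "g z = (\<Sum>i. g z * indicator (annulus i) z)" for z
 proof -
  have "(\<Sum>i. g z * indicator (annulus i) z) = (\<Sum>i. if i = idx z then g z else 0)"
   by (intro suminf_cong) (auto simp: indicator_def annulus_idx)
  also have "... = g z" using suminf_finite[of "{idx z}" "%i. if i = idx z then g z else 0"] by simp
  finally show ?thesis by simp
 qed
 hence "(NN z. g z) = (NN z. (\<Sum>i. g z * indicator (annulus i) z))" by simp
 also have "... = (\<Sum>i. (NN z. g z * indicator (annulus i) z))"
  using annulus_borel by (intro nn_integral_suminf borel_measurable_times_ennreal borel_measurable_indicator) auto
 finally show ?thesis .
qed

text \<open>Up to annulus J the weight is at least 2^(-al J). Truncation therefore leads from the
  weighted space to L2, where orthogonality is available, at this price.\<close>

lemma square_integrable_cut: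
 assumes f: "wadm al f" and P[measurable]: "Measurable.pred borel P" and b: "!!z. P z ==> idx z <= J"
 shows "square_integrable lborel (cut P f)" "(NN z. nq (cut P f z)) <= en (2 powr (al * real J)) * wn al f"
proof -
 have [measurable]: "f \<in> bm" and a: "al >= 0" and w: "wn al f < \<infinity>" using f by (auto simp: wadm_def)
 have "(NN z. nq (cut P f z)) <= (NN z. en (2 powr (al * real J)) * (nq (f z) * wt al z))"
 proof (intro nn_integral_mono)
  fix z
  show "nq (cut P f z) <= en (2 powr (al * real J)) * (nq (f z) * wt al z)"
  proof (cases "P z")
   case True
   have "1 <= 2 powr (al * real J) * weight al z"
   proof -
    have "al * real (idx z) <= al * real J" using b[OF True] a by (intro mult_left_mono) auto
    thus ?thesis unfolding weight_idx powr_add[symmetric] by (intro ge_one_powr_ge_zero) auto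
   qed
   hence "(cmod (f z))^2 * 1 <= (cmod (f z))^2 * (2 powr (al * real J) * weight al z)" by (intro mult_left_mono) auto
   hence "(cmod (f z))^2 <= 2 powr (al * real J) * ((cmod (f z))^2 * weight al z)" by (simp add: mult_ac)
   thus ?thesis using True weight_pos[of al z] by (simp add: cut_def ennreal_mult[symmetric] less_imp_le ennreal_leI)
  qed (simp add: cut_def)
 qed
 also have "... = en (2 powr (al * real J)) * wn al f" unfolding wn_def by (rule nn_integral_cmult) measurable
 finally show 1: "(NN z. nq (cut P f z)) <= en (2 powr (al * real J)) * wn al f" .
 thus "square_integrable lborel (cut P f)"
  unfolding square_integrable_iff using w by (auto intro: le_less_trans simp: ennreal_mult_less_top)
qed

lemma near_sq: "wadm al f ==> square_integrable lborel (cut (nearP i) f)"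
 by (rule square_integrable_cut(1)[where J = "i + 1"]) (auto simp: nearP_def apart_def)

lemma low_sq: "wadm al f ==> square_integrable lborel (cut (lowP i J) f)"
 by (rule square_integrable_cut(1)[where J = J]) (auto simp: lowP_def)

section \<open>Global and local estimates for the multiplier operators\<close>

lemma measurable_Tm:
 assumes "square_integrable lborel f" shows "(%z. Tm ze s t f z) \<in> bm"
 unfolding Tm_def using borel_measurable_spj[OF assms] by measurable

lemma Tm_L2:
 fixes f :: "'d::finite fld"
 assumes "square_integrable lborel f"
 shows "(NN z. nq (Tm ze s t f z)) <= en (sh_norm TYPE('d)) * (\<Sum>k. en ((am CARD('d) ze s t k)^2) * en (pen k f))"
proof -
 have "(NN z. nq (Tm ze s t f z)) <= en (sh_norm TYPE('d) * (\<Sum>k\<le>nat \<lfloor>t\<^sup>2\<rfloor>. (am CARD('d) ze s t k)^2 * pen k f))"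
  unfolding Tm_def by (rule spectral_L2[OF assms])
 also have "... = en (sh_norm TYPE('d)) * (\<Sum>k\<le>nat \<lfloor>t\<^sup>2\<rfloor>. en ((am CARD('d) ze s t k)^2) * en (pen k f))"
  by (simp add: ennreal_mult sh_norm_nonneg pen_nonneg sum_nonneg sum_ennreal[symmetric])
 also have "... <= en (sh_norm TYPE('d)) * (\<Sum>k. en ((am CARD('d) ze s t k)^2) * en (pen k f))"
  by (intro mult_left_mono sum_le_suminf) auto
 finally show ?thesis .
qed

text \<open>On a ball the levels are no longer orthogonal, so Cauchy-Schwarz over the at most s t^2
  + 1 active ones takes the place of orthogonality. Each active eigenvalue is at least t^2 / 2,
  which gives the trace factor 2^i / t.\<close>

lemma Tm_trace:
 fixes f :: "'d::finite fld"
 assumes f: "square_integrable lborel f" and b: "bump M A ze" and s: "0 < s" "s <= 1/4" and t: "1 <= t"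
 shows "(NN z. nq (Tm ze s t f z) * indicator (annulus i) z)
  <= en (32 * real CARD('d) * 2 ^ i * (s * t^2 + 1) / t * sh_norm TYPE('d)) * (\<Sum>k. en ((am CARD('d) ze s t k)^2) * en (pen k f))"
proof -
 let ?a = "am CARD('d) ze s t"
 define S where "S = {k. ?a k ~= 0}"
 have S: "finite S" "real (card S) <= s * t^2 + 1" unfolding S_def by (rule am_count[OF b s t])+
 have SK: "S \<subseteq> {..nat \<lfloor>t\<^sup>2\<rfloor>}" using am_zero[OF b s(1) t] unfolding S_def by (metis (mono_tags, lifting) atMost_iff mem_Collect_eq not_le subsetI)
 have T: "Tm ze s t f z = (\<Sum>k\<in>S. of_real (?a k) * spj k f z)" for z
  unfolding Tm_def by (rule sum.mono_neutral_right) (use SK in \<open>auto simp: S_def\<close>)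
 let ?n = "s * t^2 + 1"
 have n: "?n >= 0" using s by simp
 have [measurable]: "(%z. spj k f z) \<in> bm" for k by (rule borel_measurable_spj[OF f])
 have pt: "nq (Tm ze s t f z) * indicator (annulus i) z
   <= (\<Sum>k\<in>S. en (?n * (?a k)^2) * (nq (spj k f z) * indicator (cball 0 (2 ^ i)) z))" for z
 proof (cases "z \<in> annulus i")
  case True
  hence zb: "z \<in> cball 0 (2 ^ i)" using idx_le[of z] by (simp add: annulus_idx)
  have "(cmod (Tm ze s t f z))^2 <= (\<Sum>k\<in>S. cmod (of_real (?a k) * spj k f z))^2"
   unfolding T by (intro power_mono norm_sum) auto
  also have "... = (\<Sum>k\<in>S. 1 * cmod (of_real (?a k) * spj k f z))^2" by simp
  also have "... <= (\<Sum>k\<in>S. 1^2) * (\<Sum>k\<in>S. (cmod (of_real (?a k) * spj k f z))^2)"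
   by (rule Cauchy_Schwarz_ineq_sum)
  also have "... <= ?n * (\<Sum>k\<in>S. (cmod (of_real (?a k) * spj k f z))^2)"
   using S by (intro mult_right_mono sum_nonneg) auto
  also have "... = (\<Sum>k\<in>S. (?n * (?a k)^2) * (cmod (spj k f z))^2)"
   by (simp add: sum_distrib_left norm_mult power_mult_distrib mult.assoc)
  finally have "nq (Tm ze s t f z) <= en (\<Sum>k\<in>S. (?n * (?a k)^2) * (cmod (spj k f z))^2)"
   by (rule ennreal_leI)
  also have "... = (\<Sum>k\<in>S. en (?n * (?a k)^2) * (nq (spj k f z) * indicator (cball 0 (2 ^ i)) z))"
   using zb n by (subst sum_ennreal[symmetric]) (auto simp: ennreal_mult intro!: sum.cong)
  finally show ?thesis using True by simp
 qed simp
 have "(NN z. nq (Tm ze s t f z) * indicator (annulus i) z)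
  <= (NN z. (\<Sum>k\<in>S. en (?n * (?a k)^2) * (nq (spj k f z) * indicator (cball 0 (2 ^ i)) z)))"
  by (intro nn_integral_mono pt)
 also have "... = (\<Sum>k\<in>S. en (?n * (?a k)^2) * (NN z. nq (spj k f z) * indicator (cball 0 (2 ^ i)) z))"
  by (subst nn_integral_sum) (auto intro!: sum.cong nn_integral_cmult borel_measurable_times_ennreal borel_measurable_indicator)
 also have "... <= (\<Sum>k\<in>S. en (32 * real CARD('d) * 2 ^ i * ?n / t * sh_norm TYPE('d)) * (en ((?a k)^2) * en (pen k f)))"
 proof (intro sum_mono)
  fix k assume k: "k \<in> S"
  have "t^2 / 2 <= 2 * real k + real CARD('d)" using am_window(1)[OF b s t] k by (auto simp: S_def)
  hence "(t / 2)^2 <= 2 * real k + real CARD('d)" using zero_le_power2[of t] by (simp add: power_divide)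
  hence rt: "t / 2 <= sqrt (2 * real k + real CARD('d))" by (rule real_le_rsqrt)
  have "(NN z. nq (spj k f z) * indicator (cball 0 (2 ^ i)) z)
    <= en (16 * real CARD('d) * 2 ^ i / sqrt (2 * real k + real CARD('d)) * (sh_norm TYPE('d) * pen k f))"
   by (rule spectral_trace[OF f]) simp
  also have "... <= en (16 * real CARD('d) * 2 ^ i / (t / 2) * (sh_norm TYPE('d) * pen k f))"
  proof (intro ennreal_leI mult_right_mono mult_nonneg_nonneg sh_norm_nonneg pen_nonneg divide_left_mono rt)
   have "t / 2 > 0" using t by simp
   thus "0 < sqrt (2 * real k + real CARD('d)) * (t / 2)" using rt by (intro mult_pos_pos) linarith+
  qed auto
  finally have "en (?n * (?a k)^2) * (NN z. nq (spj k f z) * indicator (cball 0 (2 ^ i)) z)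
    <= en (?n * (?a k)^2) * en (16 * real CARD('d) * 2 ^ i / (t / 2) * (sh_norm TYPE('d) * pen k f))"
   by (intro mult_left_mono) auto
  also have "... = en (32 * real CARD('d) * 2 ^ i * ?n / t * sh_norm TYPE('d)) * (en ((?a k)^2) * en (pen k f))"
  proof -
   let ?c = "32 * real CARD('d) * 2 ^ i * ?n / t * sh_norm TYPE('d)"
   have c: "?c >= 0" using t n sh_norm_nonneg[of "TYPE('d)"] by (intro mult_nonneg_nonneg divide_nonneg_nonneg) auto
   have p: "16 * real CARD('d) * 2 ^ i / (t / 2) * (sh_norm TYPE('d) * pen k f) >= 0"
    using t sh_norm_nonneg[of "TYPE('d)"] pen_nonneg[of k f] by (intro mult_nonneg_nonneg divide_nonneg_nonneg) auto
   have "en (?n * (?a k)^2) * en (16 * real CARD('d) * 2 ^ i / (t / 2) * (sh_norm TYPE('d) * pen k f))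
     = en (?n * (?a k)^2 * (16 * real CARD('d) * 2 ^ i / (t / 2) * (sh_norm TYPE('d) * pen k f)))"
    using n p by (intro ennreal_mult[symmetric]) auto
   also have "?n * (?a k)^2 * (16 * real CARD('d) * 2 ^ i / (t / 2) * (sh_norm TYPE('d) * pen k f)) = ?c * ((?a k)^2 * pen k f)"
    using t by (simp add: divide_simps)
   also have "en (?c * ((?a k)^2 * pen k f)) = ennreal ?c * (en ((?a k)^2) * en (pen k f))"
    using c pen_nonneg[of k f] by (simp only: ennreal_mult zero_le_power2 mult_nonneg_nonneg)
   finally show ?thesis .
  qed
  finally show "en (?n * (?a k)^2) * (NN z. nq (spj k f z) * indicator (cball 0 (2 ^ i)) z) <= ..." .
 qed
 also have "... <= en (32 * real CARD('d) * 2 ^ i * ?n / t * sh_norm TYPE('d)) * (\<Sum>k. en ((?a k)^2) * en (pen k f))"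
  unfolding sum_distrib_left[symmetric] by (intro mult_left_mono sum_le_suminf S(1)) auto
 finally show ?thesis .
qed

section \<open>The square function\<close>

definition enS :: "(real => real) => real => real => ('d::finite fld) => ennreal" where
 "enS ze s t g = (\<Sum>k. en ((am CARD('d) ze s t k)^2) * en (pen k g))"

lemma measurable_am: assumes "continuous_on UNIV ze" shows "(%t. am d ze s t k) \<in> bm"
proof -
 have [measurable]: "ze \<in> bm" using assms by (rule borel_measurable_continuous_onI)
 show ?thesis unfolding am_def by measurable
qed

lemma enS_measurable: assumes "continuous_on UNIV ze" shows "(%t. enS ze s t g) \<in> bm"
 unfolding enS_def using measurable_am[OF assms] by measurable

text \<open>Integration in t comes first: every level contributes its energy times a dt/t-measure of
  order s, and the energies are then summed by Bessel.\<close>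

lemma enS_integral:
 fixes g :: "'d::finite fld"
 assumes g: "square_integrable lborel g" and b: "bump (Suc M) A ze" and s: "0 < s" "s <= 1/4"
 shows "(NN t. enS ze s t g * (dlog t))
  <= en (4 * A^2 * s * sh_norm TYPE('d)) * (NN z. nq (g z))"
proof -
 have [measurable]: "(%t. am CARD('d) ze s t k) \<in> bm" for k
  by (rule measurable_am[OF bump_continuous[OF b]])
 have d: "CARD('d) >= 1" by (simp add: Suc_leI)
 have "(NN t. enS ze s t g * (dlog t))
  = (NN t. (\<Sum>k. en (pen k g) * (en ((am CARD('d) ze s t k)^2 / t) * indicator {1..} t)))"
 proof (intro nn_integral_cong)
  fix t :: real
  show "enS ze s t g * (dlog t) = (\<Sum>k. en (pen k g) * (en ((am CARD('d) ze s t k)^2 / t) * indicator {1..} t))"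
  proof (cases "t >= 1")
   case True
   have e: "en ((am CARD('d) ze s t k)^2 / t) = en ((am CARD('d) ze s t k)^2) * en (1 / t)" for k
    using True by (subst ennreal_mult[symmetric]) auto
   show ?thesis using True unfolding enS_def e
    by (simp only: ennreal_suminf_multc[symmetric] indicator_simps(1) atLeast_iff mult_1_right) (simp only: mult_ac)
  qed simp
 qed
 also have "... = (\<Sum>k. en (pen k g) * (NN t. en ((am CARD('d) ze s t k)^2 / t) * indicator {1..} t))"
  by (subst nn_integral_suminf) (auto intro!: suminf_cong nn_integral_cmult)
 also have "... <= (\<Sum>k. en (pen k g) * en (4 * A^2 * s))"
  by (intro suminf_le mult_left_mono am_window_integral[OF b s d]) auto
 also have "... = (\<Sum>k. en (pen k g)) * en (4 * A^2 * s)" by (simp add: ennreal_suminf_multc)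
 also have "(\<Sum>k. en (pen k g)) <= en (sh_norm TYPE('d)) * (NN z. nq (g z))"
 proof (rule suminf_le_const)
  fix n
  have "(\<Sum>k<n. en (pen k g)) = en (\<Sum>k<n. pen k g)" by (simp add: sum_ennreal pen_nonneg)
  also have "... <= en (sh_norm TYPE('d) * (LI z. (cmod (g z))^2))"
   by (intro ennreal_leI pen_sum_le g) auto
  finally show "(\<Sum>k<n. en (pen k g)) <= en (sh_norm TYPE('d)) * (NN z. nq (g z))"
   by (simp add: square_integrable_nn[OF g] ennreal_mult sh_norm_nonneg)
 qed simp
 also have "en (sh_norm TYPE('d)) * (NN z. nq (g z)) * en (4 * A^2 * s)
   = en (4 * A^2 * s * sh_norm TYPE('d)) * (NN z. nq (g z))"
  using s sh_norm_nonneg[of "TYPE('d)"] by (simp add: ennreal_mult mult_ac)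
 finally show ?thesis by (simp add: mult_right_mono)
qed

text \<open>A point is near to at most three annuli, and the weights of neighbouring annuli differ
  at most by the factor 2^al.\<close>

lemma near_weight_sum:
 fixes f :: "'d::finite fld"
 assumes f: "wadm al f"
 shows "(\<Sum>i. en (2 powr (- al * real i)) * (NN z. nq (cut (nearP i) f z))) <= en (3 * 2 powr al) * wn al f"
proof -
 have [measurable]: "f \<in> bm" and a: "al >= 0" using f by (auto simp: wadm_def)
 have [measurable]: "cut (nearP i) f \<in> bm" for i by measurable
 have "(\<Sum>i. en (2 powr (- al * real i)) * (NN z. nq (cut (nearP i) f z)))
   = (NN z. (\<Sum>i. en (2 powr (- al * real i)) * nq (cut (nearP i) f z)))"
  by (subst nn_integral_suminf) (auto intro!: suminf_cong nn_integral_cmult[symmetric])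
 also have "... <= (NN z. en (3 * 2 powr al) * (nq (f z) * wt al z))"
 proof (intro nn_integral_mono)
  fix z :: "complex ^ 'd"
  let ?j = "idx z"
  let ?N = "{?j - 1..?j + 1}"
  have "(\<Sum>i. en (2 powr (- al * real i)) * nq (cut (nearP i) f z))
   = (\<Sum>i\<in>?N. en (2 powr (- al * real i)) * nq (cut (nearP i) f z))"
   by (rule suminf_finite) (auto simp: cut_def nearP_def apart_def)
  also have "... <= (\<Sum>i\<in>?N. en (2 powr al * weight al z * (cmod (f z))^2))"
  proof (intro sum_mono)
   fix i assume i: "i \<in> ?N"
   have "2 powr (- al * real i) <= 2 powr (al + - al * real ?j)"
   proof (intro powr_mono)
    have "al * (real ?j - 1) <= al * real i" using i a by (intro mult_left_mono) auto
    thus "- al * real i <= al + - al * real ?j" by (simp add: algebra_simps)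
   qed simp
   hence "2 powr (- al * real i) <= 2 powr al * weight al z" by (simp only: weight_idx powr_add)
   hence "2 powr (- al * real i) * (cmod (cut (nearP i) f z))^2 <= 2 powr al * weight al z * (cmod (f z))^2"
    using weight_pos[of al z] by (intro mult_mono) (auto simp: cut_def intro!: mult_nonneg_nonneg less_imp_le)
   thus "en (2 powr (- al * real i)) * nq (cut (nearP i) f z) <= en (2 powr al * weight al z * (cmod (f z))^2)"
    by (simp add: ennreal_mult[symmetric] ennreal_leI)
  qed
  also have "... = of_nat (card ?N) * en (2 powr al * weight al z * (cmod (f z))^2)" by simp
  also have "... <= en 3 * en (2 powr al * weight al z * (cmod (f z))^2)"
  proof (intro mult_right_mono)
   have "of_nat (card ?N) = en (real (card ?N))" by (simp add: ennreal_of_nat_eq_real_of_nat)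
   also have "... <= en 3" by (intro ennreal_leI) auto
   finally show "of_nat (card ?N) <= en 3" .
  qed simp
  also have "... = en (3 * 2 powr al) * (nq (f z) * wt al z)"
   using weight_pos[of al z] by (simp add: ennreal_mult[symmetric] less_imp_le mult_ac del: ennreal_numeral)
  finally show "(\<Sum>i. en (2 powr (- al * real i)) * nq (cut (nearP i) f z)) <= ..." .
 qed
 also have "... = en (3 * 2 powr al) * wn al f" unfolding wn_def by (rule nn_integral_cmult) measurable
 finally show ?thesis .
qed

lemma sum3_sq_le: "(a + b + c)^2 <= 3 * (a^2 + b^2 + c^2)" for a b c :: real
 using sum_squares_bound[of a b] sum_squares_bound[of a c] sum_squares_bound[of b c]
 by (simp add: power2_eq_square algebra_simps)

lemma Tm_three_split:
 fixes f :: "'d::finite fld"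
 assumes f: "wadm al f"
 shows "Tm ze s t f z = Tm ze s t (cut (nearP i) f) z + Tm ze s t (cut (lowP i J) f) z + Tm ze s t (cut (farP i J) f) z"
proof -
 let ?g = "cut (%z. \<not> nearP i z) f"
 have g: "wadm al ?g" by (rule wadm_cut[OF f]) measurable
 have e: "cut (lowP i J) ?g = cut (lowP i J) f" "cut (%z. \<not> lowP i J z) ?g = cut (farP i J) f"
  by (auto simp: cut_def fun_eq_iff nearP_def lowP_def farP_def)
 have "Tm ze s t f z = Tm ze s t (cut (nearP i) f) z + Tm ze s t ?g z"
  by (rule Tm_split[OF f]) measurable
 moreover have "Tm ze s t ?g z = Tm ze s t (cut (lowP i J) ?g) z + Tm ze s t (cut (%z. \<not> lowP i J z) ?g) z"
  by (rule Tm_split[OF g]) measurable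
 ultimately show ?thesis unfolding e by simp
qed

lemma Tm_zero: "Tm ze s t (%_. 0) z = 0"
 by (simp add: Tm_def spj_def)

lemma ind_suminf: "(\<Sum>i. g i * indicator (annulus i) z) = (g (idx z) :: ennreal)"
proof -
 have "(\<Sum>i. g i * indicator (annulus i) z) = (\<Sum>i. if i = idx z then g i else 0)"
  by (intro suminf_cong) (auto simp: indicator_def annulus_idx)
 also have "... = g (idx z)" using suminf_finite[of "{idx z}" "%i. if i = idx z then g i else 0"] by simp
 finally show ?thesis .
qed

text \<open>The weight is constant on each annulus, so each annulus gets its own splitting of f into
  three parts. Near parts are handled by global orthogonality; the bounds for the other two are
  hypotheses because they depend on the relation between t and s.\<close>

lemma fixed_t_estimate:
 fixes f :: "'d::finite fld"
 assumes f: "wadm al f" and F: "F >= 0"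
  and low: "!!i. i <= J ==> (NN z. nq (Tm ze s t (cut (lowP i J) f) z) * indicator (annulus i) z) <= en (b i) * enS ze s t (cut (lowP i J) f)"
  and far: "!!z. nq (Tm ze s t (cut (farP (idx z) J) f) z) <= en (F * (1/2) ^ (idx z * P)) * wn al f"
 shows "(NN z. nq (Tm ze s t f z) * wt al z) <=
   3 * ((\<Sum>i. en (2 powr (- al * real i)) * (en (sh_norm TYPE('d)) * enS ze s t (cut (nearP i) f)))
    + (\<Sum>i\<le>J. en (2 powr (- al * real i)) * (en (b i) * enS ze s t (cut (lowP i J) f)))
    + en F * (wn al f * (NN z. en ((1/2) ^ (idx (z :: complex ^ 'd) * P)))))"
proof -
 have a: "al >= 0" using f by (simp add: wadm_def)
 let ?w = "%i. en (2 powr (- al * real i))"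
 let ?n = "%i z. nq (Tm ze s t (cut (nearP i) f) z)"
 let ?l = "%i z. nq (Tm ze s t (cut (lowP i J) f) z)"
 let ?V = "%z :: complex ^ 'd. en ((1/2) ^ (idx z * P))"
 have [measurable]: "?n i \<in> bm" "?l i \<in> bm" for i
  using measurable_Tm[OF near_sq[OF f]] measurable_Tm[OF low_sq[OF f]] by measurable
 have [measurable]: "annulus i \<in> sets borel" for i by (rule annulus_borel)
 have pt: "nq (Tm ze s t f z) * wt al z <= 3 * ((\<Sum>i. ?w i * (?n i z * indicator (annulus i) z))
   + (\<Sum>i\<le>J. ?w i * (?l i z * indicator (annulus i) z)) + en F * (wn al f * ?V z))" for z
 proof -
  let ?i = "idx z"
  let ?F = "nq (Tm ze s t (cut (farP ?i J) f) z)"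
  have w: "wt al z = ?w ?i" by (simp add: weight_idx)
  have "(cmod (Tm ze s t f z))^2 <= (cmod (Tm ze s t (cut (nearP ?i) f) z) + cmod (Tm ze s t (cut (lowP ?i J) f) z) + cmod (Tm ze s t (cut (farP ?i J) f) z))^2"
   unfolding Tm_three_split[OF f, of ze s t z ?i J]
   by (intro power_mono order_trans[OF norm_triangle_ineq] add_mono norm_triangle_ineq) auto
  also have "... <= 3 * ((cmod (Tm ze s t (cut (nearP ?i) f) z))^2 + (cmod (Tm ze s t (cut (lowP ?i J) f) z))^2 + (cmod (Tm ze s t (cut (farP ?i J) f) z))^2)"
   by (rule sum3_sq_le)
  finally have "nq (Tm ze s t f z) <= en (3 * ((cmod (Tm ze s t (cut (nearP ?i) f) z))^2 + (cmod (Tm ze s t (cut (lowP ?i J) f) z))^2 + (cmod (Tm ze s t (cut (farP ?i J) f) z))^2))"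
   by (rule ennreal_leI)
  also have "... = 3 * (?n ?i z + ?l ?i z + ?F)" by (simp add: ennreal_mult ennreal_plus)
  finally have "nq (Tm ze s t f z) * wt al z <= 3 * (?n ?i z + ?l ?i z + ?F) * wt al z"
   by (rule mult_right_mono) simp
  also have "... = 3 * (?w ?i * ?n ?i z + ?w ?i * ?l ?i z + ?w ?i * ?F)"
   unfolding w by (simp add: distrib_left distrib_right mult_ac)
  also have "... <= 3 * ((\<Sum>i. ?w i * (?n i z * indicator (annulus i) z))
   + (\<Sum>i\<le>J. ?w i * (?l i z * indicator (annulus i) z)) + en F * (wn al f * ?V z))"
  proof (intro mult_left_mono add_mono)
   show "?w ?i * ?n ?i z <= (\<Sum>i. ?w i * (?n i z * indicator (annulus i) z))"
    using ind_suminf[of "%i. ?w i * ?n i z" z] by (simp add: mult.assoc)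
   show "?w ?i * ?l ?i z <= (\<Sum>i\<le>J. ?w i * (?l i z * indicator (annulus i) z))"
   proof (cases "?i <= J")
    case True
    have "?w ?i * ?l ?i z = ?w ?i * (?l ?i z * indicator (annulus ?i) z)" by (simp add: indicator_def annulus_idx)
    also have "... <= (\<Sum>i\<le>J. ?w i * (?l i z * indicator (annulus i) z))"
     by (rule member_le_sum) (use True in auto)
    finally show ?thesis .
   next
    case False
    hence "cut (lowP ?i J) f = (%_. 0)" by (auto simp: cut_def lowP_def fun_eq_iff)
    thus ?thesis by (simp add: Tm_zero)
   qed
   have "?w ?i * ?F <= 1 * ?F"
   proof (intro mult_right_mono)
    show "?w ?i <= 1" using weight_le_1[OF a, of z] unfolding weight_idx by simp
   qed simp
   also have "... <= en (F * (1/2) ^ (?i * P)) * wn al f" using far[of z] by simp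
   also have "... = en F * (wn al f * ?V z)" using F by (simp add: ennreal_mult mult_ac)
   finally show "?w ?i * ?F <= en F * (wn al f * ?V z)" .
  qed simp
  finally show ?thesis .
 qed
 have "(NN z. nq (Tm ze s t f z) * wt al z) <=
   (NN z. 3 * ((\<Sum>i. ?w i * (?n i z * indicator (annulus i) z)) + (\<Sum>i\<le>J. ?w i * (?l i z * indicator (annulus i) z)) + en F * (wn al f * ?V z)))"
  by (intro nn_integral_mono pt)
 also have "... = 3 * ((\<Sum>i. ?w i * (NN z. ?n i z * indicator (annulus i) z))
   + (\<Sum>i\<le>J. ?w i * (NN z. ?l i z * indicator (annulus i) z)) + en F * (wn al f * (NN z. ?V z)))"
  by (simp add: nn_integral_cmult nn_integral_add nn_integral_suminf nn_integral_sum)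
 also have "... <= 3 * ((\<Sum>i. ?w i * (en (sh_norm TYPE('d)) * enS ze s t (cut (nearP i) f)))
    + (\<Sum>i\<le>J. ?w i * (en (b i) * enS ze s t (cut (lowP i J) f)))
    + en F * (wn al f * (NN z. ?V z)))"
 proof (intro mult_left_mono add_mono suminf_le sum_mono order_refl)
  fix i
  have "(NN z. ?n i z * indicator (annulus i) z) <= (NN z. ?n i z)"
   by (intro nn_integral_mono) (auto simp: indicator_def)
  also have "... <= en (sh_norm TYPE('d)) * enS ze s t (cut (nearP i) f)"
   unfolding enS_def by (rule Tm_L2[OF near_sq[OF f]])
  finally show "(NN z. ?n i z * indicator (annulus i) z) <= ..." .
 qed (auto intro: low)
 finally show ?thesis .
qed

section \<open>Dyadic blocks of the parameter t and the square function estimate\<close>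

definition blk :: "nat => real set" where "blk l = {2 ^ l..<2 ^ (l + 1)}"

lemma blk_ex: assumes "t >= 1" shows "EX l. t \<in> blk l"
proof -
 obtain n where n: "t < 2 ^ n" using real_arch_pow[of 2 t] by auto
 define m where "m = (LEAST n. t < 2 ^ n)"
 have m: "t < 2 ^ m" unfolding m_def using n by (rule LeastI)
 hence "m ~= 0" using assms by (intro notI) simp
 then obtain l where l: "m = Suc l" by (cases m) auto
 have "\<not> t < 2 ^ l" using not_less_Least[of l "%n. t < 2 ^ n"] l unfolding m_def by simp
 hence "t \<in> blk l" using m l by (simp add: blk_def)
 thus ?thesis by blast
qed

lemma blk_ge_1: "t \<in> blk l ==> t >= 1"
proof -
 assume "t \<in> blk l"
 moreover have "(1::real) <= 2 ^ l" by (rule one_le_power) simp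
 ultimately show "t >= 1" unfolding blk_def atLeastLessThan_iff by linarith
qed

lemma blk_measurable[measurable]: "blk l \<in> sets borel" by (simp add: blk_def)

lemma blk_integral: "(NN t. en (1 / t) * indicator (blk l) t) <= 1"
proof -
 have "(NN t. en (1 / t) * indicator (blk l) t) <= (NN t. en (1 / 2 ^ l) * indicator (blk l) t)"
 proof (intro nn_integral_mono)
  fix t :: real
  show "en (1 / t) * indicator (blk l) t <= en (1 / 2 ^ l) * indicator (blk l) t"
  proof (cases "t \<in> blk l")
   case True
   hence "(2::real) ^ l <= t" by (simp add: blk_def)
   hence "1 / t <= 1 / 2 ^ l" by (intro frac_le) auto
   thus ?thesis using True by (simp add: ennreal_leI)
  qed simp
 qed
 also have "... = en (1 / 2 ^ l) * en (2 ^ l)"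
  by (subst nn_integral_cmult_indicator) (auto simp: blk_def)
 also have "... = 1" by (subst ennreal_mult[symmetric]) auto
 finally show ?thesis .
qed

text \<open>The width of the kernel changes with t, so \<open>J\<close>, \<open>b\<close> and
  \<open>F\<close> may change from block to block. Near parts are integrated over all t at once by
  \<open>enS_integral\<close>; the low and far parts are summed over blocks, and their convergence
  is left to the choice of parameters.\<close>

lemma square_function_abstract:
 fixes f :: "'d::finite fld" and J :: "nat => nat" and b :: "nat => nat => real" and F :: "nat => real"
 assumes f: "wadm al f" and bp: "bump (Suc M) A ze" and s: "0 < s" "s <= 1/4" and F: "!!l. F l >= 0" and b0: "!!i l. b i l >= 0"
  and low: "!!l t i. t \<in> blk l ==> i <= J l ==> (NN z. nq (Tm ze s t (cut (lowP i (J l)) f) z) * indicator (annulus i) z) <= en (b i l) * enS ze s t (cut (lowP i (J l)) f)"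
  and far: "!!l t z. t \<in> blk l ==> nq (Tm ze s t (cut (farP (idx z) (J l)) f) z) <= en (F l * (1/2) ^ (idx z * P)) * wn al f"
 shows "(NN t. (NN z. nq (Tm ze s t f z) * wt al z) * (dlog t)) <=
   3 * (en (4 * A^2 * s * (sh_norm TYPE('d))^2 * (3 * 2 powr al))
    + (\<Sum>l. en (4 * A^2 * s * sh_norm TYPE('d)) * (\<Sum>i\<le>J l. en (2 powr (- al * real i) * b i l * 2 powr (al * real (J l)))))
    + (\<Sum>l. en (F l)) * (NN z. en ((1/2) ^ (idx (z :: complex ^ 'd) * P)))) * wn al f"
proof -
 let ?w = "%i. en (2 powr (- al * real i))"
 let ?V = "(NN z. en ((1/2) ^ (idx (z :: complex ^ 'd) * P)))"
 let ?c0 = "en (sh_norm TYPE('d))"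
 let ?N = "%t. \<Sum>i. ?w i * (?c0 * enS ze s t (cut (nearP i) f))"
 let ?L = "%l t. \<Sum>i\<le>J l. ?w i * (en (b i l) * enS ze s t (cut (lowP i (J l)) f))"
 have cont: "continuous_on UNIV ze" by (rule bump_continuous[OF bp])
 have [measurable]: "(%t. enS ze s t g) \<in> bm" for g :: "'d fld" by (rule enS_measurable[OF cont])
 have pt: "(NN z. nq (Tm ze s t f z) * wt al z) * (dlog t)
   <= 3 * (?N t * (dlog t) + (\<Sum>l. (?L l t + en (F l) * (wn al f * ?V)) * (en (1 / t) * indicator (blk l) t)))" for t
 proof (cases "t >= 1")
  case True
  obtain l where l: "t \<in> blk l" using blk_ex[OF True] by blast
  have "(NN z. nq (Tm ze s t f z) * wt al z) <= 3 * (?N t + ?L l t + en (F l) * (wn al f * ?V))"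
   by (rule fixed_t_estimate[OF f F low[OF l] far[OF l]])
  hence "(NN z. nq (Tm ze s t f z) * wt al z) * (dlog t) <= 3 * (?N t + ?L l t + en (F l) * (wn al f * ?V)) * (dlog t)"
   by (rule mult_right_mono) simp
  also have "... = 3 * (?N t * (dlog t) + (?L l t + en (F l) * (wn al f * ?V)) * (en (1 / t) * indicator (blk l) t))"
   using True l by (simp add: distrib_left distrib_right mult_ac add_ac)
  also have "... <= 3 * (?N t * (dlog t) + (\<Sum>l. (?L l t + en (F l) * (wn al f * ?V)) * (en (1 / t) * indicator (blk l) t)))"
   by (intro mult_left_mono add_left_mono term_le_suminf_ennreal) simp
  finally show ?thesis .
 qed simp
 have I1: "(NN t. ?N t * (dlog t)) <= en (4 * A^2 * s * (sh_norm TYPE('d))^2 * (3 * 2 powr al)) * wn al f"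
 proof -
  have "(NN t. ?N t * (dlog t)) = (NN t. (\<Sum>i. (?w i * ?c0) * (enS ze s t (cut (nearP i) f) * (dlog t))))"
   by (intro nn_integral_cong) (simp add: ennreal_suminf_multc[symmetric] mult.assoc)
  also have "... = (\<Sum>i. (?w i * ?c0) * (NN t. enS ze s t (cut (nearP i) f) * (dlog t)))"
   by (subst nn_integral_suminf) (auto intro!: suminf_cong nn_integral_cmult)
  also have "... <= (\<Sum>i. (?w i * ?c0) * (en (4 * A^2 * s * sh_norm TYPE('d)) * (NN z. nq (cut (nearP i) f z))))"
   by (intro suminf_le mult_left_mono enS_integral[OF near_sq[OF f] bp s]) auto
  also have "... = en (4 * A^2 * s * (sh_norm TYPE('d))^2) * (\<Sum>i. ?w i * (NN z. nq (cut (nearP i) f z)))"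
  proof -
   have e: "en (4 * A^2 * s * (sh_norm TYPE('d))^2) = ?c0 * en (4 * A^2 * s * sh_norm TYPE('d))"
   proof -
    have "0 <= 4 * A^2 * s * sh_norm TYPE('d)"
     using s sh_norm_nonneg[of "TYPE('d)"] by (intro mult_nonneg_nonneg) auto
    moreover have "4 * A^2 * s * (sh_norm TYPE('d))^2 = sh_norm TYPE('d) * (4 * A^2 * s * sh_norm TYPE('d))"
     by (simp add: power2_eq_square)
    ultimately show ?thesis using sh_norm_nonneg[of "TYPE('d)"] by (simp only: ennreal_mult)
   qed
   show ?thesis unfolding e ennreal_suminf_cmult[symmetric] by (simp add: mult_ac)
  qed
  also have "... <= en (4 * A^2 * s * (sh_norm TYPE('d))^2) * (en (3 * 2 powr al) * wn al f)"
   by (intro mult_left_mono near_weight_sum[OF f]) simp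
  also have "... = en (4 * A^2 * s * (sh_norm TYPE('d))^2 * (3 * 2 powr al)) * wn al f"
  proof -
   have p: "0 <= 4 * A^2 * s * (sh_norm TYPE('d))^2" using s by (intro mult_nonneg_nonneg) auto
   have q: "0 <= 3 * 2 powr al" by simp
   show ?thesis unfolding ennreal_mult[OF p q] by (simp only: mult.assoc)
  qed
  finally show ?thesis .
 qed
 have I2: "(NN t. (?L l t + en (F l) * (wn al f * ?V)) * (en (1 / t) * indicator (blk l) t))
   <= en (4 * A^2 * s * sh_norm TYPE('d)) * (\<Sum>i\<le>J l. en (2 powr (- al * real i) * b i l * 2 powr (al * real (J l)))) * wn al f + en (F l) * ?V * wn al f" for l
 proof -
  have "(NN t. (?L l t + en (F l) * (wn al f * ?V)) * (en (1 / t) * indicator (blk l) t))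
   = (NN t. (\<Sum>i\<le>J l. (?w i * en (b i l)) * (enS ze s t (cut (lowP i (J l)) f) * (en (1 / t) * indicator (blk l) t))) + (en (F l) * (wn al f * ?V)) * (en (1 / t) * indicator (blk l) t))"
   by (intro nn_integral_cong) (simp add: distrib_right sum_distrib_right mult.assoc)
  also have "... = (\<Sum>i\<le>J l. (?w i * en (b i l)) * (NN t. enS ze s t (cut (lowP i (J l)) f) * (en (1 / t) * indicator (blk l) t))) + (en (F l) * (wn al f * ?V)) * (NN t. en (1 / t) * indicator (blk l) t)"
   by (subst nn_integral_add) (auto simp: nn_integral_sum nn_integral_cmult)
  also have "... <= (\<Sum>i\<le>J l. (?w i * en (b i l)) * (en (4 * A^2 * s * sh_norm TYPE('d)) * (en (2 powr (al * real (J l))) * wn al f))) + (en (F l) * (wn al f * ?V)) * 1"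
  proof (intro add_mono sum_mono mult_left_mono blk_integral)
   fix i
   have "(NN t. enS ze s t (cut (lowP i (J l)) f) * (en (1 / t) * indicator (blk l) t))
     <= (NN t. enS ze s t (cut (lowP i (J l)) f) * (dlog t))"
    by (intro nn_integral_mono mult_left_mono) (auto simp: indicator_def blk_ge_1)
   also have "... <= en (4 * A^2 * s * sh_norm TYPE('d)) * (NN z. nq (cut (lowP i (J l)) f z))"
    by (rule enS_integral[OF low_sq[OF f] bp s])
   also have "... <= en (4 * A^2 * s * sh_norm TYPE('d)) * (en (2 powr (al * real (J l))) * wn al f)"
    by (intro mult_left_mono square_integrable_cut(2)[OF f]) (auto simp: lowP_def)
   finally show "(NN t. enS ze s t (cut (lowP i (J l)) f) * (en (1 / t) * indicator (blk l) t)) <= ..." .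
  qed auto
  also have "... = en (4 * A^2 * s * sh_norm TYPE('d)) * (\<Sum>i\<le>J l. en (2 powr (- al * real i) * b i l * 2 powr (al * real (J l)))) * wn al f + en (F l) * ?V * wn al f"
   using b0 by (simp add: sum_distrib_left sum_distrib_right ennreal_mult mult_ac)
  finally show ?thesis .
 qed
 have m2: "(%t. (?L l t + en (F l) * (wn al f * ?V)) * (en (1 / t) * indicator (blk l) t)) \<in> borel_measurable lborel" for l
  by measurable
 have "(NN t. (NN z. nq (Tm ze s t f z) * wt al z) * (dlog t))
  <= (NN t. 3 * (?N t * (dlog t) + (\<Sum>l. (?L l t + en (F l) * (wn al f * ?V)) * (en (1 / t) * indicator (blk l) t))))"
  by (intro nn_integral_mono pt)
 also have "... = 3 * ((NN t. ?N t * (dlog t)) + (\<Sum>l. (NN t. (?L l t + en (F l) * (wn al f * ?V)) * (en (1 / t) * indicator (blk l) t))))"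
  by (subst nn_integral_cmult, measurable) (subst nn_integral_add, measurable, subst nn_integral_suminf[OF m2], rule refl)
 also have "... <= 3 * (en (4 * A^2 * s * (sh_norm TYPE('d))^2 * (3 * 2 powr al)) * wn al f
   + (\<Sum>l. en (4 * A^2 * s * sh_norm TYPE('d)) * (\<Sum>i\<le>J l. en (2 powr (- al * real i) * b i l * 2 powr (al * real (J l)))) * wn al f + en (F l) * ?V * wn al f))"
  by (intro mult_left_mono add_mono suminf_le I1 I2) auto
 also have "(\<Sum>l. en (4 * A^2 * s * sh_norm TYPE('d)) * (\<Sum>i\<le>J l. en (2 powr (- al * real i) * b i l * 2 powr (al * real (J l)))) * wn al f + en (F l) * ?V * wn al f)
   = (\<Sum>l. en (4 * A^2 * s * sh_norm TYPE('d)) * (\<Sum>i\<le>J l. en (2 powr (- al * real i) * b i l * 2 powr (al * real (J l))))) * wn al f + (\<Sum>l. en (F l)) * ?V * wn al f"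
  by (simp only: ennreal_suminf_multc[symmetric] suminf_add[OF summableI summableI, symmetric])
 finally show ?thesis by (simp add: distrib_left distrib_right mult.assoc add.assoc)
qed

lemma two_pow_half: "a + c <= b ==> 2 ^ a * (1/2) ^ b <= (1/2::real) ^ c"
proof -
 assume "a + c <= b"
 hence "2 ^ a * (1/2::real) ^ b <= 2 ^ a * (1/2) ^ (a + c)" by (intro mult_left_mono power_decreasing) auto
 also have "... = (1/2) ^ c" by (simp add: power_add power_one_over)
 finally show ?thesis .
qed

lemma bump_mono: assumes "bump M A ze" "M' <= M" shows "bump M' A ze"
proof -
 obtain D where "dchain D ze M A"
  using assms(1)[unfolded bump_def, THEN conjunct1] by (rule exE)
 hence "dchain D ze M' A"
  using assms(2) by (meson le_trans less_le_trans)
 hence "EX D. dchain D ze M' A" by (rule exI[of _ D])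
 thus ?thesis unfolding bump_def using assms(1)[unfolded bump_def, THEN conjunct2] by (rule conjI)
qed

lemma linear_le_powr: assumes "si > 0" shows "real m <= 1 / (si * ln 2) * 2 powr (si * real m)"
proof -
 have "si * real m * ln 2 <= exp (si * real m * ln 2)"
  using exp_ge_add_one_self[of "si * real m * ln 2"] by linarith
 also have "... = 2 powr (si * real m)" by (simp add: powr_def)
 finally show ?thesis using assms by (simp add: field_simps)
qed

text \<open>For t about 2^l and s = 2^(-m) the kernel width is about 2^(min(l, m - l)) as long as l
  <= m, and less than 1 afterwards.\<close>

lemma min_bound:
 assumes t: "t \<in> blk l"
 shows "min t (1 / ((1/2) ^ m * t)) <= (if l <= m then 2 * 2 ^ (min l (m - l)) else 2 ^ m * (1/2) ^ l)"
proof -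
 have tb: "2 ^ l <= t" "t < 2 * 2 ^ l" using t by (auto simp: blk_def)
 have t1: "t >= 1" by (rule blk_ge_1[OF t])
 have i: "1 / ((1/2) ^ m * t) <= 2 ^ m * (1/2) ^ l"
 proof -
  have "1 / ((1/2) ^ m * t) = 2 ^ m / t" using t1 by (simp add: power_one_over)
  also have "... <= 2 ^ m / 2 ^ l" using tb by (intro divide_left_mono) auto
  also have "(2::real) ^ m / 2 ^ l = 2 ^ m * (1/2) ^ l" by (simp add: power_one_over)
  finally show ?thesis .
 qed
 show ?thesis
 proof (cases "l <= m")
  case True
  show ?thesis
  proof (cases "l <= m - l")
   case True
   thus ?thesis using tb \<open>l <= m\<close> by (simp add: min_def)
  next
   case False
   have "(2::real) ^ m * (1/2) ^ l = 2 ^ (m - l)" using True by (simp add: power_diff power_one_over)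
   hence "1 / ((1/2) ^ m * t) <= 2 ^ (m - l)" using i by simp
   moreover have "(2::real) ^ (m - l) <= 2 * 2 ^ (m - l)" by simp
   ultimately have "1 / ((1/2) ^ m * t) <= 2 * 2 ^ (m - l)" by linarith
   moreover have "min l (m - l) = m - l" using False by simp
   ultimately show ?thesis using True by (simp add: min_le_iff_disj)
  qed
 next
  case False
  thus ?thesis using i by (auto simp: min_le_iff_disj)
 qed
qed

text \<open>The kernel is widest, about 2^(m/2), at t about 2^(m/2). Data at that radius can be
  larger than data at the centre by 2^(al m / 2) in the squared norm, while the trace estimate gains
  2^(-m/2); hence (al - 1) / 2. The excess of \<open>ka\<close> over it pays for widening the low
  region and for counting blocks and annuli. The factor (1/2)^m is s itself, from
  \<open>am_window_integral\<close>.\<close>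

theorem square_function:
 fixes al ka :: real
 assumes al: "al >= 0" and ka: "ka > 0" "ka > (al - 1) / 2"
 shows "EX M. \<forall>A\<ge>0. \<exists>C\<ge>0. ALL ze m (f :: 'd::finite fld). bump M A ze --> 2 <= m --> wadm al f -->
  (NN t. (NN z. nq (Tm ze ((1/2) ^ m) t f z) * wt al z) * (dlog t))
   <= en (C * (1/2) ^ m * 2 powr (ka * real m)) * wn al f"
proof -
 define d where "d = CARD('d)"
 define sn where "sn = sh_norm TYPE('d)"
 have sn: "sn >= 0" unfolding sn_def by (rule sh_norm_nonneg)
 define ka1 where "ka1 = max 0 ((al - 1) / 2)"
 define si where "si = ka - ka1"
 have si: "si > 0" using ka unfolding si_def ka1_def by simp
 \<comment> \<open>The low region is widened by e, about m / q binary digits. This costs 2^((al + 1)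
   e), and the choice of q keeps it below 2^(si m / 2) up to a constant.\<close>
 define q where "q = nat \<lceil>2 * (al + 1) / si\<rceil> + 1"
 have q: "2 * (al + 1) / si <= real q" unfolding q_def by linarith
 have q1: "q >= 1" by (simp add: q_def)
 define P where "P = DIM(complex ^ 'd) + 2 + nat \<lceil>al\<rceil>"
 have P: "al <= real P" "DIM(complex ^ 'd) + 2 <= P" unfolding P_def by (linarith, simp)
 \<comment> \<open>N is large enough that Q >= q (P + 4 d + 3). Widening by e >= m / q digits then
   gains at least (P + 4 d + 3) m digits in the far estimate, which covers all losses that are
   powers of 2^m.\<close>
 define N where "N = P + q * (P + 4 * d + 3) + d + 1"
 define Q where "Q = 4 * N - 2 * P"
 have Q: "4 * N = 2 * P + Q" unfolding Q_def N_def by simp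
 have Qq: "q * (P + 4 * d + 3) <= Q" unfolding Q_def N_def by simp
 define V where "V = (NN z. en ((1/2) ^ (idx (z :: complex ^ 'd) * P)))"
 have V: "V = en (enn2real V)" using idx_decay_integral[OF P(2)] unfolding V_def by (simp add: less_top)
 show ?thesis
 proof (intro exI[of _ "Suc (2 * N)"] allI impI)
  fix A :: real assume A: "A >= 0"
  obtain CN where CN: "CN >= 0" "!!ze s t k. bump (2 * N) A ze ==> 0 < s ==> s <= 1 ==> 1 <= t ==>
    \<bar>(dlap d ^^ N) (am d ze s t) k\<bar> <= CN * (min t (1 / (s * t))) ^ (2 * N)"
   using am_dlap_bound[OF A, of N d] by blast
  define c2 where "c2 = sn * sh_bound TYPE('d)"
  have c2: "c2 >= 0" unfolding c2_def by (intro mult_nonneg_nonneg sn sh_bound_nonneg)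
  define CF where "CF = c2 * CN^2 * (real N + 2) ^ d * 2 ^ (8 * N) * 2 ^ (4 * N + 2 * d)"
  have CF: "CF >= 0" unfolding CF_def using c2 by (intro mult_nonneg_nonneg) auto
  define cl where "cl = 8 * (1 / (si / 4 * ln 2))^2 * ((96 * real d + 1) * sn * 2 powr (al + 1))"
  have cl: "cl >= 0" unfolding cl_def using sn by (intro mult_nonneg_nonneg) auto
  define C where "C = 3 * (4 * A^2 * sn^2 * (3 * 2 powr al) + 4 * A^2 * sn * cl + 2 * CF * enn2real V)"
  have C: "C >= 0" unfolding C_def using sn cl CF by (intro mult_nonneg_nonneg add_nonneg_nonneg) auto
  have main: "(NN t. (NN z. nq (Tm ze ((1/2) ^ m) t f z) * wt al z) * (dlog t))
   <= en (C * (1/2) ^ m * 2 powr (ka * real m)) * wn al f"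
   if bp: "bump (Suc (2 * N)) A ze" and m: "2 <= m" and f: "wadm al f" for ze m and f :: "'d fld"
  proof -
   define s where "s = (1/2::real) ^ m"
   have s: "0 < s" "s <= 1/4"
   proof -
    have "(1/2::real) ^ m <= (1/2) ^ 2" using m by (intro power_decreasing) auto
    thus "s <= 1/4" by (simp add: s_def power2_eq_square)
   qed (simp add: s_def)
   have bp2: "bump (2 * N) A ze" by (rule bump_mono[OF bp]) simp
   define e where "e = m div q + 1"
   have e1: "m <= e * q"
   proof -
    have "m = m div q * q + m mod q" by simp
    moreover have "m mod q < q" using q1 by simp
    ultimately have "m <= m div q * q + q" by linarith
    thus ?thesis unfolding e_def by (simp add: algebra_simps)
   qed
   have e2: "(al + 1) * real e <= si / 2 * real m + (al + 1)"
   proof -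
    have "(al + 1) * 2 <= real q * si" using q si by (simp add: pos_divide_le_eq mult.commute)
    hence "(al + 1) / real q <= si / 2" using q1 by (simp add: pos_divide_le_eq mult.commute)
    moreover have "real (m div q) <= real m / real q" 
    proof -
     have "real (m div q) * real q <= real m" unfolding of_nat_mult[symmetric] by (rule of_nat_mono) simp
     thus ?thesis using q1 by (simp add: pos_le_divide_eq)
    qed
    ultimately have "(al + 1) * real (m div q) <= (al + 1) * (real m / real q)" using al by (intro mult_left_mono) auto
    also have "... = (al + 1) / real q * real m" by simp
    also have "... <= si / 2 * real m" using \<open>(al + 1) / real q <= si / 2\<close> by (intro mult_right_mono) auto
    finally show ?thesis unfolding e_def by (simp add: algebra_simps)
   qed
   have em: "e <= m + 1" unfolding e_def by simp
   \<comment> \<open>Binary logarithm of the kernel width on block l, up to a constant; truncated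
     subtraction makes it 0 for l >= m.\<close>
   define r where "r l = min l (m - l)" for l
   have r2: "2 * r l <= m" for l unfolding r_def by linarith
   \<comment> \<open>The far region begins a factor 2^e beyond the kernel width. From l = 2 m on the
     kernel is so narrow that all separated annuli count as far and no low part remains.\<close>
   define J where "J l = (if l < 2 * m then r l + e else 0)" for l
   \<comment> \<open>The trace estimate serves the blocks l <= m; between m and 2 m plain
     orthogonality is good enough because the low region has only e digits.\<close>
   define b where "b i l = (if 2 * m <= l then 0 else if m < l then sn else 96 * real d * 2 ^ i / 2 ^ (r l) * sn)" for i l
   define rh where "rh l = (if l <= m then 2 * 2 ^ (r l) else 2 ^ m * (1/2::real) ^ l)" for l
   define F where "F l = c2 * (CN * rh l ^ (2 * N))^2 * ((real N + 2) * 4 ^ (l + 1)) ^ d * (2 ^ (8 * N) * (1/2) ^ (J l * Q))" for l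
   have rh0: "rh l >= 0" for l by (simp add: rh_def)
   have F0: "F l >= 0" for l unfolding F_def using c2 by (intro mult_nonneg_nonneg) auto
   have b0: "b i l >= 0" for i l unfolding b_def using sn by auto
   have low: "(NN z. nq (Tm ze s t (cut (lowP i (J l)) f) z) * indicator (annulus i) z) <= en (b i l) * enS ze s t (cut (lowP i (J l)) f)"
    if t: "t \<in> blk l" and i: "i <= J l" for l t i
   proof -
    have t1: "t >= 1" by (rule blk_ge_1[OF t])
    consider "2 * m <= l" | "m < l" "l < 2 * m" | "l <= m" by linarith
    thus ?thesis
    proof cases
     case 1
     hence "J l = 0" by (simp add: J_def)
     hence "cut (lowP i (J l)) f = (%_. 0)" using i by (auto simp: cut_def lowP_def apart_def fun_eq_iff)
     thus ?thesis by (simp add: Tm_zero)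
    next
     case 2
     have "(NN z. nq (Tm ze s t (cut (lowP i (J l)) f) z) * indicator (annulus i) z) <= (NN z. nq (Tm ze s t (cut (lowP i (J l)) f) z))"
      by (intro nn_integral_mono) (auto simp: indicator_def)
     also have "... <= en sn * enS ze s t (cut (lowP i (J l)) f)"
      unfolding enS_def sn_def by (rule Tm_L2[OF low_sq[OF f]])
     finally show ?thesis using 2 by (simp add: b_def)
    next
     case 3
     have tb: "2 ^ l <= t" "t < 2 * 2 ^ l" using t by (auto simp: blk_def)
     \<comment> \<open>The two summands s t and 1 / t dominate at opposite ends of the range of t;
       both are at most a multiple of 2^(-r l).\<close>
     have "(s * t^2 + 1) / t = s * t + 1 / t" using t1 by (simp add: field_simps power2_eq_square)
     also have "... <= s * (2 * 2 ^ l) + 1 / 2 ^ l"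
      using s tb t1 by (intro add_mono mult_left_mono frac_le) auto
     also have "... <= 2 * (1 / 2 ^ r l) + 1 / 2 ^ r l"
     proof (intro add_mono)
      have "2 ^ l * (1/2::real) ^ m <= (1/2) ^ r l" using 3 by (intro two_pow_half) (use 3 in \<open>unfold r_def, linarith\<close>)
      thus "s * (2 * 2 ^ l) <= 2 * (1 / 2 ^ r l)" by (simp add: s_def power_one_over mult_ac)
      show "1 / 2 ^ l <= 1 / (2::real) ^ r l" unfolding r_def by (intro divide_left_mono power_increasing) auto
     qed
     finally have st: "(s * t^2 + 1) / t <= 3 / 2 ^ r l" by simp
     have "(NN z. nq (Tm ze s t (cut (lowP i (J l)) f) z) * indicator (annulus i) z)
       <= en (32 * real CARD('d) * 2 ^ i * (s * t^2 + 1) / t * sh_norm TYPE('d)) * enS ze s t (cut (lowP i (J l)) f)"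
      unfolding enS_def by (rule Tm_trace[OF low_sq[OF f] bp s t1])
     also have "... <= en (b i l) * enS ze s t (cut (lowP i (J l)) f)"
     proof (intro mult_right_mono ennreal_leI)
      have "32 * real CARD('d) * 2 ^ i * (s * t^2 + 1) / t * sh_norm TYPE('d) = (32 * real d * 2 ^ i) * ((s * t^2 + 1) / t) * sn"
       by (simp add: d_def sn_def)
      also have "... <= (32 * real d * 2 ^ i) * (3 / 2 ^ r l) * sn"
       by (intro mult_right_mono mult_left_mono st sn) auto
      also have "... = b i l" using 3 m by (simp add: b_def)
      finally show "32 * real CARD('d) * 2 ^ i * (s * t^2 + 1) / t * sh_norm TYPE('d) <= b i l" .
     qed simp
     finally show ?thesis .
    qed
   qed
   have far: "nq (Tm ze s t (cut (farP (idx z) (J l)) f) z) <= en (F l * (1/2) ^ (idx z * P)) * wn al f"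
    if t: "t \<in> blk l" for l t z
   proof -
    have t1: "t >= 1" by (rule blk_ge_1[OF t])
    have B: "\<bar>(dlap CARD('d) ^^ N) (am CARD('d) ze s t) k\<bar> <= CN * rh l ^ (2 * N)" for k
    proof -
     have "\<bar>(dlap d ^^ N) (am d ze s t) k\<bar> <= CN * (min t (1 / (s * t))) ^ (2 * N)"
      by (rule CN(2)[OF bp2]) (use s t1 in auto)
     also have "... <= CN * rh l ^ (2 * N)"
     proof (intro mult_left_mono power_mono CN(1))
      show "min t (1 / (s * t)) <= rh l" using min_bound[OF t, of m] unfolding s_def rh_def r_def .
      show "0 <= min t (1 / (s * t))" using t1 s by simp
     qed
     finally show ?thesis by (simp add: d_def)
    qed
    have "nq (Tm ze s t (cut (farP (idx z) (J l)) f) z)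
     <= en (sh_norm TYPE('d) * sh_bound TYPE('d) * (CN * rh l ^ (2 * N))^2 * (t^2 + real N + 1) ^ CARD('d) * (2 ^ (8 * N) * (1/2) ^ (J l * Q)) * (1/2) ^ (idx z * P)) * wn al f"
     by (rule far_pointwise[OF f bp s(1) t1 B P(1) Q])
    also have "... <= en (F l * (1/2) ^ (idx z * P)) * wn al f"
    proof (intro mult_right_mono ennreal_leI)
     have t4: "t^2 <= 4 ^ (l + 1)"
     proof -
      have "t^2 <= (2 * 2 ^ l)^2" using t t1 by (intro power_mono) (auto simp: blk_def)
      also have "... = (4::real) ^ (l + 1)"
      proof -
       have "(4::real) ^ (l + 1) = (2 ^ 2) ^ (l + 1)" by simp
       thus ?thesis by (simp only: power_mult[symmetric]) (simp add: power_mult_distrib power_add power_mult mult.commute)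
      qed
      finally show ?thesis .
     qed
     have "t^2 + real N + 1 <= (real N + 2) * 4 ^ (l + 1)"
     proof -
      have "(1::real) <= 4 ^ (l + 1)" by (rule one_le_power) simp
      hence "(real N + 1) * 1 <= (real N + 1) * 4 ^ (l + 1)" by (intro mult_left_mono) auto
      thus ?thesis using t4 by (simp add: algebra_simps)
     qed
     hence "(t^2 + real N + 1) ^ CARD('d) <= ((real N + 2) * 4 ^ (l + 1)) ^ d"
      unfolding d_def by (intro power_mono) auto
     thus "sh_norm TYPE('d) * sh_bound TYPE('d) * (CN * rh l ^ (2 * N))^2 * (t^2 + real N + 1) ^ CARD('d) * (2 ^ (8 * N) * (1/2) ^ (J l * Q)) <= F l"
      unfolding F_def c2_def[symmetric, unfolded sn_def] using c2
      by (intro mult_right_mono mult_left_mono mult_nonneg_nonneg) auto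
    qed auto
    finally show ?thesis .
   qed
   have Fb: "F l <= CF * (1/2) ^ m * (1/2) ^ l" for l
   proof -
    have Qe: "(P + 4 * d + 3) * m <= e * Q"
    proof -
     have "(P + 4 * d + 3) * m <= (P + 4 * d + 3) * (e * q)" using e1 by (rule mult_le_mono2)
     also have "... = e * (q * (P + 4 * d + 3))" by (simp add: mult_ac)
     also have "... <= e * Q" using Qq by (rule mult_le_mono2)
     finally show ?thesis .
    qed
    have f4: "((4::real) ^ (l + 1)) ^ d = 2 ^ (2 * (l + 1) * d)"
    proof -
     have "(4::real) ^ (l + 1) = 2 ^ (2 * (l + 1))" unfolding power_mult by simp
     thus ?thesis by (simp only: power_mult)
    qed
    \<comment> \<open>Comparison of exponents. For l <= m the part r of J compensates the kernel
      width and the part e all remaining powers; for m < l < 2 m the width is at most 1 and e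
      suffices; for l >= 2 m the smallness of \<open>rh\<close> itself does it.\<close>
    have core: "rh l ^ (4 * N) * (4 ^ (l + 1)) ^ d * (1/2) ^ (J l * Q) <= 2 ^ (4 * N + 2 * d) * (1/2) ^ (m + l)"
    proof -
     consider "l <= m" | "m < l" "l < 2 * m" | "2 * m <= l" by linarith
     thus ?thesis
     proof cases
      case 1
      hence J: "J l = r l + e" using m by (simp add: J_def)
      have "rh l ^ (4 * N) = 2 ^ (4 * N + r l * (4 * N))"
       using 1 by (simp add: rh_def power_mult_distrib power_add power_mult)
      hence "rh l ^ (4 * N) * (4 ^ (l + 1)) ^ d * (1/2) ^ (J l * Q) = 2 ^ (4 * N) * (2 ^ (r l * (4 * N) + 2 * (l + 1) * d) * (1/2) ^ (J l * Q))"
       unfolding f4 by (simp only: power_add mult.assoc)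
      also have "... <= 2 ^ (4 * N) * (1/2) ^ (m + l)"
      proof (intro mult_left_mono two_pow_half)
       have "r l * (4 * N) = 2 * r l * P + r l * Q" unfolding Q by (simp add: algebra_simps)
       moreover have "2 * r l * P <= m * P" using r2 by (rule mult_le_mono1)
       moreover have "2 * (l + 1) * d <= 4 * m * d" using 1 m by (intro mult_le_mono1) simp
       moreover have "J l * Q = r l * Q + e * Q" unfolding J by (simp add: algebra_simps)
       moreover have "m * P + 4 * m * d + 3 * m = (P + 4 * d + 3) * m" by (simp add: algebra_simps)
       ultimately show "r l * (4 * N) + 2 * (l + 1) * d + (m + l) <= J l * Q" using Qe 1 by linarith
      qed simp
      also have "... <= 2 ^ (4 * N + 2 * d) * (1/2) ^ (m + l)" by (intro mult_right_mono power_increasing) auto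
      finally show ?thesis .
     next
      case 2
      hence J: "J l = e" by (simp add: J_def r_def)
      have "rh l <= 1"
       using two_pow_half[of m 0 l] 2 by (simp add: rh_def)
      hence "rh l ^ (4 * N) <= 1" using rh0 by (intro power_le_one) auto
      hence "rh l ^ (4 * N) * (4 ^ (l + 1)) ^ d * (1/2) ^ (J l * Q) <= 1 * (4 ^ (l + 1)) ^ d * (1/2) ^ (J l * Q)"
       by (intro mult_right_mono) auto
      also have "... = 2 ^ (2 * (l + 1) * d) * (1/2) ^ (e * Q)" unfolding f4 J by (simp only: mult_1_left)
      also have "... <= (1/2) ^ (m + l)"
      proof (intro two_pow_half)
       have "2 * (l + 1) * d <= 4 * m * d" using 2 by (intro mult_le_mono1) simp
       moreover have "4 * m * d + 3 * m <= (P + 4 * d + 3) * m" by (simp add: algebra_simps)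
       ultimately show "2 * (l + 1) * d + (m + l) <= e * Q" using Qe 2 by linarith
      qed
      also have "... <= 2 ^ (4 * N + 2 * d) * (1/2) ^ (m + l)"
       using mult_right_mono[of 1 "2 ^ (4 * N + 2 * d)" "(1/2::real) ^ (m + l)"] one_le_power[of "2::real" "4 * N + 2 * d"] by simp
      finally show ?thesis .
     next
      case 3
      hence J: "J l = 0" by (simp add: J_def)
      have "l > m" using 3 m by linarith
      hence "rh l ^ (4 * N) * (4 ^ (l + 1)) ^ d * (1/2) ^ (J l * Q) = 2 ^ (2 * d) * (2 ^ (m * (4 * N) + 2 * l * d) * (1/2) ^ (l * (4 * N)))"
      proof -
       have "rh l ^ (4 * N) = 2 ^ (m * (4 * N)) * (1/2) ^ (l * (4 * N))"
        using \<open>l > m\<close> by (simp add: rh_def power_mult_distrib power_mult)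
       moreover have "2 * (l + 1) * d = 2 * d + 2 * l * d" by (simp add: algebra_simps)
       ultimately show ?thesis unfolding f4 J by (simp only: power_add mult_0 power_0 mult_1_right mult_ac)
      qed
      also have "... <= 2 ^ (2 * d) * (1/2) ^ (m + l)"
      proof (intro mult_left_mono two_pow_half)
       have "2 * (m * (4 * N)) <= l * (4 * N)" using 3 by simp
       moreover have "2 * l * d + 2 * l <= l * (2 * N)"
       proof -
        have "2 * l * d + 2 * l = l * (2 * (d + 1))" by (simp add: algebra_simps)
        also have "... <= l * (2 * N)" unfolding N_def by (intro mult_le_mono2) simp
        finally show ?thesis .
       qed
       moreover have "l * (4 * N) = 2 * (l * (2 * N))" by simp
       ultimately show "m * (4 * N) + 2 * l * d + (m + l) <= l * (4 * N)" using 3 by linarith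
      qed simp
      also have "... <= 2 ^ (4 * N + 2 * d) * (1/2) ^ (m + l)" by (intro mult_right_mono power_increasing) auto
      finally show ?thesis .
     qed
    qed
    have "F l = (c2 * CN^2 * (real N + 2) ^ d * 2 ^ (8 * N)) * (rh l ^ (4 * N) * (4 ^ (l + 1)) ^ d * (1/2) ^ (J l * Q))"
    proof -
     have "(CN * rh l ^ (2 * N))^2 = CN^2 * rh l ^ (4 * N)" by (simp add: power_mult_distrib power_mult[symmetric] mult.commute)
     thus ?thesis unfolding F_def by (simp only: power_mult_distrib) (simp only: mult_ac)
    qed
    also have "... <= (c2 * CN^2 * (real N + 2) ^ d * 2 ^ (8 * N)) * (2 ^ (4 * N + 2 * d) * (1/2) ^ (m + l))"
     using c2 by (intro mult_left_mono core mult_nonneg_nonneg) auto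
    also have "... = CF * (1/2) ^ m * (1/2) ^ l" unfolding CF_def by (simp add: power_add)
    finally show ?thesis .
   qed
   have FS: "(\<Sum>l. en (F l)) <= en (2 * CF * (1/2) ^ m)"
   proof -
    have "(\<Sum>l. en (F l)) <= (\<Sum>l. en (CF * (1/2) ^ m * (1/2) ^ l))"
     by (intro suminf_le ennreal_leI Fb) auto
    also have "... = en (\<Sum>l. CF * (1/2) ^ m * (1/2) ^ l)"
     using CF by (intro suminf_ennreal2 summable_mult summable_geometric) auto
    also have "(\<Sum>l. CF * (1/2) ^ m * (1/2) ^ l) = 2 * CF * (1/2) ^ m"
     by (subst suminf_mult) (auto simp: suminf_geometric summable_geometric)
    finally show ?thesis .
   qed
   have LS: "(\<Sum>l. en (4 * A^2 * s * sn) * (\<Sum>i\<le>J l. en (2 powr (- al * real i) * b i l * 2 powr (al * real (J l)))))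
     <= en (4 * A^2 * sn * cl * (1/2) ^ m * 2 powr (ka * real m))"
   proof -
    define W where "W = (96 * real d + 1) * sn * 2 powr (ka1 * real m + (al + 1) * real e)"
    have W: "W >= 0" unfolding W_def using sn by auto
    have trm: "2 powr (- al * real i) * b i l * 2 powr (al * real (J l)) <= W" if l: "l < 2 * m" and i: "i <= J l" for i l
    proof (cases "l <= m")
     case True
     have J: "J l = r l + e" using l by (simp add: J_def)
     have "2 powr (- al * real i) * b i l * 2 powr (al * real (J l)) = (96 * real d) * sn * (2 powr (- al * real i) * (2 powr real i * 2 powr (- real (r l))) * 2 powr (al * real (J l)))"
      using True l by (simp add: b_def powr_realpow powr_minus divide_inverse)
     also have "2 powr (- al * real i) * (2 powr real i * 2 powr (- real (r l))) * 2 powr (al * real (J l)) = 2 powr ((- al * real i) + (real i + - real (r l)) + al * real (J l))"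
      by (simp only: powr_add)
     also have "... <= 2 powr (ka1 * real m + (al + 1) * real e)"
     proof (intro powr_mono)
      \<comment> \<open>Weight, trace factor and truncation cost combine to the exponent (1 - al)(i
        - r) + al e. For al <= 1 it is largest at the outermost annulus, where i - r = e; for al > 1
        at the centre, where r <= m / 2 produces \<open>ka1\<close> m.\<close>
      have eq: "(- al * real i) + (real i + - real (r l)) + al * real (J l) = (1 - al) * (real i - real (r l)) + al * real e"
       unfolding J by (simp add: algebra_simps)
      have "(1 - al) * (real i - real (r l)) <= ka1 * real m + real e"
      proof (cases "al <= 1")
       case True
       have "real i - real (r l) <= real e" using i unfolding J by linarith
       hence "(1 - al) * (real i - real (r l)) <= (1 - al) * real e" using True by (intro mult_left_mono) auto
       also have "... <= 1 * real e" using al by (intro mult_right_mono) auto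
       finally show ?thesis unfolding ka1_def by (simp add: add_increasing)
      next
       case False
       have "(1 - al) * (real i - real (r l)) = (al - 1) * (real (r l) - real i)" by (simp add: algebra_simps)
       also have "... <= (al - 1) * (real m / 2)"
       proof (intro mult_left_mono)
        have "2 * real (r l) <= real m" using r2[of l] by linarith
        thus "real (r l) - real i <= real m / 2" by linarith
       qed (use False in auto)
       also have "... = ka1 * real m" using False by (simp add: ka1_def)
       finally show ?thesis by simp
      qed
      thus "(- al * real i) + (real i + - real (r l)) + al * real (J l) <= ka1 * real m + (al + 1) * real e"
       unfolding eq by (simp add: algebra_simps)
     qed simp
     finally have "2 powr (- al * real i) * b i l * 2 powr (al * real (J l)) <= 96 * real d * sn * 2 powr (ka1 * real m + (al + 1) * real e)"
      using sn by (simp add: mult_left_mono)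
     also have "... <= W" unfolding W_def using sn by (intro mult_right_mono) auto
     finally show ?thesis .
    next
     case False
     have J: "J l = e" using l False by (simp add: J_def r_def)
     have "2 powr (- al * real i) * b i l * 2 powr (al * real (J l)) = 2 powr (- al * real i) * (sn * 2 powr (al * real e))"
      using False l unfolding J by (simp add: b_def)
     also have "... <= 1 * (sn * 2 powr (ka1 * real m + (al + 1) * real e))"
     proof (intro mult_mono powr_mono sn)
      show "2 powr (- al * real i) <= 1" using powr_mono[of "- al * real i" 0 2] al by simp
      have "0 <= ka1 * real m" unfolding ka1_def by simp
      thus "al * real e <= ka1 * real m + (al + 1) * real e" by (simp add: algebra_simps)
     qed (use sn in auto)
     also have "... <= W" unfolding W_def mult_1_left using sn mult_right_mono[of 1 "96 * real d + 1" sn] by (intro mult_right_mono) auto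
     finally show ?thesis .
    qed
    have inner: "(\<Sum>i\<le>J l. en (2 powr (- al * real i) * b i l * 2 powr (al * real (J l)))) <= en ((2 * real m + 2) * W)" if l: "l < 2 * m" for l
    proof -
     have "(\<Sum>i\<le>J l. en (2 powr (- al * real i) * b i l * 2 powr (al * real (J l)))) <= (\<Sum>i\<le>J l. en W)"
      by (intro sum_mono ennreal_leI trm[OF l]) auto
     also have "... = en (real (J l + 1) * W)"
      using W by (simp add: ennreal_of_nat_eq_real_of_nat ennreal_mult[symmetric] del: ennreal_plus)
     also have "... <= en ((2 * real m + 2) * W)"
     proof (intro ennreal_leI mult_right_mono W)
      have "J l <= m + e" using r2[of l] by (simp add: J_def)
      hence "J l + 1 <= 2 * m + 2" using em by linarith
      hence "real (J l + 1) <= real (2 * m + 2)" by (rule of_nat_mono)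
      thus "real (J l + 1) <= 2 * real m + 2" by simp
     qed
     finally show ?thesis .
    qed
    have out: "(\<Sum>i\<le>J l. en (2 powr (- al * real i) * b i l * 2 powr (al * real (J l)))) = 0" if "l \<notin> {..<2 * m}" for l
     using that by (simp add: b_def)
    let ?c = "en (4 * A^2 * s * sn)"
    have "(\<Sum>l. ?c * (\<Sum>i\<le>J l. en (2 powr (- al * real i) * b i l * 2 powr (al * real (J l)))))
      = (\<Sum>l\<in>{..<2 * m}. ?c * (\<Sum>i\<le>J l. en (2 powr (- al * real i) * b i l * 2 powr (al * real (J l)))))"
     by (rule suminf_finite) (use out in auto)
    also have "... <= (\<Sum>l\<in>{..<2 * m}. ?c * en ((2 * real m + 2) * W))"
     by (intro sum_mono mult_left_mono inner) auto
    also have "... = en (4 * A^2 * s * sn * (2 * real m * ((2 * real m + 2) * W)))"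
    proof -
     have p: "0 <= 4 * A^2 * s * sn" "0 <= (2 * real m + 2) * W" using s sn W by (auto intro!: mult_nonneg_nonneg)
     have "(\<Sum>l\<in>{..<2 * m}. ?c * en ((2 * real m + 2) * W)) = en (real (2 * m)) * en (4 * A^2 * s * sn * ((2 * real m + 2) * W))"
      unfolding ennreal_mult[OF p] by (simp add: ennreal_of_nat_eq_real_of_nat)
     also have "... = en (real (2 * m) * (4 * A^2 * s * sn * ((2 * real m + 2) * W)))"
      using p by (intro ennreal_mult[symmetric]) auto
     finally show ?thesis by (simp add: mult_ac)
    qed
    also have "... <= en (4 * A^2 * s * sn * (cl * 2 powr (ka * real m)))"
    proof (intro ennreal_leI mult_left_mono)
     define g where "g = 1 / (si / 4 * ln 2)"
     \<comment> \<open>There are 2 m blocks with at most 2 m + 2 annuli each. Applying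
       \<open>linear_le_powr\<close> with si / 4 absorbs this quadratic factor in half of the slack
       \<open>si\<close>; the widening e takes the other half.\<close>
     have mg: "real m <= g * 2 powr (si / 4 * real m)" unfolding g_def using linear_le_powr[of "si / 4" m] si by simp
     have "2 * real m * (2 * real m + 2) <= 8 * (real m)^2" using m by (simp add: power2_eq_square algebra_simps)
     also have "... <= 8 * (g * 2 powr (si / 4 * real m))^2" by (intro mult_left_mono power_mono mg) auto
     also have "... = 8 * g^2 * 2 powr (si / 2 * real m)"
      by (simp add: power_mult_distrib power2_eq_square powr_add[symmetric])
     finally have m2: "2 * real m * (2 * real m + 2) <= 8 * g^2 * 2 powr (si / 2 * real m)" .
     have "W <= (96 * real d + 1) * sn * 2 powr (ka1 * real m + (si / 2 * real m + (al + 1)))"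
      unfolding W_def using sn e2 by (intro mult_left_mono powr_mono add_left_mono) auto
     also have "... = (96 * real d + 1) * sn * 2 powr (al + 1) * 2 powr (ka1 * real m + si / 2 * real m)"
      by (simp add: powr_add)
     finally have W2: "W <= (96 * real d + 1) * sn * 2 powr (al + 1) * 2 powr (ka1 * real m + si / 2 * real m)" .
     have "2 * real m * ((2 * real m + 2) * W) = (2 * real m * (2 * real m + 2)) * W" by simp
     also have "... <= (8 * g^2 * 2 powr (si / 2 * real m)) * ((96 * real d + 1) * sn * 2 powr (al + 1) * 2 powr (ka1 * real m + si / 2 * real m))"
      by (intro mult_mono m2 W2 W) auto
     also have "... = cl * (2 powr (si / 2 * real m) * 2 powr (ka1 * real m + si / 2 * real m))"
      unfolding cl_def g_def[symmetric] by (simp add: mult_ac)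
     also have "2 powr (si / 2 * real m) * 2 powr (ka1 * real m + si / 2 * real m) = 2 powr (ka * real m)"
      unfolding powr_add[symmetric] si_def by (simp add: algebra_simps)
     finally show "2 * real m * ((2 * real m + 2) * W) <= cl * 2 powr (ka * real m)" .
     show "0 <= 4 * A^2 * s * sn" using s sn by (intro mult_nonneg_nonneg) auto
    qed
    also have "4 * A^2 * s * sn * (cl * 2 powr (ka * real m)) = 4 * A^2 * sn * cl * (1/2) ^ m * 2 powr (ka * real m)"
     unfolding s_def by (simp add: mult_ac)
    finally show ?thesis .
   qed
   have pk: "1 <= 2 powr (ka * real m)" using ka by (intro ge_one_powr_ge_zero) auto
   have "(NN t. (NN z. nq (Tm ze s t f z) * wt al z) * (dlog t)) <=
    3 * (en (4 * A^2 * s * sn^2 * (3 * 2 powr al))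
    + (\<Sum>l. en (4 * A^2 * s * sn) * (\<Sum>i\<le>J l. en (2 powr (- al * real i) * b i l * 2 powr (al * real (J l)))))
    + (\<Sum>l. en (F l)) * V) * wn al f"
    unfolding V_def sn_def
    by (rule square_function_abstract[OF f bp s F0 b0[unfolded sn_def] low[unfolded sn_def] far])
   also have "... <= (3 * (en (4 * A^2 * s * sn^2 * (3 * 2 powr al)) + en (4 * A^2 * sn * cl * (1/2) ^ m * 2 powr (ka * real m))
    + en (2 * CF * (1/2) ^ m) * en (enn2real V))) * wn al f"
    unfolding V[symmetric] by (intro mult_right_mono mult_left_mono add_mono FS LS order_refl) auto
   also have "... <= en (C * (1/2) ^ m * 2 powr (ka * real m)) * wn al f"
   proof (intro mult_right_mono)
    define X where "X = 4 * A^2 * s * sn^2 * (3 * 2 powr al)"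
    define Y where "Y = 4 * A^2 * sn * cl * (1/2) ^ m * 2 powr (ka * real m)"
    define Z where "Z = 2 * CF * (1/2) ^ m * enn2real V"
    have XYZ: "X >= 0" "Y >= 0" "Z >= 0"
     unfolding X_def Y_def Z_def using s sn cl CF by (auto intro!: mult_nonneg_nonneg)
    have "en (2 * CF * (1/2) ^ m) * en (enn2real V) = en Z"
     unfolding Z_def using CF by (intro ennreal_mult[symmetric]) auto
    hence "3 * (en X + en Y + en (2 * CF * (1/2) ^ m) * en (enn2real V)) = en 3 * (en X + en Y + en Z)"
     by simp
    also have "... = en (3 * (X + Y + Z))"
    proof -
     have "en X + en Y + en Z = en (X + Y + Z)" using XYZ by simp
     thus ?thesis using XYZ by (simp only:) (rule ennreal_mult[symmetric], auto)
    qed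
    also have "... <= en (C * (1/2) ^ m * 2 powr (ka * real m))"
    proof (intro ennreal_leI)
     have "X <= X * 2 powr (ka * real m)" "Z <= Z * 2 powr (ka * real m)"
      using XYZ pk mult_left_mono[OF pk, of X] mult_left_mono[OF pk, of Z] by auto
     hence "3 * (X + Y + Z) <= 3 * (X * 2 powr (ka * real m) + Y + Z * 2 powr (ka * real m))" by simp
     also have "... = C * (1/2) ^ m * 2 powr (ka * real m)"
      unfolding C_def X_def Y_def Z_def s_def by (simp add: algebra_simps)
     finally show "3 * (X + Y + Z) <= C * (1/2) ^ m * 2 powr (ka * real m)" .
    qed
    finally show "3 * (en (4 * A^2 * s * sn^2 * (3 * 2 powr al)) + en (4 * A^2 * sn * cl * (1/2) ^ m * 2 powr (ka * real m))
     + en (2 * CF * (1/2) ^ m) * en (enn2real V)) <= en (C * (1/2) ^ m * 2 powr (ka * real m))"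
     unfolding X_def Y_def .
   qed simp
   finally show ?thesis unfolding s_def .
  qed
  thus "\<exists>C\<ge>0. ALL ze m (f :: 'd fld). bump (Suc (2 * N)) A ze --> 2 <= m --> wadm al f -->
   (NN t. (NN z. nq (Tm ze ((1/2) ^ m) t f z) * wt al z) * (dlog t))
    <= en (C * (1/2) ^ m * 2 powr (ka * real m)) * wn al f"
   using C by blast
 qed
qed

section \<open>Maximal functions\<close>

text \<open>Schur's test for a symmetric kernel of bounded mass. Summed over finitely many scales it
  provides the crude finite bound from which the bootstrap starts.\<close>

lemma maximal_weak_step:
 fixes ka :: "nat => 'a::euclidean_space \<times> 'a => ennreal" and h :: "'a => ennreal"
 assumes [measurable]: "!!l. ka l \<in> borel_measurable (borel \<Otimes>\<^sub>M borel)" and [measurable]: "h \<in> bm"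
  and C0: "!!l z. (NN y. ka l (z, y)) <= en C0"
  and sym: "!!l z y. ka l (z, y) = ka l (y, z)"
 shows "(NN z. (NN y. ka l (z, y) * h y)^2) <= en C0 * en C0 * (NN y. (h y)^2)"
proof -
 have pt: "(NN y. ka l (z, y) * h y)^2 <= en C0 * (NN y. ka l (z, y) * (h y)^2)" for z
 proof -
  \<comment> \<open>Cauchy-Schwarz for the measure with this density, applied to the functions 1 and
    h.\<close>
  define M where "M = density lborel (%y. ka l (z, y))"
  have hM: "h \<in> borel_measurable M" by (simp add: M_def)
  have "(\<integral>\<^sup>+y. 1 * h y \<partial>M)^2 <= (\<integral>\<^sup>+y. 1^2 \<partial>M) * (\<integral>\<^sup>+y. (h y)^2 \<partial>M)"
   by (rule Cauchy_Schwarz_nn_integral) (simp_all add: hM)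
  also have "... = (NN y. ka l (z, y)) * (NN y. ka l (z, y) * (h y)^2)"
   unfolding M_def by (subst (1 2) nn_integral_density) auto
  also have "(\<integral>\<^sup>+y. 1 * h y \<partial>M) = (NN y. ka l (z, y) * h y)"
   unfolding M_def by (subst nn_integral_density) auto
  also have "(NN y. ka l (z, y)) * (NN y. ka l (z, y) * (h y)^2) <= en C0 * (NN y. ka l (z, y) * (h y)^2)"
   by (intro mult_right_mono C0) auto
  finally show ?thesis .
 qed
 have "(NN z. (NN y. ka l (z, y) * h y)^2) <= (NN z. en C0 * (NN y. ka l (z, y) * (h y)^2))"
  by (intro nn_integral_mono pt)
 also have "... = en C0 * (NN z. (NN y. ka l (z, y) * (h y)^2))"
  by (intro nn_integral_cmult) measurable
 also have "(NN z. (NN y. ka l (z, y) * (h y)^2)) = (NN y. (NN z. ka l (z, y) * (h y)^2))"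
  by (rule lborel_pair.Fubini'[symmetric]) measurable
 also have "... = (NN y. (NN z. ka l (y, z)) * (h y)^2)"
  by (intro nn_integral_cong) (subst sym, rule nn_integral_multc, measurable)
 also have "... <= (NN y. en C0 * (h y)^2)" by (intro nn_integral_mono mult_right_mono C0) auto
 also have "... = en C0 * (NN y. (h y)^2)" by (intro nn_integral_cmult) measurable
 finally show ?thesis by (simp add: mult.assoc mult_left_mono)
qed

text \<open>Linearise the maximum by a measurable choice of \<open>l\<close> and compute \<open>T T\<^sup>*\<close>: since a product of two kernels is bounded by the wider one, a bound \<open>K\<close> for the maximal operator improves to \<open>2 c \<surd>K\<close>.\<close>
lemma maximal_bootstrap:
 fixes ka :: "nat => 'a::euclidean_space \<times> 'a => ennreal" and h :: "'a => ennreal" and L :: nat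
 defines "mx \<equiv> (%h z. SUP l\<in>{..L}. (NN y. ka l (z, y) * h y))"
 assumes ka[measurable]: "!!l. ka l \<in> borel_measurable (borel \<Otimes>\<^sub>M borel)" and h[measurable]: "h \<in> bm"
  and sym: "!!l z y. ka l (z, y) = ka l (y, z)" and c: "c >= 0"
  and comp: "!!l l' z z'. l <= l' ==> (NN y. ka l (z, y) * ka l' (y, z')) <= en c * ka l (z, z')"
  and H: "(NN y. (h y)^2) < \<infinity>" and U: "(NN z. (mx h z)^2) < \<infinity>" and K0: "K >= 0"
  and K: "!!g. g \<in> bm ==> (NN y. (g y)^2) < \<infinity> ==> (NN z. (mx g z)^2) <= en K * (NN y. (g y)^2)"
 shows "(NN z. (mx h z)^2) <= en (2 * c * sqrt K) * (NN y. (h y)^2)"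
proof -
 define a where "a h l z = (NN y. ka l (z, y) * h y)" for h :: "'a => ennreal" and l z
 have am: "(%z. a g l z) \<in> bm" if [measurable]: "g \<in> bm" for g l
  unfolding a_def by measurable
 define u where "u z = mx h z" for z
 have mm: "mx g \<in> bm" if "g \<in> bm" for g
  unfolding mx_def a_def[symmetric] using am[OF that] by measurable
 have u[measurable]: "u \<in> bm" using mm[OF h] unfolding u_def .
 note ahm[measurable] = am[OF h]
 \<comment> \<open>A supremum over finitely many scales is attained, and the least maximiser depends
   measurably on z.\<close>
 define la where "la z = (LEAST l. l <= L & a h l z = u z)" for z
 have la[measurable]: "la \<in> measurable borel (count_space UNIV)" unfolding la_def by measurable
 have lau: "la z <= L" "a h (la z) z = u z" for z
 proof -
  have fin: "finite ((%l. a h l z) ` {..L})" "(%l. a h l z) ` {..L} ~= {}" by auto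
  have "u z = Max ((%l. a h l z) ` {..L})" unfolding u_def mx_def a_def[symmetric] using cSup_eq_Max[OF fin] by simp
  hence "u z \<in> (%l. a h l z) ` {..L}" using Max_in[OF fin] by simp
  hence "EX l. l <= L & a h l z = u z" by auto
  from LeastI_ex[OF this] show "la z <= L" "a h (la z) z = u z" unfolding la_def by auto
 qed
 define q where "q p = ka (la (fst p)) p" for p
 have q[measurable]: "q \<in> borel_measurable (borel \<Otimes>\<^sub>M borel)"
  unfolding q_def by (rule measurable_compose_countable[where f = "%i p. ka i p"]) measurable
 have qu: "(NN y. q (z, y) * h y) = u z" for z using lau(2)[of z] unfolding a_def q_def by simp
 \<comment> \<open>The adjoint of the linearised operator, applied to the maximal function u
   itself.\<close>
 define v where "v y = (NN z. u z * q (z, y))" for y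
 have v[measurable]: "v \<in> bm" unfolding v_def by measurable
 define Ui where "Ui = (NN z. (u z)^2)"
 define Hi where "Hi = (NN z. (h z)^2)"
 define Xi where "Xi = (NN z. u z * mx u z)"
 have "Ui = (NN z. (NN y. u z * q (z, y) * h y))"
  unfolding Ui_def
 proof (intro nn_integral_cong)
  fix z
  have "(u z)^2 = u z * (NN y. q (z, y) * h y)" by (simp add: qu power2_eq_square)
  also have "... = (NN y. u z * (q (z, y) * h y))" by (intro nn_integral_cmult[symmetric]) measurable
  finally show "(u z)^2 = (NN y. u z * q (z, y) * h y)" by (simp add: mult.assoc)
 qed
 also have "... = (NN y. (NN z. u z * q (z, y) * h y))"
  by (rule lborel_pair.Fubini'[symmetric]) measurable
 also have "... = (NN y. v y * h y)"
  unfolding v_def by (intro nn_integral_cong nn_integral_multc) measurable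
 finally have "Ui^2 <= (NN y. (v y)^2) * Hi"
  unfolding Hi_def by (simp add: Cauchy_Schwarz_nn_integral)
 moreover have V: "(NN y. (v y)^2) <= 2 * (en c * Xi)"
 proof -
  have "(NN y. (v y)^2) = (NN y. (NN z. (NN z'. u z * q (z, y) * (u z' * q (z', y)))))"
  proof (intro nn_integral_cong)
   fix y
   have "(v y)^2 = (NN z. u z * q (z, y) * v y)"
    unfolding power2_eq_square v_def[of y] by (intro nn_integral_multc[symmetric]) measurable
   also have "... = (NN z. (NN z'. u z * q (z, y) * (u z' * q (z', y))))"
    unfolding v_def by (intro nn_integral_cong nn_integral_cmult[symmetric]) measurable
   finally show "(v y)^2 = (NN z. (NN z'. u z * q (z, y) * (u z' * q (z', y))))" .
  qed
  also have "... = (NN z. (NN y. (NN z'. u z * q (z, y) * (u z' * q (z', y)))))"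
   by (rule lborel_pair.Fubini') measurable
  also have "... = (NN z. (NN z'. (NN y. u z * q (z, y) * (u z' * q (z', y)))))"
   by (intro nn_integral_cong lborel_pair.Fubini') measurable
  also have "... <= (NN z. (NN z'. en c * (u z * u z' * q (z, z')) + en c * (u z' * u z * q (z', z))))"
  proof (intro nn_integral_mono)
   fix z z'
   have "(NN y. u z * q (z, y) * (u z' * q (z', y))) = (NN y. (u z * u z') * (q (z, y) * q (z', y)))"
    by (simp add: mult_ac)
   also have "... = (u z * u z') * (NN y. q (z, y) * q (z', y))"
    by (rule nn_integral_cmult) measurable
   also have "... <= (u z * u z') * (en c * q (z, z') + en c * q (z', z))"
   proof (intro mult_left_mono)
    show "(NN y. q (z, y) * q (z', y)) <= en c * q (z, z') + en c * q (z', z)"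
    proof (cases "la z <= la z'")
     case True
     have "(NN y. q (z, y) * q (z', y)) = (NN y. ka (la z) (z, y) * ka (la z') (y, z'))"
      by (simp add: q_def sym[of "la z'" z'])
     also have "... <= en c * q (z, z')" using comp[OF True, of z z'] by (simp add: q_def)
     finally show ?thesis by (rule order_trans) simp
    next
     case False
     have "(NN y. q (z, y) * q (z', y)) = (NN y. ka (la z') (z', y) * ka (la z) (y, z))"
      by (simp add: q_def sym[of "la z" z] mult.commute)
     also have "... <= en c * q (z', z)" using comp[of "la z'" "la z" z' z] False by (simp add: q_def)
     finally show ?thesis by (rule order_trans) simp
    qed
   qed simp
   finally show "(NN y. u z * q (z, y) * (u z' * q (z', y))) <= en c * (u z * u z' * q (z, z')) + en c * (u z' * u z * q (z', z))"
    by (simp add: distrib_left mult_ac)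
  qed
  also have "... = (NN z. (NN z'. en c * (u z * u z' * q (z, z')))) + (NN z. (NN z'. en c * (u z' * u z * q (z', z))))"
   by (subst nn_integral_add[symmetric]) (measurable, intro nn_integral_cong nn_integral_add, measurable)
  also have "(NN z. (NN z'. en c * (u z' * u z * q (z', z)))) = (NN z. (NN z'. en c * (u z * u z' * q (z, z'))))"
   by (rule lborel_pair.Fubini') measurable
  also have "(NN z. (NN z'. en c * (u z * u z' * q (z, z')))) + (NN z. (NN z'. en c * (u z * u z' * q (z, z')))) <= en c * Xi + en c * Xi"
  proof (intro add_mono)
   have "(NN z. (NN z'. en c * (u z * u z' * q (z, z')))) = (NN z. en c * (u z * a u (la z) z))"
   proof (intro nn_integral_cong)
    fix z
    have "(NN z'. en c * (u z * u z' * q (z, z'))) = (NN z'. (en c * u z) * (q (z, z') * u z'))" by (simp add: mult_ac)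
    also have "... = (en c * u z) * (NN z'. q (z, z') * u z')" by (rule nn_integral_cmult) measurable
    finally show "(NN z'. en c * (u z * u z' * q (z, z'))) = en c * (u z * a u (la z) z)"
     by (simp add: q_def a_def mult.assoc)
   qed
   also have "... <= (NN z. en c * (u z * mx u z))"
   proof (intro nn_integral_mono mult_left_mono)
    show "a u (la z) z <= mx u z" for z
     unfolding mx_def a_def[symmetric] by (rule SUP_upper) (use lau in auto)
   qed auto
   also have "... = en c * Xi" unfolding Xi_def using mm[OF u] by (intro nn_integral_cmult) measurable
   finally show "(NN z. (NN z'. en c * (u z * u z' * q (z, z')))) <= en c * Xi" .
   thus "(NN z. (NN z'. en c * (u z * u z' * q (z, z')))) <= en c * Xi" .
  qed
  finally show ?thesis by (simp add: mult_2)
 qed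
 ultimately have e1: "Ui^2 <= 2 * (en c * Xi) * Hi"
  by (meson mult_right_mono order_trans zero_le)
 \<comment> \<open>Finiteness is what permits cancelling one factor \<open>Ui\<close> at the
   end.\<close>
 have Uf: "Ui < \<infinity>" using U unfolding Ui_def u_def .
 have "Xi^2 <= Ui * (NN z. (mx u z)^2)" unfolding Xi_def Ui_def
  using mm[OF u] by (intro Cauchy_Schwarz_nn_integral) auto
 also have "... <= Ui * (en K * Ui)" using K[OF u] Uf unfolding Ui_def by (intro mult_left_mono) auto
 finally have e2: "Xi^2 <= Ui * (en K * Ui)" .
 obtain ur where ur: "Ui = en ur" "ur >= 0" using Uf by (cases Ui) auto
 obtain hr where hr: "Hi = en hr" "hr >= 0" using H unfolding Hi_def[symmetric] by (cases Hi) auto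
 have "Xi^2 <= en (ur * (K * ur))" using e2 ur K0 by (simp add: ennreal_mult)
 hence "Xi < \<infinity>" by (cases Xi) (auto simp: top_unique)
 then obtain xr where xr: "Xi = en xr" "xr >= 0" by (cases Xi) auto
 have "xr^2 <= ur * (K * ur)" using \<open>Xi\<^sup>2 <= en (ur * (K * ur))\<close> xr ur K0 by (simp add: ennreal_power)
 also have "... = (sqrt K * ur)^2" using K0 by (simp add: power_mult_distrib) (simp add: power2_eq_square)
 finally have x2: "xr <= sqrt K * ur" by (rule power2_le_imp_le) (use K0 ur in auto)
 have "en (ur^2) <= en (2 * (c * xr) * hr)"
 proof -
  have "en (2 * (c * xr) * hr) = 2 * (en c * Xi) * Hi" using c xr hr by (simp add: ennreal_mult)
  thus ?thesis using e1 ur by (simp add: ennreal_power)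
 qed
 hence "ur * ur <= 2 * (c * xr) * hr" using c xr hr by (simp add: ennreal_le_iff power2_eq_square)
 also have "... <= 2 * (c * (sqrt K * ur)) * hr" using c hr x2 by (intro mult_right_mono mult_left_mono) auto
 also have "... = (2 * c * sqrt K * hr) * ur" by (simp add: mult_ac)
 finally have "ur <= 2 * c * sqrt K * hr"
  using ur(2) c K0 hr by (cases "ur = 0") auto
 hence "Ui <= en (2 * c * sqrt K) * Hi" using ur hr c K0 by (simp add: ennreal_mult[symmetric])
 thus ?thesis unfolding Ui_def u_def Hi_def .
qed

text \<open>For finitely many scales the crude bound depends on their number, but the map K to 2 c
  sqrt K pushes every admissible constant towards its fixed point 4 c^2. The infimum of the
  admissible constants is thus bounded independently of L, and monotone convergence lets L
  grow.\<close>

lemma maximal_abstract: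
 fixes ka :: "nat => 'a::euclidean_space \<times> 'a => ennreal" and h :: "'a => ennreal"
 assumes ka[measurable]: "!!l. ka l \<in> borel_measurable (borel \<Otimes>\<^sub>M borel)" and h[measurable]: "h \<in> bm"
  and sym: "!!l z y. ka l (z, y) = ka l (y, z)" and c: "c >= 0" and C0: "C0 >= 0"
  and fin: "!!l z. (NN y. ka l (z, y)) <= en C0"
  and comp: "!!l l' z z'. l <= l' ==> (NN y. ka l (z, y) * ka l' (y, z')) <= en c * ka l (z, z')"
 shows "(NN z. (SUP l. (NN y. ka l (z, y) * h y)^2)) <= en (4 * c^2 + 1) * (NN y. (h y)^2)"
proof (cases "(NN y. (h y)^2) < \<infinity>")
 case False
 have "0 < 4 * c^2 + 1" by (simp add: add_nonneg_pos)
 thus ?thesis using False by (simp add: ennreal_mult_top not_less top_unique)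
next
 case True
 define a where "a g l z = (NN y. ka l (z, y) * g y)" for g :: "'a => ennreal" and l z
 have am: "(%z. a g l z) \<in> bm" if [measurable]: "g \<in> bm" for g l
  unfolding a_def by measurable
 define mx where "mx L g z = (SUP l\<in>{..L}. a g l z)" for L :: nat and g z
 have mxm: "mx L g \<in> bm" if "g \<in> bm" for L g
  unfolding mx_def using am[OF that] by measurable
 have fixL: "(NN z. (mx L h z)^2) <= en (4 * c^2 + 1) * (NN y. (h y)^2)" for L
 proof -
  define S where "S = {K. K >= 0 & (\<forall>g\<in>bm. (NN y. (g y)^2) < \<infinity> --> (NN z. (mx L g z)^2) <= en K * (NN y. (g y)^2))}"
  define K0 where "K0 = real (Suc L) * (C0 * C0)"
  have K0: "K0 \<in> S"
  proof -
   have "(NN z. (mx L g z)^2) <= en K0 * (NN y. (g y)^2)" if g[measurable]: "g \<in> bm" for g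
   proof -
    note agm[measurable] = am[OF g]
    have "(NN z. (mx L g z)^2) <= (NN z. (\<Sum>l\<le>L. (a g l z)^2))"
    proof (intro nn_integral_mono)
     fix z
     have f: "finite ((%l. a g l z) ` {..L})" "(%l. a g l z) ` {..L} ~= {}" by auto
     have "mx L g z \<in> (%l. a g l z) ` {..L}" unfolding mx_def cSup_eq_Max[OF f] by (rule Max_in[OF f])
     then obtain l where l: "l <= L" "mx L g z = a g l z" by auto
     have "(a g l z)^2 <= (\<Sum>l\<le>L. (a g l z)^2)" using l by (intro member_le_sum) auto
     thus "(mx L g z)^2 <= (\<Sum>l\<le>L. (a g l z)^2)" using l by simp
    qed
    also have "... = (\<Sum>l\<le>L. (NN z. (a g l z)^2))" by (intro nn_integral_sum) measurable
    also have "... <= (\<Sum>l\<le>L. en C0 * en C0 * (NN y. (g y)^2))"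
     unfolding a_def by (intro sum_mono maximal_weak_step fin sym) measurable
    also have "... = en K0 * (NN y. (g y)^2)"
    proof -
     have "en K0 = of_nat (Suc L) * (en C0 * en C0)"
      unfolding K0_def ennreal_of_nat_eq_real_of_nat ennreal_mult[OF C0 C0, symmetric] using C0 by (intro ennreal_mult) auto
     thus ?thesis by (simp add: mult.assoc)
    qed
    finally show ?thesis .
   qed
   thus ?thesis unfolding S_def using C0 by (auto simp: K0_def)
  qed
  have step: "2 * c * sqrt K \<in> S" if "K \<in> S" for K
  proof -
   have K: "K >= 0" "!!g. g \<in> bm ==> (NN y. (g y)^2) < \<infinity> ==> (NN z. (mx L g z)^2) <= en K * (NN y. (g y)^2)"
    using that unfolding S_def by auto
   have "(NN z. (mx L g z)^2) <= en (2 * c * sqrt K) * (NN y. (g y)^2)"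
    if g: "g \<in> bm" and gf: "(NN y. (g y)^2) < \<infinity>" for g
   proof -
    have "en K * (NN y. (g y)^2) < \<infinity>" using gf by (simp add: ennreal_mult_less_top)
    hence "(NN z. (mx L g z)^2) < \<infinity>" using K(2)[OF g gf] by (rule le_less_trans[rotated])
    thus ?thesis unfolding mx_def a_def
     by (intro maximal_bootstrap[OF ka g sym c comp gf _ K(1)] K(2)[unfolded mx_def a_def])
   qed
   thus ?thesis unfolding S_def using c K by auto
  qed
  have "\<exists>K\<in>S. K <= 4 * c^2 + 1"
  proof (rule ccontr)
   assume "\<not> ?thesis"
   hence B: "4 * c^2 + 1 <= K" if "K \<in> S" for K using that by force
   define I where "I = Inf S"
   have bdd: "bdd_below S" using B by (rule bdd_belowI)
   have I: "4 * c^2 + 1 <= I" unfolding I_def using K0 B by (intro cInf_greatest) auto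
   have I0: "I > 0" using I by (smt (verit) zero_le_power2)
   \<comment> \<open>A value strictly between 4 c^2 and the assumed lower bound 4 c^2 + 1; it is
     positive even for c = 0, so division by it is safe.\<close>
   define q where "q = 4 * c^2 + 1/2"
   have q: "q > 0" unfolding q_def by (simp add: add_nonneg_pos)
   have "I^2 / q <= I"
   proof -
    have "I^2 / q <= K" if "K \<in> S" for K
    proof -
     have K: "K >= 0" using that by (simp add: S_def)
     have "I <= 2 * c * sqrt K" unfolding I_def by (rule cInf_lower[OF step[OF that] bdd])
     hence "I^2 <= (2 * c * sqrt K)^2" using I0 by (intro power_mono) auto
     also have "... = 4 * c^2 * K" using K by (simp add: power_mult_distrib)
     also have "... <= q * K" using K by (intro mult_right_mono) (auto simp: q_def)
     finally show ?thesis using q by (simp add: pos_divide_le_eq mult.commute)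
    qed
    thus ?thesis using K0 unfolding I_def[of] by (intro cInf_greatest) auto
   qed
   hence "I * I <= I * q" using q by (simp add: pos_divide_le_eq power2_eq_square)
   hence "I <= q" using I0 by simp
   thus False using I by (simp add: q_def)
  qed
  then obtain K where K: "K \<in> S" "K <= 4 * c^2 + 1" by blast
  have "(NN z. (mx L h z)^2) <= en K * (NN y. (h y)^2)" using K(1) True h by (simp add: S_def)
  also have "... <= en (4 * c^2 + 1) * (NN y. (h y)^2)" using K(2) by (intro mult_right_mono ennreal_leI) auto
  finally show ?thesis .
 qed
 note mh[measurable] = mxm[OF h]
 have "(NN z. (SUP l. (a h l z)^2)) <= (NN z. (SUP L. (mx L h z)^2))"
 proof (intro nn_integral_mono SUP_mono)
  show "\<exists>m\<in>UNIV. (a h n z)^2 <= (mx m h z)^2" for n z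
   unfolding mx_def by (rule bexI[of _ n]) (auto intro!: power_mono SUP_upper)
 qed
 also have "... = (SUP L. (NN z. (mx L h z)^2))"
 proof (rule nn_integral_monotone_convergence_SUP)
  show "incseq (%L z. (mx L h z)^2)"
   unfolding incseq_def le_fun_def mx_def by (auto intro!: power_mono SUP_subset_mono)
 qed measurable
 also have "... <= en (4 * c^2 + 1) * (NN y. (h y)^2)" by (rule SUP_least) (rule fixL)
 finally show ?thesis unfolding a_def .
qed

section \<open>Dilated kernels with polynomial decay and the low-frequency maximal function\<close>

definition dk :: "nat => nat => 'a::euclidean_space \<times> 'a => real" where
 "dk n l p = 2 ^ (l * DIM('a)) / (1 + 2 ^ l * norm (fst p - snd p)) ^ n"

lemma dk_nonneg: "dk n l p >= 0" by (simp add: dk_def)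

lemma measurable_dk[measurable]: "dk n l \<in> borel_measurable (borel \<Otimes>\<^sub>M borel)"
 unfolding dk_def by measurable

lemma dk_sym: "dk n l (z, y) = dk n l (y, z)" by (simp add: dk_def norm_minus_commute)

lemma dk_integral:
 fixes z :: "'a::euclidean_space"
 shows "(NN y. en (dk n l (z, y))) = (NN y. en (1 / (1 + norm (y::'a)) ^ n))"
proof -
 define c where "c = (1/2::real) ^ l"
 have c: "c > 0" "2 ^ l * c = 1" by (auto simp: c_def power_one_over)
 have m: "(%y. en (dk n l (z, y))) \<in> bm" by measurable
 have "(NN y. en (dk n l (z, y))) = (\<integral>\<^sup>+y. en (dk n l (z, y)) \<partial>(density (distr lborel borel (%x. z + c *\<^sub>R x)) (%_. en (\<bar>c\<bar> ^ DIM('a)))))"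
  using lborel_affine[of c z] c by simp
 also have "... = (NN y. en (\<bar>c\<bar> ^ DIM('a)) * en (dk n l (z, z + c *\<^sub>R y)))"
  using m by (subst nn_integral_density) (auto simp: nn_integral_distr)
 also have "... = (NN y. en (1 / (1 + norm (y::'a)) ^ n))"
 proof (intro nn_integral_cong)
  fix y :: 'a
  have "\<bar>c\<bar> ^ DIM('a) * dk n l (z, z + c *\<^sub>R y) = (2 ^ l * c) ^ DIM('a) / (1 + (2 ^ l * c) * norm y) ^ n"
   using c(1) by (simp add: dk_def power_mult power_mult_distrib mult_ac)
  thus "en (\<bar>c\<bar> ^ DIM('a)) * en (dk n l (z, z + c *\<^sub>R y)) = en (1 / (1 + norm y) ^ n)"
   using c by (simp add: ennreal_mult[symmetric] dk_nonneg)
 qed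
 finally show ?thesis .
qed

text \<open>The point y is at distance comparable to |z - z'| from z or from z', so one of the two
  factors is at most a multiple of the wider kernel at (z, z'). For the narrow factor this uses n >=
  D, with D the dimension: its height gains 2^(e D) while its tail loses 2^(e n).\<close>

lemma dk_comp:
 fixes z y z' :: "'a::euclidean_space"
 assumes n: "DIM('a) <= n" and ll: "l <= l'"
 shows "dk n l (z, y) * dk n l' (y, z') <= 4 ^ n * dk n l (z, z') * (dk n l (z, y) + dk n l' (y, z'))"
proof -
 define w a b where "w = norm (z - z')" and "a = norm (z - y)" and "b = norm (y - z')"
 have wab: "w <= a + b" unfolding w_def a_def b_def by (rule norm_triangle_sub[of "z - z'" "z - y", simplified, THEN order_trans]) (simp add: norm_minus_commute)
 have nn: "w >= 0" "a >= 0" "b >= 0" by (auto simp: w_def a_def b_def)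
 define P where "P = dk n l (z, y)"
 define Q where "Q = dk n l' (y, z')"
 define R where "R = dk n l (z, z')"
 have PQR: "P >= 0" "Q >= 0" "R >= 0" by (auto simp: P_def Q_def R_def dk_nonneg)
 have "P <= 4 ^ n * R \<or> Q <= 4 ^ n * R"
 proof (cases "1 + 2 ^ l * w <= 4 * (1 + 2 ^ l * a)")
  case True
  have "P = 4 ^ n * 2 ^ (l * DIM('a)) / (4 * (1 + 2 ^ l * a)) ^ n"
   unfolding power_mult_distrib[of 4] by (simp add: P_def dk_def a_def)
  also have "... <= 4 ^ n * 2 ^ (l * DIM('a)) / (1 + 2 ^ l * w) ^ n"
   using True nn by (intro divide_left_mono power_mono mult_pos_pos zero_less_power) (auto simp: add_pos_nonneg)
  also have "... = 4 ^ n * R" by (simp add: R_def dk_def w_def)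
  finally show ?thesis ..
 next
  case False
  define e where "e = l' - l"
  have l': "l' = l + e" using ll by (simp add: e_def)
  define X where "X = 2 ^ l * w"
  have "2 ^ l * w <= 2 ^ l * a + 2 ^ l * b" using mult_left_mono[OF wab, of "2 ^ l"] by (simp add: distrib_left)
  hence Xb: "1 + X <= 4 * (2 ^ l * b)" using False nn unfolding X_def by (smt (verit) mult_nonneg_nonneg zero_le_power)
  have "2 ^ e * (1 + X) <= 2 ^ e * (4 * (2 ^ l * b))" by (rule mult_left_mono[OF Xb]) simp
  hence "2 ^ e * (1 + X) <= 4 * (2 ^ l' * b)" unfolding l' by (simp add: power_add mult_ac)
  hence "2 ^ e * (1 + X) <= 4 * (1 + 2 ^ l' * b)" by (simp add: distrib_left)
  hence "(2 ^ e * (1 + X)) ^ n <= (4 * (1 + 2 ^ l' * b)) ^ n" using nn by (intro power_mono) (auto simp: X_def)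
  hence "4 ^ n * 2 ^ (l' * DIM('a)) / (4 * (1 + 2 ^ l' * b)) ^ n <= 4 ^ n * 2 ^ (l' * DIM('a)) / (2 ^ e * (1 + X)) ^ n"
   using nn by (intro divide_left_mono mult_pos_pos zero_less_power) (auto simp: X_def add_pos_nonneg)
  moreover have "Q = 4 ^ n * 2 ^ (l' * DIM('a)) / (4 * (1 + 2 ^ l' * b)) ^ n"
   unfolding power_mult_distrib[of 4] by (simp add: Q_def dk_def b_def)
  moreover have "4 ^ n * 2 ^ (l' * DIM('a)) / (2 ^ e * (1 + X)) ^ n = 4 ^ n * R * (2 ^ (e * DIM('a)) / 2 ^ (e * n))"
   unfolding l' add_mult_distrib power_add power_mult_distrib power_mult[symmetric] R_def dk_def fst_conv snd_conv w_def[symmetric] X_def by (simp add: mult_ac del: power_add power_mult)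
  moreover have "4 ^ n * R * (2 ^ (e * DIM('a)) / 2 ^ (e * n)) <= 4 ^ n * R * 1"
   using n PQR by (intro mult_left_mono) (auto intro!: power_increasing)
  ultimately have "Q <= 4 ^ n * R" by simp
  thus ?thesis ..
 qed
 hence "P * Q <= 4 ^ n * R * (P + Q)"
 proof
  assume "P <= 4 ^ n * R"
  hence "P * Q <= 4 ^ n * R * Q" using PQR by (intro mult_right_mono) auto
  moreover have "0 <= 4 ^ n * R * P" using PQR by (intro mult_nonneg_nonneg) auto
  ultimately show ?thesis by (simp add: distrib_left)
 next
  assume "Q <= 4 ^ n * R"
  hence "P * Q <= P * (4 ^ n * R)" using PQR by (intro mult_left_mono) auto
  moreover have "0 <= 4 ^ n * R * Q" using PQR by (intro mult_nonneg_nonneg) auto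
  ultimately show ?thesis by (simp add: algebra_simps)
 qed
 thus ?thesis by (simp add: P_def Q_def R_def)
qed

lemma maximal_dk:
 assumes n: "DIM('a::euclidean_space) + 2 <= n"
 shows "\<exists>K\<ge>0. \<forall>h \<in> bm.
  (NN z. (SUP l. (NN y. en (dk n l (z::'a, y)) * h y)^2)) <= en K * (NN y. (h y)^2)"
proof -
 define I where "I = (NN y. en (1 / (1 + norm (y::'a)) ^ n))"
 have "I <= (NN y. en (norm (1 / (1 + norm (y::'a)) ^ (DIM('a) + 2))))"
  unfolding I_def
 proof (intro nn_integral_mono ennreal_leI)
  fix y :: 'a
  have "(1 + norm y) ^ (DIM('a) + 2) <= (1 + norm y) ^ n" using n by (intro power_increasing) auto
  moreover have "(1 + norm y) ^ (DIM('a) + 2) > 0" by (intro zero_less_power add_pos_nonneg) auto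
  ultimately have "1 / (1 + norm y) ^ n <= 1 / (1 + norm y) ^ (DIM('a) + 2)" by (intro divide_left_mono mult_pos_pos) auto
  also have "... <= norm (1 / (1 + norm y) ^ (DIM('a) + 2))" unfolding real_norm_def by (rule abs_ge_self)
  finally show "1 / (1 + norm y) ^ n <= norm (1 / (1 + norm y) ^ (DIM('a) + 2))" .
 qed
 also have "... < \<infinity>" using integrable_poly_decay_aux[where 'a='a] by (simp add: integrable_iff_bounded)
 finally obtain C0 where C0: "I = en C0" "C0 >= 0" by (cases I) auto
 define c where "c = 4 ^ n * (2 * C0)"
 have c: "c >= 0" using C0 by (simp add: c_def)
 have comp: "(NN y. en (dk n l (z, y)) * en (dk n l' (y, z'))) <= en c * en (dk n l (z, z'))"
  if "l <= l'" for l l' and z z' :: 'a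
 proof -
  have "(NN y. en (dk n l (z, y)) * en (dk n l' (y, z')))
   <= (NN y. en (4 ^ n * dk n l (z, z')) * (en (dk n l (z, y)) + en (dk n l' (z', y))))"
  proof (intro nn_integral_mono)
   fix y
   have "dk n l (z, y) * dk n l' (y, z') <= 4 ^ n * dk n l (z, z') * (dk n l (z, y) + dk n l' (y, z'))"
    by (rule dk_comp) (use that n in auto)
   hence "en (dk n l (z, y) * dk n l' (y, z')) <= en (4 ^ n * dk n l (z, z') * (dk n l (z, y) + dk n l' (y, z')))" by (rule ennreal_leI)
   thus "en (dk n l (z, y)) * en (dk n l' (y, z')) <= en (4 ^ n * dk n l (z, z')) * (en (dk n l (z, y)) + en (dk n l' (z', y)))"
    by (simp add: ennreal_mult dk_nonneg dk_sym[of n l' z'])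
  qed
  also have "... = en (4 ^ n * dk n l (z, z')) * (NN y. en (dk n l (z, y)) + en (dk n l' (z', y)))"
   by (rule nn_integral_cmult) measurable
  also have "(NN y. en (dk n l (z, y)) + en (dk n l' (z', y))) = en C0 + en C0"
   by (subst nn_integral_add) (measurable, simp add: dk_integral I_def[symmetric] C0)
  also have "en (4 ^ n * dk n l (z, z')) * (en C0 + en C0) = en c * en (dk n l (z, z'))"
   unfolding c_def using C0 by (simp add: ennreal_plus[symmetric] ennreal_mult[symmetric] dk_nonneg mult_ac del: ennreal_plus)
  finally show ?thesis .
 qed
 have "0 <= 4 * c^2 + 1" by (simp add: add_nonneg_pos less_imp_le)
 moreover have "(NN z. (SUP l. (NN y. en (dk n l (z::'a, y)) * h y)^2)) <= en (4 * c^2 + 1) * (NN y. (h y)^2)"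
  if h: "h \<in> bm" for h
  by (rule maximal_abstract[where ka = "%l p. en (dk n l p)", OF _ h _ c C0(2) _ comp])
   (use C0 in \<open>auto simp: dk_integral I_def[symmetric] intro!: arg_cong[where f = ennreal] dk_sym\<close>)
 ultimately show ?thesis by blast
qed

text \<open>For s = 1 the multiplier is smooth on the scale t^2 of the spectrum and the kernel
  concentrates at distance 1 / t. The number of second indices, about t^(2d), supplies the height,
  as 2 d is the real dimension.\<close>

lemma low_kernel_bound:
 fixes A :: real
 assumes A: "A >= 0"
 shows "\<exists>C\<ge>0. ALL ze l t (z :: complex ^ 'd::finite) z'. bump (2 * N) A ze --> t \<in> blk l -->
  cmod (kerA (nat \<lfloor>t\<^sup>2\<rfloor>) (am CARD('d) ze 1 t) z z') <= C * dk (2 * N) l (z, z')"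
proof -
 define d where "d = CARD('d)"
 obtain CN where CN: "CN >= 0" "!!ze s t k. bump (2 * N) A ze ==> 0 < s ==> s <= 1 ==> 1 <= t ==>
   \<bar>(dlap d ^^ N) (am d ze s t) k\<bar> <= CN * (min t (1 / (s * t))) ^ (2 * N)"
  using am_dlap_bound[OF A, of N d] by blast
 define B where "B = sh_bound TYPE('d)"
 have B: "B >= 0" unfolding B_def by (rule sh_bound_nonneg)
 define C where "C = 2 ^ (2 * N) * (B * (A + CN) * (4 * (real N + 2)) ^ d)"
 have "C >= 0" unfolding C_def using A B CN by auto
 moreover have "cmod (kerA (nat \<lfloor>t\<^sup>2\<rfloor>) (am CARD('d) ze 1 t) z z') <= C * dk (2 * N) l (z, z')"
  if bp: "bump (2 * N) A ze" and t: "t \<in> blk l" for ze l t and z z' :: "complex ^ 'd"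
 proof -
  have t1: "t >= 1" by (rule blk_ge_1[OF t])
  have tb: "2 ^ l <= t" "t < 2 * 2 ^ l" using t by (auto simp: blk_def)
  define K where "K = nat \<lfloor>t\<^sup>2\<rfloor>"
  define k where "k = cmod (kerA K (am CARD('d) ze 1 t) z z')"
  define w where "w = norm (z - z')"
  define X where "X = (4 * (real N + 2)) ^ d * 2 ^ (l * DIM(complex ^ 'd))"
  have Kb: "(real (K + N) + 1) ^ d <= X"
  proof -
   have "real K <= t^2" unfolding K_def by simp
   also have "t^2 <= (2 * 2 ^ l)^2" using tb t1 by (intro power_mono) auto
   finally have "real K <= 4 * (2 ^ l)^2" by (simp add: power_mult_distrib)
   moreover have "1 <= ((2::real) ^ l)^2" by simp
   ultimately have "real (K + N) + 1 <= 4 * (2 ^ l)^2 + (real N + 1) * (2 ^ l)^2"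
   proof -
    have "(real N + 1) * 1 <= (real N + 1) * (2 ^ l)^2" by (intro mult_left_mono) auto
    thus ?thesis using \<open>real K <= 4 * (2 ^ l)^2\<close> by (simp only: of_nat_add mult_1_right)
   qed
   also have "... <= 4 * (real N + 2) * (2 ^ l)^2" by (simp add: distrib_right)
   finally have "(real (K + N) + 1) ^ d <= (4 * (real N + 2) * (2 ^ l)^2) ^ d" by (intro power_mono) auto
   also have "... = (4 * (real N + 2)) ^ d * ((2 ^ l)^2) ^ d" by (rule power_mult_distrib)
   also have "((2 ^ l)^2) ^ d = (2::real) ^ (l * DIM(complex ^ 'd))"
    by (simp add: d_def power_mult[symmetric])
   finally show ?thesis unfolding X_def .
  qed
  have k1: "k <= B * A * X"
  proof -
   have "k <= B * A * (real K + 1) ^ CARD('d)" unfolding k_def B_def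
    by (rule kerA_pointwise) (use bumpD(1)[OF bp] in \<open>auto simp: am_def\<close>)
   also have "... <= B * A * (real (K + N) + 1) ^ d" unfolding d_def using A B by (intro mult_left_mono power_mono) auto
   also have "... <= B * A * X" using A B by (intro mult_left_mono Kb) auto
   finally show ?thesis .
  qed
  have k2: "(2 ^ l * w) ^ (2 * N) * k <= B * CN * X"
  proof -
   have "w ^ (2 * N) * k <= B * (CN * (1 / t) ^ (2 * N)) * (real (K + N) + 1) ^ CARD('d)"
    unfolding k_def B_def w_def
   proof (rule kerA_weighted_pointwise)
    show "am CARD('d) ze 1 t k = 0" if "K < k" for k using that unfolding K_def by (intro am_zero[OF bp]) (use t1 in auto)
    show "\<bar>(dlap CARD('d) ^^ N) (am CARD('d) ze 1 t) k\<bar> <= CN * (1 / t) ^ (2 * N)" for k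
    proof -
     have "\<bar>(dlap d ^^ N) (am d ze 1 t) k\<bar> <= CN * (min t (1 / (1 * t))) ^ (2 * N)" by (rule CN(2)[OF bp]) (use t1 in auto)
     also have "... <= CN * (1 / t) ^ (2 * N)" using t1 CN by (intro mult_left_mono power_mono) auto
     finally show ?thesis unfolding d_def .
    qed
   qed
   hence "t ^ (2 * N) * (w ^ (2 * N) * k) <= t ^ (2 * N) * (B * (CN * (1 / t) ^ (2 * N)) * (real (K + N) + 1) ^ d)"
    unfolding d_def using t1 by (intro mult_left_mono) auto
   also have "... = B * CN * (real (K + N) + 1) ^ d" using t1 by (simp add: power_one_over field_simps)
   also have "... <= B * CN * X" using B CN by (intro mult_left_mono Kb) auto
   finally have "(t * w) ^ (2 * N) * k <= B * CN * X" by (simp add: power_mult_distrib mult.assoc)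
   moreover have "(2 ^ l * w) ^ (2 * N) * k <= (t * w) ^ (2 * N) * k"
    using tb by (intro mult_right_mono power_mono) (auto simp: k_def w_def)
   ultimately show ?thesis by linarith
  qed
  have "(1 + 2 ^ l * w) ^ (2 * N) * k <= 2 ^ (2 * N) * (1 + (2 ^ l * w) ^ (2 * N)) * k"
   by (intro mult_right_mono one_plus_pow_le) (auto simp: w_def k_def)
  also have "... = 2 ^ (2 * N) * (k + (2 ^ l * w) ^ (2 * N) * k)" by (simp add: algebra_simps)
  also have "... <= 2 ^ (2 * N) * (B * A * X + B * CN * X)" by (intro mult_left_mono add_mono k1 k2) auto
  also have "... = C * 2 ^ (l * DIM(complex ^ 'd))" unfolding C_def X_def by (simp add: algebra_simps)
  finally have "k <= C * 2 ^ (l * DIM(complex ^ 'd)) / (1 + 2 ^ l * w) ^ (2 * N)"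
   by (subst pos_le_divide_eq) (auto simp: mult.commute w_def intro!: zero_less_power add_pos_nonneg)
  thus ?thesis unfolding k_def K_def dk_def w_def by simp
 qed
 ultimately show ?thesis by blast
qed

text \<open>With s = 1 the kernel width is at most 1, so J = 0 can be taken; then no low part is
  left, since separated annuli have an index of at least 2. The maximal function is formed for each
  annulus from the data near it, so that the weight can be treated as constant. A Borel majorant
  \<open>G\<close> stands for the supremum over uncountably many t.\<close>

theorem low_maximal:
 assumes al: "al >= 0"
 shows "EX M. \<forall>A\<ge>0. \<exists>C\<ge>0. ALL ze (f :: 'd::finite fld). bump M A ze --> wadm al f -->
  (\<exists>G \<in> bm. (\<forall>t\<ge>1. ALL z. nq (Tm ze 1 t f z) <= G z) &
   (NN z. G z * wt al z) <= en C * wn al f)"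
proof -
 define d where "d = CARD('d)"
 define D where "D = DIM(complex ^ 'd)"
 define P where "P = D + 2 + nat \<lceil>al\<rceil>"
 have P: "al <= real P" "DIM(complex ^ 'd) + 2 <= P" unfolding P_def D_def by (linarith, simp)
 define N where "N = P + d + 1"
 define Q where "Q = 4 * N - 2 * P"
 have Q: "4 * N = 2 * P + Q" unfolding Q_def N_def by simp
 define V where "V = (NN z. en ((1/2) ^ (idx (z :: complex ^ 'd) * P)))"
 have V: "V = en (enn2real V)" using idx_decay_integral[OF P(2)] unfolding V_def by (simp add: less_top)
 have nN: "DIM(complex ^ 'd) + 2 <= 2 * N" unfolding N_def P_def D_def by simp
 obtain K where K: "K >= 0" "!!h. h \<in> bm ==>
  (NN z. (SUP l. (NN y. en (dk (2 * N) l (z::complex ^ 'd, y)) * h y)^2)) <= en K * (NN y. (h y)^2)"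
  using maximal_dk[OF nN] by blast
 show ?thesis
 proof (intro exI[of _ "2 * N"] allI impI)
  fix A :: real assume A: "A >= 0"
  obtain Ck where Ck: "Ck >= 0" "!!ze l t (z :: complex ^ 'd) z'. bump (2 * N) A ze ==> t \<in> blk l ==>
   cmod (kerA (nat \<lfloor>t\<^sup>2\<rfloor>) (am CARD('d) ze 1 t) z z') <= Ck * dk (2 * N) l (z, z')"
   using low_kernel_bound[OF A, of N] by blast
  obtain CN where CN: "CN >= 0" "!!ze s t k. bump (2 * N) A ze ==> 0 < s ==> s <= 1 ==> 1 <= t ==>
    \<bar>(dlap d ^^ N) (am d ze s t) k\<bar> <= CN * (min t (1 / (s * t))) ^ (2 * N)"
   using am_dlap_bound[OF A, of N d] by blast
  define c2 where "c2 = sh_norm TYPE('d) * sh_bound TYPE('d)"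
  have c2: "c2 >= 0" unfolding c2_def by (intro mult_nonneg_nonneg sh_norm_nonneg sh_bound_nonneg)
  define CF where "CF = c2 * CN^2 * (real N + 2) ^ d * 2 ^ (8 * N)"
  have CF: "CF >= 0" unfolding CF_def using c2 by (intro mult_nonneg_nonneg) auto
  define C where "C = 2 * (Ck^2 * (K * (3 * 2 powr al)) + CF * enn2real V)"
  have C: "C >= 0" unfolding C_def using K CF by (intro mult_nonneg_nonneg add_nonneg_nonneg) auto
  have main: "\<exists>G \<in> bm. (\<forall>t\<ge>1. ALL z. nq (Tm ze 1 t f z) <= G z) &
   (NN z. G z * wt al z) <= en C * wn al f"
   if bp: "bump (2 * N) A ze" and f: "wadm al f" for ze and f :: "'d fld"
  proof -
   have fm[measurable]: "f \<in> bm" using f by (simp add: wadm_def)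
   define g where "g i z = cut (nearP i) f z" for i z
   have gm[measurable]: "g i \<in> bm" for i
   proof -
    have "g i = cut (nearP i) f" by (simp add: g_def fun_eq_iff)
    thus ?thesis using measurable_cut measurable_preds fm by simp
   qed
   define H where "H i z = (SUP l. (NN y. en (dk (2 * N) l (z, y)) * en (cmod (g i y)))^2)" for i z
   have Hm[measurable]: "H i \<in> bm" for i unfolding H_def by measurable
   have HI: "(NN z. H i z) <= en K * (NN y. nq (g i y))" for i
   proof -
    have "(%y. en (cmod (g i y))) \<in> bm" by measurable
    from K(2)[OF this] show ?thesis unfolding H_def by (simp add: ennreal_power)
   qed
   define G1 where "G1 z = en (Ck^2) * (\<Sum>i. H i z * indicator (annulus i) z)" for z
   define G2 where "G2 z = en (CF * (1/2) ^ (idx z * P)) * wn al f" for z :: "complex ^ 'd"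
   define G where "G z = 2 * (G1 z + G2 z)" for z
   note annulus_borel[measurable]
   have G1m[measurable]: "G1 \<in> bm" unfolding G1_def by measurable
   have G2m[measurable]: "G2 \<in> bm" unfolding G2_def by measurable
   have Gm: "G \<in> bm" unfolding G_def by measurable
   have near: "nq (Tm ze 1 t (cut (nearP (idx z)) f) z) <= G1 z" if t: "t >= 1" for t z
   proof -
    obtain l where l: "t \<in> blk l" using blk_ex[OF t] by blast
    let ?g = "cut (nearP (idx z)) f"
    have wg: "wadm al ?g" by (rule wadm_cut[OF f]) measurable
    have "en (cmod (Tm ze 1 t ?g z)) <= (NN y. en (cmod (kerA (nat \<lfloor>t\<^sup>2\<rfloor>) (am CARD('d) ze 1 t) z y * ?g y)))"
     unfolding Tm_kernel(2)[OF wg] by (rule integral_norm_bound_ennreal[OF Tm_kernel(1)[OF wg]])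
    also have "... <= (NN y. en Ck * (en (dk (2 * N) l (z, y)) * en (cmod (g (idx z) y))))"
    proof (intro nn_integral_mono)
     fix y
     have "cmod (kerA (nat \<lfloor>t\<^sup>2\<rfloor>) (am CARD('d) ze 1 t) z y * ?g y) <= Ck * dk (2 * N) l (z, y) * cmod (g (idx z) y)"
      unfolding norm_mult g_def by (intro mult_right_mono Ck(2)[OF bp l]) auto
     hence "en (cmod (kerA (nat \<lfloor>t\<^sup>2\<rfloor>) (am CARD('d) ze 1 t) z y * ?g y)) <= en (Ck * (dk (2 * N) l (z, y) * cmod (g (idx z) y)))"
      by (intro ennreal_leI) (simp add: mult.assoc)
     thus "en (cmod (kerA (nat \<lfloor>t\<^sup>2\<rfloor>) (am CARD('d) ze 1 t) z y * ?g y)) <= en Ck * (en (dk (2 * N) l (z, y)) * en (cmod (g (idx z) y)))"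
      using Ck(1) by (simp add: ennreal_mult dk_nonneg)
    qed
    also have "... = en Ck * (NN y. en (dk (2 * N) l (z, y)) * en (cmod (g (idx z) y)))"
     by (rule nn_integral_cmult) measurable
    finally have "(en (cmod (Tm ze 1 t ?g z)))^2 <= (en Ck * (NN y. en (dk (2 * N) l (z, y)) * en (cmod (g (idx z) y))))^2"
     by (rule power_mono) simp
    also have "... = en (Ck^2) * (NN y. en (dk (2 * N) l (z, y)) * en (cmod (g (idx z) y)))^2"
     using Ck(1) by (simp add: power_mult_distrib ennreal_power)
    also have "... <= en (Ck^2) * H (idx z) z" unfolding H_def by (intro mult_left_mono SUP_upper) auto
    also have "... = G1 z" unfolding G1_def by (subst ind_suminf) simp
    finally show ?thesis by (simp add: ennreal_power)
   qed
   have far: "nq (Tm ze 1 t (cut (farP (idx z) 0) f) z) <= G2 z" if t: "t >= 1" for t z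
   proof -
    have B: "\<bar>(dlap CARD('d) ^^ N) (am CARD('d) ze 1 t) k\<bar> <= CN * (1 / t) ^ (2 * N)" for k
    proof -
     have "\<bar>(dlap d ^^ N) (am d ze 1 t) k\<bar> <= CN * (min t (1 / (1 * t))) ^ (2 * N)" by (rule CN(2)[OF bp]) (use t in auto)
     also have "... <= CN * (1 / t) ^ (2 * N)" using t CN by (intro mult_left_mono power_mono) auto
     finally show ?thesis unfolding d_def .
    qed
    have "nq (Tm ze 1 t (cut (farP (idx z) 0) f) z)
     <= en (sh_norm TYPE('d) * sh_bound TYPE('d) * (CN * (1 / t) ^ (2 * N))^2 * (t^2 + real N + 1) ^ CARD('d) * (2 ^ (8 * N) * (1/2) ^ (0 * Q)) * (1/2) ^ (idx z * P)) * wn al f"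
     by (rule far_pointwise[OF f bp zero_less_one t B P(1) Q])
    also have "... <= G2 z" unfolding G2_def
    proof (rule mult_right_mono, rule ennreal_leI)
     \<comment> \<open>The decay t^(-4N) of the kernel bound outweighs the growth t^(2d) of the
       number of indices, uniformly in t >= 1.\<close>
     have "(CN * (1 / t) ^ (2 * N))^2 * (t^2 + real N + 1) ^ d <= CN^2 * (real N + 2) ^ d"
     proof -
      have t2: "1 <= t^2" using t by simp
      hence "t^2 + real N + 1 <= (real N + 2) * t^2"
       using mult_left_mono[OF t2, of "real N + 1"] by (simp add: distrib_right)
      hence "(t^2 + real N + 1) ^ d <= ((real N + 2) * t^2) ^ d" by (intro power_mono) auto
      also have "... = (real N + 2) ^ d * t ^ (2 * d)" by (simp add: power_mult_distrib power_mult)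
      also have "... <= (real N + 2) ^ d * t ^ (4 * N)" using t unfolding N_def by (intro mult_left_mono power_increasing) auto
      finally have "(CN * (1 / t) ^ (2 * N))^2 * (t^2 + real N + 1) ^ d <= (CN * (1 / t) ^ (2 * N))^2 * ((real N + 2) ^ d * t ^ (4 * N))"
       by (intro mult_left_mono) auto
      also have "... = CN^2 * (real N + 2) ^ d * ((1 / t) ^ (4 * N) * t ^ (4 * N))"
      proof -
       have "((1 / t) ^ (2 * N))^2 = (1 / t) ^ (4 * N)" by (simp add: power_mult[symmetric] mult.commute)
       thus ?thesis by (simp only: power_mult_distrib mult_ac)
      qed
      also have "(1 / t) ^ (4 * N) * t ^ (4 * N) = 1" using t by (simp add: power_mult_distrib[symmetric])
      finally show ?thesis by simp
     qed
     hence "c2 * ((CN * (1 / t) ^ (2 * N))^2 * (t^2 + real N + 1) ^ d) * (2 ^ (8 * N) * (1/2) ^ (idx z * P)) <= c2 * (CN^2 * (real N + 2) ^ d) * (2 ^ (8 * N) * (1/2) ^ (idx z * P))"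
      using c2 by (intro mult_right_mono mult_left_mono) auto
     thus "sh_norm TYPE('d) * sh_bound TYPE('d) * (CN * (1 / t) ^ (2 * N))^2 * (t^2 + real N + 1) ^ CARD('d) * (2 ^ (8 * N) * (1/2) ^ (0 * Q)) * (1/2) ^ (idx z * P) <= CF * (1/2) ^ (idx z * P)"
      unfolding CF_def c2_def[symmetric] d_def[symmetric] by (simp only: mult_0 power_0 mult_1_right mult.assoc)
    qed simp
    finally show ?thesis .
   qed
   have "nq (Tm ze 1 t f z) <= G z" if t: "t >= 1" for t z
   proof -
    have "cut (lowP (idx z) 0) f = (%_. 0)" by (auto simp: cut_def lowP_def apart_def fun_eq_iff)
    hence "Tm ze 1 t f z = Tm ze 1 t (cut (nearP (idx z)) f) z + Tm ze 1 t (cut (farP (idx z) 0) f) z"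
     using Tm_three_split[OF f, of ze 1 t z "idx z" 0] by (simp add: Tm_zero)
    hence "(cmod (Tm ze 1 t f z))^2 <= (cmod (Tm ze 1 t (cut (nearP (idx z)) f) z) + cmod (Tm ze 1 t (cut (farP (idx z) 0) f) z))^2"
     by (intro power_mono) (auto intro: norm_triangle_ineq)
    also have "... <= 2 * (cmod (Tm ze 1 t (cut (nearP (idx z)) f) z))^2 + 2 * (cmod (Tm ze 1 t (cut (farP (idx z) 0) f) z))^2"
     by (rule sum_sq_le)
    finally have "nq (Tm ze 1 t f z) <= en (2 * (cmod (Tm ze 1 t (cut (nearP (idx z)) f) z))^2 + 2 * (cmod (Tm ze 1 t (cut (farP (idx z) 0) f) z))^2)"
     by (rule ennreal_leI)
    also have "... = 2 * (nq (Tm ze 1 t (cut (nearP (idx z)) f) z) + nq (Tm ze 1 t (cut (farP (idx z) 0) f) z))"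
     by (simp add: ennreal_mult distrib_left)
    also have "... <= G z" unfolding G_def by (intro mult_left_mono add_mono near far t) auto
    finally show ?thesis .
   qed
   moreover have "(NN z. G z * wt al z) <= en C * wn al f"
   proof -
    have i1: "(NN z. G1 z * wt al z) <= en (Ck^2 * (K * (3 * 2 powr al))) * wn al f"
    proof -
     have "(NN z. G1 z * wt al z) = (\<Sum>i. (NN z. G1 z * wt al z * indicator (annulus i) z))"
      by (rule nn_integral_idx) measurable
     also have "... <= (\<Sum>i. en (Ck^2 * K) * (en (2 powr (- al * real i)) * (NN z. nq (cut (nearP i) f z))))"
     proof (intro suminf_le)
      fix i
      have "(NN z. G1 z * wt al z * indicator (annulus i) z) <= (NN z. en (Ck^2) * en (2 powr (- al * real i)) * H i z)"
      proof (intro nn_integral_mono)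
       fix z :: "complex ^ 'd"
       show "G1 z * wt al z * indicator (annulus i) z <= en (Ck^2) * en (2 powr (- al * real i)) * H i z"
       proof (cases "z \<in> annulus i")
        case True
        hence "idx z = i" by (simp add: annulus_idx)
        thus ?thesis using True unfolding G1_def by (subst ind_suminf) (simp add: weight_idx mult_ac)
       qed simp
      qed
      also have "... = en (Ck^2) * en (2 powr (- al * real i)) * (NN z. H i z)" by (rule nn_integral_cmult) measurable
      also have "... <= en (Ck^2) * en (2 powr (- al * real i)) * (en K * (NN y. nq (g i y)))"
       by (intro mult_left_mono HI) auto
      also have "... = en (Ck^2 * K) * (en (2 powr (- al * real i)) * (NN z. nq (cut (nearP i) f z)))"
       unfolding g_def using K(1) by (simp add: ennreal_mult mult_ac)
      finally show "(NN z. G1 z * wt al z * indicator (annulus i) z) <= en (Ck^2 * K) * (en (2 powr (- al * real i)) * (NN z. nq (cut (nearP i) f z)))" .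
     qed auto
     also have "... = en (Ck^2 * K) * (\<Sum>i. en (2 powr (- al * real i)) * (NN z. nq (cut (nearP i) f z)))"
      by (rule ennreal_suminf_cmult)
     also have "... <= en (Ck^2 * K) * (en (3 * 2 powr al) * wn al f)"
      by (intro mult_left_mono near_weight_sum[OF f]) auto
     also have "... = en (Ck^2 * (K * (3 * 2 powr al))) * wn al f"
     proof -
      have "en (Ck^2 * K * (3 * 2 powr al)) = en (Ck^2 * K) * en (3 * 2 powr al)" using K(1) by (intro ennreal_mult) auto
      thus ?thesis by (simp add: mult.assoc)
     qed
     finally show ?thesis .
    qed
    have i2: "(NN z. G2 z * wt al z) <= en (CF * enn2real V) * wn al f"
    proof -
     have "(NN z. G2 z * wt al z) <= (NN z. (en CF * wn al f) * en ((1/2) ^ (idx (z :: complex ^ 'd) * P)))"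
     proof (intro nn_integral_mono)
      fix z :: "complex ^ 'd"
      have "G2 z * wt al z <= G2 z * en 1" by (intro mult_left_mono ennreal_leI weight_le_1 al) auto
      also have "... = (en CF * wn al f) * en ((1/2) ^ (idx z * P))" unfolding G2_def using CF by (simp add: ennreal_mult mult_ac)
      finally show "G2 z * wt al z <= (en CF * wn al f) * en ((1/2) ^ (idx z * P))" .
     qed
     also have "... = (en CF * wn al f) * V" unfolding V_def by (rule nn_integral_cmult) measurable
     also have "... = (en CF * wn al f) * en (enn2real V)" using V by simp
     also have "... = en (CF * enn2real V) * wn al f" using CF by (simp add: ennreal_mult mult_ac)
     finally show ?thesis .
    qed
    have "(NN z. G z * wt al z) = (NN z. 2 * (G1 z * wt al z + G2 z * wt al z))"
     unfolding G_def by (simp add: distrib_right mult.assoc)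
    also have "... = 2 * ((NN z. G1 z * wt al z) + (NN z. G2 z * wt al z))"
    proof -
     have "(NN z. 2 * (G1 z * wt al z + G2 z * wt al z)) = 2 * (NN z. G1 z * wt al z + G2 z * wt al z)"
      by (rule nn_integral_cmult) measurable
     also have "(NN z. G1 z * wt al z + G2 z * wt al z) = (NN z. G1 z * wt al z) + (NN z. G2 z * wt al z)"
      by (rule nn_integral_add) measurable
     finally show ?thesis .
    qed
    also have "... <= 2 * (en (Ck^2 * (K * (3 * 2 powr al))) * wn al f + en (CF * enn2real V) * wn al f)"
     by (intro mult_left_mono add_mono i1 i2) auto
    also have "... = en C * wn al f"
    proof -
     have p: "0 <= Ck^2 * (K * (3 * 2 powr al))" "0 <= CF * enn2real V" using K CF by auto
     have "en C = en 2 * (en (Ck^2 * (K * (3 * 2 powr al))) + en (CF * enn2real V))"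
      unfolding C_def ennreal_plus[OF p, symmetric] using p by (intro ennreal_mult) auto
     thus ?thesis by (simp only: distrib_right mult.assoc ennreal_numeral)
    qed
    finally show ?thesis .
   qed
   ultimately show ?thesis using Gm by blast
  qed
  show "\<exists>C\<ge>0. ALL ze (f :: 'd fld). bump (2 * N) A ze --> wadm al f -->
   (\<exists>G \<in> bm. (\<forall>t\<ge>1. ALL z. nq (Tm ze 1 t f z) <= G z) &
    (NN z. G z * wt al z) <= en C * wn al f)"
   using C main by blast
 qed
qed

section \<open>Smooth cutoffs\<close>

text \<open>Finite smoothness as a recursive existential: closure under sums, products and
  reciprocals becomes a plain induction, and the explicit chain demanded by \<open>bump\<close> is
  extracted at the end.\<close>

primrec cdiff :: "real set => nat => (real => real) => bool" where
 "cdiff U 0 f \<longleftrightarrow> continuous_on U f"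
| "cdiff U (Suc n) f \<longleftrightarrow> (EX g. (\<forall>x\<in>U. (f has_real_derivative g x) (at x)) & cdiff U n g)"

lemma cdiff_SucI: "(!!x. x \<in> U ==> (f has_real_derivative g x) (at x)) ==> cdiff U n g ==> cdiff U (Suc n) f"
 by auto

lemma cdiff_continuous: assumes "cdiff U n f" shows "continuous_on U f"
proof (cases n)
 case (Suc m)
 then obtain g where "!!x. x \<in> U ==> (f has_real_derivative g x) (at x)" using assms by auto
 thus ?thesis by (intro continuous_at_imp_continuous_on ballI) (rule DERIV_isCont)
qed (use assms in simp)

lemma cdiff_Suc_imp: "cdiff U (Suc n) f ==> cdiff U n f"
proof (induction n arbitrary: f)
 case 0
 thus ?case by (simp only: cdiff.simps(1) cdiff_continuous)
next
 case (Suc n)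
 thus ?case by (metis cdiff.simps(2))
qed

lemma cdiff_subset: "cdiff U n f ==> V \<subseteq> U ==> cdiff V n f"
proof (induction n arbitrary: f)
 case 0
 thus ?case by (auto intro: continuous_on_subset)
next
 case (Suc n)
 thus ?case by (metis cdiff.simps(2) subsetD)
qed

lemma cdiff_cong: assumes "open U" "cdiff U n f" "!!x. x \<in> U ==> f x = g x" shows "cdiff U n g"
proof (cases n)
 case 0
 thus ?thesis using assms(2,3) by (simp cong: continuous_on_cong)
next
 case (Suc m)
 then obtain f' where f': "!!x. x \<in> U ==> (f has_real_derivative f' x) (at x)" "cdiff U m f'" using assms(2) by auto
 have "(g has_real_derivative f' x) (at x)" if "x \<in> U" for x
  by (rule has_field_derivative_transform_within_open[OF f'(1)[OF that] assms(1) that assms(3)])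
 thus ?thesis using f'(2) Suc by auto
qed

lemma cdiff_const: "cdiff U n (%_. c)"
proof (induction n arbitrary: c)
 case (Suc n)
 show ?case by (rule cdiff_SucI[OF _ Suc[of 0]]) simp
qed simp

lemma cdiff_ident: "cdiff U n (%x. x)"
proof (cases n)
 case (Suc m)
 show ?thesis unfolding Suc by (rule cdiff_SucI[OF _ cdiff_const[of U m 1]]) simp
qed simp

lemma cdiff_add: "cdiff U n f ==> cdiff U n g ==> cdiff U n (%x. f x + g x)"
proof (induction n arbitrary: f g)
 case 0
 thus ?case by (simp add: continuous_on_add)
next
 case (Suc n)
 obtain f' where f': "!!x. x \<in> U ==> (f has_real_derivative f' x) (at x)" "cdiff U n f'" using Suc.prems(1) by auto
 obtain g' where g': "!!x. x \<in> U ==> (g has_real_derivative g' x) (at x)" "cdiff U n g'" using Suc.prems(2) by auto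
 show ?case by (rule cdiff_SucI[OF _ Suc.IH[OF f'(2) g'(2)]]) (intro DERIV_add f'(1) g'(1))
qed

lemma cdiff_mult: "cdiff U n f ==> cdiff U n g ==> cdiff U n (%x. f x * g x)"
proof (induction n arbitrary: f g)
 case 0
 thus ?case by (simp add: continuous_on_mult)
next
 case (Suc n)
 obtain f' where f': "!!x. x \<in> U ==> (f has_real_derivative f' x) (at x)" "cdiff U n f'" using Suc.prems(1) by auto
 obtain g' where g': "!!x. x \<in> U ==> (g has_real_derivative g' x) (at x)" "cdiff U n g'" using Suc.prems(2) by auto
 note c = cdiff_Suc_imp[OF Suc.prems(1)] cdiff_Suc_imp[OF Suc.prems(2)]
 show ?case
  by (rule cdiff_SucI[OF _ cdiff_add[OF Suc.IH[OF f'(2) c(2)] Suc.IH[OF g'(2) c(1)]]]) (intro DERIV_mult f'(1) g'(1))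
qed

lemma cdiff_inverse: "cdiff U n f ==> (!!x. x \<in> U ==> f x ~= 0) ==> cdiff U n (%x. inverse (f x))"
proof (induction n)
 case 0
 thus ?case by (simp add: continuous_on_inverse)
next
 case (Suc n)
 obtain f' where f': "!!x. x \<in> U ==> (f has_real_derivative f' x) (at x)" "cdiff U n f'" using Suc.prems(1) by auto
 note c = Suc.IH[OF cdiff_Suc_imp[OF Suc.prems(1)] Suc.prems(2)]
 have "cdiff U n (%x. (- 1) * ((inverse (f x) * f' x) * inverse (f x)))" by (intro cdiff_mult cdiff_const c f'(2))
 moreover have "((%x. inverse (f x)) has_real_derivative (- 1) * ((inverse (f x) * f' x) * inverse (f x))) (at x)" if "x \<in> U" for x
  using DERIV_inverse'[OF f'(1)[OF that] Suc.prems(2)[OF that]] by simp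
 ultimately show ?case by (rule cdiff_SucI[rotated])
qed

lemma cdiff_affine: "cdiff UNIV n f ==> cdiff UNIV n (%x. f (a * x + b))"
proof (induction n arbitrary: f)
 case 0
 thus ?case by (auto intro!: continuous_on_compose2[of UNIV f] continuous_intros)
next
 case (Suc n)
 obtain f' where f': "!!x. (f has_real_derivative f' x) (at x)" "cdiff UNIV n f'" using Suc.prems(1) by auto
 have "((%x. f (a * x + b)) has_real_derivative f' (a * x + b) * a) (at x)" for x
  by (rule DERIV_chain2[OF f'(1)]) (auto intro!: derivative_eq_intros)
 thus ?case by (intro cdiff_SucI[OF _ cdiff_mult[OF Suc.IH[OF f'(2)] cdiff_const[of _ _ a]]]) 
qed

text \<open>Truncated powers are a piecewise polynomial source of cutoffs of any prescribed finite
  smoothness.\<close>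

lemma cdiff_max_power: "cdiff UNIV n (%x. max 0 x ^ Suc n)"
proof (induction n)
 case 0
 show ?case by (auto intro!: continuous_intros)
next
 case (Suc n)
 have "((%x. max 0 x ^ Suc (Suc n)) has_real_derivative real (Suc (Suc n)) * max 0 x ^ Suc n) (at x)" for x :: real
 proof (cases "x = 0")
  case False
  show ?thesis
  proof (cases "x > 0")
   case True
   have "((%x. x ^ Suc (Suc n)) has_real_derivative real (Suc (Suc n)) * x ^ Suc n) (at x)"
    using DERIV_pow[of "Suc (Suc n)" x UNIV] by simp
   hence "((%x. max 0 x ^ Suc (Suc n)) has_real_derivative real (Suc (Suc n)) * x ^ Suc n) (at x)"
    by (rule has_field_derivative_transform_within_open[where S = "{0<..}"]) (use True in \<open>auto simp: max_def\<close>)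
   thus ?thesis using True by (simp add: max_def)
  next
   case False
   hence x: "x < 0" using \<open>x ~= 0\<close> by simp
   have "((%x. 0) has_real_derivative 0) (at x)" by simp
   hence "((%x. max 0 x ^ Suc (Suc n)) has_real_derivative 0) (at x)"
    by (rule has_field_derivative_transform_within_open[where S = "{..<0}"]) (use x in \<open>auto simp: max_def\<close>)
   thus ?thesis using x by (simp add: max_def)
  qed
 next
  case True
  have "((%h. (max 0 (0 + h) ^ Suc (Suc n) - max 0 0 ^ Suc (Suc n)) / h) \<longlongrightarrow> 0) (at (0::real))"
  proof (rule Lim_null_comparison)
   show "\<forall>\<^sub>F h in at (0::real). norm ((max 0 (0 + h) ^ Suc (Suc n) - max 0 0 ^ Suc (Suc n)) / h) <= \<bar>h\<bar> ^ Suc n"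
   proof (intro always_eventually allI)
    fix h :: real
    show "norm ((max 0 (0 + h) ^ Suc (Suc n) - max 0 0 ^ Suc (Suc n)) / h) <= \<bar>h\<bar> ^ Suc n"
    proof (cases "h > 0")
     case False
     hence "(max 0 (0 + h) ^ Suc (Suc n) - max 0 0 ^ Suc (Suc n)) / h = 0" by simp
     moreover have "0 <= \<bar>h\<bar> ^ Suc n" by (intro zero_le_power abs_ge_zero)
     ultimately show ?thesis by (simp only: norm_zero)
    qed simp
   qed
   have "((%h. \<bar>h\<bar> ^ Suc n) \<longlongrightarrow> \<bar>0\<bar> ^ Suc n) (at (0::real))" by (intro tendsto_intros)
   thus "((%h. \<bar>h\<bar> ^ Suc n) \<longlongrightarrow> 0) (at (0::real))" by simp
  qed
  thus ?thesis unfolding True by (simp add: DERIV_def)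
 qed
 thus ?case by (rule cdiff_SucI) (intro cdiff_mult cdiff_const Suc)
qed

lemma cdiff_powr: "cdiff {0<..} n (%x. x powr de)"
proof (induction n arbitrary: de)
 case 0
 show ?case by (auto intro!: continuous_intros)
next
 case (Suc n)
 show ?case by (rule cdiff_SucI[OF _ cdiff_mult[OF cdiff_const[of _ _ de] Suc[of "de - 1"]]]) (use has_real_derivative_powr in auto)
qed

text \<open>Meant for products of u powr de with a cutoff vanishing near 0: the singularity of the
  power at 0 disappears.\<close>

lemma cdiff_glue: "cdiff {0<..} n f ==> e > 0 ==> (!!x. x < e ==> f x = 0) ==> cdiff UNIV n f"
proof (induction n arbitrary: f)
 case 0
 have "continuous_on {..<e} (%_. 0 :: real)" by simp
 hence "continuous_on {..<e} f" by (rule continuous_on_cong[THEN iffD1, rotated 2]) (use 0(3) in auto)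
 hence "continuous_on ({..<e} \<union> {0<..}) f" using 0 by (intro continuous_on_open_Un) auto
 moreover have "{..<e} \<union> {0<..} = (UNIV :: real set)" using 0(2) by auto
 ultimately show ?case by simp
next
 case (Suc n)
 obtain f' where f': "!!x. x \<in> {0<..} ==> (f has_real_derivative f' x) (at x)" "cdiff {0<..} n f'" using Suc.prems(1) by auto
 define g where "g x = (if x <= 0 then 0 else f' x)" for x
 have z: "(f has_real_derivative 0) (at x)" if "x < e" for x
 proof -
  have "((%x. 0) has_real_derivative 0) (at x)" by simp
  thus ?thesis by (rule has_field_derivative_transform_within_open[where S = "{..<e}"]) (use that Suc.prems(3) in auto)
 qed
 have "cdiff UNIV n g"
 proof (rule Suc.IH[OF _ Suc.prems(2)])
  show "cdiff {0<..} n g" by (rule cdiff_cong[OF _ f'(2)]) (auto simp: g_def)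
  show "g x = 0" if "x < e" for x
   using DERIV_unique[OF z[OF that] f'(1)] by (auto simp: g_def)
 qed
 moreover have "(f has_real_derivative g x) (at x)" for x
  using z[of x] f'(1)[of x] Suc.prems(2) by (cases "x <= 0") (auto simp: g_def)
 ultimately show ?case by auto
qed

text \<open>All derivatives inherit the compact support and are continuous, hence bounded; one
  constant is collected for the whole chain.\<close>

lemma cdiff_bump:
 assumes "cdiff UNIV M ze" "!!u. u \<notin> {1/8..2} ==> ze u = 0"
 shows "\<exists>A\<ge>0. bump M A ze"
proof -
 have "EX D A. dchain D f n A & A >= 0"
  if "cdiff UNIV n f" "!!u. u \<notin> {1/8..2} ==> f u = 0" for n f
  using that
 proof (induction n arbitrary: f)
  case (0 f)
  have "compact (f ` {1/8..2})" using 0(1) by (intro compact_continuous_image) (auto intro: continuous_on_subset)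
  then obtain B where B: "!!x. x \<in> {1/8..2} ==> \<bar>f x\<bar> <= B" using compact_imp_bounded bounded_iff by (metis imageI real_norm_def)
  have "\<bar>f x\<bar> <= max 0 B" for x using B[of x] 0(2)[of x] by (cases "x \<in> {1/8..2}") auto
  thus ?case by (intro exI[of _ "%_. f"] exI[of _ "max 0 B"]) auto
 next
  case (Suc n f)
  obtain B where "bounded (f ` {1/8..2})" and fc: "continuous_on UNIV f"
  proof -
   have c: "continuous_on UNIV f" by (rule cdiff_continuous[OF Suc.prems(1)])
   hence "compact (f ` {1/8..2})" by (intro compact_continuous_image) (auto intro: continuous_on_subset)
   thus ?thesis using that c compact_imp_bounded by blast
  qed
  then obtain B where B: "!!x. x \<in> {1/8..2} ==> \<bar>f x\<bar> <= B" using bounded_iff by (metis imageI real_norm_def)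
  have fB: "\<bar>f x\<bar> <= max 0 B" for x using B[of x] Suc.prems(2)[of x] by (cases "x \<in> {1/8..2}") auto
  obtain g where g: "!!x. (f has_real_derivative g x) (at x)" "cdiff UNIV n g" using Suc.prems(1) by auto
  have "g u = 0" if u: "u \<notin> {1/8..2}" for u
  proof -
   have "((%x. 0) has_real_derivative 0) (at u)" by simp
   hence "(f has_real_derivative 0) (at u)"
    by (rule has_field_derivative_transform_within_open[where S = "- {1/8..2}"]) (use u Suc.prems(2) in \<open>auto intro!: open_Compl\<close>)
   thus ?thesis using g(1) by (rule DERIV_unique[OF _ _, symmetric])
  qed
  hence "EX D A. dchain D g n A & A >= 0"
   by (rule Suc.IH[OF g(2)])
  then obtain D where "EX A. dchain D g n A & A >= 0"
   by (rule exE)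
  then obtain A where D': "dchain D g n A & A >= 0"
   by (rule exE)
  have D: "D 0 = g" "!!i x. i < n ==> (D i has_real_derivative D (Suc i) x) (at x)" "!!i x. i <= n ==> \<bar>D i x\<bar> <= A" "A >= 0"
   using D' by auto
  define E where "E i = (case i of 0 => f | Suc j => D j)" for i
  have "E 0 = f & (ALL i<Suc n. ALL x. (E i has_real_derivative E (Suc i) x) (at x)) & (\<forall>i\<le>Suc n. ALL x. \<bar>E i x\<bar> <= max 0 B + A) & max 0 B + A >= 0"
  proof (intro conjI allI impI)
   show "(E i has_real_derivative E (Suc i) x) (at x)" if "i < Suc n" for i x
    using that g(1) D(1,2) by (cases i) (auto simp: E_def)
   show "\<bar>E i x\<bar> <= max 0 B + A" if "i <= Suc n" for i x
   proof (cases i)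
    case 0
    thus ?thesis using fB[of x] D(4) by (simp add: E_def)
   next
    case (Suc j)
    hence "\<bar>D j x\<bar> <= A" using D(3)[of j x] that by simp
    thus ?thesis using Suc by (simp add: E_def)
   qed
  qed (use D(4) in \<open>auto simp: E_def\<close>)
  thus ?case by (intro exI[of _ E] exI[of _ "max 0 B + A"]) blast
 qed
 hence "EX D A. dchain D ze M A & A >= 0"
  using assms by blast
 then obtain D where "EX A. dchain D ze M A & A >= 0"
  by (rule exE)
 then obtain A where D: "dchain D ze M A & A >= 0"
  by (rule exE)
 have "bump M A ze" unfolding bump_def
  by (intro conjI exI[of _ D]) (use D assms(2) in auto)
 thus ?thesis using D by blast
qed

lemma bump_le: assumes "bump M A ze" "A <= B" shows "bump M B ze"
proof -
 obtain D where "dchain D ze M A"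
  using assms(1)[unfolded bump_def, THEN conjunct1] by (rule exE)
 hence "dchain D ze M B"
  using assms(2) by (meson order_trans)
 hence "EX D. dchain D ze M B" by (rule exI[of _ D])
 thus ?thesis unfolding bump_def using assms(1)[unfolded bump_def, THEN conjunct2] by (rule conjI)
qed

lemma bump_lincomb:
 assumes "bump M A f" "bump M B g"
 shows "bump M (\<bar>a\<bar> * A + \<bar>b\<bar> * B) (%u. a * f u + b * g u)"
proof -
 obtain D where D': "dchain D f M A"
  using assms(1)[unfolded bump_def, THEN conjunct1] by (rule exE)
 have D: "D 0 = f" "!!i x. i < M ==> (D i has_real_derivative D (Suc i) x) (at x)" "!!i x. i <= M ==> \<bar>D i x\<bar> <= A"
  using D' by auto
 obtain E where E': "dchain E g M B"
  using assms(2)[unfolded bump_def, THEN conjunct1] by (rule exE)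
 have E: "E 0 = g" "!!i x. i < M ==> (E i has_real_derivative E (Suc i) x) (at x)" "!!i x. i <= M ==> \<bar>E i x\<bar> <= B"
  using E' by auto
 define F where "F i u = a * D i u + b * E i u" for i u
 have "F 0 = (%u. a * f u + b * g u)" by (simp add: F_def D(1) E(1) fun_eq_iff)
 moreover have "(F i has_real_derivative F (Suc i) x) (at x)" if "i < M" for i x
  unfolding F_def by (intro DERIV_add DERIV_cmult D(2) E(2) that)
 moreover have "\<bar>F i x\<bar> <= \<bar>a\<bar> * A + \<bar>b\<bar> * B" if "i <= M" for i x
 proof -
  have "\<bar>F i x\<bar> <= \<bar>a\<bar> * \<bar>D i x\<bar> + \<bar>b\<bar> * \<bar>E i x\<bar>" unfolding F_def using abs_triangle_ineq[of "a * D i x" "b * E i x"] by (simp add: abs_mult)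
  also have "... <= \<bar>a\<bar> * A + \<bar>b\<bar> * B" by (intro add_mono mult_left_mono D(3) E(3) that) auto
  finally show ?thesis .
 qed
 moreover have "a * f u + b * g u = 0" if "u \<notin> {1/8..2}" for u
  using assms that unfolding bump_def by simp
 ultimately show ?thesis unfolding bump_def by (intro conjI exI[of _ F] allI impI)
qed

text \<open>The quotient p / (p + q) of two truncated powers, p starting at 1/2 and q ending at 1;
  they never vanish at the same point.\<close>

lemma smooth_step: "EX ps. cdiff UNIV n ps & (\<forall>u\<le>1/2. ps u = 0) & (\<forall>u\<ge>1. ps u = (1::real))"
proof -
 define p where "p u = max 0 (1 * u + - 1/2) ^ Suc n" for u :: real
 define q where "q u = max 0 (- 1 * u + 1) ^ Suc n" for u :: real
 have pos: "p u + q u ~= 0" for u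
 proof -
  have "p u > 0 \<or> q u > 0" unfolding p_def q_def by (cases "u > 1/2") (auto simp: max_def)
  moreover have "p u >= 0" "q u >= 0" by (auto simp: p_def q_def)
  ultimately show ?thesis by linarith
 qed
 have c: "cdiff UNIV n p" "cdiff UNIV n q"
  unfolding p_def q_def by (rule cdiff_affine[OF cdiff_max_power])+
 have "cdiff UNIV n (%u. p u * inverse (p u + q u))"
  by (intro cdiff_mult cdiff_inverse cdiff_add c pos)
 moreover have "p u * inverse (p u + q u) = 0" if "u <= 1/2" for u using that by (simp add: p_def max_def)
 moreover have "p u * inverse (p u + q u) = 1" if "u >= 1" for u
 proof -
  have "q u = 0" using that by (simp add: q_def max_def)
  thus ?thesis using pos[of u] by simp
 qed
 ultimately show ?thesis by blast
qed

text \<open>The differences ps (2 v) - ps v telescope over dyadic dilations to 1 - ps (4 u), and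
  \<open>ze\<close> takes the complementary ps (4 u). The sum starts at m = 2 so that s = 2^(-m) <=
  1/4, as the window estimates require. In \<open>ze\<close> the factor 1 - ps (u/2) enforces
  compact support; it equals 1 for u <= 1.\<close>

lemma cutoffs_exist:
 fixes de :: real
 shows "EX A et et' ze. A >= 0 & bump M A ze & bump M A et & (ALL u. (et has_real_derivative et' u) (at u)) & continuous_on UNIV et' &
  (ALL s. 0 < s --> s <= 1 --> bump M A (%v. 2 * (1 - s * v) * et' v)) &
  (ALL u n. 0 < u --> u < 1 --> 1 <= n --> 1 <= 2 ^ (n + 1) * u -->
   u powr de = ze u + (\<Sum>m = 2..n. 2 powr (- de * real m) * et (2 ^ m * u)))"
proof -
 obtain ps where ps: "cdiff UNIV (Suc M) ps" "!!u. u <= 1/2 ==> ps u = 0" "!!u. u >= 1 ==> ps u = 1"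
  using smooth_step[of "Suc M"] by blast
 have aff: "cdiff UNIV (Suc M) (%u. ps (a * u))" for a using cdiff_affine[OF ps(1), of a 0] by simp
 define et where "et v = v powr de * (ps (2 * v) + (- 1) * ps (1 * v))" for v
 define ze where "ze u = u powr de * (ps (4 * u) * (1 + (- 1) * ps (1/2 * u)))" for u
 have et0: "et v = 0" if "v \<notin> {1/4..1}" for v
  using that ps(2)[of "2 * v"] ps(2)[of v] ps(3)[of "2 * v"] ps(3)[of v] by (cases "v < 1/4") (auto simp: et_def)
 have ze0: "ze v = 0" if "v \<notin> {1/8..2}" for v
  using that ps(2)[of "4 * v"] ps(3)[of "1/2 * v"] by (cases "v < 1/8") (auto simp: ze_def)
 have c: "cdiff UNIV (Suc M) et"
 proof (rule cdiff_glue[where e = "1/4"])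
  show "cdiff {0<..} (Suc M) et" unfolding et_def
   by (intro cdiff_mult cdiff_add cdiff_powr cdiff_const cdiff_subset[OF aff]) auto
 qed (use et0 in auto)
 have c0: "cdiff UNIV (Suc M) ze"
 proof (rule cdiff_glue[where e = "1/8"])
  show "cdiff {0<..} (Suc M) ze" unfolding ze_def
   by (intro cdiff_mult cdiff_add cdiff_powr cdiff_const cdiff_subset[OF aff]) auto
 qed (use ze0 in auto)
 obtain A0 where A0: "A0 >= 0" "bump M A0 ze" using cdiff_bump[OF cdiff_Suc_imp[OF c0] ze0] by blast
 have et1: "et v = 0" if "v \<notin> {1/8..2}" for v using et0[of v] that by auto
 obtain A1 where A1: "A1 >= 0" "bump M A1 et" using cdiff_bump[OF cdiff_Suc_imp[OF c] et1] by blast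
 obtain et' where et': "!!x. (et has_real_derivative et' x) (at x)" "cdiff UNIV M et'" using c by auto
 have et'0: "et' u = 0" if u: "u \<notin> {1/8..2}" for u
 proof -
  have "((%x. 0) has_real_derivative 0) (at u)" by simp
  hence "(et has_real_derivative 0) (at u)"
   by (rule has_field_derivative_transform_within_open[where S = "- {1/8..2}"]) (use u et1 in \<open>auto intro!: open_Compl\<close>)
  thus ?thesis using et'(1) by (rule DERIV_unique[OF _ _, symmetric])
 qed
 have et'c: "continuous_on UNIV et'"
  by (rule cdiff_continuous[OF et'(2)])
 obtain A2 where A2: "A2 >= 0" "bump M A2 et'" using cdiff_bump[OF et'(2) et'0] by blast
 have "cdiff UNIV M (%u. u * et' u)" by (intro cdiff_mult cdiff_ident et'(2))
 moreover have "u * et' u = 0" if "u \<notin> {1/8..2}" for u using et'0[OF that] by simp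
 ultimately obtain A3 where A3: "A3 >= 0" "bump M A3 (%u. u * et' u)" using cdiff_bump by blast
 define A where "A = A0 + A1 + 2 * A2 + 2 * A3"
 \<comment> \<open>The function is affine in s, so bounds for et' and for u et' yield one constant
   for all s <= 1.\<close>
 have "bump M A (%v. 2 * (1 - s * v) * et' v)" if s: "0 < s" "s <= 1" for s
 proof -
  have "bump M (\<bar>2\<bar> * A2 + \<bar>- 2 * s\<bar> * A3) (%u. 2 * et' u + - 2 * s * (u * et' u))"
   by (rule bump_lincomb[OF A2(2) A3(2)])
  moreover have "\<bar>2\<bar> * A2 + \<bar>- 2 * s\<bar> * A3 <= A"
  proof -
   have "s * A3 <= 1 * A3" using s A3 by (intro mult_right_mono) auto
   thus ?thesis unfolding A_def using s A0 A1 by (simp add: abs_mult)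
  qed
  ultimately show ?thesis by (auto intro: bump_le simp: algebra_simps)
 qed
 moreover have "A >= 0" "bump M A ze" "bump M A et"
  using A0 A1 A2 A3 by (auto simp: A_def intro: bump_le)
 moreover have "u powr de = ze u + (\<Sum>m = 2..n. 2 powr (- de * real m) * et (2 ^ m * u))"
  if u: "0 < u" "u < 1" and n: "1 <= n" and nu: "1 <= 2 ^ (n + 1) * u" for u n
 proof -
  have tm: "2 powr (- de * real m) * et (2 ^ m * u) = u powr de * (ps (2 ^ Suc m * u) - ps (2 ^ m * u))" for m
  proof -
   have "(2 ^ m * u) powr de = 2 powr (de * real m) * u powr de"
    using u by (simp add: powr_mult powr_realpow[symmetric] powr_powr mult.commute)
   moreover have "2 powr (- de * real m) * 2 powr (de * real m) = 1" by (simp add: powr_add[symmetric])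
   ultimately have "2 powr (- de * real m) * (2 ^ m * u) powr de = u powr de" by (metis mult.assoc mult_1)
   moreover have "et (2 ^ m * u) = (2 ^ m * u) powr de * (ps (2 ^ Suc m * u) - ps (2 ^ m * u))" by (simp add: et_def mult.assoc)
   ultimately show ?thesis by (metis mult.assoc)
  qed
  have "(\<Sum>m = 2..n. 2 powr (- de * real m) * et (2 ^ m * u)) = u powr de * (\<Sum>m = 2..n. ps (2 ^ Suc m * u) - ps (2 ^ m * u))"
   unfolding tm by (rule sum_distrib_left[symmetric])
  also have "(\<Sum>m = 2..n. ps (2 ^ Suc m * u) - ps (2 ^ m * u)) = ps (2 ^ Suc n * u) - ps (2 ^ 2 * u)"
   using sum_Suc_diff[of 2 n "%m. ps (2 ^ m * u)"] n by simp
  also have "ps (2 ^ Suc n * u) = 1" using ps(3) nu by simp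
  finally have "(\<Sum>m = 2..n. 2 powr (- de * real m) * et (2 ^ m * u)) = u powr de * (1 - ps (4 * u))" by simp
  moreover have "ze u = u powr de * ps (4 * u)" using ps(2)[of "1/2 * u"] u by (simp add: ze_def)
  ultimately show ?thesis by (simp add: algebra_simps)
 qed
 ultimately show ?thesis using et'(1) et'c by blast
qed

section \<open>Maximal estimates\<close>

lemma am_nonpos: assumes "bump M A ze" "s > 0" "t > 0" "t^2 <= 2 * real k + real d" shows "am d ze s t k = 0"
proof -
 have "1 <= (2 * real k + real d) / t^2" using assms by (simp add: pos_le_divide_eq)
 hence "(1 - (2 * real k + real d) / t^2) / s <= 0" using assms(2) by (simp add: divide_le_0_iff)
 hence "\<not> 1/8 <= (1 - (2 * real k + real d) / t^2) / s" by linarith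
 thus ?thesis unfolding am_def using bumpD(2)[OF assms(1)] by blast
qed

lemma Tm_upto:
 fixes f :: "'d::finite fld"
 assumes "bump M A ze" "s > 0" "t >= 1" "nat \<lfloor>t\<^sup>2\<rfloor> <= K"
 shows "Tm ze s t f z = (\<Sum>k\<le>K. of_real (am CARD('d) ze s t k) * spj k f z)"
 unfolding Tm_def by (rule sum.mono_neutral_left) (use assms am_zero[OF assms(1-3)] in auto)

text \<open>For f outside L2 measurability comes from truncations to balls, which are square
  integrable. They converge at every z by dominated convergence, the dominating function being that
  of \<open>kk_integrable'\<close>.\<close>

lemma measurable_spj_wadm:
 assumes "wadm al (f :: 'd::finite fld)" shows "(%z. spj k f z) \<in> bm"
proof (rule borel_measurable_LIMSEQ_metric)
 let ?g = "%n. cut (%z. idx z <= n) f"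
 have [measurable]: "f \<in> bm" using assms by (simp add: wadm_def)
 show "(%z. spj k (?g n) z) \<in> bm" for n
 proof -
  have "Measurable.pred borel (%z :: complex ^ 'd. idx z <= n)" by measurable
  thus ?thesis by (intro borel_measurable_spj square_integrable_cut(1)[OF assms, where J = n])
 qed
 show "(%n. spj k (?g n) z) \<longlonglongrightarrow> spj k f z" for z
  unfolding spj_def
 proof (rule integral_dominated_convergence)
  show "integrable lborel (%z'. norm (kk k z z' * f z'))" using kk_integrable'[OF assms] by (rule integrable_norm)
  show "AE z' in lborel. (%n. kk k z z' * ?g n z') \<longlonglongrightarrow> kk k z z' * f z'"
  proof (intro always_eventually allI tendsto_mult tendsto_const)
   fix z' :: "complex ^ 'd"
   have "\<forall>\<^sub>F n in sequentially. ?g n z' = f z'" using eventually_ge_at_top[of "idx z'"] by eventually_elim (simp add: cut_def)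
   thus "(%n. ?g n z') \<longlonglongrightarrow> f z'" by (rule tendsto_eventually)
  qed
  show "AE z' in lborel. norm (kk k z z' * ?g n z') <= norm (kk k z z' * f z')" for n by (simp add: cut_def)
 qed measurable
qed

lemma measurable_Tm_time:
 assumes "continuous_on UNIV ze" shows "(%t. Tm ze s t (f :: 'd::finite fld) z) \<in> bm"
proof -
 have [measurable]: "(%t. am CARD('d) ze s t k) \<in> bm" for k by (rule measurable_am[OF assms])
 show ?thesis unfolding Tm_def
  by (rule measurable_compose_countable[where f = "%n t. \<Sum>k\<le>n. of_real (am CARD('d) ze s t k) * spj k f z"]) measurable
qed

lemma measurable_Tm_joint:
 assumes c: "continuous_on UNIV ze" and f: "wadm al (f :: 'd::finite fld)"
 shows "(%p. Tm ze s (snd p) f (fst p)) \<in> borel_measurable (borel \<Otimes>\<^sub>M borel)"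
proof -
 have [measurable]: "(%t. am CARD('d) ze s t k) \<in> bm" for k by (rule measurable_am[OF c])
 have [measurable]: "(%z. spj k f z) \<in> bm" for k by (rule measurable_spj_wadm[OF f])
 show ?thesis unfolding Tm_def
  by (rule measurable_compose_countable[where f = "%n p. \<Sum>k\<le>n. of_real (am CARD('d) ze s (snd p) k) * spj k f (fst p)"]) measurable
qed

definition Yf :: "(real => real) => real => ('d::finite fld) => complex ^ 'd => ennreal" where
 "Yf ze s f z = (NN t. nq (Tm ze s t f z) * (dlog t))"

lemma Yf_swap:
 assumes c: "continuous_on UNIV ze" and f: "wadm al (f :: 'd::finite fld)"
 shows "Yf ze s f \<in> bm"
  "(NN z. Yf ze s f z * wt al z) =
   (NN t. (NN z. nq (Tm ze s t f z) * wt al z) * (dlog t))"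
proof -
 define T where "T p = Tm ze s (snd p) f (fst p)" for p
 have [measurable]: "T \<in> borel_measurable (borel \<Otimes>\<^sub>M borel)" using measurable_Tm_joint[OF c f] unfolding T_def .
 have TT: "Tm ze s t f z = T (z, t)" for z t by (simp add: T_def)
 show "Yf ze s f \<in> bm" unfolding Yf_def TT by measurable
 have "(NN z. Yf ze s f z * wt al z) = (NN z. (NN t. nq (T (z, t)) * (dlog t) * wt al z))"
  unfolding Yf_def TT by (intro nn_integral_cong nn_integral_multc[symmetric]) measurable
 also have "... = (NN t. (NN z. nq (T (z, t)) * (dlog t) * wt al z))"
  by (rule lborel_pair.Fubini'[symmetric]) measurable
 also have "... = (NN t. (NN z. nq (T (z, t)) * wt al z * (dlog t)))"
  by (simp only: mult_ac)
 also have "... = (NN t. (NN z. nq (T (z, t)) * wt al z) * (dlog t))"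
  by (intro nn_integral_cong nn_integral_multc) measurable
 finally show "(NN z. Yf ze s f z * wt al z) =
   (NN t. (NN z. nq (Tm ze s t f z) * wt al z) * (dlog t))"
  unfolding TT .
qed

text \<open>The multiplier \<open>th\<close> is \<open>s t\<close> times the \<open>t\<close>-derivative of \<open>t \<mapsto> et ((1 - mu / t\<^sup>2) / s)\<close>.\<close>
lemma Tm_sup_bound:
 fixes f :: "'d::finite fld" and z :: "complex ^ 'd"
 defines "th \<equiv> (%et' s v. 2 * (1 - s * v) * et' v)"
 assumes b: "bump M A et" and b2: "bump M' A' (th et' s)" and det: "!!u. (et has_real_derivative et' u) (at u)"
  and cet: "continuous_on UNIV et'" and s: "0 < s" and t: "1 <= t"
 shows "nq (Tm et s t f z) <= en (1 / s) * (Yf et s f z + Yf (th et' s) s f z)"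
proof -
 define d where "d = CARD('d)"
 \<comment> \<open>One range of levels is fixed for all parameters up to t, so that the sum can be
   differentiated term by term in ta.\<close>
 define K where "K = nat \<lfloor>t\<^sup>2\<rfloor>"
 define v where "v k ta = (1 - (2 * real k + real d) / ta^2) / s" for k ta
 define S where "S p xi ta = (\<Sum>k\<le>K. xi (v k ta) * p k)" for p :: "nat => real" and xi :: "real => real" and ta
 have dv: "(v k has_real_derivative (1 / (s * ta)) * (2 * (1 - s * v k ta))) (at ta)" if "ta > 0" for k ta
  unfolding v_def using that s by (auto intro!: derivative_eq_intros simp: field_simps power2_eq_square eval_nat_numeral)
 have dS: "(S p et has_real_derivative (1 / (s * ta)) * S p (th et' s) ta) (at ta)" if "ta > 0" for p ta
 proof -
  have "((%ta. et (v k ta) * p k) has_real_derivative (1 / (s * ta)) * (th et' s (v k ta) * p k)) (at ta)" for k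
   using DERIV_cmult_right[OF DERIV_chain2[OF det dv[OF that]], where c = "p k"] by (simp add: th_def mult_ac)
  thus ?thesis unfolding S_def sum_distrib_left by (intro DERIV_sum)
 qed
 have et'at: "isCont et' x" for x using cet by (simp add: continuous_on_eq_continuous_at)
 have cS: "isCont (S p (th et' s)) ta" if "ta > 0" for p ta
 proof -
  have cv: "isCont (v k) ta" for k using DERIV_isCont[OF dv[OF that]] .
  have "isCont (%ta. 2 * (1 - s * v k ta) * et' (v k ta) * p k) ta" for k
   by (intro continuous_intros cv isCont_o2[OF cv et'at])
  thus ?thesis unfolding S_def th_def by (intro continuous_sum) auto
 qed
 define P where "P k = Re (spj k f z)" for k
 define Q where "Q k = Im (spj k f z)" for k
 define N where "N xi ta = (S P xi ta)^2 + (S Q xi ta)^2" for xi ta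
 have NT: "(cmod (Tm xi s ta f z))^2 = N xi ta" if "bump M A xi" "1 <= ta" "ta <= t" for M A xi ta
 proof -
  have "ta^2 <= t^2" using that by (intro power_mono) auto
  hence K: "nat \<lfloor>ta\<^sup>2\<rfloor> <= K" unfolding K_def by (intro nat_mono floor_mono)
  have "Tm xi s ta f z = (\<Sum>k\<le>K. of_real (xi (v k ta)) * spj k f z)"
   using Tm_upto[OF that(1) s that(2) K, of f z] by (simp add: am_def v_def d_def)
  hence "Re (Tm xi s ta f z) = S P xi ta" "Im (Tm xi s ta f z) = S Q xi ta"
   unfolding S_def P_def Q_def by simp_all
  thus ?thesis unfolding cmod_power2 N_def by simp
 qed
 define h where "h ta = 2 * S P et ta * ((1 / (s * ta)) * S P (th et' s) ta) + 2 * S Q et ta * ((1 / (s * ta)) * S Q (th et' s) ta)" for ta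
 have dN: "(N et has_real_derivative h ta) (at ta)" if "ta > 0" for ta
  unfolding N_def h_def by (rule derivative_eq_intros dS[OF that] refl)+ (simp add: mult_ac)
 have ch: "isCont h ta" if "ta > 0" for ta
  unfolding h_def by (intro continuous_intros DERIV_isCont[OF dS[OF that]] cS[OF that]) (use s that in auto)
 have ht: "\<bar>h ta\<bar> <= (1 / s) * ((N et ta + N (th et' s) ta) * (1 / ta))" if "ta > 0" for ta
 proof -
  have ab: "\<bar>2 * a * b\<bar> <= a^2 + b^2" for a b :: real
   using sum_squares_bound[of "\<bar>a\<bar>" "\<bar>b\<bar>"] by (simp add: abs_mult)
  have "h ta = (1 / (s * ta)) * (2 * S P et ta * S P (th et' s) ta + 2 * S Q et ta * S Q (th et' s) ta)" unfolding h_def by (simp add: algebra_simps)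
  hence "\<bar>h ta\<bar> = (1 / (s * ta)) * \<bar>2 * S P et ta * S P (th et' s) ta + 2 * S Q et ta * S Q (th et' s) ta\<bar>" using s that by (simp only: abs_mult) simp
  also have "... <= (1 / (s * ta)) * (N et ta + N (th et' s) ta)"
  proof (intro mult_left_mono)
   show "\<bar>2 * S P et ta * S P (th et' s) ta + 2 * S Q et ta * S Q (th et' s) ta\<bar> <= N et ta + N (th et' s) ta"
    unfolding N_def using ab[of "S P et ta" "S P (th et' s) ta"] ab[of "S Q et ta" "S Q (th et' s) ta"] by linarith
  qed (use s that in auto)
  finally show ?thesis by (simp add: mult_ac)
 qed
 \<comment> \<open>At t = 1 no eigenvalue lies below t^2, so the multiplier vanishes and the
   integral of the derivative starts from 0.\<close>
 have N1: "N et 1 = 0"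
 proof -
  have "et (v k 1) = 0" for k
  proof -
   have "real CARD('d) >= real 1" by (intro of_nat_mono) (simp add: Suc_leI)
   hence "1^2 <= 2 * real k + real d" using of_nat_0_le_iff[of k] unfolding d_def power_one of_nat_1 by linarith
   from am_nonpos[OF b s zero_less_one this] show ?thesis by (simp add: am_def v_def)
  qed
  thus ?thesis by (simp add: N_def S_def)
 qed
 have int: "integrable lborel (%ta. h ta * indicator {1..t} ta)" by (rule borel_integrable_atLeastAtMost) (use ch in auto)
 have "N et t = (LI ta. h ta * indicator {1..t} ta)"
  using integral_FTC_Icc_real[of 1 t "N et" h] t dN ch N1 by auto
 hence "en (N et t) <= en (norm (LI ta. h ta * indicator {1..t} ta))" by (intro ennreal_leI) simp
 also have "... <= (NN ta. en (norm (h ta * indicator {1..t} ta)))" by (rule integral_norm_bound_ennreal[OF int])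
 also have "... <= (NN ta. en (1 / s) * ((nq (Tm et s ta f z) + nq (Tm (th et' s) s ta f z)) * (dlog ta)))"
 proof (intro nn_integral_mono)
  fix ta :: real
  show "en (norm (h ta * indicator {1..t} ta)) <= en (1 / s) * ((nq (Tm et s ta f z) + nq (Tm (th et' s) s ta f z)) * (dlog ta))"
  proof (cases "ta \<in> {1..t}")
   case True
   hence ta: "1 <= ta" "ta <= t" by auto
   have n0: "N et ta >= 0" "N (th et' s) ta >= 0" by (auto simp: N_def)
   have "en (norm (h ta * indicator {1..t} ta)) <= en ((1 / s) * ((N et ta + N (th et' s) ta) * (1 / ta)))"
    using True ht[of ta] by (intro ennreal_leI) simp
   also have "... = en (1 / s) * ((en (N et ta) + en (N (th et' s) ta)) * en (1 / ta))"
   proof -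
    have "en ((1 / s) * ((N et ta + N (th et' s) ta) * (1 / ta))) = en (1 / s) * en ((N et ta + N (th et' s) ta) * (1 / ta))"
     using s n0 ta by (intro ennreal_mult) auto
    also have "en ((N et ta + N (th et' s) ta) * (1 / ta)) = en (N et ta + N (th et' s) ta) * en (1 / ta)"
     using n0 ta by (intro ennreal_mult) auto
    finally show ?thesis using n0 by simp
   qed
   finally show ?thesis using ta by (simp add: NT[OF b ta] NT[OF b2 ta])
  qed simp
 qed
 also have "... = en (1 / s) * (Yf et s f z + Yf (th et' s) s f z)"
 proof -
  have c: "continuous_on UNIV et" using det by (intro continuous_at_imp_continuous_on ballI) (rule DERIV_isCont)
  have c2: "continuous_on UNIV (th et' s)" unfolding th_def by (intro continuous_intros cet)
  note [measurable] = measurable_Tm_time[OF c] measurable_Tm_time[OF c2]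
  show ?thesis unfolding Yf_def distrib_right
   by (subst nn_integral_add[symmetric], measurable) (rule nn_integral_cmult, measurable)
 qed
 finally show ?thesis unfolding NT[OF b t order_refl] .
qed

section \<open>Reduction of the Bochner-Riesz means to multiplier operators\<close>

lemma bochner_riesz_small:
 assumes "0 < t" "t < 1" shows "bochner_riesz de t (f :: 'd::finite fld) z = 0"
proof -
 have "{mu. mu \<in> range (%k. 2 * k + CARD('d)) & real mu <= t^2} = {}"
 proof -
  have t: "t^2 < 1" using assms by (simp add: power_less_one_iff)
  have "1 <= 2 * k + CARD('d)" for k using zero_less_card_finite[where 'a='d] by linarith
  hence "1 <= real mu" if "mu \<in> range (%k. 2 * k + CARD('d))" for mu using that by auto
  thus ?thesis using t by force
 qed
 thus ?thesis unfolding bochner_riesz_def by (simp only: sum.empty)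
qed

text \<open>The range of levels is enlarged to k <= t^2, the range used by \<open>Tm\<close>. The
  added levels contribute nothing because 0 powr de = 0.\<close>

lemma bochner_riesz_sum:
 fixes f :: "'d::finite fld"
 assumes f: "f \<in> bm" and t: "t >= 1"
 shows "bochner_riesz de t f z = (\<Sum>k\<le>nat \<lfloor>t\<^sup>2\<rfloor>. of_real ((max 0 (1 - (2 * real k + real CARD('d)) / t^2)) powr de) * spj k f z)"
proof -
 define h where "h k = 2 * k + CARD('d)" for k
 define I where "I = {k. real (h k) <= t^2}"
 have I: "{mu. mu \<in> range (%k. 2 * k + CARD('d)) & real mu <= t^2} = h ` I" by (auto simp: I_def h_def)
 have inj: "inj_on h I" by (auto simp: inj_on_def h_def)
 have "bochner_riesz de t f z = (\<Sum>k\<in>I. of_real ((1 - real (h k) / t^2) powr de) * spectral_proj (h k) f z)"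
  unfolding bochner_riesz_def I by (rule sum.reindex_cong[OF inj refl]) simp
 also have "... = (\<Sum>k\<in>I. of_real ((max 0 (1 - (2 * real k + real CARD('d)) / t^2)) powr de) * spj k f z)"
 proof (intro sum.cong refl)
  fix k assume "k \<in> I"
  hence "real (h k) / t^2 <= 1" using t by (simp add: I_def)
  thus "of_real ((1 - real (h k) / t^2) powr de) * spectral_proj (h k) f z = of_real ((max 0 (1 - (2 * real k + real CARD('d)) / t^2)) powr de) * spj k f z"
   using spectral_proj_spj[OF f, of k z] by (simp add: h_def max_def)
 qed
 also have "... = (\<Sum>k\<le>nat \<lfloor>t\<^sup>2\<rfloor>. of_real ((max 0 (1 - (2 * real k + real CARD('d)) / t^2)) powr de) * spj k f z)"
 proof (rule sum.mono_neutral_left)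
  show "I \<subseteq> {..nat \<lfloor>t\<^sup>2\<rfloor>}"
  proof
   fix k assume "k \<in> I"
   hence "real k <= t^2" by (simp add: I_def h_def)
   thus "k \<in> {..nat \<lfloor>t\<^sup>2\<rfloor>}" by (simp add: le_nat_floor)
  qed
  show "\<forall>k\<in>{..nat \<lfloor>t\<^sup>2\<rfloor>} - I. of_real ((max 0 (1 - (2 * real k + real CARD('d)) / t^2)) powr de) * spj k f z = 0"
  proof
   fix k assume "k \<in> {..nat \<lfloor>t\<^sup>2\<rfloor>} - I"
   hence "1 <= (2 * real k + real CARD('d)) / t^2" using t by (simp add: I_def h_def pos_le_divide_eq)
   thus "of_real ((max 0 (1 - (2 * real k + real CARD('d)) / t^2)) powr de) * spj k f z = 0" by (simp add: max_def)
  qed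
 qed simp
 finally show ?thesis .
qed

text \<open>The number n of pieces depends on t: it must resolve the smallest positive value of 1 -
  mu / t^2 among the finitely many levels. The later estimates therefore have to be summable over
  all m.\<close>

lemma bochner_riesz_decomp:
 fixes f :: "'d::finite fld"
 assumes f: "f \<in> bm" and t: "t >= 1" and b: "bump M A ze" "bump M A et"
  and dec: "!!u n. 0 < u ==> u < 1 ==> 1 <= n ==> 1 <= 2 ^ (n + 1) * u ==>
   u powr de = ze u + (\<Sum>m = 2..n. 2 powr (- de * real m) * et (2 ^ m * u))"
 shows "EX n. bochner_riesz de t f z = Tm ze 1 t f z + (\<Sum>m = 2..n. of_real (2 powr (- de * real m)) * Tm et ((1/2) ^ m) t f z)"
proof -
 define K where "K = nat \<lfloor>t\<^sup>2\<rfloor>"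
 define u where "u k = 1 - (2 * real k + real CARD('d)) / t^2" for k
 have u1: "u k < 1" for k
 proof -
  have "0 < (2 * real k + real CARD('d)) / t^2" using t by (intro divide_pos_pos add_nonneg_pos) auto
  thus ?thesis unfolding u_def by linarith
 qed
 have "EX n. u k > 0 --> 1 <= 2 ^ n * u k" for k
 proof (cases "u k > 0")
  case True
  obtain n where "1 / u k < 2 ^ n" using real_arch_pow[of 2 "1 / u k"] by auto
  thus ?thesis using True by (intro exI[of _ n]) (simp add: pos_divide_less_eq)
 qed auto
 then obtain g where g: "!!k. u k > 0 ==> 1 <= 2 ^ g k * u k" by metis
 define n where "n = Suc (\<Sum>k\<le>K. g k)"
 have co: "max 0 (u k) powr de = am CARD('d) ze 1 t k + (\<Sum>m = 2..n. 2 powr (- de * real m) * am CARD('d) et ((1/2) ^ m) t k)" if k: "k <= K" for k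
 proof -
  have am: "am CARD('d) et ((1/2) ^ m) t k = et (2 ^ m * u k)" "am CARD('d) ze 1 t k = ze (u k)" for m
   by (simp_all add: am_def u_def power_one_over mult.commute)
  show ?thesis
  proof (cases "u k > 0")
   case True
   have "g k <= (\<Sum>k\<le>K. g k)" using k by (intro member_le_sum) auto
   hence "(2::real) ^ g k <= 2 ^ (n + 1)" unfolding n_def by (intro power_increasing) auto
   hence "2 ^ g k * u k <= 2 ^ (n + 1) * u k" using True by (intro mult_right_mono) auto
   hence "1 <= 2 ^ (n + 1) * u k" using g[OF True] by linarith
   hence "u k powr de = ze (u k) + (\<Sum>m = 2..n. 2 powr (- de * real m) * et (2 ^ m * u k))"
    using True u1 by (intro dec) (auto simp: n_def)
   thus ?thesis using True unfolding am by simp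
  next
   case False
   have "2 ^ m * u k <= 0" for m using False by (simp add: mult_le_0_iff)
   hence "et (2 ^ m * u k) = 0" for m using bumpD(2)[OF b(2), of "2 ^ m * u k"] by (smt (verit) divide_pos_pos)
   moreover have "ze (u k) = 0" using False bumpD(2)[OF b(1), of "u k"] by (smt (verit) divide_pos_pos)
   ultimately show ?thesis using False unfolding am by simp
  qed
 qed
 have "bochner_riesz de t f z = (\<Sum>k\<le>K. of_real (am CARD('d) ze 1 t k + (\<Sum>m = 2..n. 2 powr (- de * real m) * am CARD('d) et ((1/2) ^ m) t k)) * spj k f z)"
  unfolding bochner_riesz_sum[OF f t] K_def[symmetric] u_def[symmetric] by (intro sum.cong refl) (simp only: co atMost_iff)
 also have "... = (\<Sum>k\<le>K. of_real (am CARD('d) ze 1 t k) * spj k f z) + (\<Sum>k\<le>K. \<Sum>m = 2..n. of_real (2 powr (- de * real m)) * (of_real (am CARD('d) et ((1/2) ^ m) t k) * spj k f z))"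
  by (simp add: distrib_right sum.distrib sum_distrib_right mult.assoc)
 also have "(\<Sum>k\<le>K. \<Sum>m = 2..n. of_real (2 powr (- de * real m)) * (of_real (am CARD('d) et ((1/2) ^ m) t k) * spj k f z))
  = (\<Sum>m = 2..n. of_real (2 powr (- de * real m)) * Tm et ((1/2) ^ m) t f z)"
  by (subst sum.swap) (simp only: Tm_def K_def sum_distrib_left)
 also have "(\<Sum>k\<le>K. of_real (am CARD('d) ze 1 t k) * spj k f z) = Tm ze 1 t f z" by (simp add: Tm_def K_def)
 finally show ?thesis by blast
qed

text \<open>Cauchy-Schwarz with the geometric weight 2^(-ep m), which makes the number n of pieces
  disappear at the price of an arbitrarily small power.\<close>

lemma dyadic_sum_sq:
 fixes x :: "nat => complex"
 assumes e: "ep > 0"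
 shows "nq (\<Sum>m = 2..n. of_real (2 powr (- de * real m)) * x m)
  <= en (\<Sum>m. 2 powr (- ep * real m)) * (\<Sum>m. en (2 powr ((ep - 2 * de) * real m)) * (if m < 2 then 0 else nq (x m)))"
  and "summable (%m. 2 powr (- ep * real m))"
proof -
 have eq: "2 powr (- ep * real m) = (2 powr - ep) ^ m" for m by (simp add: powr_realpow[symmetric] powr_powr)
 have "2 powr - ep < 2 powr 0" using e by (intro powr_less_mono) auto
 thus sm: "summable (%m. 2 powr (- ep * real m))" unfolding eq by (intro summable_geometric) simp
 define a where "a m = 2 powr (- (ep / 2) * real m)" for m
 define b where "b m = 2 powr ((ep / 2 - de) * real m) * cmod (x m)" for m
 have ab: "2 powr (- de * real m) * cmod (x m) = a m * b m" for m
 proof -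
  have "a m * b m = 2 powr (- (ep / 2) * real m + (ep / 2 - de) * real m) * cmod (x m)" unfolding a_def b_def powr_add by simp
  also have "- (ep / 2) * real m + (ep / 2 - de) * real m = - de * real m" by (simp add: algebra_simps)
  finally show ?thesis by simp
 qed
 have a2: "(a m)^2 = 2 powr (- ep * real m)" for m unfolding a_def power2_eq_square powr_add[symmetric] by simp
 have b2: "(b m)^2 = 2 powr ((ep - 2 * de) * real m) * (cmod (x m))^2" for m
  unfolding b_def power_mult_distrib power2_eq_square[of "_ powr _"] powr_add[symmetric] by (simp add: algebra_simps)
 have "cmod (\<Sum>m = 2..n. of_real (2 powr (- de * real m)) * x m) <= (\<Sum>m = 2..n. a m * b m)"
  by (rule order_trans[OF norm_sum]) (simp only: norm_mult norm_of_real abs_of_nonneg powr_ge_zero ab order_refl)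
 hence "(cmod (\<Sum>m = 2..n. of_real (2 powr (- de * real m)) * x m))^2 <= (\<Sum>m = 2..n. a m * b m)^2" by (intro power_mono) auto
 also have "... <= (\<Sum>m = 2..n. (a m)^2) * (\<Sum>m = 2..n. (b m)^2)" by (rule Cauchy_Schwarz_ineq_sum)
 also have "... <= (\<Sum>m. 2 powr (- ep * real m)) * (\<Sum>m = 2..n. (b m)^2)"
  unfolding a2 using sm by (intro mult_right_mono sum_le_suminf sum_nonneg) auto
 finally have "nq (\<Sum>m = 2..n. of_real (2 powr (- de * real m)) * x m) <= en ((\<Sum>m. 2 powr (- ep * real m)) * (\<Sum>m = 2..n. (b m)^2))" by (rule ennreal_leI)
 also have "... = en (\<Sum>m. 2 powr (- ep * real m)) * en (\<Sum>m = 2..n. (b m)^2)"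
  using sm by (intro ennreal_mult suminf_nonneg sum_nonneg) auto
 also have "en (\<Sum>m = 2..n. (b m)^2) = (\<Sum>m = 2..n. en (2 powr ((ep - 2 * de) * real m)) * (if m < 2 then 0 else nq (x m)))"
  by (subst sum_ennreal[symmetric]) (auto simp: b2 ennreal_mult intro!: sum.cong)
 also have "... <= (\<Sum>m. en (2 powr ((ep - 2 * de) * real m)) * (if m < 2 then 0 else nq (x m)))"
  by (rule sum_le_suminf) auto
 finally show "nq (\<Sum>m = 2..n. of_real (2 powr (- de * real m)) * x m)
  <= en (\<Sum>m. 2 powr (- ep * real m)) * (\<Sum>m. en (2 powr ((ep - 2 * de) * real m)) * (if m < 2 then 0 else nq (x m)))"
  by (simp add: mult_left_mono)
qed

text \<open>The factor 2^m of \<open>Tm_sup_bound\<close> cancels (1/2)^m of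
  \<open>square_function\<close>. What remains is 2^(ka m) against the squared amplitudes 2^(-2 de
  m), and 2 de exceeds max 0 ((al - 1) / 2) exactly by hypothesis.\<close>

theorem borel_maximal:
 fixes al de :: real
 assumes al: "al >= 0" and de: "de > max ((al - 1) / 4) 0"
 shows "\<exists>C\<ge>0. ALL f :: 'd::finite fld. wadm al f -->
  (\<exists>G \<in> bm. (ALL t>0. ALL z. nq (bochner_riesz de t f z) <= G z) &
   (NN z. G z * wt al z) <= en C * wn al f)"
proof -
 define ka0 where "ka0 = max 0 ((al - 1) / 2)"
 \<comment> \<open>The gap between 2 de and \<open>ka0\<close> is divided into three: one part
   enters \<open>ka\<close>, one is lost in \<open>dyadic_sum_sq\<close>, and one is left over for
   summing in m.\<close>
 define ep where "ep = (2 * de - ka0) / 3"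
 define ka where "ka = ka0 + ep"
 have ep: "ep > 0" using de unfolding ep_def ka0_def by (auto simp: max_def split: if_splits)
 have "ka0 >= 0" "ka0 >= (al - 1) / 2" unfolding ka0_def by simp_all
 hence ka: "ka > 0" "ka > (al - 1) / 2" using ep unfolding ka_def by linarith+
 have expo: "(ep - 2 * de) + ka = - ep" unfolding ka_def ep_def by (simp add: field_simps)
 obtain M1 where M1: "\<forall>A\<ge>0. \<exists>C\<ge>0. ALL ze (f :: 'd fld). bump M1 A ze --> wadm al f -->
  (\<exists>G \<in> bm. (\<forall>t\<ge>1. ALL z. nq (Tm ze 1 t f z) <= G z) &
   (NN z. G z * wt al z) <= en C * wn al f)"
  using low_maximal[OF al, where 'd='d] by (rule exE)
 obtain M2 where M2: "\<forall>A\<ge>0. \<exists>C\<ge>0. ALL ze m (f :: 'd fld). bump M2 A ze --> 2 <= m --> wadm al f -->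
  (NN t. (NN z. nq (Tm ze ((1/2) ^ m) t f z) * wt al z) * (dlog t))
   <= en (C * (1/2) ^ m * 2 powr (ka * real m)) * wn al f"
  using square_function[OF al ka, where 'd='d] by (rule exE)
 define M where "M = M1 + M2 + 1"
 obtain A et et' ze where A: "A >= 0" and bze: "bump M A ze" and bet: "bump M A et" and det: "!!u. (et has_real_derivative et' u) (at u)"
  and cet': "continuous_on UNIV et'" and bth: "!!s. 0 < s ==> s <= 1 ==> bump M A (%v. 2 * (1 - s * v) * et' v)"
  and dec: "!!u n. 0 < u ==> u < 1 ==> 1 <= n ==> 1 <= 2 ^ (n + 1) * u ==>
   u powr de = ze u + (\<Sum>m = 2..n. 2 powr (- de * real m) * et (2 ^ m * u))"
  using cutoffs_exist[of M de] by (elim exE conjE) (rule that, auto)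
 obtain C1 where C1': "C1 >= 0 & (ALL ze (f :: 'd fld). bump M1 A ze --> wadm al f -->
  (\<exists>G \<in> bm. (\<forall>t\<ge>1. ALL z. nq (Tm ze 1 t f z) <= G z) &
   (NN z. G z * wt al z) <= en C1 * wn al f))"
  using M1[THEN spec, THEN mp, OF A] by (rule exE)
 note C1 = C1'[THEN conjunct1] C1'[THEN conjunct2, rule_format]
 obtain C2 where C2': "C2 >= 0 & (ALL ze m (f :: 'd fld). bump M2 A ze --> 2 <= m --> wadm al f -->
  (NN t. (NN z. nq (Tm ze ((1/2) ^ m) t f z) * wt al z) * (dlog t))
   <= en (C2 * (1/2) ^ m * 2 powr (ka * real m)) * wn al f)"
  using M2[THEN spec, THEN mp, OF A] by (rule exE)
 note C2 = C2'[THEN conjunct1] C2'[THEN conjunct2, rule_format]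
 define Se where "Se = (\<Sum>m. 2 powr (- ep * real m))"
 have Ssum: "summable (%m. 2 powr (- ep * real m))" by (rule dyadic_sum_sq(2)[OF ep])
 have Se: "Se >= 0" unfolding Se_def by (intro suminf_nonneg Ssum) auto
 define C where "C = 2 * C1 + 2 * Se * (2 * C2 * Se)"
 have C: "C >= 0" unfolding C_def using C1 C2 Se by (intro add_nonneg_nonneg mult_nonneg_nonneg) auto
 have "\<exists>G \<in> bm. (ALL t>0. ALL z. nq (bochner_riesz de t f z) <= G z) &
   (NN z. G z * wt al z) <= en C * wn al f"
  if f: "wadm al f" for f :: "'d fld"
 proof -
  have fm: "f \<in> bm" using f by (simp add: wadm_def)
  obtain G0 where G0[measurable]: "G0 \<in> bm" and G0b: "!!t z. t >= 1 ==> nq (Tm ze 1 t f z) <= G0 z"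
   and G0i: "(NN z. G0 z * wt al z) <= en C1 * wn al f"
   using C1(2)[OF bump_mono[OF bze] f] unfolding M_def by auto
  define s where "s m = (1/2::real) ^ m" for m
  have s: "0 < s m" "s m <= 1" for m by (auto simp: s_def power_le_one)
  define th where "th m v = 2 * (1 - s m * v) * et' v" for m v
  have bthm: "bump M A (th m)" for m unfolding th_def using bth[OF s] .
  have cet: "continuous_on UNIV et" using det by (intro continuous_at_imp_continuous_on ballI) (rule DERIV_isCont)
  have cth: "continuous_on UNIV (th m)" for m unfolding th_def by (intro continuous_intros cet')
  define X where "X m z = (if m < 2 then 0 else en (2 ^ m) * (Yf et (s m) f z + Yf (th m) (s m) f z))" for m z
  note [measurable] = Yf_swap(1)[OF cet f] Yf_swap(1)[OF cth f]
  have Xm[measurable]: "X m \<in> bm" for m unfolding X_def by measurable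
  have Xb: "(if m < 2 then 0 else nq (Tm et (s m) t f z)) <= X m z" if t: "t >= 1" for m t z
  proof (cases "m < 2")
   case False
   have "1 / s m = 2 ^ m" by (simp add: s_def power_one_over)
   moreover have "th m = (%v. 2 * (1 - s m * v) * et' v)" by (simp add: th_def fun_eq_iff)
   ultimately show ?thesis using False Tm_sup_bound[where f = f and z = z, OF bet bthm[of m, unfolded th_def] det cet' s(1)[of m] t] by (simp only: X_def if_False)
  qed simp
  define w where "w m = en (2 powr ((ep - 2 * de) * real m))" for m
  define G1 where "G1 z = (\<Sum>m. w m * X m z)" for z
  define G where "G z = 2 * G0 z + 2 * (en Se * G1 z)" for z
  have [measurable]: "G1 \<in> bm" unfolding G1_def by measurable
  have Gm: "G \<in> bm" unfolding G_def by measurable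
  have "nq (bochner_riesz de t f z) <= G z" if t0: "t > 0" for t z
  proof (cases "t >= 1")
   case False
   thus ?thesis using bochner_riesz_small[of t de f z] t0 by simp
  next
   case t: True
   obtain n where n: "bochner_riesz de t f z = Tm ze 1 t f z + (\<Sum>m = 2..n. of_real (2 powr (- de * real m)) * Tm et ((1/2) ^ m) t f z)"
   proof -
    have "EX n. bochner_riesz de t f z = Tm ze 1 t f z + (\<Sum>m = 2..n. of_real (2 powr (- de * real m)) * Tm et ((1/2) ^ m) t f z)"
     by (rule bochner_riesz_decomp[OF fm t bze bet]) (rule dec)
    thus ?thesis using that by (elim exE)
   qed
   define R where "R = (\<Sum>m = 2..n. of_real (2 powr (- de * real m)) * Tm et (s m) t f z)"
   have "(cmod (bochner_riesz de t f z))^2 <= (cmod (Tm ze 1 t f z) + cmod R)^2"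
    unfolding n R_def s_def by (intro power_mono norm_triangle_ineq) auto
   also have "... <= 2 * (cmod (Tm ze 1 t f z))^2 + 2 * (cmod R)^2" by (rule sum_sq_le)
   finally have "nq (bochner_riesz de t f z) <= en (2 * (cmod (Tm ze 1 t f z))^2 + 2 * (cmod R)^2)" by (rule ennreal_leI)
   also have "... = 2 * nq (Tm ze 1 t f z) + 2 * en ((cmod R)^2)" by (simp add: ennreal_mult)
   also have "... <= G z" unfolding G_def
   proof (intro add_mono mult_left_mono G0b t)
    have "en ((cmod R)^2) <= en Se * (\<Sum>m. w m * (if m < 2 then 0 else nq (Tm et (s m) t f z)))"
     unfolding R_def Se_def w_def by (rule dyadic_sum_sq(1)[OF ep])
    also have "... <= en Se * G1 z" unfolding G1_def by (intro mult_left_mono suminf_le Xb t) auto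
    finally show "en ((cmod R)^2) <= en Se * G1 z" .
   qed auto
   finally show ?thesis .
  qed
  moreover have "(NN z. G z * wt al z) <= en C * wn al f"
  proof -
   have Xi: "w m * (NN z. X m z * wt al z) <= en (2 * C2 * 2 powr (- ep * real m)) * wn al f" for m
   proof (cases "m < 2")
    case True
    thus ?thesis by (simp add: X_def)
   next
    case False
    define c where "c = C2 * (1/2) ^ m * 2 powr (ka * real m)"
    have c0: "c >= 0" using C2(1) by (simp add: c_def)
    have y: "(NN z. Yf xi (s m) f z * wt al z) <= en c * wn al f" if "bump M A xi" "continuous_on UNIV xi" for xi
     unfolding Yf_swap(2)[OF that(2) f] s_def c_def by (rule C2(2)) (use bump_mono[OF that(1)] False f in \<open>auto simp: M_def\<close>)
    have "(NN z. X m z * wt al z) = (NN z. en (2 ^ m) * (Yf et (s m) f z * wt al z + Yf (th m) (s m) f z * wt al z))"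
     using False by (simp add: X_def distrib_right mult.assoc)
    also have "... = en (2 ^ m) * (NN z. Yf et (s m) f z * wt al z + Yf (th m) (s m) f z * wt al z)"
     by (rule nn_integral_cmult) measurable
    also have "(NN z. Yf et (s m) f z * wt al z + Yf (th m) (s m) f z * wt al z)
     = (NN z. Yf et (s m) f z * wt al z) + (NN z. Yf (th m) (s m) f z * wt al z)"
     by (rule nn_integral_add) measurable
    also have "... <= en c * wn al f + en c * wn al f" by (intro add_mono y bet bthm cet cth)
    finally have "w m * (NN z. X m z * wt al z) <= w m * (en (2 ^ m) * (en c * wn al f + en c * wn al f))"
     by (simp add: mult_left_mono)
    also have "... = en (2 powr ((ep - 2 * de) * real m) * (2 ^ m * (2 * c))) * wn al f"
    proof -
     have "en (2 * c) = en c + en c" unfolding mult_2 using c0 by (intro ennreal_plus)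
     moreover have "en (2 powr ((ep - 2 * de) * real m) * (2 ^ m * (2 * c))) = w m * en (2 ^ m * (2 * c))"
      unfolding w_def using c0 by (intro ennreal_mult) auto
     moreover have "en (2 ^ m * (2 * c)) = en (2 ^ m) * en (2 * c)" using c0 by (intro ennreal_mult) auto
     ultimately show ?thesis by (simp only: distrib_right mult.assoc)
    qed
    also have "2 powr ((ep - 2 * de) * real m) * (2 ^ m * (2 * c)) = 2 * C2 * 2 powr (- ep * real m)"
    proof -
     have "(2::real) ^ m * (1/2) ^ m = 1" by (simp add: power_one_over)
     moreover have "2 powr ((ep - 2 * de) * real m) * 2 powr (ka * real m) = 2 powr (- ep * real m)"
      unfolding powr_add[symmetric] expo[symmetric] by (simp add: algebra_simps)
     moreover have "2 powr ((ep - 2 * de) * real m) * (2 ^ m * (2 * c)) = 2 * C2 * (2 ^ m * (1/2) ^ m) * (2 powr ((ep - 2 * de) * real m) * 2 powr (ka * real m))"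
      unfolding c_def by (simp only: mult_ac)
     ultimately show ?thesis by simp
    qed
    finally show ?thesis .
   qed
   have i1: "(NN z. G1 z * wt al z) <= en (2 * C2 * Se) * wn al f"
   proof -
    have "(NN z. G1 z * wt al z) = (NN z. (\<Sum>m. w m * (X m z * wt al z)))"
     unfolding G1_def ennreal_suminf_multc[symmetric] by (simp only: mult.assoc)
    also have "... = (\<Sum>m. (NN z. w m * (X m z * wt al z)))" by (rule nn_integral_suminf) measurable
    also have "... = (\<Sum>m. w m * (NN z. X m z * wt al z))" by (intro suminf_cong nn_integral_cmult) measurable
    also have "... <= (\<Sum>m. en (2 * C2 * 2 powr (- ep * real m)) * wn al f)" by (intro suminf_le Xi) auto
    also have "... = (\<Sum>m. en (2 * C2 * 2 powr (- ep * real m))) * wn al f" by (rule ennreal_suminf_multc)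
    also have "(\<Sum>m. en (2 * C2 * 2 powr (- ep * real m))) = en (\<Sum>m. 2 * C2 * 2 powr (- ep * real m))"
     using C2(1) by (intro suminf_ennreal2 summable_mult Ssum) auto
    also have "(\<Sum>m. 2 * C2 * 2 powr (- ep * real m)) = 2 * C2 * Se" unfolding Se_def by (rule suminf_mult[OF Ssum])
    finally show ?thesis .
   qed
   have "(NN z. G z * wt al z) = (NN z. 2 * (G0 z * wt al z) + (2 * en Se) * (G1 z * wt al z))"
    unfolding G_def by (simp add: distrib_right mult.assoc)
   also have "... = (NN z. 2 * (G0 z * wt al z)) + (NN z. (2 * en Se) * (G1 z * wt al z))"
    by (rule nn_integral_add) measurable
   also have "(NN z. 2 * (G0 z * wt al z)) = 2 * (NN z. G0 z * wt al z)" by (rule nn_integral_cmult) measurable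
   also have "(NN z. (2 * en Se) * (G1 z * wt al z)) = (2 * en Se) * (NN z. G1 z * wt al z)" by (rule nn_integral_cmult) measurable
   also have "2 * (NN z. G0 z * wt al z) + (2 * en Se) * (NN z. G1 z * wt al z)
     <= 2 * (en C1 * wn al f) + (2 * en Se) * (en (2 * C2 * Se) * wn al f)"
    by (intro add_mono mult_left_mono G0i i1) auto
   also have "... = en C * wn al f"
   proof -
    have p: "0 <= 2 * C1" "0 <= 2 * Se * (2 * C2 * Se)" using C1 C2 Se by auto
    have "en C = en (2 * C1) + en (2 * Se * (2 * C2 * Se))" unfolding C_def by (rule ennreal_plus[OF p])
    moreover have "en (2 * C1) = 2 * en C1" using C1 by (simp add: ennreal_mult)
    moreover have "en (2 * Se * (2 * C2 * Se)) = (2 * en Se) * en (2 * C2 * Se)"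
    proof -
     have "en (2 * Se * (2 * C2 * Se)) = en (2 * Se) * en (2 * C2 * Se)" using C2 Se by (intro ennreal_mult) auto
     moreover have "en (2 * Se) = 2 * en Se" using Se by (simp add: ennreal_mult)
     ultimately show ?thesis by simp
    qed
    ultimately show ?thesis by (simp only: distrib_right mult.assoc)
   qed
   finally show ?thesis .
  qed
  ultimately show ?thesis using Gm by blast
 qed
 thus ?thesis using C by blast
qed

section \<open>From Borel to Lebesgue measurable functions\<close>

lemma lebesgue_borel_representative:
 fixes f :: "'d::finite fld"
 assumes "f \<in> borel_measurable lebesgue"
 shows "\<exists>g\<in>bm. AE z in lborel. f z = g z"
proof -
 have "(%z. Re (f z)) \<in> borel_measurable lebesgue" "(%z. Im (f z)) \<in> borel_measurable lebesgue"
  using assms by measurable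
 note ex = completion_ex_borel_measurable_real[OF this(1)] completion_ex_borel_measurable_real[OF this(2)]
 obtain a where a: "a \<in> borel_measurable lborel" "AE z in lborel. Re (f z) = a z" using ex(1) by (rule bexE)
 obtain b where b: "b \<in> borel_measurable lborel" "AE z in lborel. Im (f z) = b z" using ex(2) by (rule bexE)
 have [measurable]: "a \<in> bm" "b \<in> bm" using a b by simp_all
 have "(%z. Complex (a z) (b z)) \<in> bm" unfolding Complex_eq by measurable
 moreover have "AE z in lborel. f z = Complex (a z) (b z)" using a(2) b(2) by eventually_elim (simp add: complex_eq_iff)
 ultimately show ?thesis by (intro bexI[of _ "%z. Complex (a z) (b z)"])
qed

text \<open>Since the means are kernel integrals, changing f on a null set leaves them unchanged at
  every z. The maximal functions therefore agree everywhere, although the supremum runs over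
  uncountably many t.\<close>

lemma bochner_riesz_cong_AE:
 fixes f g :: "'d::finite fld"
 assumes f: "f \<in> borel_measurable lebesgue" and g: "g \<in> bm" and ae: "AE z in lborel. f z = g z"
 shows "bochner_riesz de t f z = bochner_riesz de t g z"
 unfolding bochner_riesz_def
proof (intro sum.cong refl)
 fix mu assume "mu \<in> {mu. mu \<in> range (%k. 2 * k + CARD('d)) & real mu <= t^2}"
 then obtain k where mu: "mu = 2 * k + CARD('d)" by auto
 have [measurable]: "f \<in> borel_measurable lebesgue" "g \<in> borel_measurable lebesgue" "(%z'. kk k z z') \<in> borel_measurable lebesgue"
  using f g borel_measurable_kk[of k z] by (auto intro: measurable_completion)
 have "spectral_proj mu f z = spectral_proj mu g z"
  unfolding spectral_proj_def mu spectral_kernel_kk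
 proof (rule integral_cong_AE)
  show "AE x in lebesgue. kk k z x * f x = kk k z x * g x" using AE_completion[OF ae] by eventually_elim simp
 qed measurable
 thus "of_real ((1 - real mu / t^2) powr de) * spectral_proj mu f z = of_real ((1 - real mu / t^2) powr de) * spectral_proj mu g z" by simp
qed

lemma SUP_power2_le:
 fixes x :: "'i => real" and G :: ennreal
 assumes "!!i. i \<in> I ==> ennreal ((x i)^2) <= G" "!!i. i \<in> I ==> x i >= 0"
 shows "(SUP i\<in>I. en (x i))^2 <= G"
proof (cases G)
 case (real g)
 have "(SUP i\<in>I. en (x i)) <= en (sqrt g)"
 proof (rule SUP_least)
  fix i assume i: "i \<in> I"
  hence "(x i)^2 <= g" using assms(1)[OF i] real by (simp add: ennreal_le_iff)
  thus "en (x i) <= en (sqrt g)" by (intro ennreal_leI real_le_rsqrt)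
 qed
 hence "(SUP i\<in>I. en (x i))^2 <= (en (sqrt g))^2" by (intro power_mono) auto
 also have "... = G" using real by (simp add: ennreal_power)
 finally show ?thesis .
qed simp

theorem theorem1p2:
 fixes \<alpha> \<delta> :: real
 assumes "\<alpha> \<ge> 0" and "\<delta> > max ((\<alpha> - 1) / 4) 0"
 shows "\<exists>C>0. \<forall>f \<in> (weighted_L2 \<alpha> :: (complex ^ 'd::finite \<Rightarrow> complex) set).
      weighted_L2_norm \<alpha> (maximal_bochner_riesz \<delta> f)
       \<le> ennreal C * weighted_L2_norm \<alpha> (\<lambda>z. ennreal (cmod (f z)))"
proof -
 obtain C where C': "C \<ge> 0 \<and> (\<forall>f :: complex ^ 'd \<Rightarrow> complex. wadm \<alpha> f \<longrightarrow>
  (\<exists>G \<in> borel_measurable borel. (\<forall>t>0. \<forall>z. ennreal ((cmod (bochner_riesz \<delta> t f z))\<^sup>2) \<le> G z) \<and>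
   (\<integral>\<^sup>+z. G z * ennreal (weight \<alpha> z) \<partial>lborel) \<le> ennreal C * wn \<alpha> f))"
  using borel_maximal[OF assms, where 'd='d] by (rule exE)
 note C = C'[THEN conjunct1] C'[THEN conjunct2, rule_format]
 \<comment> \<open>The 1 added to the square root keeps the constant positive when C = 0.\<close>
 have "weighted_L2_norm \<alpha> (maximal_bochner_riesz \<delta> f) \<le> ennreal (sqrt C + 1) * weighted_L2_norm \<alpha> (\<lambda>z. ennreal (cmod (f z)))"
  if f: "f \<in> weighted_L2 \<alpha>" for f :: "complex ^ 'd \<Rightarrow> complex"
 proof -
  have fm: "f \<in> borel_measurable lebesgue" using f by (simp add: weighted_L2_def)
  obtain g where g: "g \<in> borel_measurable borel" "AE z in lborel. f z = g z"
   using lebesgue_borel_representative[OF fm] by (rule bexE)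
  have I: "(\<integral>\<^sup>+z. (ennreal (cmod (f z)))\<^sup>2 * ennreal (weight \<alpha> z) \<partial>lebesgue) = wn \<alpha> g"
  proof -
   have "(\<integral>\<^sup>+z. (ennreal (cmod (f z)))\<^sup>2 * ennreal (weight \<alpha> z) \<partial>lborel) = wn \<alpha> g"
    unfolding wn_def
   proof (rule nn_integral_cong_AE)
    show "AE z in lborel. (ennreal (cmod (f z)))\<^sup>2 * ennreal (weight \<alpha> z) = ennreal ((cmod (g z))\<^sup>2) * ennreal (weight \<alpha> z)"
     using g(2) by eventually_elim (simp add: ennreal_power)
   qed
   then show ?thesis by (simp add: nn_integral_completion)
  qed
  have "weighted_L2_norm \<alpha> (\<lambda>z. ennreal (cmod (f z))) < \<infinity>" using f by (simp add: weighted_L2_def)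
  then have fin: "wn \<alpha> g < \<infinity>"
   unfolding weighted_L2_norm_def Let_def I by (auto simp: less_top split: if_splits)
  then have nf: "weighted_L2_norm \<alpha> (\<lambda>z. ennreal (cmod (f z))) = ennreal (sqrt (enn2real (wn \<alpha> g)))"
   unfolding weighted_L2_norm_def Let_def I by auto
  have "wadm \<alpha> g" unfolding wadm_def using assms(1) g(1) fin by blast
  from C(2)[OF this] obtain G where G: "G \<in> borel_measurable borel" "\<And>t z. t > 0 \<Longrightarrow> ennreal ((cmod (bochner_riesz \<delta> t g z))\<^sup>2) \<le> G z"
   "(\<integral>\<^sup>+z. G z * ennreal (weight \<alpha> z) \<partial>lborel) \<le> ennreal C * wn \<alpha> g" by blast
  define J where "J = (\<integral>\<^sup>+z. (maximal_bochner_riesz \<delta> f z)\<^sup>2 * ennreal (weight \<alpha> z) \<partial>lebesgue)"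
  \<comment> \<open>Monotonicity of the nonnegative integral holds for arbitrary functions, so the
    majorant G controls the maximal function directly.\<close>
  have "J \<le> (\<integral>\<^sup>+z. G z * ennreal (weight \<alpha> z) \<partial>lebesgue)"
   unfolding J_def maximal_bochner_riesz_def bochner_riesz_cong_AE[OF fm g]
   by (intro nn_integral_mono mult_right_mono SUP_power2_le G(2)) auto
  also have "\<dots> \<le> ennreal C * wn \<alpha> g" using G(3) by (simp add: nn_integral_completion)
  also have "\<dots> = ennreal (C * enn2real (wn \<alpha> g))" using fin C(1) by (simp add: ennreal_mult less_top)
  finally have J: "J \<le> ennreal (C * enn2real (wn \<alpha> g))" .
  then have "J \<noteq> \<infinity>" by (auto simp: top_unique)
  then have "weighted_L2_norm \<alpha> (maximal_bochner_riesz \<delta> f) = ennreal (sqrt (enn2real J))"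
   unfolding weighted_L2_norm_def Let_def J_def by simp
  also have "\<dots> \<le> ennreal (sqrt (C * enn2real (wn \<alpha> g)))"
   using J C(1) by (intro ennreal_leI real_sqrt_le_mono enn2real_leI) auto
  also have "\<dots> \<le> ennreal ((sqrt C + 1) * sqrt (enn2real (wn \<alpha> g)))"
   unfolding real_sqrt_mult by (intro ennreal_leI mult_right_mono) auto
  also have "\<dots> = ennreal (sqrt C + 1) * ennreal (sqrt (enn2real (wn \<alpha> g)))"
   using C(1) by (intro ennreal_mult) auto
  finally show ?thesis unfolding nf .
 qed
 moreover have "sqrt C + 1 > 0" using C(1) by (simp add: add_nonneg_pos)
 ultimately show ?thesis by blast
qed

end
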